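(* Assume the axiom of determinacy $\mathsf{AD}$. Then the order type of the Wadge degrees of sets in $\Delta(D^\ast_\omega(\boldsymbol{\Pi}^1_1))$ is $\omega_2$.
   Context: Sets are subsets of Baire space $\omega^\omega$. For $A,B\subseteq\omega^\omega$, $A\le_{\mathsf W}B$ (Wadge reducibility) means there is a continuous $\theta:\omega^\omega\to\omega^\omega$ with $A=\theta^{-1}[B]$. Under $\mathsf{AD}$ the Wadge degrees are semi-well-ordered, i.e. they become well-ordered after identifying the degree of each $A$ with the degree of its complement $\neg A$; "order type" refers to this well-order. For a decreasing sequence $(B_n)_{n<\omega}$ of sets, $\mathbb{D}^\ast_{n<\omega}B_n=\bigcup_{n\text{ even}}(B_n\setminus B_{n+1})$. $D^\ast_\omega(\boldsymbol{\Pi}^1_1)$ is the class of all sets $\mathbb{D}^\ast_{n<\omega}B_n$ for decreasing sequences $(B_n)_{n<\omega}$ of coanalytic ($\boldsymbol{\Pi}^1_1$) subsets of $\omega^\omega$. For a class $\Gamma$, $\neg\Gamma=\{\neg A:A\in\Gamma\}$ and $\Delta(\Gamma)=\Gamma\cap\neg\Gamma$. *)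

theory Defs
  imports Main
begin

text \<open>
  HOL proves the axiom of choice, so determinacy of all subsets of the type
  \<open>nat \<Rightarrow> nat\<close> is refutable and cannot serve as a hypothesis.  The theorem is a
  theorem of ZF + AD, and it is stated as such: it is asserted to hold in every structure
  \<open>('m, mem)\<close> that satisfies the first-order axioms of ZF together with AD.  By the completeness
  theorem this is the same as provability in ZF + AD.

  Structures are not required to be well-founded, standard or transitive.  Hence every notion
  below, natural numbers and ordinals included, is the set-theoretic notion of the structure:
  it is given by a first-order formula in which all quantifiers range over \<open>'m\<close> and the only
  primitive is \<open>mem\<close>.  Separation and Replacement have to be schemas over first-order formulas;
  their second-order versions would let choice functions of HOL into the structure.
\<close>

section \<open>First-order formulas of set theory and the axioms of ZF\<close>

datatype fm =
    FMem nat nat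
  | FEq nat nat
  | FNeg fm
  | FConj fm fm
  | FAll nat fm

primrec sat :: "('m \<Rightarrow> 'm \<Rightarrow> bool) \<Rightarrow> fm \<Rightarrow> (nat \<Rightarrow> 'm) \<Rightarrow> bool" where
  "sat mem (FMem i j) s \<longleftrightarrow> mem (s i) (s j)"
| "sat mem (FEq i j) s \<longleftrightarrow> s i = s j"
| "sat mem (FNeg \<phi>) s \<longleftrightarrow> \<not> sat mem \<phi> s"
| "sat mem (FConj \<phi> \<psi>) s \<longleftrightarrow> sat mem \<phi> s \<and> sat mem \<psi> s"
| "sat mem (FAll i \<phi>) s \<longleftrightarrow> (\<forall>a. sat mem \<phi> (s(i := a)))"

context
  fixes mem :: "'m \<Rightarrow> 'm \<Rightarrow> bool"  (infix "\<epsilon>" 50)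
begin

definition extensionality_ax :: bool where
  "extensionality_ax \<longleftrightarrow> (\<forall>a b. (\<forall>x. x \<epsilon> a \<longleftrightarrow> x \<epsilon> b) \<longrightarrow> a = b)"

definition foundation_ax :: bool where
  "foundation_ax \<longleftrightarrow> (\<forall>a. (\<exists>x. x \<epsilon> a) \<longrightarrow> (\<exists>x. x \<epsilon> a \<and> \<not> (\<exists>y. y \<epsilon> x \<and> y \<epsilon> a)))"

definition pairing_ax :: bool where
  "pairing_ax \<longleftrightarrow> (\<forall>a b. \<exists>c. \<forall>x. x \<epsilon> c \<longleftrightarrow> x = a \<or> x = b)"

definition union_ax :: bool where
  "union_ax \<longleftrightarrow> (\<forall>a. \<exists>u. \<forall>x. x \<epsilon> u \<longleftrightarrow> (\<exists>y. x \<epsilon> y \<and> y \<epsilon> a))"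

definition powerset_ax :: bool where
  "powerset_ax \<longleftrightarrow> (\<forall>a. \<exists>p. \<forall>x. x \<epsilon> p \<longleftrightarrow> (\<forall>y. y \<epsilon> x \<longrightarrow> y \<epsilon> a))"

definition infinity_ax :: bool where
  "infinity_ax \<longleftrightarrow>
    (\<exists>w. (\<exists>e. e \<epsilon> w \<and> (\<forall>x. \<not> x \<epsilon> e)) \<and>
         (\<forall>x. x \<epsilon> w \<longrightarrow> (\<exists>y. y \<epsilon> w \<and> (\<forall>z. z \<epsilon> y \<longleftrightarrow> z \<epsilon> x \<or> z = x))))"

text \<open>The assignment \<open>s\<close> supplies the parameters of \<open>\<phi>\<close>.\<close>

definition separation_ax :: bool where
  "separation_ax \<longleftrightarrow>
    (\<forall>\<phi> s a. \<exists>b. \<forall>x. x \<epsilon> b \<longleftrightarrow> x \<epsilon> a \<and> sat (\<epsilon>) \<phi> (s(0 := x)))"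

definition replacement_ax :: bool where
  "replacement_ax \<longleftrightarrow>
    (\<forall>\<phi> s a. (\<forall>x. x \<epsilon> a \<longrightarrow> (\<exists>!y. sat (\<epsilon>) \<phi> (s(0 := x, 1 := y)))) \<longrightarrow>
       (\<exists>b. \<forall>y. y \<epsilon> b \<longleftrightarrow> (\<exists>x. x \<epsilon> a \<and> sat (\<epsilon>) \<phi> (s(0 := x, 1 := y)))))"

definition ZF :: bool where
  "ZF \<longleftrightarrow> extensionality_ax \<and> foundation_ax \<and> pairing_ax \<and> union_ax \<and> powerset_ax \<and>
     infinity_ax \<and> separation_ax \<and> replacement_ax"


section \<open>Basic set theory inside the structure\<close>

text \<open>
  \<open>coll P\<close> is the element of the structure whose members are exactly the \<open>x\<close> with \<open>P x\<close>.  It is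
  used only where ZF proves that this element exists; it is unique by extensionality.
\<close>

definition coll :: "('m \<Rightarrow> bool) \<Rightarrow> 'm" where
  "coll P = (THE a. \<forall>x. x \<epsilon> a \<longleftrightarrow> P x)"

definition subset :: "'m \<Rightarrow> 'm \<Rightarrow> bool" where
  "subset a b \<longleftrightarrow> (\<forall>x. x \<epsilon> a \<longrightarrow> x \<epsilon> b)"

definition empty :: 'm where
  "empty = coll (\<lambda>x. False)"

definition upair :: "'m \<Rightarrow> 'm \<Rightarrow> 'm" where
  "upair a b = coll (\<lambda>x. x = a \<or> x = b)"

definition opair :: "'m \<Rightarrow> 'm \<Rightarrow> 'm" where
  "opair a b = upair (upair a a) (upair a b)"

definition setminus :: "'m \<Rightarrow> 'm \<Rightarrow> 'm" where
  "setminus a b = coll (\<lambda>x. x \<epsilon> a \<and> \<not> x \<epsilon> b)"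

definition successor :: "'m \<Rightarrow> 'm" where
  "successor a = coll (\<lambda>x. x \<epsilon> a \<or> x = a)"

definition omega :: 'm where
  "omega = coll (\<lambda>n. \<forall>w. empty \<epsilon> w \<and> (\<forall>k. k \<epsilon> w \<longrightarrow> successor k \<epsilon> w) \<longrightarrow> n \<epsilon> w)"

definition even_number :: "'m \<Rightarrow> bool" where
  "even_number n \<longleftrightarrow> n \<epsilon> omega \<and>
    (\<forall>w. empty \<epsilon> w \<and> (\<forall>k. k \<epsilon> w \<longrightarrow> successor (successor k) \<epsilon> w) \<longrightarrow> n \<epsilon> w)"

definition is_function :: "'m \<Rightarrow> 'm \<Rightarrow> 'm \<Rightarrow> bool" where
  "is_function f a b \<longleftrightarrow>
    (\<forall>p. p \<epsilon> f \<longrightarrow> (\<exists>x y. x \<epsilon> a \<and> y \<epsilon> b \<and> p = opair x y)) \<and>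
    (\<forall>x. x \<epsilon> a \<longrightarrow> (\<exists>!y. opair x y \<epsilon> f))"

definition app :: "'m \<Rightarrow> 'm \<Rightarrow> 'm" where
  "app f x = (THE y. opair x y \<epsilon> f)"

definition is_bijection :: "'m \<Rightarrow> 'm \<Rightarrow> 'm \<Rightarrow> bool" where
  "is_bijection f a b \<longleftrightarrow> is_function f a b \<and> (\<forall>y. y \<epsilon> b \<longrightarrow> (\<exists>!x. x \<epsilon> a \<and> app f x = y))"

definition restriction :: "'m \<Rightarrow> 'm \<Rightarrow> 'm" where
  "restriction f a = coll (\<lambda>p. p \<epsilon> f \<and> (\<exists>x y. x \<epsilon> a \<and> p = opair x y))"

definition preimage :: "'m \<Rightarrow> 'm \<Rightarrow> 'm \<Rightarrow> 'm" where
  "preimage f a b = coll (\<lambda>x. x \<epsilon> a \<and> app f x \<epsilon> b)"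


section \<open>Ordinals, cardinals and order types\<close>

text \<open>In the presence of Foundation, the von Neumann ordinals are the transitive sets all of whose
  members are transitive.\<close>

definition transitive_set :: "'m \<Rightarrow> bool" where
  "transitive_set a \<longleftrightarrow> (\<forall>x. x \<epsilon> a \<longrightarrow> subset x a)"

definition ordinal :: "'m \<Rightarrow> bool" where
  "ordinal a \<longleftrightarrow> transitive_set a \<and> (\<forall>x. x \<epsilon> a \<longrightarrow> transitive_set x)"

definition cardinal :: "'m \<Rightarrow> bool" where
  "cardinal \<kappa> \<longleftrightarrow> ordinal \<kappa> \<and> \<not> (\<exists>\<alpha> f. \<alpha> \<epsilon> \<kappa> \<and> is_bijection f \<alpha> \<kappa>)"

definition successor_cardinal :: "'m \<Rightarrow> 'm" where
  "successor_cardinal \<kappa> =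
    (THE \<mu>. cardinal \<mu> \<and> \<kappa> \<epsilon> \<mu> \<and> (\<forall>\<nu>. cardinal \<nu> \<and> \<kappa> \<epsilon> \<nu> \<longrightarrow> subset \<mu> \<nu>))"

definition omega1 :: 'm where
  "omega1 = successor_cardinal omega"

definition omega2 :: 'm where
  "omega2 = successor_cardinal omega1"

text \<open>\<open>has_order_type D R \<alpha>\<close>: the set \<open>D\<close>, ordered by the reflexive order \<open>R\<close>, is isomorphic, by an
  isomorphism belonging to the structure, to the ordinal \<open>\<alpha>\<close>; so \<open>R\<close> well-orders \<open>D\<close>.\<close>

definition has_order_type :: "'m \<Rightarrow> ('m \<Rightarrow> 'm \<Rightarrow> bool) \<Rightarrow> 'm \<Rightarrow> bool" where
  "has_order_type D R \<alpha> \<longleftrightarrow> ordinal \<alpha> \<and>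
    (\<exists>f. is_bijection f D \<alpha> \<and>
      (\<forall>d e. d \<epsilon> D \<and> e \<epsilon> D \<longrightarrow> (R d e \<longleftrightarrow> app f d \<epsilon> app f e \<or> app f d = app f e)))"


section \<open>Baire space\<close>

definition baire :: 'm where
  "baire = coll (\<lambda>x. is_function x omega omega)"

text \<open>A natural number is the set of its predecessors, so \<open>restriction x n\<close> is the initial segment
  of \<open>x\<close> of length \<open>n\<close>.\<close>

definition open_set :: "'m \<Rightarrow> bool" where
  "open_set U \<longleftrightarrow> subset U baire \<and>
    (\<forall>x. x \<epsilon> U \<longrightarrow>
      (\<exists>n. n \<epsilon> omega \<and> (\<forall>y. y \<epsilon> baire \<and> restriction y n = restriction x n \<longrightarrow> y \<epsilon> U)))"

definition continuous :: "'m \<Rightarrow> bool" where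
  "continuous \<theta> \<longleftrightarrow> is_function \<theta> baire baire \<and>
    (\<forall>U. open_set U \<longrightarrow> open_set (preimage \<theta> baire U))"

definition complement :: "'m \<Rightarrow> 'm" where
  "complement A = setminus baire A"

text \<open>The analytic sets are the empty set and the continuous images of Baire space.\<close>

definition analytic :: "'m \<Rightarrow> bool" where
  "analytic A \<longleftrightarrow> A = empty \<or>
    (\<exists>\<theta>. continuous \<theta> \<and> (\<forall>y. y \<epsilon> A \<longleftrightarrow> (\<exists>x. x \<epsilon> baire \<and> app \<theta> x = y)))"

definition coanalytic :: "'m \<Rightarrow> bool" where
  "coanalytic A \<longleftrightarrow> subset A baire \<and> analytic (complement A)"


section \<open>The axiom of determinacy\<close>

definition finite_sequences :: 'm where
  "finite_sequences = coll (\<lambda>s. \<exists>n. n \<epsilon> omega \<and> is_function s n omega)"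

text \<open>Player I plays the values \<open>x(n)\<close> for even \<open>n\<close> and player II those for odd \<open>n\<close>; player I wins
  the run \<open>x\<close> of the game with payoff set \<open>A\<close> iff \<open>x \<in> A\<close>.  Strategies are defined on all positions;
  their values at positions where it is the opponent's turn are irrelevant.\<close>

definition strategy :: "'m \<Rightarrow> bool" where
  "strategy \<sigma> \<longleftrightarrow> is_function \<sigma> finite_sequences omega"

definition winning_for_I :: "'m \<Rightarrow> 'm \<Rightarrow> bool" where
  "winning_for_I \<sigma> A \<longleftrightarrow>
    (\<forall>x. x \<epsilon> baire \<and>
         (\<forall>n. n \<epsilon> omega \<and> even_number n \<longrightarrow> app x n = app \<sigma> (restriction x n)) \<longrightarrow> x \<epsilon> A)"

definition winning_for_II :: "'m \<Rightarrow> 'm \<Rightarrow> bool" where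
  "winning_for_II \<sigma> A \<longleftrightarrow>
    (\<forall>x. x \<epsilon> baire \<and>
         (\<forall>n. n \<epsilon> omega \<and> \<not> even_number n \<longrightarrow> app x n = app \<sigma> (restriction x n)) \<longrightarrow> \<not> x \<epsilon> A)"

definition determined :: "'m \<Rightarrow> bool" where
  "determined A \<longleftrightarrow> (\<exists>\<sigma>. strategy \<sigma> \<and> (winning_for_I \<sigma> A \<or> winning_for_II \<sigma> A))"

definition AD :: bool where
  "AD \<longleftrightarrow> (\<forall>A. subset A baire \<longrightarrow> determined A)"


section \<open>The class of decreasing omega-differences of coanalytic sets\<close>

text \<open>Classes of subsets of Baire space are given as predicates on the structure.\<close>

definition neg_class :: "('m \<Rightarrow> bool) \<Rightarrow> 'm \<Rightarrow> bool" where
  "neg_class \<Gamma> A \<longleftrightarrow> (\<exists>B. \<Gamma> B \<and> A = complement B)"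

definition Delta :: "('m \<Rightarrow> bool) \<Rightarrow> 'm \<Rightarrow> bool" where
  "Delta \<Gamma> A \<longleftrightarrow> \<Gamma> A \<and> neg_class \<Gamma> A"

definition powerset_baire :: 'm where
  "powerset_baire = coll (\<lambda>A. subset A baire)"

definition decreasing_sequence :: "'m \<Rightarrow> bool" where
  "decreasing_sequence B \<longleftrightarrow> is_function B omega powerset_baire \<and>
    (\<forall>n. n \<epsilon> omega \<longrightarrow> subset (app B (successor n)) (app B n))"

definition Dstar :: "'m \<Rightarrow> 'm" where
  "Dstar B = coll (\<lambda>x. \<exists>n. even_number n \<and> x \<epsilon> setminus (app B n) (app B (successor n)))"

definition Dstar_omega :: "('m \<Rightarrow> bool) \<Rightarrow> 'm \<Rightarrow> bool" where
  "Dstar_omega \<Gamma> A \<longleftrightarrow>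
    (\<exists>B. decreasing_sequence B \<and> (\<forall>n. n \<epsilon> omega \<longrightarrow> \<Gamma> (app B n)) \<and> A = Dstar B)"


section \<open>Wadge degrees\<close>

definition wadge_le :: "'m \<Rightarrow> 'm \<Rightarrow> bool" where
  "wadge_le A B \<longleftrightarrow> (\<exists>\<theta>. continuous \<theta> \<and> A = preimage \<theta> baire B)"

definition wadge_equiv :: "'m \<Rightarrow> 'm \<Rightarrow> bool" where
  "wadge_equiv A B \<longleftrightarrow> wadge_le A B \<and> wadge_le B A"

text \<open>The degree of \<open>A\<close> identified with the degree of its complement: the union of the two Wadge
  equivalence classes.\<close>

definition wadge_degree :: "'m \<Rightarrow> 'm" where
  "wadge_degree A =
    coll (\<lambda>C. subset C baire \<and> (wadge_equiv C A \<or> wadge_equiv C (complement A)))"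

definition wadge_degrees :: "('m \<Rightarrow> bool) \<Rightarrow> 'm" where
  "wadge_degrees \<Gamma> = coll (\<lambda>d. \<exists>A. subset A baire \<and> \<Gamma> A \<and> d = wadge_degree A)"

definition wadge_degree_le :: "'m \<Rightarrow> 'm \<Rightarrow> bool" where
  "wadge_degree_le d e \<longleftrightarrow> (\<exists>A B. A \<epsilon> d \<and> B \<epsilon> e \<and> wadge_le A B)"

end

end

theory Submission
 imports Defs
begin

unbundle no member_ASCII_syntax

abbreviation (input) eqv (infixr "<->" 25) where "A <-> B == (A::bool) = B"

text \<open>
 The argument is carried out in a model of ZF + AD, with classes and class functions of the model rendered as
 definable predicates and functions of HOL. AD enters only through determinacy of the Lipschitz game, which yields
 Wadge's lemma, countable choice for reals and the coding of \<open>\<omega>\<^sub>1\<close>-sequences of sets of reals along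
 the well-founded trees.

 Instead of the theory of pointclasses one extends initial segments of the Wadge order. Let a segment be closed under joins. If
 it is not closed under some open operation, or if some set is outside it although its parts of bounded rank are inside,
 then a set of this kind lies directly above the segment; if neither happens, the segment contains the whole
 class in question. This shows that the Wadge order of the class is well-founded and that proper initial segments are unions of
 \<open>\<omega>\<^sub>1\<close> many bounded sets; as \<open>\<omega>\<^sub>2\<close> is regular, all ranks are below \<open>\<omega>\<^sub>2\<close>. Conversely, no map
 from \<open>\<omega>\<^sub>1\<close> is cofinal, since \<open>\<omega>\<^sub>1\<close> many members of the class can be amalgamated into a single one,
 and so the order type is \<open>\<omega>\<^sub>2\<close>.
\<close>

text \<open>The axioms are those of ZF with first-order schemas, plus AD; dependent choice is not
  among them. Separation, replacement, induction and recursion apply only to what is definable with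
  parameters, hence the obligations \<open>dp\<close> and \<open>dt\<close> everywhere. Sequences
  are built by taking least numbers or ordinals, and choices of reals are made by winning
  strategies: if player I must name a countable ordinal by a well-founded tree, boundedness defeats
  all strategies of I, and a strategy of II chooses for all of \<open>\<omega>\<^sub>1\<close> at
  once. An ill-founded Wadge order is usually refuted from a descending sequence of sets, which
  cannot be formed here; so a segment known to be well-founded is enlarged by one degree, and what
  is needed to go on is carried along: selfdual sets reduce to joins of smaller sets, and the sets
  below a member are few in the sense of \<open>cof1\<close>. A new degree is a join or a
  nonselfdual pivot. For pivots one device recurs: when a set and its complement both reduce to it,
  the reductions are run in parallel, and either one of them answers within a bounded rank, or the
  undecided points form a closed set onto which one retracts.\<close>

primrec ren :: "(nat => nat) => fm => fm" where
 "ren r (FMem i j) = FMem (r i) (r j)"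
| "ren r (FEq i j) = FEq (r i) (r j)"
| "ren r (FNeg \<phi>) = FNeg (ren r \<phi>)"
| "ren r (FConj \<phi> \<psi>) = FConj (ren r \<phi>) (ren r \<psi>)"
| "ren r (FAll i \<phi>) = FAll (r i) (ren r \<phi>)"

text \<open>Bound variables are renamed as well, so injectivity is what excludes capture.\<close>

lemma sat_ren:
 assumes "inj r" shows "sat mem (ren r \<phi>) s = sat mem \<phi> (%n. s (r n))"
proof (induction \<phi> arbitrary: s)
 case (FAll i \<phi>)
 have "(%n. (s(r i := a)) (r n)) = (%n. s (r n))(i := a)" for a
  using assms by (auto simp: fun_eq_iff inj_eq)
 then show ?case using FAll by simp
qed auto

definition mrg :: "(nat => 'm) => (nat => 'm) => nat => 'm" where
 "mrg s c n = (if even n then s (n div 2) else c (n div 2))"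

section \<open>Definability with parameters over the structure\<close>

locale zf =
 fixes mem :: "'m => 'm => bool"  (infix ":" 50)
 assumes ZF: "ZF mem"
begin

text \<open>\<open>dp P\<close> and \<open>dt t\<close>: the predicate \<open>P\<close> and the term \<open>t\<close>, which depend on an assignment,
 are first-order definable over the structure with parameters.  The even variables of the
 defining formula are the arguments and the odd ones hold the parameters.\<close>

definition dp :: "((nat => 'm) => bool) => bool" where
 "dp P <-> (EX \<phi> c. ALL s. P s = sat (:) \<phi> (mrg s c))"

definition dt :: "((nat => 'm) => 'm) => bool" where
 "dt t <-> dp (%s. s 0 = t (%n. s (Suc n)))"

lemma dp_neg [simp]: "dp P ==> dp (%s. ~P s)"
 unfolding dp_def by (metis sat.simps(3))

lemma dp_mem_var: "dp (%s. s i:s j)"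
 unfolding dp_def by (rule exI[of _ "FMem (2*i) (2*j)"]) (simp add: mrg_def)

lemma dp_eq_var: "dp (%s. s i = s j)"
 unfolding dp_def by (rule exI[of _ "FEq (2*i) (2*j)"]) (simp add: mrg_def)

lemma dp_conj [simp]:
 assumes "dp P" "dp Q" shows "dp (%s. P s & Q s)"
proof -
 obtain \<phi> c where 1: "!!s. P s = sat (:) \<phi> (mrg s c)" using assms(1) dp_def by auto
 obtain \<psi> d where 2: "!!s. Q s = sat (:) \<psi> (mrg s d)" using assms(2) dp_def by auto
 \<comment> \<open>The parameters of the two formulas are interleaved: parameter \<open>k\<close>
   moves to variable \<open>4k+1\<close> or \<open>4k+3\<close>.\<close>
 define r1 where "r1 n = (if even n then n else 2*(n-1)+1)" for n :: nat
 define r2 where "r2 n = (if even n then n else 2*(n-1)+3)" for n :: nat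
 have i1: "inj r1" by (auto simp: inj_def r1_def split: if_splits; presburger)
 have i2: "inj r2" by (auto simp: inj_def r2_def split: if_splits; presburger)
 define e where "e n = (if even n then c (n div 2) else d (n div 2))" for n :: nat
 have "mrg s e (r1 n) = mrg s c n" for s n
  by (auto simp: mrg_def r1_def e_def elim!: oddE)
 then have e1: "(%n. mrg s e (r1 n)) = mrg s c" for s by (auto simp: fun_eq_iff)
 have "mrg s e (r2 n) = mrg s d n" for s n
  by (auto simp: mrg_def r2_def e_def elim!: oddE)
 then have e2: "(%n. mrg s e (r2 n)) = mrg s d" for s by (auto simp: fun_eq_iff)
 have "(P s & Q s) = sat (:) (FConj (ren r1 \<phi>) (ren r2 \<psi>)) (mrg s e)" for s
  by (simp add: sat_ren[OF i1] sat_ren[OF i2] e1 e2 1 2)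
 then show ?thesis unfolding dp_def by blast
qed

lemma dp_all [simp]:
 assumes "dp (%s. P (%n. s (Suc n)) (s 0))" shows "dp (%s. ALL x. P s x)"
proof -
 obtain \<phi> c where 1: "!!s. P (%n. s (Suc n)) (s 0) = sat (:) \<phi> (mrg s c)"
  using assms dp_def by auto
 \<comment> \<open>The bound variable needs a slot of its own: the parameters move up by two, which
   frees variable 1, and argument 0 of the body moves there.\<close>
 define r where "r n = (if n = 0 then 1 else if even n then n - 2 else n + 2)" for n :: nat
 have i: "inj r" by (auto simp: inj_def r_def split: if_splits; presburger)
 define d where "d n = c (n - 1)" for n :: nat
 have "(%n. ((mrg s d)(1 := a)) (r n)) = mrg (case_nat a s) c" for s a
 proof
  fix n show "((mrg s d)(1 := a)) (r n) = mrg (case_nat a s) c n"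
  proof (cases "even n")
   case True then obtain k where "n = 2*k" by blast
   then show ?thesis by (cases k) (auto simp: r_def mrg_def)
  next
   case False then obtain k where "n = 2*k+1" by (auto elim: oddE)
   then show ?thesis by (auto simp: r_def mrg_def d_def)
  qed
 qed
 then have "(ALL x. P s x) = sat (:) (FAll 1 (ren r \<phi>)) (mrg s d)" for s
  by (simp add: sat_ren[OF i] flip: 1)
 then show ?thesis unfolding dp_def by blast
qed

lemma dp_rename:
 assumes "dp P" "inj h" shows "dp (%s. P (%n. s (h n)))"
proof -
 obtain \<phi> c where 1: "!!s. P s = sat (:) \<phi> (mrg s c)" using assms(1) dp_def by auto
 define r where "r n = (if even n then 2 * h (n div 2) else n)" for n :: nat
 have i: "inj r"
 proof (rule injI)
  fix x y assume "r x = r y"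
  then show "x = y" using injD[OF assms(2), of "x div 2" "y div 2"]
   by (auto simp: r_def split: if_splits; presburger)
 qed
 have "(%n. mrg s c (r n)) = mrg (%n. s (h n)) c" for s by (auto simp: mrg_def r_def)
 then have "P (%n. s (h n)) = sat (:) (ren r \<phi>) (mrg s c)" for s
  by (simp add: sat_ren[OF i] 1)
 then show ?thesis unfolding dp_def by blast
qed

lemma dp_param_eq: "dp (%s. s i = c)"
 unfolding dp_def by (rule exI[of _ "FEq (2*i) 1"], rule exI[of _ "%_. c"]) (simp add: mrg_def)

lemma dp_ex [simp]: "dp (%s. P (%n. s (Suc n)) (s 0)) ==> dp (%s. EX x. P s x)"
 using dp_neg[OF dp_all[of "%s x. ~P s x"]] by simp

lemma dp_disj [simp]: "dp P ==> dp Q ==> dp (%s. P s | Q s)"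
 using dp_neg[OF dp_conj[of "%s. ~P s" "%s. ~Q s"]] by simp

lemma dp_imp [simp]: "dp P ==> dp Q ==> dp (%s. P s --> Q s)"
 using dp_disj[of "%s. ~P s" Q] by simp

lemma dp_iff [simp]: "dp P ==> dp Q ==> dp (%s. P s = Q s)"
 using dp_conj[of "%s. P s --> Q s" "%s. Q s --> P s"] dp_imp[of P Q] dp_imp[of Q P]
 by (simp add: iff_conv_conj_imp)

lemma dp_const [simp]: "dp (%s. b)"
proof (cases b)
 case True then show ?thesis using dp_eq_var[of 0 0] by simp
next
 case False then show ?thesis using dp_neg[OF dp_eq_var[of 0 0]] by simp
qed

lemma dt_var [simp]: "dt (%s. s i)"
 unfolding dt_def using dp_eq_var[of 0 "Suc i"] by simp

lemma dt_const [simp]: "dt (%s. c)"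
 unfolding dt_def using dp_param_eq[of 0 c] by simp

lemma dp_subst:
 assumes "dp (%s. P (%n. s (Suc n)) (s 0))" "dt a" shows "dp (%s. P s (a s))"
proof -
 have "dp (%s. EX x. x = a s & P s x)"
  by (rule dp_ex) (use dp_conj[OF assms(2)[unfolded dt_def] assms(1)] in simp)
 then show ?thesis by simp
qed

lemma dt_push: 
 assumes "dt t" shows "dt (%s. t (%n. s (Suc n)))"
proof -
 have "inj (%n::nat. if n = 0 then 0 else Suc n)" by (auto simp: inj_def split: if_splits)
 from dp_rename[OF assms[unfolded dt_def] this] show ?thesis by (simp add: dt_def)
qed

text \<open>The lifting rules reduce a notion applied to terms to the case of variables. Each
  substitution costs one quantifier, under which the remaining terms have to be shifted by
  \<open>dt_push\<close>.\<close>

lemma dp_lift1: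
 assumes "!!i. dp (%s. Q (s i))" "dt a" shows "dp (%s. Q (a s))"
 using dp_subst[of "%s. Q" a] assms by simp

lemma dp_lift2:
 assumes "!!i j. dp (%s. Q (s i) (s j))" "dt a" "dt b" shows "dp (%s. Q (a s) (b s))"
proof -
 have "dp (%s. Q (s i) (b s))" if "dt b" for i b
  using dp_subst[of "%s. Q (s i)" b] assms(1)[of "Suc i" 0] that by simp
 from this[OF dt_push[OF assms(3)], of 0] show ?thesis
  using dp_subst[of "%s x. Q x (b s)" a] assms(2) by simp
qed

lemma dp_lift3:
 assumes "!!i j k. dp (%s. Q (s i) (s j) (s k))" "dt a" "dt b" "dt c"
 shows "dp (%s. Q (a s) (b s) (c s))"
proof -
 have "dp (%s. Q (s i) (b s) (c s))" if "dt b" "dt c" for i b c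
  using dp_subst[of "%s x. Q x (b s) (c s)" "%s. s i"]
   dp_subst[of "%s. Q (s i) (b s)" c] 
   dp_lift2[of "%x z. Q (s i) x z" b c] assms(1) that
 proof -
  have 1: "dp (%s. Q (s i) (s j) (c s))" if "dt c" for i j c
   using dp_subst[of "%s. Q (s i) (s j)" c] assms(1)[of "Suc i" "Suc j" 0] that by simp
  show ?thesis
   using dp_subst[of "%s y. Q (s i) y (c s)" b] 1[OF dt_push[OF that(2)], of "Suc i" 0] that by simp
 qed
 from this[OF dt_push[OF assms(3)] dt_push[OF assms(4)], of 0] show ?thesis
  using dp_subst[of "%s x. Q x (b s) (c s)" a] assms(2) by simp
qed

lemma dp_lift4:
 assumes "!!i j k l. dp (%s. Q (s i) (s j) (s k) (s l))" "dt a" "dt b" "dt c" "dt d"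
 shows "dp (%s. Q (a s) (b s) (c s) (d s))"
proof -
 have 1: "dp (%s. Q (s i) (s j) (s k) (d s))" if "dt d" for i j k d
  using dp_subst[of "%s. Q (s i) (s j) (s k)" d] assms(1)[of "Suc i" "Suc j" "Suc k" 0] that by simp
 have 2: "dp (%s. Q (s i) (s j) (c s) (d s))" if "dt c" "dt d" for i j c d
  using dp_subst[of "%s y. Q (s i) (s j) y (d s)" c] 1[OF dt_push[OF that(2)], of "Suc i" "Suc j" 0] that by simp
 have 3: "dp (%s. Q (s i) (b s) (c s) (d s))" if "dt b" "dt c" "dt d" for i b c d
  using dp_subst[of "%s y. Q (s i) y (c s) (d s)" b] 2[OF dt_push[OF that(2)] dt_push[OF that(3)], of "Suc i" 0] that by simp
 from 3[OF dt_push[OF assms(3)] dt_push[OF assms(4)] dt_push[OF assms(5)], of 0] show ?thesis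
  using dp_subst[of "%s x. Q x (b s) (c s) (d s)" a] assms(2) by simp
qed

lemma dp_lift5:
 assumes "!!i j k l m. dp (%s. Q (s i) (s j) (s k) (s l) (s m))" "dt a" "dt b" "dt c" "dt d" "dt e"
 shows "dp (%s. Q (a s) (b s) (c s) (d s) (e s))"
proof -
 have 1: "dp (%s. Q (s i) (s j) (s k) (s l) (d s))" if "dt d" for i j k l d
  using dp_subst[of "%s. Q (s i) (s j) (s k) (s l)" d] assms(1)[of "Suc i" "Suc j" "Suc k" "Suc l" 0] that by simp
 have 2: "dp (%s. Q (s i) (s j) (s k) (c s) (d s))" if "dt c" "dt d" for i j k c d
  using dp_subst[of "%s y. Q (s i) (s j) (s k) y (d s)" c] 1[OF dt_push[OF that(2)], of "Suc i" "Suc j" "Suc k" 0] that by simp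
 have 3: "dp (%s. Q (s i) (s j) (b s) (c s) (d s))" if "dt b" "dt c" "dt d" for i j b c d
  using dp_subst[of "%s y. Q (s i) (s j) y (c s) (d s)" b] 2[OF dt_push[OF that(2)] dt_push[OF that(3)], of "Suc i" "Suc j" 0] that by simp
 have 4: "dp (%s. Q (s i) (a s) (b s) (c s) (d s))" if "dt a" "dt b" "dt c" "dt d" for i a b c d
  using dp_subst[of "%s y. Q (s i) y (b s) (c s) (d s)" a] 3[OF dt_push[OF that(2)] dt_push[OF that(3)] dt_push[OF that(4)], of "Suc i" 0] that by simp
 from 4[OF dt_push[OF assms(3)] dt_push[OF assms(4)] dt_push[OF assms(5)] dt_push[OF assms(6)], of 0] show ?thesis
  using dp_subst[of "%s x. Q x (b s) (c s) (d s) (e s)" a] assms(2) by simp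
qed

lemma dp_mem [simp]: "dt a ==> dt b ==> dp (%s. a s:b s)"
 by (rule dp_lift2[of "(:)"]) (simp_all add: dp_mem_var)

lemma dp_eq [simp]: "dt a ==> dt b ==> dp (%s. a s = b s)"
 by (rule dp_lift2[of "(=)"]) (simp_all add: dp_eq_var)

lemma dt_lift1:
 assumes "!!i. dt (%s. F (s i))" "dt a" shows "dt (%s. F (a s))"
proof -
 have "dp (%s. s i = F (s j))" for i j
  using dp_lift2[of "%x y. x = y", OF _ dt_var assms(1)] by (simp add: dp_eq_var)
 from dp_lift2[of "%x y. x = F y", OF this dt_var[of 0] dt_push[OF assms(2)]]
 show ?thesis by (simp add: dt_def)
qed

lemma dt_lift2:
 assumes "!!i j. dt (%s. F (s i) (s j))" "dt a" "dt b" shows "dt (%s. F (a s) (b s))"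
proof -
 have "dp (%s. s i = F (s j) (s k))" for i j k
  using dp_eq[OF dt_var assms(1)] by simp
 from dp_lift3[of "%x y z. x = F y z", OF this dt_var[of 0] dt_push[OF assms(2)] dt_push[OF assms(3)]]
 show ?thesis by (simp add: dt_def)
qed

lemma dt_lift3:
 assumes "!!i j k. dt (%s. F (s i) (s j) (s k))" "dt a" "dt b" "dt c" shows "dt (%s. F (a s) (b s) (c s))"
proof -
 have "dp (%s. s i = F (s j) (s k) (s l))" for i j k l
  using dp_eq[OF dt_var assms(1)] by simp
 from dp_lift4[of "%x y z w. x = F y z w", OF this dt_var[of 0] dt_push[OF assms(2)] dt_push[OF assms(3)] dt_push[OF assms(4)]]
 show ?thesis by (simp add: dt_def)
qed

lemma dt_lift4:
 assumes "!!i j k l. dt (%s. F (s i) (s j) (s k) (s l))" "dt a" "dt b" "dt c" "dt d"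
 shows "dt (%s. F (a s) (b s) (c s) (d s))"
proof -
 have "dp (%s. s i = F (s j) (s k) (s l) (s m))" for i j k l m
  using dp_eq[OF dt_var assms(1)] by simp
 from dp_lift5[of "%x y z w v. x = F y z w v", OF this dt_var[of 0] dt_push[OF assms(2)] dt_push[OF assms(3)] dt_push[OF assms(4)] dt_push[OF assms(5)]]
 show ?thesis by (simp add: dt_def)
qed

lemma dp_push: "dp P ==> dp (%s. P (%n. s (Suc n)))"
 using dp_rename[of P Suc] by simp

section \<open>Set formation\<close>

lemma ext: "(!!x. x:a <-> x:b) ==> a = b"
 using ZF unfolding ZF_def extensionality_ax_def by blast

definition is_set :: "('m => bool) => bool" where
 "is_set P <-> (EX a. ALL x. x:a <-> P x)"

text \<open>Unlike \<open>coll\<close>, this is definable outright: it is empty when the set does not exist.\<close>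

definition col :: "('m => bool) => 'm" where
 "col P = (if is_set P then THE a. ALL x. x:a <-> P x else THE a. ALL x. ~x:a)"

text \<open>A definable description operator: it collects the members of the unique witness, and is
  empty when there is no unique witness.\<close>

definition tht :: "('m => bool) => 'm" where
 "tht P = col (%z. EX y. P y & (ALL y'. P y' --> y' = y) & z:y)"

lemma is_set_col: assumes "is_set P" shows "x:col P <-> P x"
proof -
 obtain a where a: "ALL x. x:a <-> P x" using assms is_set_def by auto
 then have "(THE a. ALL x. x:a <-> P x) = a" by (intro the_equality) (auto intro!: ext)
 then show ?thesis using a assms by (simp add: col_def)
qed

lemma dp_sat: assumes "dp (%s. P (s 0))" obtains \<phi> s where "!!x. P x = sat (:) \<phi> (s(0 := x))"
proof -
 obtain \<phi> c where 1: "!!s. P (s 0) = sat (:) \<phi> (mrg s c)" using assms dp_def by auto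
 have "P x = sat (:) \<phi> ((mrg c c)(0 := x))" for x
 proof -
  have "(mrg c c)(0 := x) = mrg (c(0 := x)) c" by (auto simp: mrg_def fun_eq_iff elim: evenE)
  then show ?thesis using 1[of "c(0 := x)"] by simp
 qed
 then show ?thesis by (rule that)
qed

lemma separation: assumes "dp (%s. P (s 0))" shows "is_set (%x. x:a & P x)"
proof -
 obtain \<phi> s where "!!x. P x = sat (:) \<phi> (s(0 := x))" using dp_sat[OF assms] by blast
 moreover have "EX b. ALL x. x:b <-> x:a & sat (:) \<phi> (s(0 := x))"
  using ZF unfolding ZF_def separation_ax_def by blast
 ultimately show ?thesis unfolding is_set_def by simp
qed

lemma is_set_subset: assumes "dp (%s. P (s 0))" "!!x. P x ==> x:a" shows "is_set P"
proof -
 have "(%x. x:a & P x) = P" using assms(2) by (auto simp: fun_eq_iff)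
 then show ?thesis using separation[OF assms(1), of a] by simp
qed

text \<open>Replacement expects the arguments in the variables 0 and 1, so variable 2 moves to 1 and
  the parameters move out of the way.\<close>

lemma dp_sat2: assumes "dp (%s. P (s 0) (s 1))"
 obtains \<phi> s where "!!x y. P x y = sat (:) \<phi> (s(0 := x, 1 := y))"
proof -
 obtain \<phi> c where 1: "!!s. P (s 0) (s 1) = sat (:) \<phi> (mrg s c)" using assms dp_def by auto
 define r where "r n = (if n = 0 then 0 else if n = 2 then 1 else n + 1)" for n :: nat
 have i: "inj r" by (auto simp: inj_def r_def split: if_splits)
 define s where "s n = c ((n-1) div 2)" for n :: nat
 have "sat (:) (ren r \<phi>) (s(0 := x, 1 := y)) = P x y" for x y
 proof -
  show ?thesis
  proof -
   let ?s = "%n. (s(0 := x, 1 := y)) (r n)"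
   have "?s = mrg (%n. if n = 0 then x else if n = 1 then y else ?s (2*n)) c"
   proof
    fix n show "?s n = mrg (%n. if n = 0 then x else if n = 1 then y else ?s (2*n)) c n"
     by (cases "even n") (auto simp: mrg_def r_def s_def elim!: oddE evenE)
   qed
   then show ?thesis using sat_ren[OF i, of "(:)" \<phi>] 1[of "%n. if n = 0 then x else if n = 1 then y else ?s (2*n)"] by simp
  qed
 qed
 then show ?thesis using that by metis
qed

lemma dp_inst1:
 assumes "dp (%s. P (%n. s (Suc n)) (s 0))" "inj h" "dt a"
 shows "dp (%s. P (%n. s (h n)) (a s))"
proof (rule dp_subst[of "%s x. P (%n. s (h n)) x"])
 have "inj (case_nat 0 (%n. Suc (h n)))" using assms(2) by (intro injI) (auto split: nat.splits dest: injD)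
 from dp_rename[OF assms(1) this] show "dp (%s. P (%n. s (Suc (h n))) (s 0))" by simp
qed (rule assms(3))

lemma dp_inst2:
 assumes "dp (%s. P (%n. s (Suc (Suc n))) (s 1) (s 0))" "inj h" "dt a" "dt b"
 shows "dp (%s. P (%n. s (h n)) (a s) (b s))"
proof -
 have 1: "dp (%s. P (%n. s (Suc (h n))) (s 0) (b s))" if "inj h" "dt b" for h b
 proof -
  have "inj (case_nat 0 (%n. Suc (h n)))" using that(1) by (intro injI) (auto split: nat.splits dest: injD)
  from dp_inst1[of "%s. P (%n. s (Suc n)) (s 0)", OF assms(1)[unfolded One_nat_def] this that(2)]
  show ?thesis by (simp only: nat.case)
 qed
 show ?thesis
  by (rule dp_subst[of "%s x. P (%n. s (h n)) x (b s)"]) (rule 1[OF assms(2) dt_push[OF assms(4)]], rule assms(3))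
qed

lemma dp_sub1: "dp (%s. P (s 0)) ==> dt a ==> dp (%s. P (a s))"
 using dp_subst[of "%s. P"] by simp

lemma dp_sub2: assumes "dp (%s. P (s 0) (s 1))" "dt a" "dt b" shows "dp (%s. P (a s) (b s))"
proof -
 have "inj (%n::nat. if n = 0 then 1 else if n = 1 then 0 else n)" by (auto simp: inj_def)
 from dp_rename[OF assms(1) this] have "dp (%s. P (s 1) (s 0))" by simp
 then show ?thesis using dp_inst2[of "%s. P" "%x. x"] assms by simp
qed

lemma dt_sub1: assumes "dt (%s. F (s 0))" "dt a" shows "dt (%s. F (a s))"
proof -
 have "dp (%s. s 0 = F (s 1))" using assms(1) by (simp add: dt_def)
 from dp_sub2[OF this dt_var[of 0] dt_push[OF assms(2)]] show ?thesis by (simp add: dt_def)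
qed

lemma dt_inst1:
 assumes "dt (%s. F (%n. s (Suc n)) (s 0))" "inj h" "dt a"
 shows "dt (%s. F (%n. s (h n)) (a s))"
proof -
 have 0: "dp (%s. s 0 = F (%n. s (Suc (Suc n))) (s 1))" using assms(1) by (simp add: dt_def)
 have "inj (%n::nat. if n = 0 then 1 else if n = 1 then 0 else n)" by (auto simp: inj_def)
 from dp_rename[OF 0 this] have "dp (%s. s (Suc 0) = F (%n. s (Suc (Suc n))) (s 0))" by simp
 then have "dp (%s. s 0 = F (%n. s (Suc (h n))) (a (%n. s (Suc n))))"
 proof -
  have "inj (case_nat 0 (%n. Suc (h n)))" using assms(2) by (intro injI) (auto split: nat.splits dest: injD)
  from dp_inst1[of "%s x. s 0 = F (%n. s (Suc n)) x", OF \<open>dp (%s. s (Suc 0) = F (%n. s (Suc (Suc n))) (s 0))\<close> this dt_push[OF assms(3)]]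
  show ?thesis by (simp only: nat.case)
 qed
 then show ?thesis by (simp add: dt_def)
qed

lemma dt_inst2:
 assumes "dt (%s. F (%n. s (Suc (Suc n))) (s 1) (s 0))" "inj h" "dt a" "dt b"
 shows "dt (%s. F (%n. s (h n)) (a s) (b s))"
proof -
 have 0: "dp (%s. s 0 = F (%n. s (Suc (Suc (Suc n)))) (s 2) (s 1))"
  using assms(1) by (simp add: dt_def numeral_2_eq_2)
 have "inj (%n::nat. if n = 0 then 2 else if n \<le> 2 then n - 1 else n)" by (auto simp: inj_def split: if_splits)
 from dp_rename[OF 0 this] have "dp (%s. s 2 = F (%n. s (Suc (Suc (Suc n)))) (s 1) (s 0))" by simp
 then have "dp (%s. s 0 = F (%n. s (Suc (h n))) (a (%n. s (Suc n))) (b (%n. s (Suc n))))"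
 proof -
  have "inj (case_nat 0 (%n. Suc (h n)))" using assms(2) by (intro injI) (auto split: nat.splits dest: injD)
  from dp_inst2[of "%s x y. s 0 = F (%n. s (Suc n)) x y",
    OF \<open>dp (%s. s 2 = F (%n. s (Suc (Suc (Suc n)))) (s 1) (s 0))\<close>[unfolded numeral_2_eq_2] this dt_push[OF assms(3)] dt_push[OF assms(4)]]
  show ?thesis by (simp only: nat.case)
 qed
 then show ?thesis by (simp add: dt_def)
qed

lemma inj_Suc2 [simp]: "inj (%n. Suc (Suc n))" "inj (%n. Suc (Suc (Suc n)))" "inj (%n. Suc (Suc (Suc (Suc n))))"
 "inj (%n. Suc (Suc (Suc (Suc (Suc n)))))" "inj (%n. Suc (Suc (Suc (Suc (Suc (Suc n))))))"
 "inj (%n. Suc (Suc (Suc (Suc (Suc (Suc (Suc n)))))))"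
 by (auto simp: inj_def)

lemma dt_pushes:
 assumes "dt t"
 shows "dt t" "dt (%s. t (%n. s (Suc n)))" "dt (%s. t (%n. s (Suc (Suc n))))"
  "dt (%s. t (%n. s (Suc (Suc (Suc n)))))" "dt (%s. t (%n. s (Suc (Suc (Suc (Suc n))))))"
 using assms dt_push[OF assms] dt_push[OF dt_push[OF assms]] dt_push[OF dt_push[OF dt_push[OF assms]]]
  dt_push[OF dt_push[OF dt_push[OF dt_push[OF assms]]]] .

lemma dp_if [simp]: "dp P ==> dp Q ==> dp R ==> dp (%s. if P s then Q s else R s)"
 using dp_conj[OF dp_imp[of P Q] dp_imp[of "%s. ~P s" R]] by (simp add: if_bool_eq_conj)

lemma dt_if [simp]: assumes "dp P" "dt a" "dt b" shows "dt (%s. if P s then a s else b s)"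
proof -
 have "dp (%s. if P (%n. s (Suc n)) then s 0 = a (%n. s (Suc n)) else s 0 = b (%n. s (Suc n)))"
  using assms dp_push[OF assms(1)] by (intro dp_if) (auto simp: dt_def)
 moreover have "(if Q then x = y else x = z) = (x = (if Q then y else z))" for Q and x y z :: 'm by simp
 ultimately show ?thesis unfolding dt_def by (simp only:)
qed

lemma dp_ex1 [simp]: assumes "dp (%s. P (%n. s (Suc n)) (s 0))" shows "dp (%s. EX! x. P s x)"
 unfolding Ex1_def
 using dp_inst1[OF assms inj_Suc2(1), of "%s. s 0"] assms by simp

lemma is_set_empty: "is_set (%x. False)"
 using separation[of "%x. False"] by simp

lemma col_eq_iff: "y = col P <-> (ALL x. x:y <-> P x) | ~(EX a. ALL x. x:a <-> P x) & (ALL x. ~x:y)"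
proof (cases "is_set P")
 case True then show ?thesis using is_set_col[OF True] by (auto intro!: ext simp: is_set_def)
next
 case False
 obtain e where e: "ALL x. ~x:e" using is_set_empty by (auto simp: is_set_def)
 then have "(THE a. ALL x. ~x:a) = e" by (intro the_equality) (auto intro!: ext)
 then have "col P = e" using False by (simp add: col_def)
 then show ?thesis using False e by (auto simp: is_set_def intro!: ext)
qed

lemma dt_col [simp]: assumes "dp (%s. P (%n. s (Suc n)) (s 0))" shows "dt (%s. col (P s))"
 unfolding dt_def col_eq_iff
 using dp_inst1[OF assms inj_Suc2(1), of "%s. s 0"] dp_inst1[OF assms inj_Suc2(2), of "%s. s 0"] by simp

lemma dt_tht [simp]: assumes "dp (%s. P (%n. s (Suc n)) (s 0))" shows "dt (%s. tht (P s))"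
 unfolding tht_def
 using dp_inst1[OF assms inj_Suc2(1), of "%s. s 0"] dp_inst1[OF assms inj_Suc2(2), of "%s. s 0"] by simp

lemma tht_eq: assumes "P y" "!!y'. P y' ==> y' = y" shows "tht P = y"
proof -
 have "(%z. EX y. P y & (ALL y'. P y' --> y' = y) & z:y) = (%z. z:y)"
  by (rule HOL.ext) (metis assms)
 moreover have "is_set (%z. z:y)" by (auto simp: is_set_def)
 ultimately have "x:tht P <-> x:y" for x unfolding tht_def by (simp only: is_set_col)
 then show ?thesis by (rule ext)
qed

definition emp where "emp = col (%x. False)"
definition upr where "upr a b = col (%x. x = a | x = b)"
definition opr where "opr a b = upr (upr a a) (upr a b)"
definition Uni where "Uni a = col (%x. EX y. x:y & y:a)"
definition sb where "sb a b <-> (ALL x. x:a --> x:b)"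
definition Pw where "Pw a = col (%x. sb x a)"
definition Sep where "Sep a P = col (%x. x:a & P x)"
definition Rep where "Rep a F = col (%y. EX x. x:a & y = F x)"
definition un where "un a b = col (%x. x:a | x:b)"
definition sc where "sc a = col (%x. x:a | x = a)"
definition Lam where "Lam a F = col (%p. EX x. x:a & p = opr x (F x))"
definition ap where "ap f x = tht (%y. opr x y:f)"
definition Prd where "Prd a b = col (%p. EX x y. x:a & y:b & p = opr x y)"
definition p1 where "p1 p = tht (%x. EX y. p = opr x y)"
definition p2 where "p2 p = tht (%y. EX x. p = opr x y)"
definition fn where "fn f a b <->
 (ALL p. p:f --> (EX x y. x:a & y:b & p = opr x y)) & (ALL x. x:a --> (EX! y. opr x y:f))"

lemma dt_upr [simp]: "dt a ==> dt b ==> dt (%s. upr (a s) (b s))"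
 by (rule dt_lift2) (simp_all add: upr_def)
lemma dt_opr [simp]: "dt a ==> dt b ==> dt (%s. opr (a s) (b s))"
 by (simp add: opr_def)
lemma dt_Uni [simp]: "dt a ==> dt (%s. Uni (a s))"
 by (rule dt_lift1) (simp_all add: Uni_def)
lemma dp_sb [simp]: "dt a ==> dt b ==> dp (%s. sb (a s) (b s))"
 by (rule dp_lift2) (simp_all add: sb_def)
lemma dt_Pw [simp]: "dt a ==> dt (%s. Pw (a s))"
 by (rule dt_lift1) (simp_all add: Pw_def)
lemma dt_Sep [simp]: "dt a ==> dp (%s. P (%n. s (Suc n)) (s 0)) ==> dt (%s. Sep (a s) (P s))"
 unfolding Sep_def using dt_push[of a] by simp
lemma dt_Rep [simp]: assumes "dt a" "dt (%s. F (%n. s (Suc n)) (s 0))" shows "dt (%s. Rep (a s) (F s))"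
 unfolding Rep_def using dt_push[OF dt_push[OF assms(1)]] dt_inst1[OF assms(2) inj_Suc2(1), of "%s. s 0"] by simp
lemma dt_un [simp]: "dt a ==> dt b ==> dt (%s. un (a s) (b s))"
 by (rule dt_lift2) (simp_all add: un_def)
lemma dt_sc [simp]: "dt a ==> dt (%s. sc (a s))"
 by (rule dt_lift1) (simp_all add: sc_def)
lemma dt_Lam [simp]: assumes "dt a" "dt (%s. F (%n. s (Suc n)) (s 0))" shows "dt (%s. Lam (a s) (F s))"
 unfolding Lam_def using dt_push[OF dt_push[OF assms(1)]] dt_inst1[OF assms(2) inj_Suc2(1), of "%s. s 0"] by simp
lemma dt_ap [simp]: "dt a ==> dt b ==> dt (%s. ap (a s) (b s))"
 by (rule dt_lift2) (simp_all add: ap_def)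
lemma dt_Prd [simp]: "dt a ==> dt b ==> dt (%s. Prd (a s) (b s))"
 by (rule dt_lift2) (simp_all add: Prd_def)
lemma dt_p1 [simp]: "dt a ==> dt (%s. p1 (a s))"
 by (rule dt_lift1) (simp_all add: p1_def)
lemma dt_p2 [simp]: "dt a ==> dt (%s. p2 (a s))"
 by (rule dt_lift1) (simp_all add: p2_def)
lemma dp_fn [simp]: "dt a ==> dt b ==> dt c ==> dp (%s. fn (a s) (b s) (c s))"
 by (rule dp_lift3) (simp_all add: fn_def)

lemma mem_emp [simp]: "~x:emp" by (simp add: emp_def is_set_col is_set_empty)
lemma mem_upr [simp]: "x:upr a b <-> x = a | x = b"
proof -
 have "is_set (%x. x = a | x = b)" using ZF unfolding ZF_def pairing_ax_def is_set_def by blast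
 then show ?thesis by (simp add: upr_def is_set_col)
qed
lemma mem_Uni [simp]: "x:Uni a <-> (EX y. x:y & y:a)"
proof -
 have "is_set (%x. EX y. x:y & y:a)" using ZF unfolding ZF_def union_ax_def is_set_def by blast
 then show ?thesis by (simp add: Uni_def is_set_col)
qed
lemma mem_Pw [simp]: "x:Pw a <-> sb x a"
proof -
 have "is_set (%x. sb x a)" using ZF unfolding ZF_def powerset_ax_def is_set_def sb_def by blast
 then show ?thesis by (simp add: Pw_def is_set_col)
qed
lemma mem_Sep [simp]: "dp (%s. P (s 0)) ==> x:Sep a P <-> x:a & P x"
 by (simp add: Sep_def is_set_col separation)
lemma mem_un [simp]: "x:un a b <-> x:a | x:b"
proof -
 have "is_set (%x. x:a | x:b)" by (rule is_set_subset[of _ "Uni (upr a b)"]) auto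
 then show ?thesis by (simp add: un_def is_set_col)
qed
lemma mem_sc [simp]: "x:sc a <-> x:a | x = a"
proof -
 have "is_set (%x. x:a | x = a)" by (rule is_set_subset[of _ "un a (upr a a)"]) auto
 then show ?thesis by (simp add: sc_def is_set_col)
qed
lemma mem_Rep [simp]: assumes "dt (%s. F (s 0))" shows "y:Rep a F <-> (EX x. x:a & y = F x)"
proof -
 have "dp (%s. s 1 = F (s 0))" using dp_eq[OF dt_var[of 1] assms] .
 then obtain \<phi> s where s: "!!x y. (y = F x) = sat (:) \<phi> (s(0 := x, 1 := y))"
  using dp_sat2[of "%x y. y = F x"] by auto
 have "EX b. ALL y. y:b <-> (EX x. x:a & sat (:) \<phi> (s(0 := x, 1 := y)))"
 proof -
  have "ALL x. x:a --> (EX! y. sat (:) \<phi> (s(0 := x, 1 := y)))" unfolding s[symmetric] by auto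
  then show ?thesis using ZF unfolding ZF_def replacement_ax_def by blast
 qed
 then have "is_set (%y. EX x. x:a & y = F x)" by (simp add: is_set_def s)
 then show ?thesis by (simp add: Rep_def is_set_col)
qed

lemma emp_iff: "a = emp <-> (ALL x. ~x:a)" by (auto intro: ext)
lemma sbI: "(!!x. x:a ==> x:b) ==> sb a b" by (simp add: sb_def)
lemma sbD: "sb a b ==> x:a ==> x:b" by (simp add: sb_def)
lemma sb_refl [simp]: "sb a a" by (simp add: sb_def)
lemma sb_trans: "sb a b ==> sb b c ==> sb a c" by (simp add: sb_def)
lemma sb_antisym: "sb a b ==> sb b a ==> a = b" by (auto simp: sb_def intro: ext)
lemma sb_Sep [simp]: "dp (%s. P (s 0)) ==> sb (Sep a P) a" by (simp add: sb_def)

lemma upr_eq: "upr a b = upr c d <-> (a = c & b = d) | (a = d & b = c)"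
proof
 assume "upr a b = upr c d"
 then have "x:upr a b <-> x:upr c d" for x by simp
 then have "x = a | x = b <-> x = c | x = d" for x by simp
 then show "(a = c & b = d) | (a = d & b = c)" by metis
qed (auto intro: ext)
lemma opr_eq [simp]: "opr a b = opr c d <-> a = c & b = d"
 by (auto simp: opr_def upr_eq)

lemma p1_opr [simp]: "p1 (opr a b) = a" unfolding p1_def by (rule tht_eq) auto
lemma p2_opr [simp]: "p2 (opr a b) = b" unfolding p2_def by (rule tht_eq) auto

lemma mem_Lam [simp]: assumes "dt (%s. F (s 0))" shows "p:Lam a F <-> (EX x. x:a & p = opr x (F x))"
proof -
 have "Lam a F = Rep a (%x. opr x (F x))" by (simp add: Lam_def Rep_def)
 then show ?thesis using mem_Rep[of "%x. opr x (F x)"] assms by simp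
qed

lemma mem_Prd [simp]: "p:Prd a b <-> (EX x y. x:a & y:b & p = opr x y)"
proof -
 have "is_set (%p. EX x y. x:a & y:b & p = opr x y)"
 proof (rule is_set_subset[of _ "Uni (Rep a (%x. Rep b (%y. opr x y)))"])
  fix p assume "EX x y. x:a & y:b & p = opr x y"
  then obtain x y where "x:a" "y:b" "p = opr x y" by blast
  then have "p:Rep b (%y. opr x y) & Rep b (%y. opr x y):Rep a (%x. Rep b (%y. opr x y))" by auto
  then show "p:Uni (Rep a (%x. Rep b (%y. opr x y)))" by (auto simp del: mem_Rep)
 qed simp
 then show ?thesis by (simp add: Prd_def is_set_col)
qed

lemma ap_eqI: "(!!y. opr x y:f <-> y = v) ==> ap f x = v"
 unfolding ap_def by (rule tht_eq) auto

lemma ap_Lam [simp]: "x:a ==> dt (%s. F (s 0)) ==> ap (Lam a F) x = F x"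
 by (rule ap_eqI) auto

lemma Lam_cong: "(!!x. x:a ==> F x = G x) ==> Lam a F = Lam a G"
proof -
 assume "!!x. x:a ==> F x = G x"
 then have "(%p. EX x. x:a & p = opr x (F x)) = (%p. EX x. x:a & p = opr x (G x))"
  by (auto simp: fun_eq_iff)
 then show ?thesis by (simp add: Lam_def)
qed

lemma fn_ap: assumes "fn f a b" "x:a" shows "opr x y:f <-> y = ap f x" "ap f x:b"
proof -
 have "EX! v. opr x v:f" using assms by (simp add: fn_def)
 then obtain v where v: "opr x v:f" "!!y. opr x y:f ==> y = v" by blast
 have e: "ap f x = v" by (rule ap_eqI) (metis v)
 show "opr x y:f <-> y = ap f x" unfolding e by (metis v)
 have "EX x' y. x':a & y:b & opr x v = opr x' y" using assms(1) v(1) unfolding fn_def by blast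
 then show "ap f x:b" using e by auto
qed

lemma fn_Lam: "dt (%s. F (s 0)) ==> (!!x. x:a ==> F x:b) ==> fn (Lam a F) a b"
 by (auto simp: fn_def)

lemma fn_ext: assumes "fn f a b" "fn g a c" "!!x. x:a ==> ap f x = ap g x" shows "f = g"
proof (rule ext)
 fix p 
 have "p:f <-> (EX x. x:a & p = opr x (ap f x))" using assms(1) fn_ap(1)[OF assms(1)]
  by (metis fn_def)
 moreover have "p:g <-> (EX x. x:a & p = opr x (ap g x))" using assms(2) fn_ap(1)[OF assms(2)]
  by (metis fn_def)
 ultimately show "p:f <-> p:g" using assms(3) by auto
qed

lemma fn_sb_Pw: "fn f a b ==> f:Pw (Prd a b)"
 by (auto simp: fn_def sb_def)

definition Fn where "Fn a b = Sep (Pw (Prd a b)) (%f. fn f a b)"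
lemma mem_Fn [simp]: "f:Fn a b <-> fn f a b"
 using fn_sb_Pw by (auto simp: Fn_def)

lemma foundation: "x:a ==> EX x. x:a & (ALL y. y:x --> ~y:a)"
 using ZF unfolding ZF_def foundation_ax_def by blast

lemma mem_irrefl [simp]: "~x:x"
 using foundation[of x "upr x x"] by auto

lemma mem_asym: "x:y ==> ~y:x"
 using foundation[of x "upr x y"] by auto

section \<open>Recursion along well-founded relations\<close>

definition wf where "wf A r <->
 (ALL Z. sb Z A & (EX x. x:Z) --> (EX x. x:Z & (ALL y. y:Z --> ~r y x)))"

lemma dp_wf [simp]: assumes "dt A" "dp (%s. r (%n. s (Suc (Suc n))) (s 1) (s 0))" shows "dp (%s. wf (A s) (r s))"
 unfolding wf_def using dt_push[OF assms(1)] dp_inst2[OF assms(2) inj_Suc2(2), of "%s. s 0" "%s. s 1"]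
 by simp

lemma wf_ind:
 assumes "wf A r" "x:A" "dp (%s. P (s 0))"
  "!!x. x:A ==> (!!y. y:A ==> r y x ==> P y) ==> P x"
 shows "P x"
proof (rule ccontr)
 assume "~P x"
 then have "x:Sep A (%x. ~P x)" using assms by simp
 moreover have "sb (Sep A (%x. ~P x)) A" using assms(3) by simp
 ultimately obtain z where "z:Sep A (%x. ~P x)" "!!y. y:Sep A (%x. ~P x) ==> ~r y z"
  using assms(1) unfolding wf_def by meson
 then show False using assms(3,4) by auto
qed

text \<open>An attempt at the recursion: \<open>f\<close> satisfies it on \<open>D\<close>, which is
  closed under predecessors. Attempts agree where both are defined, so \<open>wr\<close> need not
  choose one.\<close>

definition att where "att A r H f D <-> sb D A &
 (ALL x y. x:D --> y:A --> r y x --> y:D) &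
 (ALL x. x:D --> ap f x = H x (Lam (Sep A (%y. r y x)) (ap f)))"

definition wr where "wr A r H x = tht (%v. EX f D. att A r H f D & x:D & v = ap f x)"

lemma dp_att [simp]:
 assumes A: "dt A" and r: "dp (%s. r (%n. s (Suc (Suc n))) (s 1) (s 0))"
  and H: "dt (%s. H (%n. s (Suc (Suc n))) (s 1) (s 0))" and "dt f" "dt D"
 shows "dp (%s. att (A s) (r s) (H s) (f s) (D s))"
proof -
 have 1: "dp (%s. r (%n. s (Suc (Suc n))) (s 0) (s (Suc 0)))"
  using dp_inst2[OF r inj_Suc2(1), of "%s. s 0" "%s. s 1"] by simp
 have 3: "dt (%s. Lam (Sep (A (%n. s (Suc n))) (%y. r (%n. s (Suc n)) y (s 0))) (ap (f (%n. s (Suc n)))))"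
  using 1 dt_pushes[OF A] dt_pushes[OF assms(4)] by simp
 have 2: "dt (%s. H (%n. s (Suc n)) (s 0) (Lam (Sep (A (%n. s (Suc n))) (%y. r (%n. s (Suc n)) y (s 0))) (ap (f (%n. s (Suc n))))))"
  by (rule dt_inst2[OF H inj_Suc]) (use 3 in simp_all)
 show ?thesis unfolding att_def using 1 2 dt_pushes[OF A] dt_pushes[OF assms(4)] dt_pushes[OF assms(5)] by simp
qed

lemma dt_wr [simp]:
 assumes A: "dt A" and r: "dp (%s. r (%n. s (Suc (Suc n))) (s 1) (s 0))"
  and H: "dt (%s. H (%n. s (Suc (Suc n))) (s 1) (s 0))" and x: "dt x"
 shows "dt (%s. wr (A s) (r s) (H s) (x s))"
proof -
 have "dp (%s. r (%n. s (Suc (Suc (Suc (Suc (Suc n)))))) (s 1) (s 0))"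
  using dp_inst2[OF r inj_Suc2(4), of "%s. s 1" "%s. s 0"] by simp
 moreover have "dt (%s. H (%n. s (Suc (Suc (Suc (Suc (Suc n)))))) (s 1) (s 0))"
  using dt_inst2[OF H inj_Suc2(4), of "%s. s 1" "%s. s 0"] by simp
 ultimately show ?thesis unfolding wr_def
  using dt_pushes[OF A] dt_pushes[OF x] by simp
qed

lemma wr_unfold:
 assumes wf: "wf A r" and r: "dp (%s. r (s 1) (s 0))" and H: "dt (%s. H (s 1) (s 0))" and x: "x:A"
 shows "wr A r H x = H x (Lam (Sep A (%y. r y x)) (wr A r H))"
proof -
 have r': "dp (%s. r (a s) (b s))" if "dt a" "dt b" for a b
  using dp_inst2[of "%s. r" "%n. n" a b] r that by simp
 have H': "dt (%s. H (a s) (b s))" if "dt a" "dt b" for a b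
  using dt_inst2[of "%s. H" "%n. n" a b] H that by simp
 have agree: "x:D --> x:E --> ap f x = ap g x" if "x:A" and f: "att A r H f D" and g: "att A r H g E" for f D g E x
 proof (rule wf_ind[OF wf that(1)])
  fix x assume x: "x:A" and IH: "!!y. y:A ==> r y x ==> y:D --> y:E --> ap f y = ap g y"
  show "x:D --> x:E --> ap f x = ap g x"
  proof (intro impI)
   assume D: "x:D" and E: "x:E"
   have "Lam (Sep A (%y. r y x)) (ap f) = Lam (Sep A (%y. r y x)) (ap g)"
    by (rule Lam_cong) (use IH f g D E r' in \<open>auto simp: att_def\<close>)
   then show "ap f x = ap g x" using f g D E by (simp add: att_def)
  qed
 qed auto
 have wr: "wr A r H x = ap f x" if f: "att A r H f D" "x:D" for f D x
  unfolding wr_def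
 proof (rule tht_eq)
  show "EX g E. att A r H g E & x:E & ap f x = ap g x" using f by blast
  fix y assume "EX g E. att A r H g E & x:E & y = ap g x"
  then obtain g E where g: "att A r H g E" "x:E" "y = ap g x" by blast
  have "x:A" using f unfolding att_def sb_def by blast
  then show "y = ap f x" using agree[OF _ f(1) g(1)] f(2) g by metis
 qed
 \<comment> \<open>The union of the domains of all attempts. It is all of \<open>A\<close>, because
   an attempt on \<open>D\<close> extends to one more point whose predecessors are already in
   \<open>D\<close>.\<close>
 define D where "D = Sep A (%y. EX f E. att A r H f E & y:E)"
 have D: "y:D <-> y:A & (EX f E. att A r H f E & y:E)" for y
  unfolding D_def by (simp add: r' H')
 have dwr: "dt (%s. wr A r H (s i))" for i by (simp add: r' H')
 have Dw: "wr A r H y = H y (Lam (Sep A (%z. r z y)) (wr A r H))" if y: "y:D" for y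
 proof -
  obtain f E where f: "att A r H f E" "y:E" using y D by auto
  have "Lam (Sep A (%z. r z y)) (ap f) = Lam (Sep A (%z. r z y)) (wr A r H)"
  proof (rule Lam_cong)
   fix z assume "z:Sep A (%z. r z y)"
   then have "z:A" "r z y" using r' by auto
   then have "z:E" using f unfolding att_def by blast
   then show "ap f z = wr A r H z" using wr[OF f(1)] by simp
  qed
  moreover have "ap f y = H y (Lam (Sep A (%z. r z y)) (ap f))" using f unfolding att_def by blast
  ultimately show ?thesis using wr[OF f] by simp
 qed
 have dc: "z:D" if "y:D" "z:A" "r z y" for y z
  using that unfolding D att_def by blast
 have "y:D" if "y:A" for y
 proof (rule wf_ind[OF wf that, of "%y. y:D"])
  fix y assume y: "y:A" and IH: "!!z. z:A ==> r z y ==> z:D"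
  define D' where "D' = un D (upr y y)"
  define f where "f = Lam D' (%z. if z:D then wr A r H z else H y (Lam (Sep A (%z. r z y)) (wr A r H)))"
  have fz: "ap f z = (if z:D then wr A r H z else H y (Lam (Sep A (%z. r z y)) (wr A r H)))" if "z:D'" for z
   unfolding f_def using that dwr by (simp add: H' r')
  have "att A r H f D'"
   unfolding att_def
  proof (intro conjI allI impI)
   show "sb D' A" using D y by (auto simp: D'_def sb_def)
   show "z:D'" if "x:D'" "z:A" "r z x" for x z using that dc IH by (auto simp: D'_def)
   fix x assume x: "x:D'"
   have "Lam (Sep A (%z. r z x)) (ap f) = Lam (Sep A (%z. r z x)) (wr A r H)"
   proof (rule Lam_cong)
    fix z assume "z:Sep A (%z. r z x)"
    then have z: "z:A" "r z x" using r' by auto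
    then have "z:D" using x dc IH by (auto simp: D'_def)
    then show "ap f z = wr A r H z" using fz by (simp add: D'_def)
   qed
   then show "ap f x = H x (Lam (Sep A (%y. r y x)) (ap f))"
    using fz[OF x] Dw[of x] x by (auto simp: D'_def)
  qed
  moreover have "y:D'" by (simp add: D'_def)
  ultimately show "y:D" using D y by blast
 qed simp
 then show ?thesis using Dw x by blast
qed

section \<open>Ordinals and natural numbers\<close>

definition Ord where "Ord a <-> (ALL x. x:a --> sb x a) & (ALL x. x:a --> (ALL y. y:x --> sb y x))"
text \<open>The means of making definable choices; natural numbers are ordinals, so it serves for
  them too.\<close>

definition lst where "lst P = tht (%a. Ord a & P a & (ALL b. b:a --> ~P b))"

lemma dp_Ord [simp]: "dt a ==> dp (%s. Ord (a s))"
 by (rule dp_lift1) (simp_all add: Ord_def)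

lemma dt_lst [simp]: assumes "dp (%s. P (%n. s (Suc n)) (s 0))" shows "dt (%s. lst (P s))"
 unfolding lst_def using assms dp_inst1[OF assms inj_Suc2(1), of "%s. s 0"] by simp

lemma Ord_trans: "Ord a ==> x:y ==> y:a ==> x:a"
 unfolding Ord_def sb_def by blast

lemma Ord_sb: "Ord a ==> x:a ==> sb x a"
 unfolding Ord_def by blast

lemma Ord_in: "Ord a ==> x:a ==> Ord x"
 unfolding Ord_def sb_def by blast

lemma wf_mem: "wf A (%y x. y:x)"
 unfolding wf_def using foundation by blast

lemma Ord_ind:
 assumes "Ord a" "dp (%s. P (s 0))" "!!x. Ord x ==> (!!y. y:x ==> P y) ==> P x"
 shows "P a"
proof (rule wf_ind[of "sc a" "%y x. y:x", OF wf_mem _ assms(2)])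
 fix x assume x: "x:sc a" and IH: "!!y. y:sc a ==> y:x ==> P y"
 have "Ord x" using x Ord_in assms(1) by auto
 moreover have "y:sc a" if "y:x" for y using x that Ord_trans[OF assms(1)] by auto
 ultimately show "P x" using assms(3) IH by blast
qed simp

lemma Ord_linear: assumes "Ord a" "Ord b" shows "a:b | a = b | b:a"
proof -
 have "ALL b. Ord b --> a:b | a = b | b:a"
 proof (rule Ord_ind[OF assms(1)])
  fix a assume a: "Ord a" and IH: "!!x. x:a ==> ALL b. Ord b --> x:b | x = b | b:x"
  show "ALL b. Ord b --> a:b | a = b | b:a"
  proof (intro allI impI)
   fix b assume "Ord b"
   then show "a:b | a = b | b:a"
   proof (rule Ord_ind)
    fix b assume b: "Ord b" and IH2: "!!y. y:b ==> a:y | a = y | y:a"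
    have "a = b" if "~a:b" "~b:a"
    proof (rule ext)
     fix x show "x:a <-> x:b"
      using IH[of x] IH2[of x] that b Ord_trans[OF a] Ord_trans[OF b] by blast
    qed
    then show "a:b | a = b | b:a" by blast
   qed simp
  qed
 qed simp
 then show ?thesis using assms(2) by blast
qed

lemma Ord_sb_iff: "Ord a ==> Ord b ==> sb a b <-> a:b | a = b"
 using Ord_linear[of a b] Ord_sb[of b a] mem_asym mem_irrefl unfolding sb_def by metis

lemma Ord_not_mem: "Ord a ==> Ord b ==> ~a:b <-> sb b a"
 using Ord_linear[of a b] Ord_sb_iff[of b a] mem_asym by auto

lemma Ord_sb_mem: "Ord a ==> Ord c ==> sb a b ==> b:c ==> a:c"
 using Ord_not_mem[of a c] by (metis mem_irrefl sb_def)

lemma Ord_emp [simp]: "Ord emp" by (simp add: Ord_def)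
lemma Ord_sc [simp]: "Ord a ==> Ord (sc a)"
 unfolding Ord_def sb_def mem_sc by blast
lemma Ord_set: "(!!x. x:A ==> Ord x) ==> (!!x y. x:A ==> y:x ==> y:A) ==> Ord A"
 unfolding Ord_def sb_def by blast

lemma lst:
 assumes "dp (%s. P (s 0))" "Ord a" "P a"
 shows "Ord (lst P)" "P (lst P)" "sb (lst P) a" "!!b. b:lst P ==> ~P b"
proof -
 have "a:Sep (sc a) P" using assms by simp
 then obtain m where "m:Sep (sc a) P" "!!y. y:m ==> ~y:Sep (sc a) P" using foundation by meson
 then have m: "m:sc a" "P m" "!!y. y:m ==> y:sc a ==> ~P y" using assms by auto
 have om: "Ord m" using m(1) assms(2) Ord_in by auto
 have least: "~P y" if "y:m" for y using m that Ord_trans[OF assms(2)] by auto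
 have "lst P = m" unfolding lst_def
 proof (rule tht_eq)
  show "Ord m & P m & (ALL b. b:m --> ~P b)" using om m(2) least by blast
  show "y = m" if "Ord y & P y & (ALL b. b:y --> ~P b)" for y
   using that Ord_linear[of y m] om m(2) least by blast
 qed
 then show "Ord (lst P)" "P (lst P)" "sb (lst P) a" "!!b. b:lst P ==> ~P b"
  using om m least Ord_sb[OF assms(2)] by auto
qed

definition om where "om = col (%n. ALL w. emp:w & (ALL k. k:w --> sc k:w) --> n:w)"

lemma mem_om: "n:om <-> (ALL w. emp:w & (ALL k. k:w --> sc k:w) --> n:w)"
proof -
 obtain w e where w: "e:w" "ALL x. ~x:e"
  "ALL x. x:w --> (EX y. y:w & (ALL z. z:y <-> z:x | z = x))"
  using ZF unfolding ZF_def infinity_ax_def by blast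
 have "e = emp" using w(2) by (simp add: emp_iff)
 moreover have "sc k:w" if k: "k:w" for k
 proof -
  obtain y where y: "y:w" "ALL z. z:y <-> z:k | z = k" using w(3) k by blast
  have "y = sc k" by (rule ext) (simp add: y(2))
  then show ?thesis using y(1) by simp
 qed
 ultimately have "emp:w & (ALL k. k:w --> sc k:w)" using w(1) by blast
 then have "is_set (%n. ALL w. emp:w & (ALL k. k:w --> sc k:w) --> n:w)"
  by (intro is_set_subset[of _ w]) auto
 then show ?thesis by (simp add: om_def is_set_col)
qed

lemma emp_om [simp]: "emp:om" by (simp add: mem_om)
lemma sc_om [simp]: "n:om ==> sc n:om" by (simp add: mem_om)

lemma nat_ind:
 assumes "n:om" "dp (%s. P (s 0))" "P emp" "!!n. n:om ==> P n ==> P (sc n)"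
 shows "P n"
proof -
 have "n:Sep om P" using assms(1)[unfolded mem_om, rule_format, of "Sep om P"] assms(2-4) by auto
 then show ?thesis using assms(2) by simp
qed

lemma nat_Ord: "n:om ==> Ord n" by (rule nat_ind[of n Ord]) auto

lemma nat_in: assumes "n:om" "m:n" shows "m:om"
proof -
 have "ALL m. m:n --> m:om" by (rule nat_ind[OF assms(1)]) auto
 then show ?thesis using assms(2) by blast
qed

lemma Ord_om [simp]: "Ord om" by (rule Ord_set) (auto simp: nat_Ord intro: nat_in)

lemma nat_cases: assumes "n:om" obtains "n = emp" | m where "m:om" "n = sc m"
proof -
 have "n = emp | (EX m. m:om & n = sc m)" by (rule nat_ind[OF assms]) auto
 then show ?thesis using that by blast
qed

lemma sc_inj [simp]: "sc a = sc b <-> a = b"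
 using mem_asym by (metis mem_sc)
lemma sc_not_emp [simp]: "sc a ~= emp" "emp ~= sc a"
 by (metis mem_emp mem_sc)+
lemma Uni_sc: "Ord a ==> Uni (sc a) = a"
 by (rule ext) (auto dest: Ord_trans)

lemma emp_mem_sc: "n:om ==> emp:sc n"
 by (rule nat_ind[of n "%n. emp:sc n"]) auto

lemma emp_mem_nat: "n:om ==> n ~= emp ==> emp:n"
 by (erule nat_cases) (auto intro: emp_mem_sc simp del: mem_sc)

lemma sc_mem_sc: assumes "Ord b" "a:b" shows "sc a:sc b"
proof -
 have o: "Ord a" using Ord_in assms by blast
 have "sb (sc a) b" using assms Ord_trans[OF assms(1)] by (auto simp: sb_def)
 then show ?thesis using Ord_sb_iff[of "sc a" b] o assms by simp
qed

lemma nat_lin: "m:om ==> n:om ==> m:n | m = n | n:m"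
 using Ord_linear nat_Ord by blast

lemma nat_trans: "x:y ==> y:n ==> n:om ==> x:n"
 using Ord_trans nat_Ord by blast

definition natrec where "natrec a G n =
 wr om (%y x. y:x) (%x g. if x = emp then a else G (Uni x) (ap g (Uni x))) n"

lemma dt_natrec [simp]:
 assumes "dt a" "dt (%s. G (%n. s (Suc (Suc n))) (s 1) (s 0))" "dt n"
 shows "dt (%s. natrec (a s) (G s) (n s))"
 unfolding natrec_def
 using dt_inst2[OF assms(2) inj_Suc2(1), of "%s. Uni (s 1)" "%s. ap (s 0) (Uni (s 1))"] dt_pushes[OF assms(1)] assms(3)
 by simp

lemma natrec_0 [simp]: assumes "dt (%s. G (s 1) (s 0))" shows "natrec a G emp = a"
proof -
 have "dt (%s. if s 1 = emp then a else G (Uni (s 1)) (ap (s 0) (Uni (s 1))))"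
  using dt_inst2[of "%s. G" "%n. n" "%s. Uni (s 1)" "%s. ap (s 0) (Uni (s 1))"] assms by simp
 from wr_unfold[OF wf_mem[of om] _ this emp_om] show ?thesis by (simp add: natrec_def)
qed

lemma natrec_sc [simp]: assumes "dt (%s. G (s 1) (s 0))" "n:om" shows "natrec a G (sc n) = G n (natrec a G n)"
proof -
 have G: "dt (%s. G (u s) (v s))" if "dt u" "dt v" for u v
  using dt_inst2[of "%s. G" "%n. n" u v] assms(1) that by simp
 have "dt (%s. if s 1 = emp then a else G (Uni (s 1)) (ap (s 0) (Uni (s 1))))" using G by simp
 from wr_unfold[OF wf_mem[of om] _ this sc_om[OF assms(2)]] 
 show ?thesis using assms(2) by (simp add: natrec_def Uni_sc nat_Ord G)
qed

lemma natrec_in: assumes "n:om" "dt (%s. G (s 1) (s 0))" "a:A" "!!n v. n:om ==> v:A ==> G n v:A"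
 shows "natrec a G n:A"
proof (rule nat_ind[OF assms(1)])
 have G: "dt (%s. G (u s) (v s))" if "dt u" "dt v" for u v
  using dt_inst2[of "%s. G" "%n. n" u v] assms(2) that by simp
 show "dp (%s. natrec a G (s 0):A)" using G by simp
qed (use assms in auto)

definition rk where "rk A r x =
 wr A r (%x g. Uni (Rep (Sep A (%y. r y x)) (%y. sc (ap g y)))) x"

lemma dt_rk [simp]:
 assumes "dt A" "dp (%s. r (%n. s (Suc (Suc n))) (s 1) (s 0))" "dt x"
 shows "dt (%s. rk (A s) (r s) (x s))"
 unfolding rk_def
 using dp_inst2[OF assms(2) inj_Suc2(2), of "%s. s 0" "%s. s 2"] dt_pushes[OF assms(1)] assms(2,3)
 by (simp add: numeral_2_eq_2)

context
 fixes A r assumes wf: "wf A r" and r: "dp (%s. r (s 1) (s 0))"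
begin

lemma dpr: "dt a ==> dt b ==> dp (%s. r (a s) (b s))"
 using dp_inst2[of "%s. r" "%n. n" a b] r by simp

lemma rk_eq: assumes "x:A"
 shows "rk A r x = Uni (Rep (Sep A (%y. r y x)) (%y. sc (rk A r y)))"
proof -
 have "dt (%s. Uni (Rep (Sep A (%y. r y (s 1))) (%y. sc (ap (s 0) y))))"
  by (simp add: dpr)
 from wr_unfold[OF wf r this assms]
 have 1: "rk A r x = Uni (Rep (Sep A (%y. r y x)) (%y. sc (ap (Lam (Sep A (%y. r y x)) (rk A r)) y)))"
  by (simp add: rk_def[abs_def])
 have "v:Rep (Sep A (%y. r y x)) (%y. sc (ap (Lam (Sep A (%y. r y x)) (rk A r)) y))
  <-> v:Rep (Sep A (%y. r y x)) (%y. sc (rk A r y))" for v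
  by (auto simp: dpr)
 from ext[OF this] 1 show ?thesis by simp
qed

lemma mem_rk: assumes "x:A" shows "v:rk A r x <-> (EX y. y:A & r y x & (v:rk A r y | v = rk A r y))"
proof -
 have "v:rk A r x <-> (EX z. v:z & (EX y. (y:A & r y x) & z = sc (rk A r y)))"
  by (subst rk_eq[OF assms]) (simp add: dpr)
 also have "\<dots> <-> (EX y. y:A & r y x & v:sc (rk A r y))" by blast
 finally show ?thesis by simp
qed

lemma rk_mono: "x:A ==> y:A ==> r y x ==> rk A r y:rk A r x"
 using mem_rk by blast

lemma Ord_rk: assumes "x:A" shows "Ord (rk A r x)"
proof (rule wf_ind[OF wf assms, of "%x. Ord (rk A r x)"])
 show "dp (%s. Ord (rk A r (s 0)))" by (simp add: dpr)
 fix x assume x: "x:A" and IH: "!!y. y:A ==> r y x ==> Ord (rk A r y)"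
 show "Ord (rk A r x)"
 proof (rule Ord_set)
  fix v assume "v:rk A r x"
  then obtain y where y: "y:A" "r y x" "v:rk A r y | v = rk A r y" using mem_rk[OF x] by blast
  then show "Ord v" using IH[of y] Ord_in by blast
  show "w:rk A r x" if "w:v" for w using y that IH[of y] Ord_trans[of "rk A r y" w v] mem_rk[OF x, of w] by blast
 qed
qed

lemma rk_least: assumes "x:A" "Ord a" "!!y. y:A ==> r y x ==> rk A r y:a" shows "sb (rk A r x) a"
 using assms mem_rk[OF assms(1)] Ord_trans[OF assms(2)] unfolding sb_def by blast

lemma rk_onto: assumes "x:A" "v:rk A r x" shows "EX y. y:A & rk A r y = v"
proof -
 have "v:rk A r x --> (EX y. y:A & rk A r y = v)"
 proof (rule wf_ind[OF wf assms(1), of "%x. v:rk A r x --> (EX y. y:A & rk A r y = v)"])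
  show "dp (%s. v:rk A r (s 0) --> (EX y. y:A & rk A r y = v))" by (simp add: dpr)
  fix x assume x: "x:A" and IH: "!!y. y:A ==> r y x ==> v:rk A r y --> (EX y. y:A & rk A r y = v)"
  show "v:rk A r x --> (EX y. y:A & rk A r y = v)" using mem_rk[OF x] IH by blast
 qed
 then show ?thesis using assms(2) by blast
qed

definition rng where "rng = Rep A (rk A r)"

lemma mem_rng: "v:rng <-> (EX x. x:A & v = rk A r x)"
 by (simp add: rng_def dpr)

lemma Ord_rng: "Ord rng"
 by (rule Ord_set) (auto simp: mem_rng Ord_rk dest: rk_onto)

end

section \<open>Ordinals that are images of a given set\<close>

text \<open>A partial surjection: values outside \<open>b\<close> are harmless.\<close>

definition img where "img a b <-> (EX f. ALL y. y:b --> (EX x. x:a & ap f x = y))"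
lemma dp_img [simp]: "dt a ==> dt b ==> dp (%s. img (a s) (b s))"
 by (rule dp_lift2) (simp_all add: img_def)

lemma imgI: assumes "dt (%s. F (s 0))" "!!y. y:b ==> EX x. x:a & F x = y" shows "img a b"
 unfolding img_def using assms by (intro exI[of _ "Lam a F"]) (metis ap_Lam)

lemma img_trans: assumes "img a b" "img b c" shows "img a c"
proof -
 obtain f g where "ALL y. y:b --> (EX x. x:a & ap f x = y)" "ALL y. y:c --> (EX x. x:b & ap g x = y)"
  using assms unfolding img_def by blast
 then show ?thesis by (intro imgI[of "%x. ap g (ap f x)"]) (simp, metis)
qed

lemma img_sb: "sb b a ==> img a b"
 by (rule imgI[of "%x. x"]) (auto simp: sb_def)

definition hart where "hart a = col (%\<alpha>. Ord \<alpha> & img a \<alpha>)"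

text \<open>If \<open>f\<close> maps \<open>a\<close> onto the ordinal, then the ordinal is the set
  of ranks of the relation that \<open>f\<close> pulls back from membership to a subset of
  \<open>a\<close>. So replacement over the pairs of a subset and a relation yields all such
  ordinals.\<close>

lemma mem_hart: "\<alpha>:hart a <-> Ord \<alpha> & img a \<alpha>"
proof -
 define H where "H = Rep (Prd (Pw a) (Pw (Prd a a))) (%p. Rep (p1 p) (rk (p1 p) (%x y. opr x y:p2 p)))"
 have "\<alpha>:H" if \<alpha>: "Ord \<alpha> & img a \<alpha>" for \<alpha>
 proof -
  obtain f where f: "!!y. y:\<alpha> ==> EX x. x:a & ap f x = y" using \<alpha> unfolding img_def by blast
  define B where "B = Sep a (%x. ap f x:\<alpha>)"
  define R where "R = Sep (Prd a a) (%p. ap f (p1 p):ap f (p2 p))"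
  have B: "x:B <-> x:a & ap f x:\<alpha>" for x by (simp add: B_def)
  have R: "opr x y:R <-> ap f x:ap f y" if "x:B" "y:B" for x y using that by (simp add: R_def B)
  have wf: "wf B (%x y. opr x y:R)"
   unfolding wf_def
  proof (intro allI impI)
   fix Z assume Z: "sb Z B & (EX x. x:Z)"
   then obtain x where "ap f x:Rep Z (ap f)" by auto
   then obtain v where v: "v:Rep Z (ap f)" "!!y. y:v ==> ~y:Rep Z (ap f)" using foundation by meson
   then obtain z where "z:Z" "v = ap f z" by auto
   then show "EX x. x:Z & (ALL y. y:Z --> ~opr y x:R)" using v(2) R Z sbD[of Z B]
    by (intro exI[of _ z]) (auto simp del: R_def)
  qed
  have d: "dp (%s. opr (s 1) (s 0):R)" by simp
  have rk: "rk B (%x y. opr x y:R) x = ap f x" if "x:B" for x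
  proof (rule wf_ind[OF wf that])
   fix x assume x: "x:B" and IH: "!!y. y:B ==> opr y x:R ==> rk B (%x y. opr x y:R) y = ap f y"
   have ox: "Ord (ap f x)" using x B \<alpha> Ord_in by blast
   show "rk B (%x y. opr x y:R) x = ap f x"
   proof (rule ext)
    fix v
    have "(EX y. y:B & opr y x:R & (v:rk B (%x y. opr x y:R) y | v = rk B (%x y. opr x y:R) y))
     <-> (EX y. y:B & ap f y:ap f x & (v:ap f y | v = ap f y))" using IH R x by metis
    moreover have "EX y. y:B & ap f y:ap f x & (v:ap f y | v = ap f y)" if "v:ap f x"
    proof -
     have "v:\<alpha>" using that x B \<alpha> Ord_trans by blast
     then obtain y where "y:a" "ap f y = v" using f by blast
     then show ?thesis using that \<open>v:\<alpha>\<close> B by blast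
    qed
    moreover have "v:ap f x" if "EX y. y:B & ap f y:ap f x & (v:ap f y | v = ap f y)"
     using that Ord_trans[OF ox] by blast
    ultimately show "v:rk B (%x y. opr x y:R) x <-> v:ap f x"
     unfolding mem_rk[OF wf d x, of v] by argo
   qed
  qed simp
  have "\<alpha> = Rep B (rk B (%x y. opr x y:R))"
  proof (rule ext)
   fix v show "v:\<alpha> <-> v:Rep B (rk B (%x y. opr x y:R))" using rk f B by (simp, metis)
  qed
  moreover have "opr B R:Prd (Pw a) (Pw (Prd a a))" by (simp add: B_def R_def sb_def)
  ultimately show ?thesis unfolding H_def
   by (subst mem_Rep, simp, intro exI[of _ "opr B R"]) simp
 qed
 then have "is_set (%\<alpha>. Ord \<alpha> & img a \<alpha>)" by (intro is_set_subset[of _ H]) auto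
 then show ?thesis by (simp add: hart_def is_set_col)
qed

lemma Ord_hart [simp]: "Ord (hart a)"
 by (rule Ord_set) (auto simp: mem_hart intro: Ord_in img_trans[OF _ img_sb] Ord_sb)

lemma not_img_hart: "~img a (hart a)"
 using mem_hart[of "hart a" a] by simp

definition w1 where "w1 = hart om"
definition w2 where "w2 = hart w1"

lemma Ord_w1 [simp]: "Ord w1" and Ord_w2 [simp]: "Ord w2" by (simp_all add: w1_def w2_def)

lemma img_rk_w1: assumes "wf om r" "dp (%s. r (s 1) (s 0))" "x:om" shows "rk om r x:w1"
proof -
 have "img om (rk om r x)"
  by (rule imgI[of "rk om r"]) (use rk_onto[OF assms] dpr[OF assms(1,2)] in auto)
 then show ?thesis using Ord_rk[OF assms] by (simp add: w1_def mem_hart)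
qed

notation ap (infixl "$" 90)

section \<open>Coding of finite sequences of natural numbers\<close>

definition dbl where "dbl n = natrec emp (%_ v. sc (sc v)) n"
lemma dt_dbl [simp]: "dt a ==> dt (%s. dbl (a s))" unfolding dbl_def by simp
lemma dbl_0 [simp]: "dbl emp = emp" by (simp add: dbl_def)
lemma dbl_sc [simp]: "n:om ==> dbl (sc n) = sc (sc (dbl n))" by (simp add: dbl_def)
lemma dbl_om [simp]: "n:om ==> dbl n:om" unfolding dbl_def by (rule natrec_in) auto

lemma parity: "n:om ==> (EX m. m:om & n = dbl m) | (EX m. m:om & n = sc (dbl m))"
proof (rule nat_ind[of n "%n. (EX m. m:om & n = dbl m) | (EX m. m:om & n = sc (dbl m))"])
 show "(EX m. m:om & emp = dbl m) | (EX m. m:om & emp = sc (dbl m))"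
  using dbl_0 emp_om by metis
 fix n assume "(EX m. m:om & n = dbl m) | (EX m. m:om & n = sc (dbl m))"
 then show "(EX m. m:om & sc n = dbl m) | (EX m. m:om & sc n = sc (dbl m))"
  using dbl_sc sc_om by metis
qed auto

lemma dbl_neq: assumes "m:om" "k:om" shows "dbl m ~= sc (dbl k)"
proof -
 have "ALL k. k:om --> dbl m ~= sc (dbl k)"
 proof (rule nat_ind[OF assms(1)])
  fix n assume n: "n:om" and IH: "ALL k. k:om --> dbl n ~= sc (dbl k)"
  show "ALL k. k:om --> dbl (sc n) ~= sc (dbl k)"
  proof (intro allI impI)
   fix k assume "k:om" then show "dbl (sc n) ~= sc (dbl k)"
    by (cases rule: nat_cases) (use n IH in auto)
  qed
 qed auto
 then show ?thesis using assms by blast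
qed

lemma dbl_neq' [simp]: "m:om ==> k:om ==> dbl m ~= sc (dbl k)" "m:om ==> k:om ==> sc (dbl k) ~= dbl m"
 using dbl_neq by metis+

lemma dbl_inj [simp]: assumes "m:om" "k:om" shows "dbl m = dbl k <-> m = k"
proof -
 have "ALL k. k:om --> dbl m = dbl k --> m = k"
 proof (rule nat_ind[OF assms(1)])
  show "ALL k. k:om --> dbl emp = dbl k --> emp = k"
  proof (intro allI impI)
   fix k assume "k:om" "dbl emp = dbl k" then show "emp = k" by (cases rule: nat_cases) auto
  qed
  fix n assume n: "n:om" and IH: "ALL k. k:om --> dbl n = dbl k --> n = k"
  show "ALL k. k:om --> dbl (sc n) = dbl k --> sc n = k"
  proof (intro allI impI)
   fix k assume "k:om" "dbl (sc n) = dbl k" then show "sc n = k"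
    by (cases rule: nat_cases) (use n IH in auto)
  qed
 qed auto
 then show ?thesis using assms by blast
qed

definition hf where "hf n = tht (%m. m:om & (n = dbl m | n = sc (dbl m)))"
lemma dt_hf [simp]: "dt a ==> dt (%s. hf (a s))" by (rule dt_lift1) (simp_all add: hf_def)
lemma hf_dbl [simp]: "m:om ==> hf (dbl m) = m" "m:om ==> hf (sc (dbl m)) = m"
 unfolding hf_def by (rule tht_eq; auto)+
lemma hf_om [simp]: "n:om ==> hf n:om" using parity[of n] by auto

lemma dbl_ge: "m:om ==> m:sc (dbl m)"
proof (rule nat_ind[of m "%m. m:sc (dbl m)"])
 fix n assume "n:om" "n:sc (dbl n)"
 then have "sc n:sc (sc (dbl n))" using sc_mem_sc nat_Ord sc_om dbl_om by blast
 then show "sc n:sc (dbl (sc n))" using \<open>n:om\<close> mem_sc[of "sc n" "sc (sc (dbl n))"] by simp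
qed auto

text \<open>The bijection \<open>(a, b) \<mapsto> 2^a (2 b + 1) - 1\<close>, with inverses \<open>q1\<close> and \<open>q2\<close>.\<close>

definition pi where "pi a b = natrec (dbl b) (%_ v. sc (dbl v)) a"
lemma dt_pi [simp]: "dt a ==> dt b ==> dt (%s. pi (a s) (b s))" unfolding pi_def by simp
lemma pi_0 [simp]: "pi emp b = dbl b" by (simp add: pi_def)
lemma pi_sc [simp]: "a:om ==> pi (sc a) b = sc (dbl (pi a b))" by (simp add: pi_def)
lemma pi_om [simp]: "a:om ==> b:om ==> pi a b:om" unfolding pi_def by (rule natrec_in) auto

lemma pi_eq [simp]: assumes "a:om" "b:om" "c:om" "d:om" shows "pi a b = pi c d <-> a = c & b = d"
proof -
 have "ALL c. c:om --> pi a b = pi c d --> a = c & b = d"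
 proof (rule nat_ind[OF assms(1)])
  show "ALL c. c:om --> pi emp b = pi c d --> emp = c & b = d"
  proof (intro allI impI)
   fix c assume "c:om" "pi emp b = pi c d" then show "emp = c & b = d"
    by (cases rule: nat_cases) (use assms in auto)
  qed
  fix n assume n: "n:om" and IH: "ALL c. c:om --> pi n b = pi c d --> n = c & b = d"
  show "ALL c. c:om --> pi (sc n) b = pi c d --> sc n = c & b = d"
  proof (intro allI impI)
   fix c assume "c:om" "pi (sc n) b = pi c d" then show "sc n = c & b = d"
    by (cases rule: nat_cases) (use n IH assms in auto)
  qed
 qed auto
 then show ?thesis using assms by blast
qed

lemma pi_surj: assumes "n:om" shows "EX a b. a:om & b:om & n = pi a b"
proof -
 have "n:om --> (EX a b. a:om & b:om & n = pi a b)"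
 proof (rule Ord_ind[OF nat_Ord[OF assms]], simp, intro impI)
  fix n assume IH: "!!m. m:n ==> m:om --> (EX a b. a:om & b:om & m = pi a b)" and n: "n:om"
  show "EX a b. a:om & b:om & n = pi a b"
  proof (cases "EX m. m:om & n = dbl m")
   case True then show ?thesis using pi_0 emp_om by metis
  next
   case False
   then obtain m where m: "m:om" "n = sc (dbl m)" using parity n by blast
   then have "m:n" using dbl_ge by simp
   then show ?thesis using IH m pi_sc sc_om by metis
  qed
 qed
 then show ?thesis using assms by blast
qed

text \<open>Later bookkeeping rests on this: the first component of \<open>n\<close> is never larger
  than \<open>n\<close>, so at stage \<open>n\<close> the column \<open>q1 n\<close> is no later
  than \<open>n\<close>.\<close>

lemma pi_ge: assumes "a:om" "b:om" shows "a:sc (pi a b)"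
proof (rule nat_ind[OF assms(1), of "%a. a:sc (pi a b)"])
 show "emp:sc (pi emp b)" using assms emp_mem_sc dbl_om pi_0 by metis
 fix n assume n: "n:om" "n:sc (pi n b)"
 have p: "pi n b:om" using n assms by simp
 have "n:sc (dbl (pi n b))" using n(2) dbl_ge[OF p] nat_trans[of n "pi n b" "sc (dbl (pi n b))"] p by auto
 then have "sc n:sc (sc (dbl (pi n b)))" using sc_mem_sc[of "sc (dbl (pi n b))" n] nat_Ord p by simp
 then show "sc n:sc (pi (sc n) b)" using n by simp
qed simp

definition q1 where "q1 n = tht (%a. a:om & (EX b. b:om & n = pi a b))"
definition q2 where "q2 n = tht (%b. b:om & (EX a. a:om & n = pi a b))"
lemma dt_q1 [simp]: "dt a ==> dt (%s. q1 (a s))" by (rule dt_lift1) (simp_all add: q1_def)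
lemma dt_q2 [simp]: "dt a ==> dt (%s. q2 (a s))" by (rule dt_lift1) (simp_all add: q2_def)
lemma q1_pi [simp]: "a:om ==> b:om ==> q1 (pi a b) = a" unfolding q1_def by (rule tht_eq) auto
lemma q2_pi [simp]: "a:om ==> b:om ==> q2 (pi a b) = b" unfolding q2_def by (rule tht_eq) auto
lemma q1_om [simp]: "n:om ==> q1 n:om" using pi_surj[of n] by auto
lemma q2_om [simp]: "n:om ==> q2 n:om" using pi_surj[of n] by auto
lemma pi_q [simp]: "n:om ==> pi (q1 n) (q2 n) = n" using pi_surj[of n] by auto

section \<open>Baire space\<close>

definition Rl where "Rl = Fn om om"
lemma RlI: "dt (%s. F (s 0)) ==> (!!n. n:om ==> F n:om) ==> Lam om F:Rl"
 by (simp add: Rl_def fn_Lam)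
lemma Rl_ap [simp]: "x:Rl ==> n:om ==> x$n:om"
 using fn_ap(2) by (simp add: Rl_def)
lemma Rl_ext: "x:Rl ==> y:Rl ==> (!!n. n:om ==> x$n = y$n) ==> x = y"
 using fn_ext by (simp add: Rl_def)

definition eqn where "eqn n x y <-> (ALL k. k:n --> x$k = y$k)"
lemma dp_eqn [simp]: "dt a ==> dt b ==> dt c ==> dp (%s. eqn (a s) (b s) (c s))"
 by (rule dp_lift3) (simp_all add: eqn_def)
lemma eqn_refl [simp]: "eqn n x x" by (simp add: eqn_def)
lemma eqn_sym: "eqn n x y ==> eqn n y x" by (simp add: eqn_def)
lemma eqn_trans: "eqn n x y ==> eqn n y z ==> eqn n x z" by (simp add: eqn_def)
lemma eqn_0 [simp]: "eqn emp x y" by (simp add: eqn_def)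
lemma eqn_sc: "eqn (sc n) x y <-> eqn n x y & x$n = y$n" by (auto simp: eqn_def)
lemma eqn_mono: "eqn n x y ==> sb m n ==> eqn m x y" by (simp add: eqn_def sb_def)
lemma eqn_in: "eqn n x y ==> m:n ==> x$m = y$m" by (simp add: eqn_def)

lemma nat_max: assumes "m:om" "n:om" obtains k where "k:om" "sb m k" "sb n k"
 using nat_lin[OF assms] Ord_sb[OF nat_Ord] assms sb_refl by metis

text \<open>Nodes of trees are numbers: \<open>kap x n\<close> codes the initial segment of \<open>x\<close> of length \<open>n\<close>. For a node \<open>u\<close>,
 \<open>ln u\<close> is its length and \<open>ex u\<close> the real that prolongs it by zeros.\<close>

definition kap where "kap x n = natrec emp (%k v. sc (pi v (x$k))) n"
lemma dt_kap [simp]: "dt a ==> dt b ==> dt (%s. kap (a s) (b s))"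
 unfolding kap_def using dt_pushes by simp
lemma kap_0 [simp]: "kap x emp = emp" by (simp add: kap_def)
lemma kap_sc [simp]: "n:om ==> kap x (sc n) = sc (pi (kap x n) (x$n))" by (simp add: kap_def)
lemma kap_om [simp]: "x:Rl ==> n:om ==> kap x n:om" unfolding kap_def by (rule natrec_in) auto

lemma kap_cong: "n:om ==> eqn n x y ==> kap x n = kap y n"
proof -
 assume n: "n:om" and "eqn n x y"
 moreover have "eqn n x y --> kap x n = kap y n"
  by (rule nat_ind[OF n]) (auto simp: eqn_sc)
 ultimately show ?thesis by blast
qed

lemma kap_eqD: assumes "n:om" "m:om" "x:Rl" "y:Rl" "kap x n = kap y m" shows "n = m" "eqn n x y"
proof -
 have "ALL m. m:om --> kap x n = kap y m --> n = m & eqn n x y"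
 proof (rule nat_ind[OF assms(1)])
  show "ALL m. m:om --> kap x emp = kap y m --> emp = m & eqn emp x y"
  proof (intro allI impI)
   fix m assume "m:om" "kap x emp = kap y m" then show "emp = m & eqn emp x y"
    by (cases rule: nat_cases) auto
  qed
  fix n assume n: "n:om" and IH: "ALL m. m:om --> kap x n = kap y m --> n = m & eqn n x y"
  show "ALL m. m:om --> kap x (sc n) = kap y m --> sc n = m & eqn (sc n) x y"
  proof (intro allI impI)
   fix m assume m: "m:om" "kap x (sc n) = kap y m"
   show "sc n = m & eqn (sc n) x y"
   proof (rule nat_cases[OF m(1)])
    assume "m = emp" then show ?thesis using m n by simp
   next
    fix v assume v: "v:om" "m = sc v"
    then have "kap x n = kap y v" "x$n = y$v" using m n assms by auto
    then show ?thesis using IH v eqn_sc by metis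
   qed
  qed
 qed auto
 then show "n = m" "eqn n x y" using assms by blast+
qed

lemma kap_eq_iff: "n:om ==> x:Rl ==> y:Rl ==> kap x n = kap y n <-> eqn n x y"
 using kap_eqD kap_cong by blast

definition zr where "zr = Lam om (%n. emp)"
lemma zr_Rl [simp]: "zr:Rl" unfolding zr_def by (rule RlI) auto

definition upd where "upd x n d = Lam om (%k. if k = n then d else x$k)"
lemma upd_Rl [simp]: "x:Rl ==> d:om ==> upd x n d:Rl" unfolding upd_def by (rule RlI) auto
lemma upd_ap [simp]: "k:om ==> upd x n d$k = (if k = n then d else x$k)" by (simp add: upd_def)
lemma eqn_upd: "n:om ==> eqn n (upd x n d) x" by (auto simp: eqn_def nat_in)

text \<open>Every number is a node, with \<open>emp\<close> as the root; the induction works because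
  a parent has a smaller code than its children.\<close>

lemma kap_surj: assumes "u:om" shows "EX x n. x:Rl & n:om & u = kap x n"
proof -
 have "u:om --> (EX x n. x:Rl & n:om & u = kap x n)"
 proof (rule Ord_ind[OF nat_Ord[OF assms]], simp, intro impI)
  fix u assume IH: "!!m. m:u ==> m:om --> (EX x n. x:Rl & n:om & m = kap x n)" and u: "u:om"
  from u show "EX x n. x:Rl & n:om & u = kap x n"
  proof (cases rule: nat_cases)
   case 1 then show ?thesis using zr_Rl emp_om kap_0 by metis
  next
   case (2 v)
   obtain a d where a: "a:om" "d:om" "v = pi a d" using pi_surj 2 by blast
   then have "a:u" using pi_ge 2 by simp
   then obtain x n where x: "x:Rl" "n:om" "a = kap x n" using IH a by blast
   have "u = kap (upd x n d) (sc n)" using x a 2 kap_cong[OF x(2) eqn_upd[OF x(2)]] by simp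
   then show ?thesis using x a by (intro exI[of _ "upd x n d"] exI[of _ "sc n"]) simp
  qed
 qed
 then show ?thesis using assms by blast
qed

definition ln where "ln u = tht (%n. n:om & (EX x. x:Rl & u = kap x n))"
lemma dt_ln [simp]: "dt a ==> dt (%s. ln (a s))" by (rule dt_lift1) (simp_all add: ln_def)
lemma ln_kap [simp]: "x:Rl ==> n:om ==> ln (kap x n) = n"
 unfolding ln_def by (rule tht_eq) (use kap_eqD in blast)+
lemma ln_om [simp]: "u:om ==> ln u:om" using kap_surj[of u] by auto

definition ex where "ex u = tht (%x. x:Rl & kap x (ln u) = u & (ALL k. k:om --> ~k:ln u --> x$k = emp))"
lemma dt_ex [simp]: "dt a ==> dt (%s. ex (a s))" by (rule dt_lift1) (simp_all add: ex_def)

lemma ex: assumes "u:om" shows "ex u:Rl" "kap (ex u) (ln u) = u" 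
proof -
 obtain x n where x: "x:Rl" "n:om" "u = kap x n" using kap_surj assms by blast
 define y where "y = Lam om (%k. if k:n then x$k else emp)"
 have y: "y:Rl" unfolding y_def by (rule RlI) (use x in auto)
 have yk: "y$k = (if k:n then x$k else emp)" if "k:om" for k using that by (simp add: y_def)
 have "eqn n y x" using yk nat_in[OF x(2)] by (auto simp: eqn_def)
 then have k: "kap y n = u" using x kap_cong by blast
 have ln: "ln u = n" using x by simp
 have "ex u = y" unfolding ex_def
 proof (rule tht_eq)
  show "y:Rl & kap y (ln u) = u & (ALL k. k:om --> ~k:ln u --> y$k = emp)" using y k ln yk by simp
  fix z assume z: "z:Rl & kap z (ln u) = u & (ALL k. k:om --> ~k:ln u --> z$k = emp)"
  have "kap z n = kap x n" using z x(3) unfolding ln by blast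
  then have e: "eqn n z x" using kap_eqD(2)[OF x(2) x(2) _ x(1)] z by blast
  show "z = y"
  proof (rule Rl_ext)
   show "z$k = y$k" if "k:om" for k
    using eqn_in[OF e, of k] z yk[OF that] that unfolding ln by (cases "k:n") auto
  qed (use y z in auto)
 qed
 then show "ex u:Rl" "kap (ex u) (ln u) = u" using y k ln by auto
qed

lemma eqn_ex: assumes "x:Rl" "n:om" shows "eqn n (ex (kap x n)) x"
 using ex[of "kap x n"] kap_eqD(2)[of n n "ex (kap x n)" x] assms by simp

text \<open>A real \<open>e\<close> is a strategy: \<open>lip e\<close> answers as player II, \<open>lipI e\<close> as player I.\<close>

definition lip where "lip e x = Lam om (%n. e$(kap x (sc n)))"
definition lipI where "lipI e x = Lam om (%n. e$(kap x n))"
definition pr where "pr x y = Lam om (%n. pi (x$n) (y$n))"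
definition fs where "fs z = Lam om (%n. q1 (z$n))"
definition sn where "sn z = Lam om (%n. q2 (z$n))"
definition cl where "cl z i = Lam om (%n. z$(pi i n))"
definition cn where "cn d x = Lam om (%n. if n = emp then d else x$(Uni n))"
definition tl where "tl x = Lam om (%n. x$(sc n))"
definition mk where "mk F = Lam om (%k. F (q1 k)$(q2 k))"

lemma dt_lip [simp]: "dt a ==> dt b ==> dt (%s. lip (a s) (b s))"
 by (rule dt_lift2) (simp_all add: lip_def)
lemma dt_lipI [simp]: "dt a ==> dt b ==> dt (%s. lipI (a s) (b s))"
 by (rule dt_lift2) (simp_all add: lipI_def)
lemma dt_pr [simp]: "dt a ==> dt b ==> dt (%s. pr (a s) (b s))"
 by (rule dt_lift2) (simp_all add: pr_def)
lemma dt_fs [simp]: "dt a ==> dt (%s. fs (a s))" by (rule dt_lift1) (simp_all add: fs_def)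
lemma dt_sn [simp]: "dt a ==> dt (%s. sn (a s))" by (rule dt_lift1) (simp_all add: sn_def)
lemma dt_cl [simp]: "dt a ==> dt b ==> dt (%s. cl (a s) (b s))"
 by (rule dt_lift2) (simp_all add: cl_def)
lemma dt_cn [simp]: "dt a ==> dt b ==> dt (%s. cn (a s) (b s))"
 by (rule dt_lift2) (simp_all add: cn_def)
lemma dt_tl [simp]: "dt a ==> dt (%s. tl (a s))" by (rule dt_lift1) (simp_all add: tl_def)
lemma dt_mk [simp]: assumes "dt (%s. F (%n. s (Suc n)) (s 0))" shows "dt (%s. mk (F s))"
 unfolding mk_def using dt_inst1[OF assms inj_Suc, of "%s. q1 (s 0)"] by simp

lemma lip_Rl [simp]: "e:Rl ==> x:Rl ==> lip e x:Rl"
 unfolding lip_def by (rule RlI) (auto simp del: kap_sc)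
lemma lipI_Rl [simp]: "e:Rl ==> x:Rl ==> lipI e x:Rl" unfolding lipI_def by (rule RlI) auto
lemma pr_Rl [simp]: "x:Rl ==> y:Rl ==> pr x y:Rl" unfolding pr_def by (rule RlI) auto
lemma fs_Rl [simp]: "x:Rl ==> fs x:Rl" unfolding fs_def by (rule RlI) auto
lemma sn_Rl [simp]: "x:Rl ==> sn x:Rl" unfolding sn_def by (rule RlI) auto
lemma cl_Rl [simp]: "x:Rl ==> i:om ==> cl x i:Rl" unfolding cl_def by (rule RlI) auto
lemma Uni_om [simp]: "n:om ==> Uni n:om"
proof (erule nat_cases)
 assume "n = emp" then have "Uni n = emp" by (simp add: emp_iff)
 then show ?thesis by simp
qed (simp add: Uni_sc nat_Ord)
lemma cn_Rl [simp]: "x:Rl ==> d:om ==> cn d x:Rl" unfolding cn_def by (rule RlI) auto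
lemma tl_Rl [simp]: "x:Rl ==> tl x:Rl" unfolding tl_def by (rule RlI) auto
lemma mk_Rl: "dt (%s. F (s 0)) ==> (!!i. i:om ==> F i:Rl) ==> mk F:Rl"
 unfolding mk_def by (rule RlI) (use dt_sub1[of F "%s. q1 (s 0)"] in auto)

lemma lip_ap [simp]: "n:om ==> lip e x$n = e$(kap x (sc n))" by (simp add: lip_def del: kap_sc)
lemma lipI_ap [simp]: "n:om ==> lipI e x$n = e$(kap x n)" by (simp add: lipI_def)
lemma pr_ap [simp]: "n:om ==> pr x y$n = pi (x$n) (y$n)" by (simp add: pr_def)
lemma fs_ap [simp]: "n:om ==> fs x$n = q1 (x$n)" by (simp add: fs_def)
lemma sn_ap [simp]: "n:om ==> sn x$n = q2 (x$n)" by (simp add: sn_def)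
lemma cl_ap [simp]: "n:om ==> cl x i$n = x$(pi i n)" by (simp add: cl_def)
lemma cn_0 [simp]: "cn d x$emp = d" by (simp add: cn_def)
lemma cn_sc [simp]: "n:om ==> cn d x$(sc n) = x$n" by (simp add: cn_def Uni_sc nat_Ord)
lemma tl_ap [simp]: "n:om ==> tl x$n = x$(sc n)" by (simp add: tl_def)

lemma fs_pr [simp]: "x:Rl ==> y:Rl ==> fs (pr x y) = x" by (rule Rl_ext) auto
lemma sn_pr [simp]: "x:Rl ==> y:Rl ==> sn (pr x y) = y" by (rule Rl_ext) auto
lemma pr_fs_sn [simp]: "z:Rl ==> pr (fs z) (sn z) = z" by (rule Rl_ext) auto
lemma tl_cn [simp]: "x:Rl ==> d:om ==> tl (cn d x) = x" by (rule Rl_ext) auto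
lemma cl_mk [simp]: assumes "dt (%s. F (s 0))" "!!i. i:om ==> F i:Rl" "i:om" shows "cl (mk F) i = F i"
proof (rule Rl_ext)
 have "mk F:Rl" using mk_Rl assms by blast
 then show "cl (mk F) i:Rl" using assms by simp
 show "cl (mk F) i$n = F i$n" if "n:om" for n
  using that assms(3) dt_sub1[OF assms(1), of "%s. q1 (s 0)"] by (simp add: mk_def)
qed (use assms in simp)

lemma eqn_pr: "n:om ==> x:Rl ==> y:Rl ==> x':Rl ==> y':Rl ==>
 eqn n (pr x y) (pr x' y') <-> eqn n x x' & eqn n y y'"
 using nat_in[of n] by (auto simp: eqn_def)
lemma eqn_fs: "n:om ==> eqn n z z' ==> eqn n (fs z) (fs z')"
 using nat_in[of n] by (auto simp: eqn_def)
lemma eqn_sn: "n:om ==> eqn n z z' ==> eqn n (sn z) (sn z')"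
 using nat_in[of n] by (auto simp: eqn_def)

section \<open>Continuous functions\<close>

definition ctn where "ctn F <-> (ALL x. x:Rl --> F x:Rl) &
 (ALL x k. x:Rl --> k:om --> (EX m. m:om & (ALL y. y:Rl --> eqn m x y --> F x$k = F y$k)))"
lemma dp_ctn [simp]: assumes "dt (%s. F (%n. s (Suc n)) (s 0))" shows "dp (%s. ctn (F s))"
 unfolding ctn_def
 using assms dt_inst1[OF assms inj_Suc2(2), of "%s. s 0"] dt_inst1[OF assms inj_Suc2(3), of "%s. s 0"]
  dt_inst1[OF assms inj_Suc2(3), of "%s. s 3"] by (simp add: numeral_3_eq_3)

text \<open>\<open>ct\<close> is for definable class functions, \<open>Ct\<close> for functions that
  are elements of the structure and can be quantified over.\<close>

definition ct where "ct F <-> dt (%s. F (s 0)) & ctn F"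
definition Ct where "Ct f <-> fn f Rl Rl & ctn (ap f)"
lemma dp_Ct [simp]: "dt a ==> dp (%s. Ct (a s))" by (rule dp_lift1) (simp_all add: Ct_def)

lemma ct_dt: "ct F ==> dt a ==> dt (%s. F (a s))" unfolding ct_def using dt_sub1 by blast
lemma ct_Rl: "ct F ==> x:Rl ==> F x:Rl" unfolding ct_def ctn_def by blast
lemma Ct_ct: "Ct f ==> ct (ap f)" by (simp add: ct_def Ct_def)
lemma ctn_cong: "(!!x. x:Rl ==> F x = G x) ==> ctn F ==> ctn G" unfolding ctn_def by simp
lemma ct_Ct: "ct F ==> Ct (Lam Rl F)"
 unfolding Ct_def using ctn_cong[of F "ap (Lam Rl F)"] ct_Rl[of F] by (auto simp: ct_def intro: fn_Lam)

lemma ctD: "ct F ==> x:Rl ==> k:om ==>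
 EX m. m:om & (ALL y. y:Rl --> eqn m x y --> F x$k = F y$k)"
 by (simp add: ct_def ctn_def)

lemma ct_eqn:
 assumes "ct F" "x:Rl" "n:om"
 shows "EX m. m:om & (ALL y. y:Rl --> eqn m x y --> eqn n (F x) (F y))"
proof (rule nat_ind[OF assms(3)])
 show "dp (%s. EX m. m:om & (ALL y. y:Rl --> eqn m x y --> eqn (s 0) (F x) (F y)))"
  by (simp add: ct_dt[OF assms(1)])
 fix n assume n: "n:om" "EX m. m:om & (ALL y. y:Rl --> eqn m x y --> eqn n (F x) (F y))"
 then obtain m where m: "m:om" "ALL y. y:Rl --> eqn m x y --> eqn n (F x) (F y)" by blast
 obtain m' where m': "m':om" "ALL y. y:Rl --> eqn m' x y --> F x$n = F y$n"
  using assms n unfolding ct_def ctn_def by blast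
 obtain l where "l:om" "sb m l" "sb m' l" using nat_max m m' by blast
 then show "EX m. m:om & (ALL y. y:Rl --> eqn m x y --> eqn (sc n) (F x) (F y))"
  using m m' eqn_mono unfolding eqn_sc by blast
next
 show "EX m. m:om & (ALL y. y:Rl --> eqn m x y --> eqn emp (F x) (F y))"
  by (rule exI[of _ emp]) simp
qed

lemma ct_id: "ct (%x. x)" unfolding ct_def ctn_def by (auto simp: eqn_def intro: sc_om exI[of _ "sc _"])
lemma ct_const: "c:Rl ==> ct (%x. c)" unfolding ct_def ctn_def by (intro conjI allI impI exI[of _ emp]) simp_all

lemma ct2:
 assumes F: "ct F" and G: "ct G" and "!!a b. dt a ==> dt b ==> dt (%s. H (a s) (b s))"
  and "!!x y. x:Rl ==> y:Rl ==> H x y:Rl"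
  and H: "!!x y k. x:Rl ==> y:Rl ==> k:om ==>
   EX m. m:om & (ALL x' y'. x':Rl --> y':Rl --> eqn m x x' --> eqn m y y' --> H x y$k = H x' y'$k)"
 shows "ct (%x. H (F x) (G x))"
 unfolding ct_def ctn_def
proof (intro conjI allI impI)
 show "dt (%s. H (F (s 0)) (G (s 0)))" by (rule assms(3)[OF ct_dt[OF F dt_var] ct_dt[OF G dt_var]])
 show "H (F x) (G x):Rl" if "x:Rl" for x using assms(4) ct_Rl F G that by blast
 fix x k assume x: "x:Rl" "k:om"
 obtain m where m: "m:om" "!!x' y'. x':Rl ==> y':Rl ==> eqn m (F x) x' ==> eqn m (G x) y' ==> H (F x) (G x)$k = H x' y'$k"
  using H[OF ct_Rl[OF F x(1)] ct_Rl[OF G x(1)] x(2)] by metis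
 obtain m1 where m1: "m1:om" "!!y. y:Rl ==> eqn m1 x y ==> eqn m (F x) (F y)"
  using ct_eqn[OF F x(1) m(1)] by metis
 obtain m2 where m2: "m2:om" "!!y. y:Rl ==> eqn m2 x y ==> eqn m (G x) (G y)"
  using ct_eqn[OF G x(1) m(1)] by metis
 obtain l where l: "l:om" "sb m1 l" "sb m2 l" by (rule nat_max[OF m1(1) m2(1)])
 have "H (F x) (G x)$k = H (F y) (G y)$k" if y: "y:Rl" "eqn l x y" for y
  by (rule m(2)[OF ct_Rl[OF F y(1)] ct_Rl[OF G y(1)] m1(2)[OF y(1) eqn_mono[OF y(2) l(2)]] m2(2)[OF y(1) eqn_mono[OF y(2) l(3)]]])
 then show "EX m. m:om & (ALL y. y:Rl --> eqn m x y --> H (F x) (G x)$k = H (F y) (G y)$k)"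
  using l(1) by blast
qed

lemma ct_comp: assumes F: "ct F" and G: "ct G" shows "ct (%x. F (G x))"
proof (rule ct2[OF G G, of "%x y. F x"])
 show "dt (%s. F (a s))" if "dt a" for a using ct_dt[OF F that] .
 show "F x:Rl" if "x:Rl" for x using ct_Rl[OF F that] .
 show "EX m. m:om & (ALL x' y'. x':Rl --> y':Rl --> eqn m x x' --> eqn m y y' --> F x$k = F x'$k)"
  if "x:Rl" "k:om" for x y k
  using ctD[OF F that] by (elim exE conjE) (intro exI conjI allI impI, assumption, simp)
qed

lemma ct2b:
 assumes "ct F" "ct G" "!!a b. dt a ==> dt b ==> dt (%s. H (a s) (b s))"
  and "!!x y. x:Rl ==> y:Rl ==> H x y:Rl" "!!k. k:om ==> B k:om"
  and H: "!!x y x' y' k. k:om ==> x$(B k) = x'$(B k) ==> y$(B k) = y'$(B k) ==> H x y$k = H x' y'$k"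
 shows "ct (%x. H (F x) (G x))"
proof (rule ct2[OF assms(1-4)])
 show "EX m. m:om & (ALL x' y'. x':Rl --> y':Rl --> eqn m x x' --> eqn m y y' --> H x y$k = H x' y'$k)"
  if k: "k:om" for x y k
  unfolding eqn_def by (intro exI[of _ "sc (B k)"] conjI allI impI sc_om assms(5)[OF k] H[OF k]) auto
qed

lemma ct_pr: "ct F ==> ct G ==> ct (%x. pr (F x) (G x))"
 by (rule ct2b[where B = "%k. k"]) auto
lemma ct_fs: "ct F ==> ct (%x. fs (F x))"
 by (rule ct2b[of F F "%x y. fs x" "%k. k"]) auto
lemma ct_sn: "ct F ==> ct (%x. sn (F x))"
 by (rule ct2b[of F F "%x y. sn x" "%k. k"]) auto
lemma ct_tl: "ct F ==> ct (%x. tl (F x))"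
 by (rule ct2b[of F F "%x y. tl x" sc]) auto
lemma ct_cl: "ct F ==> i:om ==> ct (%x. cl (F x) i)"
 by (rule ct2b[of F F "%x y. cl x i" "pi i"]) auto
lemma ct_cn: assumes "ct F" "d:om" shows "ct (%x. cn d (F x))"
proof (rule ct2b[of F F "%x y. cn d x" Uni])
 show "cn d x$k = cn d x'$k" if "k:om" "x$Uni k = x'$Uni k" for x x' k using that by (simp add: cn_def)
qed (use assms in auto)

lemma ct_lip: assumes "ct F" "ct G" shows "ct (%x. lip (F x) (G x))"
proof (rule ct2[OF assms])
 fix x y k assume *: "x:Rl" "y:Rl" "k:om"
 have kk: "kap y (sc k):om" using * by (simp del: kap_sc)
 obtain l where l: "l:om" "sb (sc k) l" "sb (sc (kap y (sc k))) l"
  by (rule nat_max[OF sc_om[OF *(3)] sc_om[OF kk]])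
 have "lip x y$k = lip x' y'$k" if "eqn l x x'" "eqn l y y'" for x' y'
 proof -
  have "kap y (sc k) = kap y' (sc k)" using kap_cong[OF sc_om[OF *(3)] eqn_mono[OF that(2) l(2)]] .
  moreover have "x$(kap y (sc k)) = x'$(kap y (sc k))"
   by (rule eqn_in[OF that(1) sbD[OF l(3)]]) (simp del: kap_sc)
  ultimately show ?thesis using * by (simp del: kap_sc)
 qed
 then show "EX m. m:om & (ALL x' y'. x':Rl --> y':Rl --> eqn m x x' --> eqn m y y' --> lip x y$k = lip x' y'$k)"
  using l(1) by blast
qed auto

lemma ct_lipI: assumes "ct F" "ct G" shows "ct (%x. lipI (F x) (G x))"
proof (rule ct2[OF assms])
 fix x y k assume *: "x:Rl" "y:Rl" "k:om"
 have kk: "kap y k:om" using * by simp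
 obtain l where l: "l:om" "sb k l" "sb (sc (kap y k)) l"
  by (rule nat_max[OF *(3) sc_om[OF kk]])
 have "lipI x y$k = lipI x' y'$k" if "eqn l x x'" "eqn l y y'" for x' y'
 proof -
  have "kap y k = kap y' k" using kap_cong[OF *(3) eqn_mono[OF that(2) l(2)]] .
  moreover have "x$(kap y k) = x'$(kap y k)"
   by (rule eqn_in[OF that(1) sbD[OF l(3)]]) simp
  ultimately show ?thesis using * by simp
 qed
 then show "EX m. m:om & (ALL x' y'. x':Rl --> y':Rl --> eqn m x x' --> eqn m y y' --> lipI x y$k = lipI x' y'$k)"
  using l(1) by blast
qed auto

lemmas ct_intros = ct_id ct_const ct_pr ct_fs ct_sn ct_tl ct_cl ct_cn ct_lip ct_lipI

section \<open>The notions of the structure\<close>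

lemma coll_eqI: "(!!x. x:a <-> P x) ==> coll (:) P = a"
 unfolding coll_def by (rule the_equality) (auto intro: ext)

lemma D_empty: "empty (:) = emp" unfolding empty_def by (rule coll_eqI) simp
lemma D_upair: "upair (:) a b = upr a b" unfolding upair_def by (rule coll_eqI) simp
lemma D_opair: "opair (:) a b = opr a b" by (simp add: opair_def opr_def D_upair)
lemma D_successor: "successor (:) a = sc a" unfolding successor_def by (rule coll_eqI) simp
lemma D_omega: "omega (:) = om" unfolding omega_def by (rule coll_eqI) (simp add: mem_om D_empty D_successor)
lemma D_subset: "subset (:) a b = sb a b" by (simp add: subset_def sb_def)
lemma D_setminus: "setminus (:) a b = Sep a (%x. ~x:b)" unfolding setminus_def by (rule coll_eqI) simp
lemma D_fn: "is_function (:) f a b = fn f a b" by (simp add: is_function_def fn_def D_opair)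
lemma D_app: assumes "fn f a b" "x:a" shows "app (:) f x = f$x"
 unfolding app_def D_opair using fn_ap(1)[OF assms] by (intro the_equality) auto
lemma D_baire: "baire (:) = Rl" unfolding baire_def by (rule coll_eqI) (simp add: Rl_def D_fn D_omega)

lemma D_even: "even_number (:) n <-> (EX m. m:om & n = dbl m)"
proof
 assume n: "even_number (:) n"
 define w where "w = Rep om dbl"
 have w: "x:w <-> (EX m. m:om & x = dbl m)" for x by (simp add: w_def)
 have "emp:w" unfolding w using emp_om dbl_0 by metis
 moreover have "sc (sc k):w" if "k:w" for k using that unfolding w using sc_om dbl_sc by metis
 ultimately have "n:w" using n unfolding even_number_def D_empty D_successor by blast
 then show "EX m. m:om & n = dbl m" by (simp add: w)
next
 assume "EX m. m:om & n = dbl m"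
 then obtain m where m: "m:om" "n = dbl m" by blast
 have "dbl m:w" if "emp:w" "ALL k. k:w --> sc (sc k):w" for w
  by (rule nat_ind[OF m(1), of "%m. dbl m:w"]) (use that in auto)
 then show "even_number (:) n" unfolding even_number_def D_empty D_successor D_omega using m by simp
qed

lemma D_restriction: assumes "fn x a b" "sb n a" shows "restriction (:) x n = Lam n (ap x)"
 unfolding restriction_def
proof (rule coll_eqI)
 fix p
 have "opr k y:x <-> y = x$k" if "k:n" for k y using fn_ap(1)[OF assms(1)] sbD[OF assms(2) that] by blast
 then show "p:Lam n (ap x) <-> p:x & (EX k y. k:n & p = opair (:) k y)"
  by (auto simp: D_opair)
qed

lemma nat_sb_om: "n:om ==> sb n om" using Ord_sb[OF Ord_om] .

lemma Rl_fn: "x:Rl <-> fn x om om" by (simp add: Rl_def)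

definition FS where "FS = Sep (Pw (Prd om om)) (%s. EX n. n:om & fn s n om)"

lemma mem_FS: "s:FS <-> (EX n. n:om & fn s n om)"
proof -
 have "sb s (Prd om om)" if "n:om" "fn s n om" for n
  using that(2) nat_in[OF that(1)] unfolding fn_def sb_def mem_Prd by blast
 then show ?thesis by (auto simp: FS_def)
qed

lemma D_FS: "finite_sequences (:) = FS"
 unfolding finite_sequences_def by (rule coll_eqI) (simp add: mem_FS D_fn D_omega)

section \<open>Games\<close>

text \<open>Moves at times in \<open>T\<close> come from the strategy. For \<open>T\<close> the even
  or the odd numbers, \<open>hf k\<close> counts the earlier times of the parity of
  \<open>k\<close>, so the opponent's moves are the entries of \<open>x\<close> in order.\<close>

definition pos where "pos T \<sigma> x n =
 natrec emp (%k p. un p (upr (opr k (if k:T then \<sigma>$p else x$(hf k))) (opr k (if k:T then \<sigma>$p else x$(hf k))))) n"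
definition run where "run T \<sigma> x = Lam om (%k. if k:T then \<sigma>$(pos T \<sigma> x k) else x$(hf k))"
definition evn where "evn z = Lam om (%n. z$(dbl n))"
definition odd where "odd z = Lam om (%n. z$(sc (dbl n)))"

lemma dt_pos [simp]: "dt T ==> dt a ==> dt b ==> dt c ==> dt (%s. pos (T s) (a s) (b s) (c s))"
 by (rule dt_lift4) (simp_all add: pos_def)
lemma dt_run [simp]: "dt T ==> dt a ==> dt b ==> dt (%s. run (T s) (a s) (b s))"
 by (rule dt_lift3) (simp_all add: run_def)
lemma dt_evn [simp]: "dt a ==> dt (%s. evn (a s))" by (rule dt_lift1) (simp_all add: evn_def)
lemma dt_odd [simp]: "dt a ==> dt (%s. odd (a s))" by (rule dt_lift1) (simp_all add: odd_def)

lemma evn_ap [simp]: "n:om ==> evn z$n = z$(dbl n)" by (simp add: evn_def)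
lemma odd_ap [simp]: "n:om ==> odd z$n = z$(sc (dbl n))" by (simp add: odd_def)
lemma evn_Rl [simp]: "z:Rl ==> evn z:Rl" unfolding evn_def by (rule RlI) auto
lemma odd_Rl [simp]: "z:Rl ==> odd z:Rl" unfolding odd_def by (rule RlI) auto

lemma pos_0 [simp]: "pos T \<sigma> x emp = emp" by (simp add: pos_def)
lemma run_ap: "k:om ==> run T \<sigma> x$k = (if k:T then \<sigma>$(pos T \<sigma> x k) else x$(hf k))"
 by (simp add: run_def)
lemma pos_sc: "n:om ==> pos T \<sigma> x (sc n) = un (pos T \<sigma> x n) (upr (opr n (run T \<sigma> x$n)) (opr n (run T \<sigma> x$n)))"
 by (simp add: run_ap pos_def)

lemma pos_Lam: "n:om ==> pos T \<sigma> x n = Lam n (ap (run T \<sigma> x))"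
proof (rule nat_ind[of n "%n. pos T \<sigma> x n = Lam n (ap (run T \<sigma> x))"])
 show "pos T \<sigma> x emp = Lam emp (ap (run T \<sigma> x))" by (rule ext) simp
 fix n assume n: "n:om" and IH: "pos T \<sigma> x n = Lam n (ap (run T \<sigma> x))"
 show "pos T \<sigma> x (sc n) = Lam (sc n) (ap (run T \<sigma> x))"
  unfolding pos_sc[OF n] IH by (rule ext) auto
qed auto

lemma run_Rl: assumes \<sigma>: "fn \<sigma> FS om" and x: "x:Rl" shows "run T \<sigma> x:Rl"
proof -
 have "k:om --> run T \<sigma> x$k:om" if "k:om" for k
 proof (rule Ord_ind[OF nat_Ord[OF that]], simp, intro impI)
  fix k assume IH: "!!y. y:k ==> y:om --> run T \<sigma> x$y:om" and k: "k:om"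
  have "fn (pos T \<sigma> x k) k om" unfolding pos_Lam[OF k] by (rule fn_Lam) (use IH nat_in[OF k] in auto)
  then have "pos T \<sigma> x k:FS" using k mem_FS by blast
  then show "run T \<sigma> x$k:om" using fn_ap(2)[OF \<sigma>] k x by (simp add: run_ap)
 qed
 then have "Lam om (ap (run T \<sigma> x)):Rl" by (intro RlI) auto
 moreover have "Lam om (ap (run T \<sigma> x)) = run T \<sigma> x"
  unfolding run_def by (rule Lam_cong) simp
 ultimately show ?thesis by simp
qed

lemma pos_cong: assumes "n:om" "!!k. k:n ==> ~k:T ==> x$(hf k) = y$(hf k)"
 shows "pos T \<sigma> x n = pos T \<sigma> y n"
proof -
 have "(ALL k. k:n --> ~k:T --> x$(hf k) = y$(hf k)) --> pos T \<sigma> x n = pos T \<sigma> y n"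
 proof (rule nat_ind[OF assms(1)])
  fix n assume n: "n:om" and IH: "(ALL k. k:n --> ~k:T --> x$(hf k) = y$(hf k)) --> pos T \<sigma> x n = pos T \<sigma> y n"
  show "(ALL k. k:sc n --> ~k:T --> x$(hf k) = y$(hf k)) --> pos T \<sigma> x (sc n) = pos T \<sigma> y (sc n)"
  proof
   assume *: "ALL k. k:sc n --> ~k:T --> x$(hf k) = y$(hf k)"
   then have p: "pos T \<sigma> x n = pos T \<sigma> y n" using IH by simp
   have "run T \<sigma> x$n = run T \<sigma> y$n" using * n by (simp add: run_ap p)
   then show "pos T \<sigma> x (sc n) = pos T \<sigma> y (sc n)" using n by (simp add: pos_sc p)
  qed
 qed auto
 then show ?thesis using assms(2) by blast
qed

lemma dbl_less: assumes "i:om" "m:om" "dbl i:dbl m" shows "i:m"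
proof -
 have mono: "i:m --> dbl i:dbl m" if "m:om" for i m
  by (rule nat_ind[OF that]) auto
 show ?thesis using nat_lin[OF assms(1,2)] mono[OF assms(1), of m] assms mem_asym mem_irrefl by blast
qed

lemma Uni_Rep: assumes "x:a" "dt (%s. F (s 0))" "!!z. z:a ==> F z = F x" shows "Uni (Rep a F) = F x"
proof (rule ext)
 fix v
 have "z:a ==> v:F z <-> v:F x" for z using assms(3)[of z] by argo
 then show "v:Uni (Rep a F) <-> v:F x" unfolding mem_Uni mem_Rep[OF assms(2)] using assms(1) by blast
qed

section \<open>Ordinals and cardinals of the structure\<close>

lemma D_ordinal: "ordinal (:) a <-> Ord a"
 unfolding ordinal_def transitive_set_def D_subset Ord_def ..

lemma D_bijI: assumes "fn f a b" "!!y. y:b ==> EX x. x:a & f$x = y"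
  "!!x x'. x:a ==> x':a ==> f$x = f$x' ==> x = x'"
 shows "is_bijection (:) f a b"
 unfolding is_bijection_def D_fn
proof (intro conjI allI impI assms(1))
 fix y assume "y:b"
 then obtain x where x: "x:a" "f$x = y" using assms(2) by blast
 show "EX! x. x:a & app (:) f x = y"
 proof (rule ex1I[of _ x])
  show "x:a & app (:) f x = y" using x D_app[OF assms(1) x(1)] by argo
  fix x' assume x': "x':a & app (:) f x' = y"
  then have "f$x' = y" using D_app[OF assms(1) conjunct1[OF x']] by argo
  then show "x' = x" using assms(3)[OF conjunct1[OF x'] x(1)] x(2) by argo
 qed
qed

lemma D_bij_img: assumes "is_bijection (:) f a b" shows "img a b"
proof -
 have f: "fn f a b" using assms unfolding is_bijection_def D_fn by blast
 have "EX x. x:a & f$x = y" if "y:b" for y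
 proof -
  obtain x where x: "x:a" "app (:) f x = y" using assms \<open>y:b\<close> unfolding is_bijection_def by blast
  then show ?thesis using D_app[OF f x(1)] by metis
 qed
 then show ?thesis unfolding img_def by blast
qed

text \<open>The map is injective on the least preimages. These form a set of ordinals below
  \<kappa>, whose collapse is an ordinal at most \<kappa> and hence a member of \<nu>.\<close>

lemma img_bij: assumes k: "Ord \<kappa>" and n: "Ord \<nu>" "\<kappa>:\<nu>" and im: "img \<kappa> \<nu>"
 shows "EX \<alpha> f. \<alpha>:\<nu> & is_bijection (:) f \<alpha> \<nu>"
proof -
 obtain g where g: "!!y. y:\<nu> ==> EX x. x:\<kappa> & g$x = y" using im unfolding img_def by blast
 define S where "S = Sep \<kappa> (%\<xi>. g$\<xi>:\<nu> & (ALL \<eta>. \<eta>:\<xi> --> g$\<eta> ~= g$\<xi>))"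
 have S: "\<xi>:S <-> \<xi>:\<kappa> & g$\<xi>:\<nu> & (ALL \<eta>. \<eta>:\<xi> --> g$\<eta> ~= g$\<xi>)" for \<xi> by (simp add: S_def)
 have OS: "Ord \<xi>" if "\<xi>:S" for \<xi> using that Ord_in[OF k] unfolding S by blast
 have gi: "\<xi> = \<eta>" if "\<xi>:S" "\<eta>:S" "g$\<xi> = g$\<eta>" for \<xi> \<eta>
  using Ord_linear[OF OS[OF that(1)] OS[OF that(2)]] that unfolding S by metis
 have r: "dp (%s. s 1:s 0)" by simp
 let ?r = "%y x. y:x"
 let ?c = "rk S ?r"
 note W = wf_mem[of S]
 have dc: "dt (%s. ?c (a s))" if "dt a" for a using that by simp
 have Oc: "Ord (?c \<xi>)" if "\<xi>:S" for \<xi> using Ord_rk[OF W r that] .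
 have cs: "sb (?c \<xi>) \<xi>" if "\<xi>:S" for \<xi>
 proof (rule wf_ind[OF W that, of "%\<xi>. sb (?c \<xi>) \<xi>"])
  show "dp (%s. sb (?c (s 0)) (s 0))" by simp
  fix x assume x: "x:S" and IH: "!!y. y:S ==> y:x ==> sb (?c y) y"
  show "sb (?c x) x"
   by (rule rk_least[OF W r x OS[OF x]]) (use Ord_sb_mem[OF Oc OS[OF x] IH] in blast)
 qed
 have ci: "\<xi> = \<eta>" if "\<xi>:S" "\<eta>:S" "?c \<xi> = ?c \<eta>" for \<xi> \<eta>
  using Ord_linear[OF OS[OF that(1)] OS[OF that(2)]] rk_mono[OF W r that(1,2)] rk_mono[OF W r that(2,1)] that(3) mem_irrefl by metis
 define \<alpha> where "\<alpha> = rng S ?r"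
 have a: "v:\<alpha> <-> (EX x. x:S & v = ?c x)" for v unfolding \<alpha>_def by (rule mem_rng[OF W r])
 have Oa: "Ord \<alpha>" unfolding \<alpha>_def by (rule Ord_rng[OF W r])
 have "sb \<alpha> \<kappa>" unfolding sb_def
 proof (intro allI impI)
  fix v assume "v:\<alpha>"
  then obtain x where x: "x:S" "v = ?c x" using a by blast
  then show "v:\<kappa>" using Ord_sb_mem[OF Oc[OF x(1)] k cs[OF x(1)]] unfolding S by blast
 qed
 then have an: "\<alpha>:\<nu>" using Ord_sb_mem[OF Oa n(1) _ n(2)] by blast
 define F where "F v = Uni (Rep (Sep S (%\<xi>. ?c \<xi> = v)) (ap g))" for v
 have dF: "dt (%s. F (s 0))" unfolding F_def by simp
 have Fc: "F (?c \<xi>) = g$\<xi>" if "\<xi>:S" for \<xi> unfolding F_def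
 proof (rule Uni_Rep)
  have m: "x:Sep S (%\<zeta>. ?c \<zeta> = ?c \<xi>) <-> x:S & ?c x = ?c \<xi>" for x by simp
  show "\<xi>:Sep S (%\<zeta>. ?c \<zeta> = ?c \<xi>)" unfolding m using that by blast
  show "g$z = g$\<xi>" if "z:Sep S (%\<zeta>. ?c \<zeta> = ?c \<xi>)" for z
   using ci[OF _ \<open>\<xi>:S\<close>] that unfolding m by blast
 qed simp
 let ?f = "Lam \<alpha> F"
 have fc: "?f$(?c \<xi>) = g$\<xi>" if "\<xi>:S" for \<xi> using ap_Lam[OF _ dF] Fc[OF that] a that by metis
 have "is_bijection (:) ?f \<alpha> \<nu>"
 proof (rule D_bijI)
  show "fn ?f \<alpha> \<nu>" by (rule fn_Lam[OF dF]) (use a Fc S in metis)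
  show "EX x. x:\<alpha> & ?f$x = y" if y: "y:\<nu>" for y
  proof -
   obtain x where x: "x:\<kappa>" "g$x = y" using g[OF y] by blast
   let ?P = "%\<xi>. \<xi>:\<kappa> & g$\<xi> = y"
   have d: "dp (%s. ?P (s 0))" by simp
   obtain z where z: "?P z" "!!b. b:z ==> ~?P b" using lst(2,4)[of ?P, OF d Ord_in[OF k x(1)]] x by blast
   then have "z:S" using y Ord_trans[OF k] unfolding S by blast
   then show ?thesis using fc z(1) a by blast
  qed
  show "v = w" if "v:\<alpha>" "w:\<alpha>" "?f$v = ?f$w" for v w
   using that fc gi unfolding a by metis
 qed
 then show ?thesis using an by blast
qed

lemma D_succ_card: assumes k: "Ord \<kappa>" shows "successor_cardinal (:) \<kappa> = hart \<kappa>"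
 unfolding successor_cardinal_def
proof (rule the_equality)
 have kh: "\<kappa>:hart \<kappa>" using k img_sb[OF sb_refl] by (simp add: mem_hart)
 have "~is_bijection (:) f \<alpha> (hart \<kappa>)" if "\<alpha>:hart \<kappa>" for f \<alpha>
  using D_bij_img that img_trans not_img_hart unfolding mem_hart by blast
 then have c: "cardinal (:) (hart \<kappa>)" unfolding cardinal_def D_ordinal using Ord_hart by blast
 have m: "sb (hart \<kappa>) \<nu>" if n: "cardinal (:) \<nu>" "\<kappa>:\<nu>" for \<nu>
 proof (rule ccontr)
  assume ns: "~sb (hart \<kappa>) \<nu>"
  have On: "Ord \<nu>" using n(1) unfolding cardinal_def D_ordinal by blast
  have "\<nu>:hart \<kappa>" using ns Ord_not_mem[OF On Ord_hart] by blast
  then have "img \<kappa> \<nu>" using mem_hart by blast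
  then show False using img_bij[OF k On n(2)] n(1) unfolding cardinal_def by blast
 qed
 show "cardinal (:) (hart \<kappa>) & \<kappa>:hart \<kappa> & (ALL \<nu>. cardinal (:) \<nu> & \<kappa>:\<nu> --> subset (:) (hart \<kappa>) \<nu>)"
  unfolding D_subset using c kh m by blast
 show "\<mu> = hart \<kappa>" if "cardinal (:) \<mu> & \<kappa>:\<mu> & (ALL \<nu>. cardinal (:) \<nu> & \<kappa>:\<nu> --> subset (:) \<mu> \<nu>)" for \<mu>
  using that c kh m sb_antisym unfolding D_subset by blast
qed

lemma D_omega2: "omega2 (:) = w2"
 unfolding omega2_def omega1_def D_omega D_succ_card[OF Ord_om] w1_def[symmetric] D_succ_card[OF Ord_w1] w2_def ..

end

locale zfad = zf +
 assumes AD: "AD (:)"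
begin

text \<open>Determinacy of the set of runs \<open>z\<close> with \<open>~P (evn z) (odd z)\<close>,
  with strategies turned from functions of positions into reals that read only the opponent's
  moves.\<close>

theorem Game:
 assumes P: "dp (%s. P (s 0) (s 1))"
 shows "(EX e. e:Rl & (ALL x. x:Rl --> P x (lip e x))) | (EX e. e:Rl & (ALL y. y:Rl --> ~P (lipI e y) y))"
proof -
 have P': "dp (%s. P (a s) (b s))" if "dt a" "dt b" for a b using dp_sub2[OF P that] .
 define A where "A = Sep Rl (%z. ~P (evn z) (odd z))"
 have A: "z:A <-> z:Rl & ~P (evn z) (odd z)" for z unfolding A_def by (simp add: P')
 have "sb A Rl" using A by (simp add: sb_def)
 then have "determined (:) A" using AD unfolding AD_def D_subset D_baire by blast
 then obtain \<sigma> where \<sigma>: "fn \<sigma> FS om" and w: "winning_for_I (:) \<sigma> A | winning_for_II (:) \<sigma> A"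
  unfolding determined_def strategy_def D_fn D_omega D_FS by blast
 have app: "app (:) (run T \<sigma> x) n = app (:) \<sigma> (restriction (:) (run T \<sigma> x) n)"
  if "x:Rl" "n:om" "n:T" for T x n
 proof -
  have r: "run T \<sigma> x:Rl" using run_Rl[OF \<sigma> that(1)] .
  have res: "restriction (:) (run T \<sigma> x) n = pos T \<sigma> x n"
   using D_restriction[of "run T \<sigma> x" om om n] r nat_sb_om that by (simp add: Rl_fn pos_Lam)
  have "fn (pos T \<sigma> x n) n om" unfolding pos_Lam[OF that(2)] by (rule fn_Lam) (use r nat_in[OF that(2)] in auto)
  then have "pos T \<sigma> x n:FS" using that mem_FS by blast
  then show ?thesis unfolding res using D_app[OF \<sigma>] D_app[of "run T \<sigma> x" om om n] r that
   by (simp add: Rl_fn run_ap)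
 qed
 from w show ?thesis
 proof
  assume I: "winning_for_I (:) \<sigma> A"
  define T where "T = Rep om dbl"
  have T: "n:T <-> (EX m. m:om & n = dbl m)" for n by (simp add: T_def)
  \<comment> \<open>The answer depends only on the opponent's moves seen so far, so their
    prolongation by zeros may stand in for the opponent.\<close>
  define e where "e = Lam om (%u. evn (run T \<sigma> (ex u))$(ln u))"
  have e: "e:Rl" unfolding e_def by (rule RlI) (use run_Rl[OF \<sigma>] ex in auto)
  have "~P (lipI e y) y" if y: "y:Rl" for y
  proof -
   have r: "run T \<sigma> y:Rl" using run_Rl[OF \<sigma> y] .
   have "app (:) (run T \<sigma> y) n = app (:) \<sigma> (restriction (:) (run T \<sigma> y) n)"
    if "n:om" "even_number (:) n" for n
    using app[OF y that(1), of T] that(2) unfolding D_even T by blast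
   then have "run T \<sigma> y:A" using I r unfolding winning_for_I_def D_baire D_omega by blast
   then have 1: "~P (evn (run T \<sigma> y)) (odd (run T \<sigma> y))" using A by blast
   have 2: "odd (run T \<sigma> y) = y"
   proof (rule Rl_ext)
    fix n assume n: "n:om"
    then have "~sc (dbl n):T" unfolding T by auto
    then show "odd (run T \<sigma> y)$n = y$n" using n by (simp add: run_ap)
   qed (use y r in auto)
   have 3: "evn (run T \<sigma> y) = lipI e y"
   proof (rule Rl_ext)
    fix n assume n: "n:om"
    have yn: "eqn n (ex (kap y n)) y" using eqn_ex[OF y n] .
    have "pos T \<sigma> (ex (kap y n)) (dbl n) = pos T \<sigma> y (dbl n)"
    proof (rule pos_cong)
     fix k assume k: "k:dbl n" "~k:T"
     then have "k:om" using n nat_in dbl_om by blast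
     then obtain i where i: "i:om" "k = sc (dbl i)" using parity[of k] k(2) unfolding T by blast
     then have "dbl i:dbl n" using nat_trans[of "dbl i" k "dbl n"] k n by simp
     then have "i:n" using dbl_less i n by blast
     then show "ex (kap y n)$hf k = y$hf k" using eqn_in[OF yn] i by simp
    qed (use n in simp)
    moreover have "dbl n:T" using n T by blast
    ultimately show "evn (run T \<sigma> y)$n = lipI e y$n" using n y by (simp add: run_ap e_def)
   qed (use y r e in auto)
   show ?thesis using 1 2 3 by simp
  qed
  then show ?thesis using e by blast
 next
  assume II: "winning_for_II (:) \<sigma> A"
  define T where "T = Rep om (%n. sc (dbl n))"
  have T: "n:T <-> (EX m. m:om & n = sc (dbl m))" for n by (simp add: T_def)
  \<comment> \<open>Player II answers after seeing one entry more, hence the predecessor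
    \<open>Uni\<close> of the length.\<close>
  define e where "e = Lam om (%u. odd (run T \<sigma> (ex u))$(Uni (ln u)))"
  have e: "e:Rl" unfolding e_def by (rule RlI) (use run_Rl[OF \<sigma>] ex in auto)
  have "P y (lip e y)" if y: "y:Rl" for y
  proof -
   have r: "run T \<sigma> y:Rl" using run_Rl[OF \<sigma> y] .
   have "app (:) (run T \<sigma> y) n = app (:) \<sigma> (restriction (:) (run T \<sigma> y) n)"
    if "n:om" "~even_number (:) n" for n
    using app[OF y that(1), of T] that(2) parity[OF that(1)] unfolding D_even T by blast
   then have "~run T \<sigma> y:A" using II r unfolding winning_for_II_def D_baire D_omega by blast
   then have 1: "P (evn (run T \<sigma> y)) (odd (run T \<sigma> y))" using A r by blast
   have 2: "evn (run T \<sigma> y) = y"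
   proof (rule Rl_ext)
    fix n assume n: "n:om"
    then have "~dbl n:T" unfolding T by auto
    then show "evn (run T \<sigma> y)$n = y$n" using n by (simp add: run_ap)
   qed (use y r in auto)
   have 3: "odd (run T \<sigma> y) = lip e y"
   proof (rule Rl_ext)
    fix n assume n: "n:om"
    have yn: "eqn (sc n) (ex (kap y (sc n))) y" using eqn_ex[OF y sc_om[OF n]] .
    have "pos T \<sigma> (ex (kap y (sc n))) (sc (dbl n)) = pos T \<sigma> y (sc (dbl n))"
    proof (rule pos_cong)
     fix k assume k: "k:sc (dbl n)" "~k:T"
     have "k:om" by (rule nat_in[OF _ k(1)]) (use n in simp)
     then obtain i where i: "i:om" "k = dbl i" using parity[of k] k(2)[unfolded T] by metis
     have "dbl i:dbl n | i = n" using k(1) i n by simp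
     then have "i:sc n" using dbl_less[OF i(1) n] unfolding mem_sc by blast
     then show "ex (kap y (sc n))$hf k = y$hf k" using eqn_in[OF yn] i by simp
    qed (use n in simp)
    moreover have "sc (dbl n):T" using n T by blast
    moreover have "kap y (sc n):om" using kap_om[OF y sc_om[OF n]] .
    moreover have "ln (kap y (sc n)) = sc n" using ln_kap[OF y sc_om[OF n]] .
    ultimately show "odd (run T \<sigma> y)$n = lip e y$n" using n y
     by (simp add: run_ap e_def Uni_sc nat_Ord del: kap_sc)
   qed (use y r e in auto)
   show ?thesis using 1 2 3 by simp
  qed
  then show ?thesis using e by blast
 qed
qed

section \<open>Well-founded trees\<close>

definition chd where "chd u d = sc (pi u d)"
lemma dt_chd [simp]: "dt a ==> dt b ==> dt (%s. chd (a s) (b s))" unfolding chd_def by simp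
lemma chd_om [simp]: "u:om ==> d:om ==> chd u d:om" by (simp add: chd_def)
lemma chd_eq [simp]: "u:om ==> d:om ==> u':om ==> d':om ==> chd u d = chd u' d' <-> u = u' & d = d'"
 by (simp add: chd_def)
lemma kap_sc_chd: "n:om ==> kap x (sc n) = chd (kap x n) (x$n)" by (simp add: chd_def)

lemma chd_kap: assumes "x:Rl" "n:om" "d:om" shows "chd (kap x n) d = kap (upd x n d) (sc n)"
 using assms kap_cong[OF assms(2) eqn_upd[OF assms(2)], of x d] by (simp add: chd_def)

lemma ln_chd [simp]: "u:om ==> d:om ==> ln (chd u d) = sc (ln u)"
 using chd_kap[of "ex u" "ln u" d] ex[of u] ln_kap[of "upd (ex u) (ln u) d" "sc (ln u)"] by (simp del: kap_sc)

lemma eqn_ex_chd: assumes "u:om" "d:om" shows "eqn (ln u) (ex (chd u d)) (ex u)"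
proof -
 have c: "chd u d = kap (upd (ex u) (ln u) d) (sc (ln u))"
  using chd_kap[of "ex u" "ln u" d] ex[of u] assms by simp
 have "eqn (sc (ln u)) (ex (chd u d)) (upd (ex u) (ln u) d)"
  unfolding c by (rule eqn_ex) (use ex assms in auto)
 then have "eqn (ln u) (ex (chd u d)) (upd (ex u) (ln u) d)" by (simp add: eqn_sc)
 then show ?thesis using eqn_upd[of "ln u" "ex u" d] eqn_trans assms by (meson ln_om)
qed

text \<open>The chain may start at any node, so \<open>V n\<close> has length at least
  \<open>n\<close>, possibly more; entry \<open>k\<close> of the branch is read off
  \<open>V (sc k)\<close>, which is long enough.\<close>

lemma branch:
 assumes V: "dt (%s. V (s 0))" "!!n. n:om ==> V n:om" "!!n. n:om ==> EX d. d:om & V (sc n) = chd (V n) d"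
 shows "EX b. b:Rl & (ALL n. n:om --> sb n (ln (V n)) & kap b (ln (V n)) = V n)"
proof -
 have V': "dt (%s. V (a s))" if "dt a" for a using dt_sub1[OF V(1) that] .
 have lnsc: "ln (V (sc n)) = sc (ln (V n))" and exsc: "eqn (ln (V n)) (ex (V (sc n))) (ex (V n))" if n: "n:om" for n
  using V(3)[OF n] V(2)[OF n] eqn_ex_chd ln_chd by metis+
 have ge: "sb n (ln (V n))" if "n:om" for n
 proof (rule nat_ind[OF that])
  show "dp (%s. sb (s 0) (ln (V (s 0))))" by (simp add: V')
  show "sb emp (ln (V emp))" by (simp add: sb_def)
  fix n assume n: "n:om" "sb n (ln (V n))"
  then have "n = ln (V n) | n:ln (V n)" using Ord_sb_iff nat_Ord V(2) ln_om by metis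
  then have "n:sc (ln (V n))" by auto
  then show "sb (sc n) (ln (V (sc n)))" unfolding lnsc[OF n(1)] using n(2) by (auto simp: sb_def)
 qed
 have coh: "sb n m --> eqn (ln (V n)) (ex (V n)) (ex (V m)) & sb (ln (V n)) (ln (V m))" if n: "n:om" and m: "m:om" for n m
 proof (rule nat_ind[OF m, of "%m. sb n m --> eqn (ln (V n)) (ex (V n)) (ex (V m)) & sb (ln (V n)) (ln (V m))"])
  show "dp (%s. sb n (s 0) --> eqn (ln (V n)) (ex (V n)) (ex (V (s 0))) & sb (ln (V n)) (ln (V (s 0))))" by (simp add: V')
  have "sb n emp ==> n = emp" using sb_antisym[of n emp] by (simp add: sb_def)
  then show "sb n emp --> eqn (ln (V n)) (ex (V n)) (ex (V emp)) & sb (ln (V n)) (ln (V emp))" by auto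
  fix m assume m: "m:om" and IH: "sb n m --> eqn (ln (V n)) (ex (V n)) (ex (V m)) & sb (ln (V n)) (ln (V m))"
  show "sb n (sc m) --> eqn (ln (V n)) (ex (V n)) (ex (V (sc m))) & sb (ln (V n)) (ln (V (sc m)))"
  proof
   assume "sb n (sc m)"
   then have "n:sc m | n = sc m" using Ord_sb_iff nat_Ord n m sc_om by blast
   then consider "sb n m" | "n = sc m" using Ord_sb[OF nat_Ord[OF m]] sb_refl by auto
   then show "eqn (ln (V n)) (ex (V n)) (ex (V (sc m))) & sb (ln (V n)) (ln (V (sc m)))"
   proof cases
    case 1
    then have *: "eqn (ln (V n)) (ex (V n)) (ex (V m))" "sb (ln (V n)) (ln (V m))" using IH by auto
    have "eqn (ln (V n)) (ex (V (sc m))) (ex (V m))" using eqn_mono[OF exsc[OF m] *(2)] .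
    from eqn_trans[OF *(1) eqn_sym[OF this]] show ?thesis
     unfolding lnsc[OF m] using *(2) by (simp add: sb_def)
   qed simp
  qed
 qed
 define b where "b = Lam om (%k. ex (V (sc k))$k)"
 have b: "b:Rl" unfolding b_def by (rule RlI) (simp add: V', use V ex in auto)
 have bk: "b$k = ex (V (sc k))$k" if "k:om" for k using that unfolding b_def by (simp add: V')
 have "kap b (ln (V n)) = V n" if n: "n:om" for n
 proof -
  have "eqn (ln (V n)) b (ex (V n))" unfolding eqn_def
  proof (intro allI impI)
   fix k assume k: "k:ln (V n)"
   have kom: "k:om" using nat_in[OF _ k] V(2) n by simp
   have k2: "k:ln (V (sc k))" using sbD[OF ge[OF sc_om[OF kom]]] by simp
   have "sb n (sc k) | sb (sc k) n"
    using Ord_linear[OF nat_Ord[OF n] nat_Ord[OF sc_om[OF kom]]] Ord_sb nat_Ord n kom sc_om sb_refl by metis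
   then show "b$k = ex (V n)$k"
    unfolding bk[OF kom] using coh[OF n sc_om[OF kom]] coh[OF sc_om[OF kom] n] k k2 eqn_in by metis
  qed
  then have "kap b (ln (V n)) = kap (ex (V n)) (ln (V n))" using kap_cong V(2) n by simp
  then show ?thesis using ex V(2) n by simp
 qed
 then show ?thesis using b ge by blast
qed

text \<open>A real \<open>w\<close> codes the tree of the nodes all of whose nonempty initial segments \<open>w\<close> maps to \<open>0\<close>;
 the empty node always counts as an element.\<close>

definition inn where "inn w b n <-> (ALL k. k:n --> w$(kap b (sc k)) = emp)"
definition WF where "WF = Sep Rl (%w. ALL b. b:Rl --> (EX n. n:om & ~inn w b n))"
definition tree where "tree w v <-> inn w (ex v) (ln v)"
text \<open>It suffices to ask that the child be in the tree: initial segments of elements are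
  elements, so a node outside has no children.\<close>

definition ch where "ch w v u <-> (EX d. d:om & v = chd u d) & tree w v"
definition rW where "rW w u = rk om (ch w) u"
definition rw where "rw w = rW w emp"

lemma dp_inn [simp]: "dt a ==> dt b ==> dt c ==> dp (%s. inn (a s) (b s) (c s))"
 by (rule dp_lift3) (simp_all add: inn_def)
lemma dp_tree [simp]: "dt a ==> dt b ==> dp (%s. tree (a s) (b s))"
 by (rule dp_lift2) (simp_all add: tree_def)
lemma dp_ch [simp]: "dt a ==> dt b ==> dt c ==> dp (%s. ch (a s) (b s) (c s))"
 by (rule dp_lift3) (simp_all add: ch_def)
lemma dt_rW [simp]: "dt a ==> dt b ==> dt (%s. rW (a s) (b s))"
 by (rule dt_lift2) (simp_all add: rW_def)
lemma dt_rw [simp]: "dt a ==> dt (%s. rw (a s))" by (simp add: rw_def)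

lemma mem_WF: "w:WF <-> w:Rl & (ALL b. b:Rl --> (EX n. n:om & ~inn w b n))"
 by (simp add: WF_def)
lemma WF_Rl [simp]: "w:WF ==> w:Rl" by (simp add: mem_WF)
lemma inn_0 [simp]: "inn w b emp" by (simp add: inn_def)
lemma inn_sc: "inn w b (sc n) <-> inn w b n & w$(kap b (sc n)) = emp" unfolding inn_def mem_sc by blast
lemma inn_mono: "inn w b n ==> sb m n ==> inn w b m" by (simp add: inn_def sb_def)
lemma inn_cong: assumes "n:om" "eqn n b b'" shows "inn w b n <-> inn w b' n"
proof -
 have "kap b (sc k) = kap b' (sc k)" if "k:n" for k
 proof (rule kap_cong)
  have "sc k:sc n" using sc_mem_sc nat_Ord assms that by blast
  then have "sb (sc k) n" using Ord_sb[OF nat_Ord[OF assms(1)]] by (auto simp: sb_def)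
  then show "eqn (sc k) b b'" using eqn_mono assms by blast
 qed (use nat_in[OF assms(1) that] in simp)
 then show ?thesis unfolding inn_def by simp
qed

lemma tree_kap [simp]: "b:Rl ==> n:om ==> tree w (kap b n) <-> inn w b n"
 unfolding tree_def using inn_cong[OF _ eqn_ex] by simp

lemma ch_kapD: assumes "ch w v (kap b n)" "b:Rl" "n:om"
 obtains b' where "b':Rl" "eqn n b' b" "v = kap b' (sc n)" "inn w b' (sc n)"
proof -
 obtain d where d: "d:om" "v = chd (kap b n) d" "tree w v" using assms(1) ch_def by blast
 have v: "v = kap (upd b n d) (sc n)" using chd_kap assms d by simp
 then have "inn w (upd b n d) (sc n)" using d assms tree_kap[of "upd b n d" "sc n" w] by simp
 then show ?thesis using that[of "upd b n d"] v eqn_upd[OF assms(3)] assms d by simp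
qed

lemma ch_kapI: assumes "b:Rl" "n:om" "inn w b (sc n)" shows "ch w (kap b (sc n)) (kap b n)"
 unfolding ch_def
proof
 show "EX d. d:om & kap b (sc n) = chd (kap b n) d" using assms by (intro exI[of _ "b$n"]) (simp add: chd_def)
 show "tree w (kap b (sc n))" using tree_kap[OF assms(1) sc_om[OF assms(2)]] assms(3) by blast
qed

text \<open>In a set without minimal element, passing each time to the least child in the set yields
  a branch; nodes are numbers, so nothing has to be chosen.\<close>

lemma wf_ch: assumes "w:WF" shows "wf om (ch w)"
 unfolding wf_def
proof (intro allI impI, rule ccontr)
 fix Z assume Z: "sb Z om & (EX x. x:Z)" and no: "~(EX x. x:Z & (ALL y. y:Z --> ~ch w y x))"
 obtain u0 where u0: "u0:Z" using Z by blast
 define nx where "nx u = lst (%v. v:Z & ch w v u)" for u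
 have dnx: "dt (%s. nx (a s))" if "dt a" for a
  unfolding nx_def by (rule dt_lst) (use dt_push[OF that] in simp)
 have nx: "nx u:Z & ch w (nx u) u" if uZ: "u:Z" for u
 proof -
  obtain v where "v:Z" "ch w v u" using no uZ by blast
  moreover have "Ord v" using calculation(1) Z sbD nat_Ord by blast
  ultimately show ?thesis unfolding nx_def using lst(2)[of "%v. v:Z & ch w v u" v] by simp
 qed
 define V where "V n = natrec u0 (%_ u. nx u) n" for n
 have dV: "dt (%s. V (a s))" if "dt a" for a unfolding V_def by (rule dt_natrec) (use dnx that in auto)
 have V0: "V emp = u0" and Vs: "n:om ==> V (sc n) = nx (V n)" for n
  unfolding V_def using dnx by simp_all
 have VZ: "V n:Z" if "n:om" for n
  by (rule nat_ind[OF that]) (use dV u0 V0 Vs nx in auto)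
 have Vc: "ch w (V (sc n)) (V n)" if "n:om" for n using nx VZ Vs that by simp
 obtain b where b: "b:Rl" "!!n. n:om ==> sb n (ln (V n)) & kap b (ln (V n)) = V n"
 proof -
  have "EX b. b:Rl & (ALL n. n:om --> sb n (ln (V n)) & kap b (ln (V n)) = V n)"
  proof (rule branch)
   show "dt (%s. V (s 0))" using dV by simp
   show "V n:om" if "n:om" for n using VZ[OF that] Z sbD by blast
   show "EX d. d:om & V (sc n) = chd (V n) d" if "n:om" for n using Vc[OF that] ch_def by blast
  qed
  then show ?thesis using that by blast
 qed
 have "inn w b n" if n: "n:om" for n
 proof -
  have Vn: "V (sc n):om" using VZ[OF sc_om[OF n]] Z sbD by blast
  have "tree w (V (sc n))" using Vc[OF n] ch_def by blast
  then have "tree w (kap b (ln (V (sc n))))" using b(2)[OF sc_om[OF n]] by simp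
  then have "inn w b (ln (V (sc n)))" using tree_kap b(1) Vn by simp
  moreover have "sb n (ln (V (sc n)))" using b(2)[OF sc_om[OF n]] by (auto simp: sb_def)
  ultimately show ?thesis using inn_mono by blast
 qed
 then show False using assms b(1) mem_WF by blast
qed

lemma dp_chv: "dp (%s. ch w (s 1) (s 0))" by simp

lemmas rW_facts = Ord_rk[OF wf_ch dp_chv] rk_mono[OF wf_ch dp_chv] rk_least[OF wf_ch dp_chv]

lemma Ord_rW [simp]: "w:WF ==> u:om ==> Ord (rW w u)" unfolding rW_def using rW_facts(1) .
lemma rW_mono: "w:WF ==> u:om ==> v:om ==> ch w v u ==> rW w v:rW w u"
 unfolding rW_def using rW_facts(2) .
lemma Ord_rw [simp]: "w:WF ==> Ord (rw w)" by (simp add: rw_def)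
lemma rw_w1: "w:WF ==> rw w:w1"
 unfolding rw_def rW_def by (rule img_rk_w1[OF wf_ch]) auto

section \<open>Comparison of ranks\<close>

lemma ch_om: "ch w v u ==> u:om ==> v:om" unfolding ch_def by auto

text \<open>By induction along \<open>w\<close>: every child on the left has a partner on the right
  whose rank is at least as large.\<close>

lemma simul:
 assumes "w:WF" "w':WF" "dp (%s. Z (s 0) (s 1))" "u:om" "v:om" "Z u v"
  and Z: "!!u v u'. Z u v ==> u:om ==> v:om ==> ch w u' u ==> EX v'. ch w' v' v & Z u' v'"
 shows "sb (rW w u) (rW w' v)"
proof -
 have dZ: "dp (%s. Z (a s) (b s))" if "dt a" "dt b" for a b using dp_sub2[OF assms(3) that] .
 have "ALL v. v:om --> Z u v --> sb (rW w u) (rW w' v)"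
 proof (rule wf_ind[OF wf_ch[OF assms(1)] assms(4)])
  fix u assume u: "u:om" and IH: "!!y. y:om ==> ch w y u ==> ALL v. v:om --> Z y v --> sb (rW w y) (rW w' v)"
  show "ALL v. v:om --> Z u v --> sb (rW w u) (rW w' v)"
  proof (intro allI impI)
   fix v assume v: "v:om" "Z u v"
   show "sb (rW w u) (rW w' v)" unfolding rW_def[of w]
   proof (rule rW_facts(3)[OF assms(1) u])
    show "Ord (rW w' v)" using assms(2) v by simp
    fix y assume y: "y:om" "ch w y u"
    obtain v' where v': "ch w' v' v" "Z y v'" using Z[OF v(2) u v(1) y(2)] by blast
    have "sb (rW w y) (rW w' v')" using IH[OF y] v' ch_om v by blast
    moreover have "rW w' v':rW w' v" using rW_mono[OF assms(2) v(1) ch_om[OF v'(1) v(1)] v'(1)] .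
    ultimately show "rk om (ch w) y:rW w' v"
     using Ord_sb_mem[of "rW w y" "rW w' v" "rW w' v'"] assms y v unfolding rW_def[symmetric] by simp
   qed
  qed
 qed (use dZ in simp)
 then show ?thesis using assms by blast
qed

text \<open>Lipschitz maps. In contrast to general continuous maps they act on nodes and preserve
  their length.\<close>

definition lz where "lz F <-> dt (%s. F (s 0)) & (ALL b. b:Rl --> F b:Rl) &
 (ALL b b' n. b:Rl --> b':Rl --> n:om --> eqn n b b' --> eqn n (F b) (F b'))"

lemma lz_eqn: "lz F ==> b:Rl ==> b':Rl ==> n:om ==> eqn n b b' ==> eqn n (F b) (F b')"
 by (simp add: lz_def)

lemma lz_Rl: "lz F ==> b:Rl ==> F b:Rl"
 by (simp add: lz_def)
lemma lz_dt: "lz F ==> dt a ==> dt (%s. F (a s))"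
 using dt_sub1[of F a] by (simp add: lz_def)

lemma eqn_lip: assumes "n:om" "eqn n b b'" shows "eqn n (lip e b) (lip e b')" "eqn n (lipI e b) (lipI e b')"
proof -
 have k: "k:om" "kap b (sc k) = kap b' (sc k)" "kap b k = kap b' k" if "k:n" for k
 proof -
  show ko: "k:om" using nat_in[OF assms(1) that] .
  have s: "sb k n" using Ord_sb nat_Ord assms that by blast
  have "sb (sc k) n" using s that by (auto simp: sb_def)
  then show "kap b (sc k) = kap b' (sc k)" by (intro kap_cong[OF sc_om[OF ko]] eqn_mono[OF assms(2)])
  show "kap b k = kap b' k" by (intro kap_cong[OF ko] eqn_mono[OF assms(2)] s)
 qed
 show "eqn n (lip e b) (lip e b')" unfolding eqn_def using k by (simp del: kap_sc)
 show "eqn n (lipI e b) (lipI e b')" unfolding eqn_def using k by simp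
qed

lemma lz_lip: "e:Rl ==> lz (lip e)" and lz_lipI: "e:Rl ==> lz (lipI e)"
 unfolding lz_def using eqn_lip by simp_all
lemma lz_pr: "z:Rl ==> lz (pr z)" unfolding lz_def using eqn_pr by simp

lemma lz_rank:
 assumes F: "lz F" and w: "w:Rl" and w': "w':WF"
  and map: "!!b n. b:Rl ==> n:om ==> inn w b n ==> inn w' (F b) n"
 shows "w:WF" "sb (rw w) (rw w')"
proof -
 have FR: "F b:Rl" if "b:Rl" for b using lz_Rl[OF F that] .
 show W: "w:WF" unfolding mem_WF
 proof (intro conjI allI impI)
  fix b assume b: "b:Rl"
  then obtain n where "n:om" "~inn w' (F b) n" using FR w' mem_WF by blast
  then show "EX n. n:om & ~inn w b n" using map[OF b] by blast
 qed (rule w)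
 have dF: "dt (%s. F (a s))" if "dt a" for a using lz_dt[OF F that] .
 have "sb (rW w emp) (rW w' emp)"
 proof (rule simul[OF W w', of "%u v. EX b n. b:Rl & n:om & u = kap b n & v = kap (F b) n & inn w b n"])
  show "EX b n. b:Rl & n:om & emp = kap b n & emp = kap (F b) n & inn w b n"
   by (intro exI[of _ zr] exI[of _ emp]) simp
  fix u v u' assume "EX b n. b:Rl & n:om & u = kap b n & v = kap (F b) n & inn w b n" and c: "ch w u' u"
  then obtain b n where b: "b:Rl" "n:om" "u = kap b n" "v = kap (F b) n" by blast
  obtain b' where b': "b':Rl" "eqn n b' b" "u' = kap b' (sc n)" "inn w b' (sc n)"
   using ch_kapD[OF c[unfolded b(3)] b(1,2)] by blast
  have "eqn n (F b') (F b)" using lz_eqn[OF F b'(1) b(1,2) b'(2)] .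
  then have v: "v = kap (F b') n" using kap_cong b by metis
  have "ch w' (kap (F b') (sc n)) v" unfolding v
   by (rule ch_kapI) (use FR b' b map[OF b'(1) sc_om[OF b(2)] b'(4)] in auto)
  then show "EX v'. ch w' v' v & (EX b n. b:Rl & n:om & u' = kap b n & v' = kap (F b) n & inn w b n)"
   using b' sc_om[OF b(2)] by blast
 qed (auto simp: dF)
 then show "sb (rw w) (rw w')" by (simp add: rw_def)
qed

lemma eqn_lipI_sc: assumes "n:om" "eqn n b b'" shows "eqn (sc n) (lipI e b) (lipI e b')"
 using eqn_lip(2)[OF assms] kap_cong[OF assms] assms by (simp add: eqn_sc)

text \<open>Maps played by player I are one step ahead, so the root of \<open>w\<close> corresponds
  to a child of the root of \<open>w'\<close>.\<close>

lemma lz_rank_strict: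
 assumes F: "lz F" and FI: "!!b b' n. n:om ==> eqn n b b' ==> eqn (sc n) (F b) (F b')" and w: "w:Rl" and w': "w':WF"
  and map: "!!b n. b:Rl ==> n:om ==> inn w b n ==> inn w' (F b) (sc n)"
 shows "rw w:rw w'"
proof -
 have FR: "F b:Rl" if "b:Rl" for b using lz_Rl[OF F that] .
 have W: "w:WF" by (rule lz_rank(1)[OF F w w']) (use map inn_sc in blast)
 have dF: "dt (%s. F (a s))" if "dt a" for a using lz_dt[OF F that] .
 have 0: "inn w' (F zr) (sc emp)" by (rule map) auto
 have v: "kap (F zr) (sc emp):om" using FR by (simp del: kap_sc)
 have "sb (rW w emp) (rW w' (kap (F zr) (sc emp)))"
 proof (rule simul[OF W w', of "%u v. EX b n. b:Rl & n:om & u = kap b n & v = kap (F b) (sc n) & inn w b n"])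
  show "EX b n. b:Rl & n:om & emp = kap b n & kap (F zr) (sc emp) = kap (F b) (sc n) & inn w b n"
   by (intro exI[of _ zr] exI[of _ emp]) simp
  fix u v u' assume "EX b n. b:Rl & n:om & u = kap b n & v = kap (F b) (sc n) & inn w b n" and c: "ch w u' u"
  then obtain b n where b: "b:Rl" "n:om" "u = kap b n" "v = kap (F b) (sc n)" by blast
  obtain b' where b': "b':Rl" "eqn n b' b" "u' = kap b' (sc n)" "inn w b' (sc n)"
   using ch_kapD[OF c[unfolded b(3)] b(1,2)] by blast
  have i: "inn w' (F b') (sc (sc n))" using map[OF b'(1) sc_om[OF b(2)] b'(4)] .
  have v: "v = kap (F b') (sc n)" using kap_cong[OF sc_om[OF b(2)] FI[OF b(2) b'(2)]] b by metis
  have "ch w' (kap (F b') (sc (sc n))) v" unfolding v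
   by (rule ch_kapI[OF FR[OF b'(1)] sc_om[OF b(2)] i])
  then show "EX v'. ch w' v' v & (EX b n. b:Rl & n:om & u' = kap b n & v' = kap (F b) (sc n) & inn w b n)"
   using b' sc_om[OF b(2)] by blast
 qed (use v in \<open>auto simp: dF simp del: kap_sc\<close>)
 moreover have "rW w' (kap (F zr) (sc emp)):rW w' emp"
  using rW_mono[OF w' emp_om v] ch_kapI[OF FR[OF zr_Rl] emp_om 0] by (simp del: kap_sc)
 ultimately show ?thesis unfolding rw_def
  using Ord_sb_mem[of "rW w emp" "rW w' emp"] W w' by simp
qed

text \<open>Converse of \<open>lz_rank\<close>, by the game in which II must stay in
  \<open>w'\<close> as long as I stays in \<open>w\<close>. A winning strategy for I would stay in
  \<open>w\<close> one step longer than II stays in \<open>w'\<close>, and then \<open>rw w'\<close>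
  would be below \<open>rw w\<close>.\<close>

lemma rank_lip:
 assumes "w:WF" "w':WF" "sb (rw w) (rw w')"
 shows "EX e. e:Rl & (ALL b n. b:Rl --> n:om --> inn w b n --> inn w' (lip e b) n)"
proof -
 have "dp (%s. ALL n. n:om --> inn w (s 0) n --> inn w' (s 1) n)" by simp
 from Game[of "%b c. ALL n. n:om --> inn w b n --> inn w' c n", OF this] show ?thesis
 proof
  assume "EX e. e:Rl & (ALL x. x:Rl --> (ALL n. n:om --> inn w x n --> inn w' (lip e x) n))"
  then show ?thesis by blast
 next
  assume "EX e. e:Rl & (ALL y. y:Rl --> ~(ALL n. n:om --> inn w (lipI e y) n --> inn w' y n))"
  then obtain e where e: "e:Rl" "!!y. y:Rl ==> EX n. n:om & inn w (lipI e y) n & ~inn w' y n" by blast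
  have "rw w':rw w"
  proof (rule lz_rank_strict[OF lz_lipI[OF e(1)] eqn_lipI_sc WF_Rl[OF assms(2)] assms(1)])
   fix b n assume b: "b:Rl" "n:om" "inn w' b n"
   obtain m where m: "m:om" "inn w (lipI e b) m" "~inn w' b m" using e(2)[OF b(1)] by blast
   have "~sb m n" using inn_mono b(3) m(3) by blast
   then have "n:m" using Ord_not_mem nat_Ord b(2) m(1) by blast
   then have "sb (sc n) m" using Ord_sb[OF nat_Ord[OF m(1)]] by (auto simp: sb_def)
   then show "inn w (lipI e b) (sc n)" using inn_mono m(2) by blast
  qed auto
  then show ?thesis using assms(3) sbD mem_irrefl by blast
 qed
qed

section \<open>Boundedness and choice by strategies\<close>

definition mkt where "mkt Q = Lam om (%u. if Q (ex u) (ln u) then emp else sc emp)"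

lemma mkt:
 assumes dQ: "dp (%s. Q (s 0) (s 1))"
  and c: "!!b b' n. b:Rl ==> b':Rl ==> n:om ==> eqn n b b' ==> Q b n ==> Q b' n"
  and m: "!!b n. b:Rl ==> n:om ==> Q b (sc n) ==> Q b n"
  and 0: "!!b. b:Rl ==> Q b emp"
 shows "mkt Q:Rl" "b:Rl ==> n:om ==> inn (mkt Q) b n <-> Q b n"
proof -
 have dQ': "dp (%s. Q (a s) (b s))" if "dt a" "dt b" for a b using dp_sub2[OF dQ that] .
 show "mkt Q:Rl" unfolding mkt_def by (rule RlI) (use dQ' in auto)
 assume b: "b:Rl" and n: "n:om"
 have e: "mkt Q$(kap b (sc n)) = emp <-> Q b (sc n)" if n: "n:om" for n
 proof -
  have "mkt Q$(kap b (sc n)) = (if Q (ex (kap b (sc n))) (sc n) then emp else sc emp)"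
   using kap_om[OF b sc_om[OF n]] ln_kap[OF b sc_om[OF n]] by (simp add: mkt_def dQ' del: kap_sc)
  moreover have "Q (ex (kap b (sc n))) (sc n) <-> Q b (sc n)"
   using c[OF _ _ sc_om[OF n] eqn_ex[OF b sc_om[OF n]]] c[OF _ _ sc_om[OF n] eqn_sym[OF eqn_ex[OF b sc_om[OF n]]]]
    ex(1)[OF kap_om[OF b sc_om[OF n]]] b by blast
  ultimately show ?thesis by simp
 qed
 show "inn (mkt Q) b n <-> Q b n"
 proof (rule nat_ind[OF n])
  fix n assume n: "n:om" and IH: "inn (mkt Q) b n <-> Q b n"
  show "inn (mkt Q) b (sc n) <-> Q b (sc n)" unfolding inn_sc e[OF n] IH using m[OF b n] by blast
 qed (use dQ' 0[OF b] in auto)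
qed

text \<open>The tree searches for a real together with a branch of its tree: a node survives if some
  \<open>z\<close> and a branch piece \<open>b\<close> of \<open>F z\<close> agree with it. By
  continuity of \<open>F\<close> an infinite branch \<open>y\<close> really yields a branch of
  \<open>F (fs y)\<close>.\<close>

lemma attempts:
 assumes F: "ct F"
 shows "EX t. t:Rl & (ALL z b n. z:Rl --> b:Rl --> n:om --> inn (F z) b n --> inn t (pr z b) n) &
  (ALL y n. y:Rl --> (ALL n. n:om --> inn t y n) --> n:om --> inn (F (fs y)) (sn y) n)"
proof -
 define Q where "Q y n <-> (EX z b. z:Rl & b:Rl & eqn n (pr z b) y & inn (F z) b n)" for y n
 have dQ: "dp (%s. Q (s 0) (s 1))" unfolding Q_def by (simp add: ct_dt[OF F])
 have c: "Q b' n" if "b:Rl" "b':Rl" "n:om" "eqn n b b'" "Q b n" for b b' n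
  using that(4,5) eqn_trans unfolding Q_def by blast
 have m: "Q b n" if "b:Rl" "n:om" "Q b (sc n)" for b n
  using that(3) unfolding Q_def eqn_sc inn_sc by blast
 have 0: "Q b emp" if "b:Rl" for b unfolding Q_def using that zr_Rl by auto
 have mk1: "mkt Q:Rl" by (rule mkt(1)[OF dQ], rule c, assumption+, rule m, assumption+, rule 0)
 have mk2: "inn (mkt Q) b n <-> Q b n" if "b:Rl" "n:om" for b n
  by (rule mkt(2)[OF dQ _ _ _ that], rule c, assumption+, rule m, assumption+, rule 0)
 have 3: "inn (F (fs y)) (sn y) n" if y: "y:Rl" and t: "!!n. n:om ==> inn (mkt Q) y n" and n: "n:om" for y n
 proof (rule nat_ind[OF n])
  have Qy: "Q y n" if "n:om" for n using mk2[OF y that] t[OF that] by blast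
  show "dp (%s. inn (F (fs y)) (sn y) (s 0))" by simp
  fix n assume n: "n:om" and i: "inn (F (fs y)) (sn y) n"
  let ?u = "kap (sn y) (sc n)"
  have u: "?u:om" using y n by (simp del: kap_sc)
  obtain m where m: "m:om" "!!z. z:Rl ==> eqn m (fs y) z ==> F (fs y)$?u = F z$?u"
   using ctD[OF F fs_Rl[OF y] u] by blast
  obtain l where l: "l:om" "sb m l" "sb (sc n) l" by (rule nat_max[OF m(1) sc_om[OF n]])
  obtain z b where z: "z:Rl" "b:Rl" "eqn l (pr z b) y" "inn (F z) b l" using Qy[OF l(1)] unfolding Q_def by blast
  have e: "eqn l z (fs y)" "eqn l b (sn y)" using eqn_fs[OF l(1) z(3)] eqn_sn[OF l(1) z(3)] z by simp_all
  have "F z$(kap b (sc n)) = emp" using z(4) l(3) unfolding inn_def sb_def by simp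
  moreover have "kap b (sc n) = ?u" using kap_cong[OF sc_om[OF n] eqn_mono[OF e(2) l(3)]] .
  moreover have "F (fs y)$?u = F z$?u" by (rule m(2)[OF z(1) eqn_sym[OF eqn_mono[OF e(1) l(2)]]])
  ultimately show "inn (F (fs y)) (sn y) (sc n)" using i unfolding inn_sc by simp
 qed simp
 have 2: "inn (mkt Q) (pr z b) n" if "z:Rl" "b:Rl" "n:om" "inn (F z) b n" for z b n
  unfolding mk2[OF pr_Rl[OF that(1,2)] that(3)] unfolding Q_def using that eqn_refl by blast
 show ?thesis using mk1 2 3 by (intro exI[of _ "mkt Q"]) blast
qed

text \<open>The boundedness theorem for analytic sets of well-founded trees: the search tree has no
  branch, and \<open>pr z\<close> embeds each \<open>F z\<close> into it.\<close>

lemma Bound: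
 assumes F: "ct F" and W: "!!z. z:Rl ==> F z:WF"
 shows "EX B. B:WF & (ALL z. z:Rl --> sb (rw (F z)) (rw B))"
proof -
 obtain t where t: "t:Rl" "!!z b n. z:Rl ==> b:Rl ==> n:om ==> inn (F z) b n ==> inn t (pr z b) n"
  "!!y n. y:Rl ==> ALL n. n:om --> inn t y n ==> n:om ==> inn (F (fs y)) (sn y) n"
  using attempts[OF F] by blast
 have B: "t:WF" unfolding mem_WF
 proof (intro conjI allI impI t(1), rule ccontr)
  fix y assume y: "y:Rl" and "~(EX n. n:om & ~inn t y n)"
  then have "inn (F (fs y)) (sn y) n" if "n:om" for n using t(3)[OF y _ that] by blast
  then show False using W[OF fs_Rl[OF y]] sn_Rl[OF y] unfolding mem_WF by blast
 qed
 have "sb (rw (F z)) (rw t)" if z: "z:Rl" for z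
  by (rule lz_rank(2)[OF lz_pr[OF z] WF_Rl[OF W[OF z]] B]) (rule t(2)[OF z])
 then show ?thesis using B by blast
qed

text \<open>Countable choice for reals. Player I names \<open>n\<close> by the first move and
  nothing else of I counts, so a strategy of I is beaten by a real chosen for the one
  \<open>n\<close> it names.\<close>

lemma CC:
 assumes R: "dp (%s. R (s 0) (s 1))" and ne: "!!n. n:om ==> EX y. y:Rl & R n y"
 shows "EX z. z:Rl & (ALL n. n:om --> R n (cl z n))"
proof -
 have "dp (%s. R (s 0$emp) (s 1))" using dp_sub2[OF R, of "%s. s 0$emp" "%s. s 1"] by simp
 from Game[of "%x y. R (x$emp) y", OF this] show ?thesis
 proof
  assume "EX e. e:Rl & (ALL x. x:Rl --> R (x$emp) (lip e x))"
  then obtain e where e: "e:Rl" "!!x. x:Rl ==> R (x$emp) (lip e x)" by blast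
  define z where "z = mk (%n. lip e (cn n zr))"
  have d: "dt (%s. lip e (cn (s 0) zr))" by simp
  have "z:Rl" unfolding z_def by (rule mk_Rl) (use e in auto)
  moreover have "R n (cl z n)" if "n:om" for n
   using e(2)[of "cn n zr"] cl_mk[OF d _ that] e(1) that by (simp add: z_def)
  ultimately show ?thesis by blast
 next
  assume "EX e. e:Rl & (ALL y. y:Rl --> ~R (lipI e y$emp) y)"
  then obtain e where e: "e:Rl" "!!y. y:Rl ==> ~R (lipI e y$emp) y" by blast
  then show ?thesis using ne[of "e$emp"] by auto
 qed
qed

text \<open>Choice along all countable ordinals. Player I names an ordinal by a tree; the trees
  played by a strategy of I are bounded, and as \<open>R\<close> is decreasing in the ordinal, a
  single answer for the bound beats the strategy.\<close>

lemma UC: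
 assumes R: "dp (%s. R (s 0) (s 1))" and ne: "!!w. w:WF ==> EX y. y:Rl & R (rw w) y"
  and dec: "!!\<xi> \<eta> y. \<eta>:w1 ==> sb \<xi> \<eta> ==> R \<eta> y ==> R \<xi> y"
 shows "EX e. e:Rl & (ALL w. w:WF --> R (rw w) (lip e w))"
proof -
 have "dp (%s. s 0:WF --> R (rw (s 0)) (s 1))" using dp_sub2[OF R, of "%s. rw (s 0)" "%s. s 1"] by simp
 from Game[of "%w y. w:WF --> R (rw w) y", OF this] show ?thesis
 proof
  assume "EX e. e:Rl & (ALL x. x:Rl --> x:WF --> R (rw x) (lip e x))"
  then show ?thesis using WF_Rl by blast
 next
  assume "EX e. e:Rl & (ALL y. y:Rl --> ~(lipI e y:WF --> R (rw (lipI e y)) y))"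
  then obtain e where e: "e:Rl" "!!y. y:Rl ==> lipI e y:WF & ~R (rw (lipI e y)) y" by blast
  obtain B where B: "B:WF" "!!y. y:Rl ==> sb (rw (lipI e y)) (rw B)"
   using Bound[OF ct_lipI[OF ct_const[OF e(1)] ct_id]] e(2) by blast
  obtain y where y: "y:Rl" "R (rw B) y" using ne[OF B(1)] by blast
  then show ?thesis using dec[OF rw_w1[OF B(1)] B(2)[OF y(1)] y(2)] e(2)[OF y(1)] by blast
 qed
qed

lemma inn_ct: assumes "b:Rl" "n:om"
 shows "EX m. m:om & (ALL w w'. eqn m w w' --> inn w b n = inn w' b n)"
proof (rule nat_ind[OF assms(2)])
 fix n assume n: "n:om" and "EX m. m:om & (ALL w w'. eqn m w w' --> inn w b n = inn w' b n)"
 then obtain m where m: "m:om" "!!w w'. eqn m w w' ==> inn w b n = inn w' b n" by blast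
 have k: "kap b (sc n):om" using assms n by (simp del: kap_sc)
 obtain l where l: "l:om" "sb m l" "sb (sc (kap b (sc n))) l" by (rule nat_max[OF m(1) sc_om[OF k]])
 have "inn w b (sc n) = inn w' b (sc n)" if "eqn l w w'" for w w'
  unfolding inn_sc using m(2)[OF eqn_mono[OF that l(2)]] eqn_in[OF that sbD[OF l(3)]] by (simp del: kap_sc)
 then show "EX m. m:om & (ALL w w'. eqn m w w' --> inn w b (sc n) = inn w' b (sc n))" using l(1) by blast
next
 show "EX m. m:om & (ALL w w'. eqn m w w' --> inn w b emp = inn w' b emp)" by (rule exI[of _ emp]) simp
qed simp

definition prt where "prt w w' = mkt (%b n. inn w (fs b) n & inn w' (sn b) n)"
lemma dt_prt [simp]: "dt a ==> dt b ==> dt (%s. prt (a s) (b s))"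
 by (rule dt_lift2) (simp_all add: prt_def mkt_def)

lemma prt: "prt w w':Rl" "b:Rl ==> n:om ==> inn (prt w w') b n <-> inn w (fs b) n & inn w' (sn b) n"
proof -
 have d: "dp (%s. inn w (fs (s 0)) (s 1) & inn w' (sn (s 0)) (s 1))" by simp
 have c: "inn w (fs b') n & inn w' (sn b') n" if "b:Rl" "b':Rl" "n:om" "eqn n b b'" "inn w (fs b) n & inn w' (sn b) n" for b b' n
  using that inn_cong[OF that(3) eqn_fs[OF that(3,4)]] inn_cong[OF that(3) eqn_sn[OF that(3,4)]] by blast
 show "prt w w':Rl" unfolding prt_def by (rule mkt(1)[OF d], rule c, assumption+) (auto simp: inn_sc)
 show "b:Rl ==> n:om ==> inn (prt w w') b n <-> inn w (fs b) n & inn w' (sn b) n"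
  unfolding prt_def by (rule mkt(2)[OF d], rule c, assumption+) (auto simp: inn_sc)
qed

lemma ct_prt: assumes "ct F" "ct G" shows "ct (%x. prt (F x) (G x))"
proof (rule ct2[OF assms])
 fix x y k assume *: "x:Rl" "y:Rl" "k:om"
 obtain m1 where m1: "m1:om" "!!w w'. eqn m1 w w' ==> inn w (fs (ex k)) (ln k) = inn w' (fs (ex k)) (ln k)"
  using inn_ct[of "fs (ex k)" "ln k"] * ex by auto
 obtain m2 where m2: "m2:om" "!!w w'. eqn m2 w w' ==> inn w (sn (ex k)) (ln k) = inn w' (sn (ex k)) (ln k)"
  using inn_ct[of "sn (ex k)" "ln k"] * ex by auto
 obtain l where l: "l:om" "sb m1 l" "sb m2 l" by (rule nat_max[OF m1(1) m2(1)])
 have "prt x y$k = prt x' y'$k" if "eqn l x x'" "eqn l y y'" for x' y'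
  using m1(2)[OF eqn_mono[OF that(1) l(2)]] m2(2)[OF eqn_mono[OF that(2) l(3)]] *(3) by (simp add: prt_def mkt_def)
 then show "EX m. m:om & (ALL x' y'. x':Rl --> y':Rl --> eqn m x x' --> eqn m y y' --> prt x y$k = prt x' y'$k)"
  using l(1) by blast
qed (auto simp: prt(1))

text \<open>The product of two trees has at least the rank of one of them. The game tells which tree
  maps into the other, and the graph of that map embeds its domain into the product.\<close>

lemma prt_min:
 assumes "w:Rl" "w':Rl" "prt w w':WF"
 shows "w:WF & sb (rw w) (rw (prt w w')) | w':WF & sb (rw w') (rw (prt w w'))"
proof -
 have "dp (%s. ALL n. n:om --> inn w (s 0) n --> inn w' (s 1) n)" by simp
 from Game[of "%b c. ALL n. n:om --> inn w b n --> inn w' c n", OF this] show ?thesis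
 proof
  assume "EX e. e:Rl & (ALL x. x:Rl --> (ALL n. n:om --> inn w x n --> inn w' (lip e x) n))"
  then obtain e where e: "e:Rl" "!!x n. x:Rl ==> n:om ==> inn w x n ==> inn w' (lip e x) n" by blast
  have "lz (%b. pr b (lip e b))" unfolding lz_def using e(1) eqn_pr eqn_lip by simp
  from lz_rank[OF this assms(1,3)] show ?thesis using e prt(2) by simp
 next
  assume "EX e. e:Rl & (ALL y. y:Rl --> ~(ALL n. n:om --> inn w (lipI e y) n --> inn w' y n))"
  then obtain e where e: "e:Rl" "!!y. y:Rl ==> EX n. n:om & inn w (lipI e y) n & ~inn w' y n" by blast
  have i: "inn w (lipI e b) n" if b: "b:Rl" "n:om" "inn w' b n" for b n
  proof -
   obtain m where m: "m:om" "inn w (lipI e b) m" "~inn w' b m" using e(2)[OF b(1)] by blast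
   have "~sb m n" using inn_mono b(3) m(3) by blast
   then have "n:m" using Ord_not_mem nat_Ord b(2) m(1) by blast
   then show ?thesis using inn_mono[OF m(2)] Ord_sb[OF nat_Ord[OF m(1)]] by blast
  qed
  have "lz (%b. pr (lipI e b) b)" unfolding lz_def using e(1) eqn_pr eqn_lip by simp
  from lz_rank[OF this assms(2,3)] show ?thesis using e i prt(2) by simp
 qed
qed

lemma sc_w1: "\<xi>:w1 ==> sc \<xi>:w1"
 unfolding w1_def mem_hart
proof safe
 assume "img om \<xi>"
 then obtain f where f: "!!y. y:\<xi> ==> EX x. x:om & f$x = y" unfolding img_def by blast
 show "img om (sc \<xi>)"
 proof (rule imgI[of "%n. if n = emp then \<xi> else f$(Uni n)"])
  fix y assume "y:sc \<xi>"
  then consider "y = \<xi>" | x where "x:om" "f$x = y" using f by auto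
  then show "EX x. x:om & (if x = emp then \<xi> else f$(Uni x)) = y"
  proof cases
   case 1 then show ?thesis using emp_om by (intro exI[of _ emp]) simp
  next
   case (2 x) then show ?thesis by (intro exI[of _ "sc x"]) (simp add: Uni_sc nat_Ord)
  qed
 qed simp
qed simp

section \<open>Wadge reducibility\<close>

definition wle where "wle X Y <-> (EX f. Ct f & X = Sep Rl (%x. f$x:Y))"
definition cmp where "cmp X = Sep Rl (%x. ~x:X)"
text \<open>Reductions by strategies are coded by reals, so that \<open>CC\<close> and
  \<open>UC\<close> can choose them.\<close>

definition wlx where "wlx X Y <-> (EX e. e:Rl & (ALL x. x:Rl --> (x:X <-> lip e x:Y)))"
definition le2 where "le2 X Y <-> wle X Y | wle X (cmp Y)"

text \<open>The strict order of the degrees of pairs \<open>{X, cmp X}\<close>; \<open>le2\<close> is the reflexive one.\<close>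

definition less where "less X Y <-> ~le2 Y X"

lemma dp_wle [simp]: "dt a ==> dt b ==> dp (%s. wle (a s) (b s))"
 by (rule dp_lift2) (simp_all add: wle_def)
lemma dt_cmp [simp]: "dt a ==> dt (%s. cmp (a s))"
 by (rule dt_lift1) (simp_all add: cmp_def)
lemma dp_le2 [simp]: "dt a ==> dt b ==> dp (%s. le2 (a s) (b s))"
 by (rule dp_lift2) (simp_all add: le2_def)
lemma dp_less [simp]: "dt a ==> dt b ==> dp (%s. less (a s) (b s))"
 by (rule dp_lift2) (simp_all add: less_def)

lemma mem_cmp [simp]: "x:cmp X <-> x:Rl & ~x:X" by (simp add: cmp_def)
lemma cmp_sb [simp]: "sb (cmp X) Rl" by (simp add: sb_def)
lemma cmp_cmp [simp]: "sb X Rl ==> cmp (cmp X) = X" by (rule ext) (auto simp: sb_def)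

lemma RlSep_eqI: "dp (%s. P (s 0)) ==> sb X Rl ==> (!!x. x:Rl ==> x:X <-> P x) ==> X = Sep Rl P"
 by (rule ext) (auto simp: sb_def)

lemma wle_sb: "wle X Y ==> sb X Rl" unfolding wle_def by (auto simp: sb_def)

lemma wleI: assumes F: "ct F" and "sb X Rl" "!!x. x:Rl ==> x:X <-> F x:Y" shows "wle X Y"
 unfolding wle_def
proof (intro exI conjI)
 show "Ct (Lam Rl F)" using ct_Ct[OF F] .
 show "X = Sep Rl (%x. Lam Rl F$x:Y)"
  by (rule RlSep_eqI) (use assms ct_dt[OF F] in auto)
qed

lemma wleE: assumes "wle X Y" obtains f where "Ct f" "ct (ap f)" "!!x. x:Rl ==> x:X <-> f$x:Y"
proof -
 obtain f where "Ct f" "X = Sep Rl (%x. f$x:Y)" using assms wle_def by blast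
 then show ?thesis using that[of f] Ct_ct by simp
qed

lemma wle_refl [simp]: "sb X Rl ==> wle X X" by (rule wleI[OF ct_id]) auto

lemma wle_trans: assumes "wle X Y" "wle Y Z" shows "wle X Z"
proof -
 obtain f g where f: "ct (ap f)" "!!x. x:Rl ==> x:X <-> f$x:Y"
  and g: "ct (ap g)" "!!x. x:Rl ==> x:Y <-> g$x:Z" using assms wleE by metis
 show ?thesis by (rule wleI[OF ct_comp[OF g(1) f(1)]]) (use assms wle_sb f(2) g(2) ct_Rl[OF f(1)] in auto)
qed

lemma wle_cmp: assumes "wle X Y" shows "wle (cmp X) (cmp Y)"
proof -
 obtain f where f: "ct (ap f)" "!!x. x:Rl ==> x:X <-> f$x:Y" using assms wleE by metis
 show ?thesis by (rule wleI[OF f(1)]) (use f(2) ct_Rl[OF f(1)] in auto)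
qed

lemma wle_cmp1: "sb X Rl ==> wle X (cmp Y) ==> sb Y Rl ==> wle (cmp X) Y"
 using wle_cmp[of X "cmp Y"] by simp
lemma wle_cmp2: "sb X Rl ==> wle (cmp X) Y ==> wle X (cmp Y)"
 using wle_cmp[of "cmp X" Y] by simp

lemma wlx_wle: "sb X Rl ==> wlx X Y ==> wle X Y"
 unfolding wlx_def by (auto intro!: wleI[OF ct_lip[OF ct_const ct_id]])

lemma Wadge: assumes "sb X Rl" "sb Y Rl" shows "wlx X Y | wle (cmp Y) X"
proof -
 have "dp (%s. s 0:X <-> s 1:Y)" by simp
 from Game[of "%x y. x:X <-> y:Y", OF this] show ?thesis
 proof
  assume "EX e. e:Rl & (ALL x. x:Rl --> (x:X <-> lip e x:Y))"
  then show ?thesis unfolding wlx_def by blast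
 next
  assume "EX e. e:Rl & (ALL y. y:Rl --> ~(lipI e y:X <-> y:Y))"
  then obtain e where e: "e:Rl" "!!y. y:Rl ==> ~(lipI e y:X <-> y:Y)" by blast
  have "wle (cmp Y) X" by (rule wleI[OF ct_lipI[OF ct_const[OF e(1)] ct_id]]) (use e(2) in auto)
  then show ?thesis ..
 qed
qed

lemma less_wlx: assumes "sb X Rl" "sb Y Rl" "less X Y" shows "wlx X Y" "wlx (cmp X) Y"
proof -
 have n: "~wle Y X" "~wle Y (cmp X)" using assms(3) unfolding less_def le2_def by auto
 show "wlx X Y" using Wadge[OF assms(1,2)] n(2) wle_cmp2[OF assms(2)] by blast
 show "wlx (cmp X) Y" using Wadge[OF cmp_sb assms(2), of X] n(1) wle_cmp[of "cmp Y" "cmp X"] assms by auto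
qed

lemma less_wle: assumes "sb X Rl" "sb Y Rl" "less X Y" shows "wle X Y" "wle (cmp X) Y"
 using less_wlx[OF assms] wlx_wle assms by auto

lemma le2_refl [simp]: "sb X Rl ==> le2 X X" by (simp add: le2_def)
lemma wle_le2: "wle X Y ==> le2 X Y" by (simp add: le2_def)

lemma le2_trans: assumes "le2 X Y" "le2 Y Z" "sb Y Rl" "sb Z Rl" shows "le2 X Z"
proof -
 have "le2 X Z" if "wle X (cmp Y)" "wle Y W" "W = Z | W = cmp Z" for W
  using wle_trans[OF that(1) wle_cmp[OF that(2)]] that(3) assms by (auto simp: le2_def)
 then show ?thesis using assms wle_trans unfolding le2_def by metis
qed

lemma less_le2: assumes "sb X Rl" "sb Y Rl" "less X Y" shows "le2 X Y" using less_wle[OF assms] wle_le2 by blast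

lemma le2_less_trans: assumes "le2 X Y" "less Y Z" "sb X Rl" "sb Y Rl" "sb Z Rl" shows "less X Z"
 using assms le2_trans unfolding less_def by blast

lemma less_le2_trans: assumes "less X Y" "le2 Y Z" "sb X Rl" "sb Y Rl" "sb Z Rl" shows "less X Z"
 using assms le2_trans unfolding less_def by blast

section \<open>Initial segments of the Wadge order\<close>

definition seg where "seg L <-> emp:L & (ALL X. X:L --> sb X Rl & cmp X:L) &
 (ALL X Y. Y:L --> wle X Y --> X:L)"
lemma dp_seg [simp]: "dt a ==> dp (%s. seg (a s))" by (rule dp_lift1) (simp_all add: seg_def)

lemma seg_emp: "seg L ==> emp:L" and seg_sb: "seg L ==> X:L ==> sb X Rl"
 and seg_cmp: "seg L ==> X:L ==> cmp X:L" and seg_wle: "seg L ==> Y:L ==> wle X Y ==> X:L"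
 unfolding seg_def by blast+
lemma seg_le2: "seg L ==> Y:L ==> le2 X Y ==> X:L"
 using seg_wle seg_cmp unfolding le2_def by blast
lemma seg_less: "seg L ==> Y:L ==> ~X:L ==> less Y X"
 using seg_le2 unfolding less_def by blast

lemma seg_inv: assumes "seg L" "ct F" "Y:L" shows "Sep Rl (%x. F x:Y):L"
 by (rule seg_wle[OF assms(1,3)], rule wleI[OF assms(2)]) (use ct_dt[OF assms(2)] in auto)

section \<open>Joins, good digits and codes\<close>

definition Jn where "Jn Q = Sep Rl (%x. tl x:Q$(x$emp))"
definition jcl where "jcl L <-> (ALL Q. fn Q om L --> Jn Q:L)"
lemma dt_Jn [simp]: "dt a ==> dt (%s. Jn (a s))" by (rule dt_lift1) (simp_all add: Jn_def)
lemma mem_Jn [simp]: "x:Jn Q <-> x:Rl & tl x:Q$(x$emp)" by (simp add: Jn_def)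

text \<open>A digit \<open>a\<close> is good for \<open>L\<close> if \<open>L\<close> is closed under countable partitions along the values of \<open>a\<close>.
 A code is a map with closed graph all of whose digits are good. A set belongs to a segment closed under
 joins as soon as this holds locally for a code, since otherwise one could follow a branch of the
 code along which it fails.\<close>

definition gd where "gd L a <->
 (ALL g Q. Ct g --> fn Q om L --> Sep Rl (%z. z:Q$(a (g$z))):L)"
lemma dp_gd [simp]: assumes "dt L" "dt (%s. a (%n. s (Suc n)) (s 0))" shows "dp (%s. gd (L s) (a s))"
 unfolding gd_def using dt_pushes[OF assms(1)] dt_inst1[OF assms(2) inj_Suc2(2), of "%s. s 2$s 0"]
 by (simp add: numeral_2_eq_2)

definition cgr where "cgr j <-> (ALL z y. z:Rl --> y:Rl -->
 (ALL n. n:om --> (EX z'. z':Rl & eqn n z z' & eqn n y (j$z'))) --> j$z = y)"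
definition code where "code L j <-> fn j Rl Rl & cgr j & (ALL m. m:om --> gd L (%z. j$z$m))"
definition jh where "jh j z = pr z (j$z)"
lemma dp_cgr [simp]: "dt a ==> dp (%s. cgr (a s))" by (rule dp_lift1) (simp_all add: cgr_def)
lemma dp_code [simp]: "dt a ==> dt b ==> dp (%s. code (a s) (b s))"
 by (rule dp_lift2) (simp_all add: code_def)
lemma dt_jh [simp]: "dt a ==> dt b ==> dt (%s. jh (a s) (b s))"
 by (rule dt_lift2) (simp_all add: jh_def)

lemma code_Rl: "code L j ==> z:Rl ==> j$z:Rl" using fn_ap(2) unfolding code_def by blast
lemma jh_Rl: "code L j ==> z:Rl ==> jh j z:Rl" using code_Rl by (simp add: jh_def)

lemma gd_use:
 assumes "gd L a" "dt (%s. a (s 0))" "ct G" "dt (%s. Q (s 0))" "!!n. n:om ==> Q n:L" "!!z. z:Rl ==> a z:om"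
 shows "Sep Rl (%z. z:Q (a (G z))):L"
proof -
 have da: "dt (%s. a (b s))" if "dt b" for b using dt_sub1[OF assms(2) that] .
 have dQ: "dt (%s. Q (b s))" if "dt b" for b using dt_sub1[OF assms(4) that] .
 have "Sep Rl (%z. z:Lam om Q$(a (Lam Rl G$z))):L"
  using assms(1) ct_Ct[OF assms(3)] fn_Lam[OF assms(4), of om L] assms(5) unfolding gd_def by blast
 moreover have "Sep Rl (%z. z:Lam om Q$(a (Lam Rl G$z))) = Sep Rl (%z. z:Q (a (G z)))"
  by (rule RlSep_eqI) (use da dQ ct_dt[OF assms(3)] ct_Rl[OF assms(3)] assms(6) in \<open>auto simp: sb_def\<close>)
 ultimately show ?thesis by simp
qed

lemma gd_comp: assumes "gd L a" "dt (%s. a (s 0))" "ct F" shows "gd L (%z. a (F z))"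
 unfolding gd_def
proof (intro allI impI)
 fix g Q assume g: "Ct g" and Q: "fn Q om L"
 have da: "dt (%s. a (b s))" if "dt b" for b using dt_sub1[OF assms(2) that] .
 have c: "ct (%z. F (g$z))" using ct_comp[OF assms(3) Ct_ct[OF g]] .
 have "Sep Rl (%z. z:Q$(a (Lam Rl (%z. F (g$z))$z))):L"
  using assms(1) ct_Ct[OF c] Q unfolding gd_def by blast
 moreover have "Sep Rl (%z. z:Q$(a (Lam Rl (%z. F (g$z))$z))) = Sep Rl (%z. z:Q$(a (F (g$z))))"
  by (rule RlSep_eqI) (use da ct_dt[OF assms(3)] in \<open>auto simp: sb_def\<close>)
 ultimately show "Sep Rl (%z. z:Q$(a (F (g$z)))):L" by simp
qed

text \<open>The partition is made along \<open>a\<close>, and each piece is then partitioned along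
  \<open>b\<close>.\<close>

lemma gd_comb:
 assumes a: "gd L a" "dt (%s. a (s 0))" "!!z. z:Rl ==> a z:om"
  and b: "gd L b" "dt (%s. b (s 0))" "!!z. z:Rl ==> b z:om"
  and h: "!!u v. dt u ==> dt v ==> dt (%s. h (u s) (v s))" "!!m n. m:om ==> n:om ==> h m n:om"
 shows "gd L (%z. h (a z) (b z))"
 unfolding gd_def
proof (intro allI impI)
 fix g Q assume g: "Ct g" and Q: "fn Q om L"
 have da: "dt (%s. a (u s))" if "dt u" for u using dt_sub1[OF a(2) that] .
 have db: "dt (%s. b (u s))" if "dt u" for u using dt_sub1[OF b(2) that] .
 have 1: "Sep Rl (%z. z:Q$(h n (b (g$z)))):L" if n: "n:om" for n
  by (rule gd_use[OF b(1,2) Ct_ct[OF g], of "%k. Q$(h n k)"]) (use b(3) h n fn_ap(2)[OF Q] in auto)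
 have "Sep Rl (%z. z:Sep Rl (%z'. z':Q$(h (a (g$z)) (b (g$z'))))):L"
  by (rule gd_use[OF a(1,2) Ct_ct[OF g], of "%n. Sep Rl (%z'. z':Q$(h n (b (g$z'))))"])
   (use a(3) h db 1 in auto)
 moreover have "Sep Rl (%z. z:Sep Rl (%z'. z':Q$(h (a (g$z)) (b (g$z'))))) = Sep Rl (%z. z:Q$(h (a (g$z)) (b (g$z))))"
  by (rule RlSep_eqI) (use da db h in \<open>auto simp: sb_def\<close>)
 ultimately show "Sep Rl (%z. z:Q$(h (a (g$z)) (b (g$z)))):L" by simp
qed

lemma ct_cnv: assumes "ct G" "m:om" shows "ct (%z. cn (G z$m) z)"
proof (rule ct2b[OF assms(1) ct_id, of "%x y. cn (x$m) y" "%k. if k = emp then m else Uni k"])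
 show "cn (x$m) y$k = cn (x'$m) y'$k"
  if "k:om" "x$(if k = emp then m else Uni k) = x'$(if k = emp then m else Uni k)"
   "y$(if k = emp then m else Uni k) = y'$(if k = emp then m else Uni k)" for x y x' y' k
  using that by (simp add: cn_def split: if_splits)
qed (use assms in auto)

text \<open>A join is a partition along the first entry, and entry \<open>m\<close> can be copied to
  the front continuously.\<close>

lemma gd_digit: assumes "seg L" "jcl L" "m:om" shows "gd L (%z. z$m)"
 unfolding gd_def
proof (intro allI impI)
 fix g Q assume g: "Ct g" and Q: "fn Q om L"
 have "Jn Q:L" using assms(2) Q jcl_def by blast
 from seg_inv[OF assms(1) ct_cnv[OF Ct_ct[OF g] assms(3)] this]
 have "Sep Rl (%z. cn (g$z$m) z:Jn Q):L" .
 moreover have "Sep Rl (%z. cn (g$z$m) z:Jn Q) = Sep Rl (%z. z:Q$(g$z$m))"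
  by (rule RlSep_eqI) (use ct_Rl[OF Ct_ct[OF g]] assms(3) in \<open>auto simp: sb_def\<close>)
 ultimately show "Sep Rl (%z. z:Q$(g$z$m)):L" by simp
qed

definition cone where "cone j S u = Sep Rl (%z. z:S & kap (jh j z) (ln u) = u)"
lemma dt_cone [simp]: "dt a ==> dt b ==> dt c ==> dt (%s. cone (a s) (b s) (c s))"
 by (rule dt_lift3) (simp_all add: cone_def)
lemma mem_cone [simp]: "z:cone j S u <-> z:Rl & z:S & kap (jh j z) (ln u) = u"
 by (simp add: cone_def)

context
 fixes L assumes seg: "seg L" and jcl: "jcl L"
begin

lemma gd_jh: assumes j: "code L j" and m: "m:om" shows "gd L (%z. jh j z$m)"
proof -
 have "gd L (%z. pi (z$m) (j$z$m))"
  by (rule gd_comb[OF gd_digit[OF seg jcl m]]) (use j m code_Rl[OF j] in \<open>auto simp: code_def\<close>)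
 then show ?thesis by (simp add: jh_def m)
qed

lemma cone_chd: assumes j: "code L j" and u: "u:om" and "!!d. d:om ==> cone j S (chd u d):L"
 shows "cone j S u:L"
proof -
 have "Sep Rl (%z. z:cone j S (chd u (jh j z$ln u))):L"
  by (rule gd_use[OF gd_jh[OF j ln_om[OF u]] _ ct_id, of "%d. cone j S (chd u d)"])
   (use assms jh_Rl[OF j] in auto)
 moreover have "cone j S u = Sep Rl (%z. z:cone j S (chd u (jh j z$ln u)))"
 proof (rule RlSep_eqI)
  fix z assume z: "z:Rl"
  then have "kap (jh j z) (sc (ln u)) = chd u (jh j z$ln u) <-> kap (jh j z) (ln u) = u"
   using kap_sc_chd[of "ln u" "jh j z"] u jh_Rl[OF j z] by (simp del: kap_sc)
  then show "z:cone j S u <-> z:cone j S (chd u (jh j z$ln u))"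
   using z u jh_Rl[OF j z] by (simp del: kap_sc)
 qed (auto simp: sb_def)
 ultimately show ?thesis by simp
qed

text \<open>The entries of the node are fixed one at a time; each is a good digit, and all other
  pieces of the partition are replaced by the empty set.\<close>

lemma G2: assumes j: "code L j" and Q: "Q:L" and u: "u:om" shows "cone j Q u:L"
proof -
 have s: "sb Q Rl" using seg_sb[OF seg Q] .
 have *: "cone j Q (kap y n):L" if y: "y:Rl" and n: "n:om" for y n
 proof (rule nat_ind[OF n])
  have "cone j Q (kap y emp) = Q" by (rule ext) (use s ln_kap[OF zr_Rl emp_om] in \<open>auto simp: sb_def\<close>)
  then show "cone j Q (kap y emp):L" using Q by simp
  fix n assume n: "n:om" and IH: "cone j Q (kap y n):L"
  have "Sep Rl (%z. z:(if jh j z$n = y$n then cone j Q (kap y n) else emp)):L"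
   by (rule gd_use[OF gd_jh[OF j n] _ ct_id, of "%d. if d = y$n then cone j Q (kap y n) else emp"])
    (use IH n seg_emp[OF seg] jh_Rl[OF j] in auto)
  moreover have "cone j Q (kap y (sc n)) = Sep Rl (%z. z:(if jh j z$n = y$n then cone j Q (kap y n) else emp))"
   by (rule RlSep_eqI) (use n y jh_Rl[OF j] ln_kap[OF y sc_om[OF n]] in \<open>auto simp: sb_def\<close>)
  ultimately show "cone j Q (kap y (sc n)):L" by simp
 qed simp
 show ?thesis using *[of "ex u" "ln u"] ex u by simp
qed

lemma G1: assumes j: "code L j" and S: "sb S Rl"
  and loc: "!!z. z:Rl ==> EX m. m:om & cone j S (kap (jh j z) m):L"
 shows "S:L"
proof (rule ccontr)
 assume SL: "~S:L"
 define bad where "bad u <-> ~cone j S u:L" for u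
 \<comment> \<open>The least bad child. By \<open>cone_chd\<close> a bad node has one.\<close>
 define nx where "nx u = chd u (lst (%d. d:om & bad (chd u d)))" for u
 have dnx: "dt (%s. nx (a s))" if "dt a" for a
  unfolding nx_def bad_def using dt_pushes[OF that] by simp
 have nx: "EX d. d:om & nx u = chd u d & bad (nx u)" if u: "u:om" "bad u" for u
 proof -
  obtain d where d: "d:om" "bad (chd u d)" using cone_chd[OF j u(1), of S] u(2) unfolding bad_def by blast
  have dd: "dp (%s. s 0:om & bad (chd u (s 0)))" by (simp add: bad_def)
  show ?thesis using lst(2)[of "%d. d:om & bad (chd u d)", OF dd nat_Ord[OF d(1)]] d unfolding nx_def by blast
 qed
 define V where "V n = natrec emp (%_ u. nx u) n" for n
 have dV: "dt (%s. V (a s))" if "dt a" for a unfolding V_def by (rule dt_natrec) (use dnx that in auto)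
 have V0: "V emp = emp" and Vs: "n:om ==> V (sc n) = nx (V n)" for n
  unfolding V_def using dnx by simp_all
 have b0: "bad emp"
 proof -
  have "cone j S emp = S" by (rule ext) (use S ln_kap[OF zr_Rl emp_om] in \<open>auto simp: sb_def\<close>)
  then show ?thesis using SL by (simp add: bad_def)
 qed
 have Vb: "V n:om & bad (V n)" if "n:om" for n
 proof (rule nat_ind[OF that])
  show "dp (%s. V (s 0):om & bad (V (s 0)))" by (simp add: bad_def dV)
  show "V emp:om & bad (V emp)" using b0 V0 by simp
  fix n assume n: "n:om" and IH: "V n:om & bad (V n)"
  then obtain d where "d:om" "nx (V n) = chd (V n) d" "bad (nx (V n))" using nx by blast
  then show "V (sc n):om & bad (V (sc n))" using Vs[OF n] IH by simp
 qed
 have Vc: "EX d. d:om & V (sc n) = chd (V n) d" if n: "n:om" for n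
  using nx Vb[OF n] Vs[OF n] by metis
 have "dt (%s. V (s 0))" using dV by simp
 from branch[of V, OF this] Vb Vc
 obtain y where y: "y:Rl" "!!n. n:om ==> sb n (ln (V n)) & kap y (ln (V n)) = V n" by blast
 have ex: "EX z. z:Rl & eqn (ln (V n)) (jh j z) y" if n: "n:om" for n
 proof -
  have "cone j S (V n) ~= emp" using Vb[OF n] seg_emp[OF seg] unfolding bad_def by metis
  then obtain z where z: "z:Rl" "kap (jh j z) (ln (V n)) = V n" unfolding emp_iff by auto
  then have "kap (jh j z) (ln (V n)) = kap y (ln (V n))" using y(2)[OF n] by simp
  then show ?thesis using kap_eq_iff[of "ln (V n)" "jh j z" y] z jh_Rl[OF j] y(1) Vb[OF n] ln_om by blast
 qed
 \<comment> \<open>Here the closed graph is used: the branch \<open>y\<close> is a limit of points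
   \<open>jh j z\<close>, hence itself such a point.\<close>
 have "j$(fs y) = sn y"
 proof -
  have "EX z'. z':Rl & eqn n (fs y) z' & eqn n (sn y) (j$z')" if n: "n:om" for n
  proof -
   obtain z where z: "z:Rl" "eqn (ln (V n)) (jh j z) y" using ex[OF n] by blast
   then have e: "eqn n y (jh j z)" using eqn_mono y(2)[OF n] eqn_sym by blast
   show ?thesis using eqn_fs[OF n e] eqn_sn[OF n e] z(1) code_Rl[OF j] by (auto simp: jh_def)
  qed
  then show ?thesis using j fs_Rl[OF y(1)] sn_Rl[OF y(1)] unfolding code_def cgr_def by blast
 qed
 then have jy: "jh j (fs y) = y" using y by (simp add: jh_def)
 obtain m where m: "m:om" "cone j S (kap y m):L" using loc[OF fs_Rl[OF y(1)]] unfolding jy by blast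
 \<comment> \<open>\<open>V m\<close> has length at least \<open>m\<close>, so its cone lies inside
   the one given by \<open>loc\<close>; \<open>G2\<close> then contradicts the badness of
   \<open>V m\<close>.\<close>
 have "cone j (cone j S (kap y m)) (V m) = cone j S (V m)"
 proof (rule ext)
  fix z
  have "kap (jh j z) m = kap y m" if "z:Rl" "kap (jh j z) (ln (V m)) = V m"
  proof -
   have "kap (jh j z) (ln (V m)) = kap y (ln (V m))" using that y(2)[OF m(1)] by simp
   then have "eqn (ln (V m)) (jh j z) y" using kap_eq_iff jh_Rl[OF j] that y(1) Vb[OF m(1)] ln_om by blast
   then show ?thesis using kap_cong[OF m(1)] eqn_mono y(2)[OF m(1)] by blast
  qed
  then show "z:cone j (cone j S (kap y m)) (V m) <-> z:cone j S (V m)" using y m by auto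
 qed
 then show False using G2[OF j m(2), of "V m"] Vb[OF m(1)] unfolding bad_def by simp
qed

text \<open>Two runs of the code side by side. Precomposition with a continuous map keeps the graph
  closed: a limit determines \<open>F z\<close> by continuity, and then the value of
  \<open>j\<close> at \<open>F z\<close> because its own graph is closed.\<close>

lemma code_pair:
 assumes j: "code L j" and g: "ct G" and h: "ct H"
 shows "code L (Lam Rl (%z. pr (jh j (G z)) (jh j (H z))))"
proof -
 let ?k = "Lam Rl (%z. pr (jh j (G z)) (jh j (H z)))"
 have d: "dt (%s. pr (jh j (G (s 0))) (jh j (H (s 0))))" using ct_dt[OF g] ct_dt[OF h] by simp
 have R: "jh j (G z):Rl" "jh j (H z):Rl" if "z:Rl" for z using jh_Rl[OF j] ct_Rl[OF g] ct_Rl[OF h] that by auto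
 have fn: "fn ?k Rl Rl" by (rule fn_Lam[OF d]) (use R in auto)
 have lim: "jh j (F z) = y" if F: "ct F" and z: "z:Rl" "y:Rl"
   and L: "!!n. n:om ==> EX z'. z':Rl & eqn n z z' & eqn n y (jh j (F z'))" for F z y
 proof -
  have ap: "EX z'. z':Rl & eqn n (F z) (F z') & eqn n (fs y) (F z') & eqn n (sn y) (j$(F z'))" if n: "n:om" for n
  proof -
   obtain m where m: "m:om" "!!y. y:Rl ==> eqn m z y ==> eqn n (F z) (F y)" using ct_eqn[OF F z(1) n] by blast
   obtain l where l: "l:om" "sb m l" "sb n l" by (rule nat_max[OF m(1) n])
   obtain z' where z': "z':Rl" "eqn l z z'" "eqn l y (jh j (F z'))" using L[OF l(1)] by blast
   have e: "eqn n y (jh j (F z'))" using eqn_mono[OF z'(3) l(3)] .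
   have "eqn n (fs y) (F z')" "eqn n (sn y) (j$(F z'))"
    using eqn_fs[OF n e] eqn_sn[OF n e] ct_Rl[OF F z'(1)] code_Rl[OF j] by (simp_all add: jh_def)
   moreover have "eqn n (F z) (F z')" by (rule m(2)[OF z'(1) eqn_mono[OF z'(2) l(2)]])
   ultimately show ?thesis using z'(1) by blast
  qed
  have "F z = fs y"
  proof (rule Rl_ext)
   fix n assume n: "n:om"
   obtain z' where "eqn (sc n) (F z) (F z')" "eqn (sc n) (fs y) (F z')" using ap[OF sc_om[OF n]] by blast
   then show "F z$n = fs y$n" unfolding eqn_sc by simp
  qed (use z ct_Rl[OF F] in auto)
  moreover have "j$(F z) = sn y"
  proof -
   have "ALL n. n:om --> (EX z'. z':Rl & eqn n (F z) z' & eqn n (sn y) (j$z'))"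
    using ap ct_Rl[OF F] by blast
   then show ?thesis using j ct_Rl[OF F z(1)] sn_Rl[OF z(2)] unfolding code_def cgr_def by blast
  qed
  ultimately show ?thesis using z by (simp add: jh_def)
 qed
 have cg: "cgr ?k" unfolding cgr_def
 proof (intro allI impI)
  fix z y assume z: "z:Rl" "y:Rl" and L: "ALL n. n:om --> (EX z'. z':Rl & eqn n z z' & eqn n y (?k$z'))"
  have L': "EX z'. z':Rl & eqn n z z' & eqn n (fs y) (jh j (G z')) & eqn n (sn y) (jh j (H z'))" if n: "n:om" for n
  proof -
   obtain z' where z': "z':Rl" "eqn n z z'" "eqn n y (?k$z')" using L n by blast
   have e: "eqn n y (pr (jh j (G z')) (jh j (H z')))" using z'(1,3) d by simp
   show ?thesis using eqn_fs[OF n e] eqn_sn[OF n e] z' R[OF z'(1)] by auto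
  qed
  have "jh j (G z) = fs y" by (rule lim[OF g z(1) fs_Rl[OF z(2)]]) (use L' in blast)
  moreover have "jh j (H z) = sn y" by (rule lim[OF h z(1) sn_Rl[OF z(2)]]) (use L' in blast)
  ultimately show "?k$z = y" using z d by simp
 qed
 have "gd L (%z. ?k$z$m)" if m: "m:om" for m
 proof -
  have 1: "gd L (%z. jh j (F z)$m)" if "ct F" for F by (rule gd_comp[OF gd_jh[OF j m] _ that]) simp
  have 2: "gd L (%z. pi (jh j (G z)$m) (jh j (H z)$m))"
   by (rule gd_comb[OF 1[OF g] _ _ 1[OF h]]) (use ct_dt[OF g] ct_dt[OF h] R m in auto)
  show ?thesis unfolding gd_def
  proof (intro allI impI)
   fix f Q assume f: "Ct f" and Q: "fn Q om L"
   have "Sep Rl (%z. z:Q$(pi (jh j (G (f$z))$m) (jh j (H (f$z))$m))):L"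
    using 2 f Q unfolding gd_def by blast
   moreover have "Sep Rl (%z. z:Q$(pi (jh j (G (f$z))$m) (jh j (H (f$z))$m))) = Sep Rl (%z. z:Q$(?k$(f$z)$m))"
    by (rule RlSep_eqI) (use d ct_dt[OF g] ct_dt[OF h] ct_Rl[OF Ct_ct[OF f]] m in \<open>auto simp: sb_def\<close>)
   ultimately show "Sep Rl (%z. z:Q$(?k$(f$z)$m)):L" by simp
  qed
 qed
 then show ?thesis unfolding code_def using fn cg by blast
qed

end

section \<open>Retractions onto closed sets\<close>

definition live where "live E u <-> (EX x. x:E & kap x (ln u) = u)"
text \<open>A retraction onto the closure of \<open>E\<close>: the entries of \<open>y\<close> are
  followed as long as some element of \<open>E\<close> remains, and otherwise the least digit that
  keeps one is taken.\<close>

definition rtn where "rtn E y n = natrec emp (%k v. if live E (chd v (y$k)) then chd v (y$k)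
 else chd v (lst (%d. d:om & live E (chd v d)))) n"
definition rt where "rt E y = Lam om (%n. q2 (Uni (rtn E y (sc n))))"
lemma dp_live [simp]: "dt a ==> dt b ==> dp (%s. live (a s) (b s))"
 by (rule dp_lift2) (simp_all add: live_def)
lemma dt_rtn [simp]: "dt a ==> dt b ==> dt c ==> dt (%s. rtn (a s) (b s) (c s))"
 by (rule dt_lift3) (simp_all add: rtn_def)
lemma dt_rt [simp]: "dt a ==> dt b ==> dt (%s. rt (a s) (b s))"
 by (rule dt_lift2) (simp_all add: rt_def)

context
 fixes E assumes E: "sb E Rl" "E ~= emp"
begin

lemma live_chd: assumes "u:om" "live E u" shows "EX d. d:om & live E (chd u d)"
proof -
 obtain x where x: "x:E" "kap x (ln u) = u" using assms live_def by blast
 have xr: "x:Rl" using x E sbD by blast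
 have "kap x (sc (ln u)) = chd u (x$ln u)" using kap_sc_chd[of "ln u" x] x assms by simp
 then show ?thesis using x xr assms unfolding live_def by (intro exI[of _ "x$ln u"]) (auto simp del: kap_sc)
qed

lemma rtn_0: "rtn E y emp = emp"
 and rtn_sc: "n:om ==> rtn E y (sc n) = (if live E (chd (rtn E y n) (y$n)) then chd (rtn E y n) (y$n)
  else chd (rtn E y n) (lst (%d. d:om & live E (chd (rtn E y n) d))))"
 unfolding rtn_def by simp_all

lemma rtn_step: assumes "y:Rl" "n:om" "rtn E y n:om" "live E (rtn E y n)"
 shows "EX d. d:om & rtn E y (sc n) = chd (rtn E y n) d & live E (rtn E y (sc n))"
proof -
 obtain d where d: "d:om" "live E (chd (rtn E y n) d)" using live_chd assms by blast
 have "dp (%s. s 0:om & live E (chd (rtn E y n) (s 0)))" by simp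
 from lst(2)[of "%d. d:om & live E (chd (rtn E y n) d)", OF this nat_Ord[OF d(1)]] d assms
 have l: "lst (%d. d:om & live E (chd (rtn E y n) d)):om"
  "live E (chd (rtn E y n) (lst (%d. d:om & live E (chd (rtn E y n) d))))" by blast+
 show ?thesis
 proof (cases "live E (chd (rtn E y n) (y$n))")
  case True then show ?thesis unfolding rtn_sc[OF assms(2)] using Rl_ap[OF assms(1,2)] by (intro exI[of _ "y$n"]) simp
 next
  case False then show ?thesis unfolding rtn_sc[OF assms(2)] using l by (intro exI[of _ "lst (%d. d:om & live E (chd (rtn E y n) d))"]) simp
 qed
qed

lemma rtn: assumes "y:Rl" "n:om" shows "rtn E y n:om & live E (rtn E y n)"
proof (rule nat_ind[OF assms(2)])
 obtain x where x: "x:E" using E emp_iff by blast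
 have "ln emp = emp" using ln_kap[OF zr_Rl emp_om] by simp
 then show "rtn E y emp:om & live E (rtn E y emp)" unfolding rtn_0 live_def using x by auto
 fix n assume "n:om" "rtn E y n:om & live E (rtn E y n)"
 then show "rtn E y (sc n):om & live E (rtn E y (sc n))" using rtn_step[OF assms(1), of n] by auto
qed simp

lemma rt_Rl: assumes "y:Rl" shows "rt E y:Rl"
 unfolding rt_def by (rule RlI) (use rtn[OF assms] in auto)

lemma kap_rt: assumes y: "y:Rl" and n: "n:om" shows "kap (rt E y) n = rtn E y n"
proof (rule nat_ind[OF n])
 fix n assume n: "n:om" and IH: "kap (rt E y) n = rtn E y n"
 obtain d where d: "d:om" "rtn E y (sc n) = chd (rtn E y n) d" using rtn_step[OF y n] rtn[OF y n] by blast
 have "rt E y$n = d" using n d rtn[OF y n] by (simp add: rt_def chd_def Uni_sc nat_Ord)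
 then show "kap (rt E y) (sc n) = rtn E y (sc n)" using kap_sc_chd[OF n] IH d by simp
qed (auto simp: rtn_0)

lemma rt_near: assumes "y:Rl" "n:om" shows "EX x. x:E & eqn n (rt E y) x"
proof -
 obtain x where x: "x:E" "kap x (ln (rtn E y n)) = rtn E y n" using rtn[OF assms] live_def by blast
 have "kap x n = kap (rt E y) n" using x(2) kap_rt[OF assms] ln_kap[OF rt_Rl[OF assms(1)] assms(2)] by simp
 then show ?thesis using kap_eq_iff[OF assms(2), of x "rt E y"] x E sbD rt_Rl assms eqn_sym by blast
qed

lemma rtn_cong: assumes "n:om" shows "eqn n y y' --> rtn E y n = rtn E y' n"
 by (rule nat_ind[OF assms]) (auto simp: rtn_0 rtn_sc eqn_sc)

lemma eqn_rt: assumes "y:Rl" "y':Rl" "n:om" "eqn n y y'" shows "eqn n (rt E y) (rt E y')"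
 using rtn_cong[of n y y'] assms kap_rt kap_eq_iff rt_Rl by metis

lemma ct_rt: assumes "ct F" shows "ct (%x. rt E (F x))"
proof (rule ct2[OF assms assms, of "%x y. rt E x"])
 fix x k assume x: "x:Rl" "k:om"
 have "rt E x$k = rt E x'$k" if "x':Rl" "eqn (sc k) x x'" for x'
  using eqn_rt[OF x(1) that(1) sc_om[OF x(2)] that(2)] unfolding eqn_sc by blast
 then show "EX m. m:om & (ALL x' y'. x':Rl --> y':Rl --> eqn m x x' --> eqn m y y' --> rt E x$k = rt E x'$k)" for y
  using sc_om[OF x(2)] by blast
qed (auto simp: rt_Rl)

lemma rt_id: assumes y: "y:Rl" and c: "!!n. n:om ==> EX x. x:E & eqn n y x" shows "rt E y = y"
proof -
 have lv: "live E (kap y n)" if n: "n:om" for n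
 proof -
  obtain x where x: "x:E" "eqn n y x" using c[OF n] by blast
  then show ?thesis unfolding live_def using kap_cong[OF n x(2)] ln_kap[OF y n] by auto
 qed
 have "rtn E y n = kap y n" if n: "n:om" for n
 proof (rule nat_ind[OF n])
  fix n assume n: "n:om" and IH: "rtn E y n = kap y n"
  show "rtn E y (sc n) = kap y (sc n)" unfolding rtn_sc[OF n] IH kap_sc_chd[OF n]
   using lv[OF sc_om[OF n]] unfolding kap_sc_chd[OF n] by simp
 qed (auto simp: rtn_0)
 then have "eqn n (rt E y) y" if "n:om" for n
  using kap_rt[OF y that] kap_eqD(2)[OF that that rt_Rl[OF y] y] that by metis
 then have "eqn (sc n) (rt E y) y" if "n:om" for n using sc_om[OF that] by metis
 then show ?thesis unfolding eqn_sc by (intro Rl_ext[OF rt_Rl[OF y] y]) blast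
qed

end

section \<open>Least degrees above an initial segment\<close>

text \<open>A pivot \<open>M\<close> is a least set above \<open>L\<close>, and it is not selfdual.\<close>

definition pv where "pv L M <-> sb M Rl & ~M:L & (ALL S. sb S Rl --> wle S M --> wle (cmp S) M --> S:L)"
definition abv where "abv L N <-> sb N Rl & ~N:L & (ALL S. sb S Rl --> ~S:L --> le2 N S)"

text \<open>If neither \<open>S\<close> nor its complement were above \<open>M\<close>, Wadge's
  lemma would put both below \<open>M\<close>, and the pivot property would put \<open>S\<close>
  into \<open>L\<close>.\<close>

lemma pv_abv: assumes "pv L M" shows "abv L M"
 unfolding abv_def
proof (intro conjI allI impI)
 show m: "sb M Rl" "~M:L" using assms pv_def by auto
 fix S assume S: "sb S Rl" "~S:L"
 show "le2 M S" using Wadge[OF m(1) S(1)] Wadge[OF m(1) cmp_sb, of S] wlx_wle[OF m(1)] assms S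
  unfolding pv_def le2_def cmp_cmp[OF S(1)] by blast
qed

lemma pv_not_sd: assumes "pv L M" shows "~wle M (cmp M)"
 using assms wle_cmp1[of M M] wle_refl[of M] unfolding pv_def by blast

lemma ct_clv: assumes "z:Rl" "m:om" shows "ct (%x. cl z (x$m))"
 by (rule ct2b[OF ct_id ct_id, of "%x y. cl z (x$m)" "%k. m"]) (use assms in auto)

text \<open>Strategies that reduce the sets \<open>Q$n\<close> to \<open>S\<close> are reals, and
  \<open>CC\<close> collects them into one.\<close>

lemma join_le:
 assumes S: "sb S Rl" and Q: "!!n. n:om ==> sb (Q$n) Rl & less (Q$n) S" shows "wle (Jn Q) S"
proof -
 have s: "sb (Jn Q) Rl" by (simp add: sb_def)
 have "EX e. e:Rl & (ALL x. x:Rl --> (x:Q$n <-> lip e x:S))" if n: "n:om" for n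
  using less_wlx(1)[of "Q$n" S] Q[OF n] S unfolding wlx_def by blast
 then obtain z where z: "z:Rl" "!!n. n:om ==> (ALL x. x:Rl --> (x:Q$n <-> lip (cl z n) x:S))"
  using CC[of "%n e. ALL x. x:Rl --> (x:Q$n <-> lip e x:S)"] by auto
 show ?thesis
  by (rule wleI[OF ct_lip[OF ct_clv[OF z(1) emp_om] ct_tl[OF ct_id]] s]) (use z(2) in simp)
qed

lemma join_abv: assumes seg: "seg L" and Q: "fn Q om L" and n: "~Jn Q:L" shows "abv L (Jn Q)"
 unfolding abv_def
proof (intro conjI allI impI n)
 show "sb (Jn Q) Rl" by (simp add: sb_def)
 fix S assume S: "sb S Rl" "~S:L"
 show "le2 (Jn Q) S"
  by (rule wle_le2, rule join_le[OF S(1)]) (use seg_sb[OF seg fn_ap(2)[OF Q]] seg_less[OF seg fn_ap(2)[OF Q] S(2)] in blast)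
qed

text \<open>The form in which selfduality is exploited: a selfdual set reduces to a countable join
  of strictly smaller sets. This is an invariant of the segments built later.\<close>

definition SDp where "SDp D <-> (wle D (cmp D) --> (EX f Q. Ct f & fn Q om (Pw Rl) &
 (ALL n. n:om --> less (Q$n) D) & (ALL x. x:Rl --> (x:D <-> f$x:Jn Q))))"
definition hit where "hit j U z <-> (EX u. u:U & kap (jh j z) (ln u) = u)"

text \<open>\<open>S\<close> arises from \<open>D\<close> by an open operation: when \<open>jh j z\<close> enters the open set given by \<open>U\<close>,
 membership in \<open>S\<close> is decided within \<open>L\<close>, and otherwise it is read off from \<open>D\<close>.\<close>

definition Op where "Op L j U D S <-> code L j & sb U om & sb S Rl & (ALL u. u:U --> cone j S u:L) &
 (ALL z. z:Rl --> ~hit j U z --> (z:S <-> jh j z:D))"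
definition ocl where "ocl L <-> (ALL D j U S. D:L --> Op L j U D S --> S:L)"

lemma dp_SDp [simp]: "dt a ==> dp (%s. SDp (a s))" by (rule dp_lift1) (simp_all add: SDp_def)
lemma dp_hit [simp]: "dt a ==> dt b ==> dt c ==> dp (%s. hit (a s) (b s) (c s))"
 by (rule dp_lift3) (simp_all add: hit_def)
lemma dp_Op [simp]: "dt a ==> dt b ==> dt c ==> dt d ==> dt e ==> dp (%s. Op (a s) (b s) (c s) (d s) (e s))"
 by (rule dp_lift5) (simp_all add: Op_def)

text \<open>For two runs in parallel: the nodes at which at least one of them has entered the open
  set of \<open>U\<close>. The real \<open>ex u\<close> only represents the node.\<close>

definition UU where "UU U = Sep om (%u. EX v. v:U & sb (ln v) (ln u) &
 (kap (fs (sn (ex u))) (ln v) = v | kap (sn (sn (ex u))) (ln v) = v))"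
lemma mem_UU: "u:UU U <-> u:om & (EX v. v:U & sb (ln v) (ln u) &
 (kap (fs (sn (ex u))) (ln v) = v | kap (sn (sn (ex u))) (ln v) = v))"
 by (simp add: UU_def)

section \<open>Two parallel runs of an open operation\<close>

context
 fixes L j U D M
 assumes seg: "seg L" and jcl: "jcl L" and Op: "Op L j U D M"
begin

lemma Op_j: "code L j" and Op_U: "sb U om" and Op_S: "sb M Rl"
 and Op_cone: "u:U ==> cone j M u:L"
 and Op_def': "z:Rl ==> ~hit j U z ==> z:M <-> jh j z:D"
 using Op unfolding Op_def by blast+

definition kk where "kk G H = Lam Rl (%z. pr (jh j (G z)) (jh j (H z)))"

context
 fixes G H assumes G: "ct G" and H: "ct H"
begin

lemma kk_code: "code L (kk G H)" unfolding kk_def by (rule code_pair[OF seg jcl Op_j G H])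
lemma jh_kk: "z:Rl ==> jh (kk G H) z = pr z (pr (jh j (G z)) (jh j (H z)))"
 by (simp add: jh_def[of "kk G H"], simp add: kk_def ct_dt[OF G] ct_dt[OF H])
lemma kk_R: "z:Rl ==> jh j (G z):Rl" "z:Rl ==> jh j (H z):Rl"
 using jh_Rl[OF Op_j] ct_Rl[OF G] ct_Rl[OF H] by auto
lemma jh_kk_R: "z:Rl ==> jh (kk G H) z:Rl" using jh_Rl[OF kk_code] .

lemma kk_parts: assumes "z:Rl" "n:om" "eqn n (jh (kk G H) z) y"
 shows "eqn n z (fs y)" "eqn n (jh j (G z)) (fs (sn y))" "eqn n (jh j (H z)) (sn (sn y))"
proof -
 have e: "eqn n (pr z (pr (jh j (G z)) (jh j (H z)))) y" using assms(3) jh_kk[OF assms(1)] by simp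
 show "eqn n z (fs y)" using eqn_fs[OF assms(2) e] assms(1) kk_R[OF assms(1)] by simp
 have e2: "eqn n (pr (jh j (G z)) (jh j (H z))) (sn y)" using eqn_sn[OF assms(2) e] assms(1) kk_R[OF assms(1)] by simp
 show "eqn n (jh j (G z)) (fs (sn y))" "eqn n (jh j (H z)) (sn (sn y))"
  using eqn_fs[OF assms(2) e2] eqn_sn[OF assms(2) e2] kk_R[OF assms(1)] by simp_all
qed

lemma in_cone_UU:
 assumes z: "z:Rl" and u: "u:om" and k: "kap (jh (kk G H) z) (ln u) = u" and v: "v:U" "sb (ln v) (ln u)"
 shows "kap (jh j (G z)) (ln v) = kap (fs (sn (ex u))) (ln v)" "kap (jh j (H z)) (ln v) = kap (sn (sn (ex u))) (ln v)"
proof -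
 have vo: "ln v:om" using v Op_U sbD ln_om by blast
 have "eqn (ln u) (jh (kk G H) z) (ex u)" using k ex[OF u] kap_eqD(2)[of "ln u" "ln u" "jh (kk G H) z" "ex u"] jh_kk_R[OF z] u by simp
 note p = kk_parts[OF z ln_om[OF u] this]
 show "kap (jh j (G z)) (ln v) = kap (fs (sn (ex u))) (ln v)" "kap (jh j (H z)) (ln v) = kap (sn (sn (ex u))) (ln v)"
  using kap_cong[OF vo eqn_mono[OF p(2) v(2)]] kap_cong[OF vo eqn_mono[OF p(3) v(2)]] .
qed

lemma hit_UU: assumes z: "z:Rl" shows "hit (kk G H) (UU U) z <-> hit j U (G z) | hit j U (H z)"
proof
 assume "hit (kk G H) (UU U) z"
 then obtain u where u: "u:UU U" "kap (jh (kk G H) z) (ln u) = u" unfolding hit_def by blast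
 then obtain v where v: "u:om" "v:U" "sb (ln v) (ln u)" "kap (fs (sn (ex u))) (ln v) = v | kap (sn (sn (ex u))) (ln v) = v"
  unfolding mem_UU by blast
 then show "hit j U (G z) | hit j U (H z)" using in_cone_UU[OF z v(1) u(2) v(2,3)] unfolding hit_def by metis
next
 assume "hit j U (G z) | hit j U (H z)"
 then obtain v where v: "v:U" "kap (jh j (G z)) (ln v) = v | kap (jh j (H z)) (ln v) = v" unfolding hit_def by blast
 have vo: "ln v:om" using v Op_U sbD ln_om by blast
 define u where "u = kap (jh (kk G H) z) (ln v)"
 have u: "u:om" "ln u = ln v" "kap (jh (kk G H) z) (ln u) = u" using jh_kk_R[OF z] vo unfolding u_def by simp_all
 have "kap (fs (sn (ex u))) (ln v) = v | kap (sn (sn (ex u))) (ln v) = v"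
  using in_cone_UU[OF z u(1,3) v(1)] u(2) v(2) by simp
 then have "u:UU U" unfolding mem_UU using u v by auto
 then show "hit (kk G H) (UU U) z" using u unfolding hit_def by blast
qed

context
 fixes S assumes S: "sb S Rl" and SG: "!!z. z:Rl ==> z:S <-> G z:M" and SH: "!!z. z:Rl ==> ~z:S <-> H z:M"
begin

text \<open>If the run at \<open>G z\<close> has entered the open set, membership in
  \<open>S\<close> is decided by a cone of \<open>M\<close> at \<open>G z\<close>; if the run at
  \<open>H z\<close> has, by the complement of a cone at \<open>H z\<close>.\<close>

lemma S_cone: assumes "u:UU U" shows "cone (kk G H) S u:L"
proof -
 obtain v where u: "u:om" and v: "v:U" "sb (ln v) (ln u)" "kap (fs (sn (ex u))) (ln v) = v | kap (sn (sn (ex u))) (ln v) = v"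
  using assms unfolding mem_UU by blast
 note ic = in_cone_UU[OF _ u _ v(1,2)]
 have R: "G z:Rl" "H z:Rl" if "z:Rl" for z using ct_Rl[OF G that] ct_Rl[OF H that] .
 from v(3) show ?thesis
 proof
  assume e: "kap (fs (sn (ex u))) (ln v) = v"
  define T where "T = Sep Rl (%z. G z:cone j M v)"
  have T: "T:L" unfolding T_def by (rule seg_inv[OF seg G Op_cone[OF v(1)]])
  have mT: "z:T <-> z:Rl & G z:cone j M v" for z unfolding T_def using ct_dt[OF G] by simp
  have "cone (kk G H) S u = cone (kk G H) T u"
   by (rule ext) (use mT ic(1) e SG R in auto)
  then show ?thesis using G2[OF seg jcl kk_code T u] by simp
 next
  assume e: "kap (sn (sn (ex u))) (ln v) = v"
  define T where "T = Sep Rl (%z. H z:cone j M v)"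
  have T: "cmp T:L" unfolding T_def by (rule seg_cmp[OF seg seg_inv[OF seg H Op_cone[OF v(1)]]])
  have mT: "z:T <-> z:Rl & H z:cone j M v" for z unfolding T_def using ct_dt[OF H] by simp
  have "cone (kk G H) S u = cone (kk G H) (cmp T) u"
  proof (rule ext)
   fix z show "z:cone (kk G H) S u <-> z:cone (kk G H) (cmp T) u"
    using mT ic(2) e SH R by (cases "z:Rl") (auto)
  qed
  then show ?thesis using G2[OF seg jcl kk_code T u] by simp
 qed
qed

definition EE where "EE = Rep (Sep Rl (%z. ~hit (kk G H) (UU U) z)) (%z. jh (kk G H) z)"

lemma mem_EE: "y:EE <-> (EX z. z:Rl & ~hit (kk G H) (UU U) z & y = jh (kk G H) z)"
 unfolding EE_def by auto

lemma EE_closed: assumes y: "y:Rl" and c: "!!n. n:om ==> EX x. x:EE & eqn n y x" shows "y:EE"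
proof -
 have "kk G H$(fs y) = sn y"
 proof -
  have "EX z'. z':Rl & eqn n (fs y) z' & eqn n (sn y) (kk G H$z')" if n: "n:om" for n
  proof -
   obtain z where z: "z:Rl" "eqn n y (jh (kk G H) z)" using c[OF n] unfolding mem_EE by blast
   show ?thesis using eqn_fs[OF n z(2)] eqn_sn[OF n z(2)] z(1) code_Rl[OF kk_code] by (auto simp: jh_def)
  qed
  then show ?thesis using kk_code fs_Rl[OF y] sn_Rl[OF y] unfolding code_def cgr_def by blast
 qed
 then have jy: "jh (kk G H) (fs y) = y" using y by (simp add: jh_def)
 have "~hit (kk G H) (UU U) (fs y)"
 proof
  assume "hit (kk G H) (UU U) (fs y)"
  then obtain u where u: "u:UU U" "kap y (ln u) = u" unfolding hit_def jy by blast
  have uo: "ln u:om" using u(1) mem_UU by simp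
  obtain z where z: "z:Rl" "~hit (kk G H) (UU U) z" "eqn (ln u) y (jh (kk G H) z)"
   using c[OF uo] unfolding mem_EE by blast
  then show False using u kap_cong[OF uo z(3)] unfolding hit_def by metis
 qed
 then show ?thesis using jy fs_Rl[OF y] unfolding mem_EE by metis
qed

text \<open>If every point were hit, \<open>S\<close> would be locally in \<open>L\<close> by
  \<open>S_cone\<close>, hence in \<open>L\<close> by \<open>G1\<close>.\<close>

lemma EE_ne: assumes SL: "~S:L" shows "EE ~= emp"
proof
  assume E: "EE = emp"
  have "EX m. m:om & cone (kk G H) S (kap (jh (kk G H) z) m):L" if z: "z:Rl" for z
  proof -
   have "hit (kk G H) (UU U) z" using E z mem_EE unfolding emp_iff by blast
   then obtain u where u: "u:UU U" "kap (jh (kk G H) z) (ln u) = u" unfolding hit_def by blast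
   then show ?thesis using S_cone[OF u(1)] mem_UU by (intro exI[of _ "ln u"]) simp
  qed
  then show False using G1[OF seg jcl kk_code S] SL by blast
qed

text \<open>On the closed set \<open>EE\<close> of undecided points, \<open>S\<close> holds iff the
  first run ends in \<open>D\<close> iff the second does not. Pulling \<open>D\<close> back along
  the retraction onto \<open>EE\<close> gives a set below both \<open>D\<close> and its complement,
  from which \<open>S\<close> arises by the same operation.\<close>

lemma piv_small: assumes ne: "EE ~= emp" and D: "sb D Rl"
 shows "EX Dt. Op L (kk G H) (UU U) Dt S & wle Dt D & wle Dt (cmp D)"
proof -
 have ER: "sb EE Rl" unfolding sb_def mem_EE using jh_kk_R by blast
 have rtE: "rt EE y:EE" if "y:Rl" for y
  by (rule EE_closed[OF rt_Rl[OF ER ne that] rt_near[OF ER ne that]])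
 have rti: "rt EE y = y" if "y:EE" for y
  by (rule rt_id[OF ER ne]) (use that ER in \<open>auto simp: sb_def intro: exI[of _ y]\<close>)
 define Dt where "Dt = Sep Rl (%y. fs (sn (rt EE y)):D)"
 have mDt: "y:Dt <-> y:Rl & fs (sn (rt EE y)):D" for y unfolding Dt_def by simp
 have s: "sb Dt Rl" by (simp add: Dt_def)
 have fsn: "fs (sn (jh (kk G H) z)) = jh j (G z)" "sn (sn (jh (kk G H) z)) = jh j (H z)" if "z:Rl" for z
  using jh_kk[OF that] kk_R[OF that] that by simp_all
 have un: "z:S <-> jh j (G z):D" "z:S <-> ~jh j (H z):D" if "z:Rl" "~hit (kk G H) (UU U) z" for z
 proof -
  have h: "~hit j U (G z)" "~hit j U (H z)" using hit_UU[OF that(1)] that(2) by auto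
  show "z:S <-> jh j (G z):D" using SG[OF that(1)] Op_def'[OF ct_Rl[OF G that(1)] h(1)] by simp
  show "z:S <-> ~jh j (H z):D" using SH[OF that(1)] Op_def'[OF ct_Rl[OF H that(1)] h(2)] by blast
 qed
 have 1: "wle Dt D" by (rule wleI[OF ct_fs[OF ct_sn[OF ct_rt[OF ER ne ct_id]]] s]) (simp add: mDt)
 have 2: "wle Dt (cmp D)"
 proof (rule wleI[OF ct_sn[OF ct_sn[OF ct_rt[OF ER ne ct_id]]] s])
  fix y assume y: "y:Rl"
  obtain z where z: "z:Rl" "~hit (kk G H) (UU U) z" "rt EE y = jh (kk G H) z"
   using rtE[OF y] unfolding mem_EE by blast
  show "y:Dt <-> sn (sn (rt EE y)):cmp D"
   unfolding mDt z(3) fsn[OF z(1)] using un[OF z(1,2)] y kk_R[OF z(1)] by simp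
 qed
 have "Op L (kk G H) (UU U) Dt S" unfolding Op_def
 proof (intro conjI allI impI kk_code S S_cone)
  show "sb (UU U) om" by (simp add: sb_def mem_UU)
  fix z assume z: "z:Rl" "~hit (kk G H) (UU U) z"
  then have "jh (kk G H) z:EE" unfolding mem_EE by blast
  then show "z:S <-> jh (kk G H) z:Dt" unfolding mDt using rti fsn[OF z(1)] un(1)[OF z] jh_kk_R[OF z(1)] by simp
 qed
 then show ?thesis using 1 2 by blast
qed

end
end
end

section \<open>A pivot from a failure of closure under open operations\<close>

lemma less_of: assumes "wle X D" "wle X (cmp D)" "~wle D (cmp D)" "sb D Rl" shows "less X D"
 unfolding less_def le2_def
proof
 assume "wle D X | wle D (cmp X)"
 then show False
 proof
  assume "wle D X" then show False using wle_trans assms by blast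
 next
  assume "wle D (cmp X)" then show False using wle_trans[OF _ wle_cmp[OF assms(1)]] assms by blast
 qed
qed

text \<open>\<open>D\<close> is taken minimal among the sets from which an open operation leads out
  of \<open>L\<close>. Minimality makes \<open>D\<close> nonselfdual; then the set supplied by
  \<open>piv_small\<close> is strictly below \<open>D\<close>, so whatever reduces to
  \<open>M\<close> together with its complement is in \<open>L\<close>.\<close>

lemma case1:
 assumes seg: "seg L" and jcl: "jcl L" and w: "wf L less" and sd: "!!D. D:L ==> SDp D"
  and D0: "D0:L" "Op L j0 U0 D0 M0" "~M0:L"
 shows "EX D j U M. D:L & ~wle D (cmp D) & Op L j U D M & pv L M &
  (ALL D' j' U' M'. D':L --> less D' D --> Op L j' U' D' M' --> M':L)"
proof -
 define Z where "Z = Sep L (%D. EX j U M. Op L j U D M & ~M:L)"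
 have mZ: "D:Z <-> D:L & (EX j U M. Op L j U D M & ~M:L)" for D unfolding Z_def by simp
 have "sb Z L" "EX x. x:Z" using D0 mZ by (auto simp: sb_def)
 then obtain D where D: "D:Z" "!!Y. Y:Z ==> ~less Y D" using w unfolding wf_def by blast
 obtain j U M where DL: "D:L" and opm: "Op L j U D M" and nML: "~M:L" using D(1) mZ by blast
 have min: "M':L" if "D':L" "less D' D" "Op L j' U' D' M'" for D' j' U' M' using D(2)[of D'] that mZ by blast
 have sD: "sb D Rl" using seg_sb[OF seg DL] .
 note j = Op_j[OF seg jcl opm] and UU = Op_U[OF seg jcl opm] and sM = Op_S[OF seg jcl opm]
  and oc = Op_cone[OF seg jcl opm] and odd1 = Op_def'[OF seg jcl opm]
 have nsd: "~wle D (cmp D)"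
 proof
  assume "wle D (cmp D)"
  then obtain f Q where f: "Ct f" and Q: "fn Q om (Pw Rl)" "!!n. n:om ==> less (Q$n) D"
   and fQ: "!!x. x:Rl ==> x:D <-> f$x:Jn Q" using sd[OF DL] unfolding SDp_def by blast
  note cf = Ct_ct[OF f]
  have Qs: "sb (Q$n) Rl" if "n:om" for n using fn_ap(2)[OF Q(1) that] by simp
  \<comment> \<open>Outside the hit region \<open>D\<close> is replaced by the \<open>n\<close>-th
    set of the join. These variants are in \<open>L\<close> by minimality of \<open>D\<close>, and
    near each point \<open>M\<close> agrees with one of them, because the first digit of
    \<open>f\<close> is locally constant.\<close>
  define Mn where "Mn n = Sep Rl (%z. if hit j U z then z:M else tl (f$(jh j z)):Q$n)" for n
  define Dn where "Dn n = Sep Rl (%y. tl (f$y):Q$n)" for n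
  have mM: "z:Mn n <-> z:Rl & (if hit j U z then z:M else tl (f$(jh j z)):Q$n)" for z n by (simp add: Mn_def)
  have mD: "y:Dn n <-> y:Rl & tl (f$y):Q$n" for y n by (simp add: Dn_def)
  have DnQ: "wle (Dn n) (Q$n)" for n by (rule wleI[OF ct_tl[OF cf]]) (auto simp: sb_def mD)
  have ME: "z:M <-> z:Mn (f$(jh j z)$emp)" if z: "z:Rl" for z
   using odd1[OF z] fQ[OF jh_Rl[OF j z]] ct_Rl[OF cf jh_Rl[OF j z]] z unfolding mM by simp
  have Mn: "Mn n:L" if n: "n:om" for n
  proof (rule min)
   have ls: "less (Dn n) D" by (rule le2_less_trans[OF wle_le2[OF DnQ] Q(2)[OF n]]) (use Qs n sD in \<open>auto simp: sb_def mD\<close>)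
   have sDn: "sb (Dn n) Rl" by (simp add: sb_def mD)
   show "less (Dn n) D" using ls .
   show "Dn n:L" using seg_wle[OF seg DL] less_wle(1)[OF sDn sD ls] by blast
   show "Op L j U (Dn n) (Mn n)" unfolding Op_def
   proof (intro conjI allI impI j UU)
    show "sb (Mn n) Rl" by (simp add: sb_def mM)
    fix u assume u: "u:U"
    have "cone j (Mn n) u = cone j M u" by (rule ext) (use u in \<open>auto simp: mM hit_def\<close>)
    then show "cone j (Mn n) u:L" using oc[OF u] by simp
   next
    fix z assume "z:Rl" "~hit j U z"
    then show "z:Mn n <-> jh j z:Dn n" using jh_Rl[OF j] by (simp add: mM mD)
   qed
  qed
  have "M:L"
  proof (rule G1[OF seg jcl j sM])
   fix z assume z: "z:Rl"
   let ?n = "f$(jh j z)$emp"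
   obtain m where m: "m:om" "!!y. y:Rl ==> eqn m (jh j z) y ==> f$(jh j z)$emp = f$y$emp"
    using ctD[OF cf jh_Rl[OF j z] emp_om] by blast
   have no: "?n:om" using ct_Rl[OF cf jh_Rl[OF j z]] by simp
   have "cone j M (kap (jh j z) m) = cone j (Mn ?n) (kap (jh j z) m)"
   proof (rule ext)
    fix x
    have "x:M <-> x:Mn ?n" if "x:Rl" "kap (jh j x) m = kap (jh j z) m"
    proof -
     have "eqn m (jh j z) (jh j x)" using kap_eq_iff[OF m(1) jh_Rl[OF j z] jh_Rl[OF j that(1)]] that(2) by simp
     then show ?thesis using ME[OF that(1)] m(2)[OF jh_Rl[OF j that(1)]] by simp
    qed
    then show "x:cone j M (kap (jh j z) m) <-> x:cone j (Mn ?n) (kap (jh j z) m)"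
     using m(1) jh_Rl[OF j z] by auto
   qed
   then show "EX m. m:om & cone j M (kap (jh j z) m):L"
    using G2[OF seg jcl j Mn[OF no], of "kap (jh j z) m"] m(1) jh_Rl[OF j z] by (intro exI[of _ m]) simp
  qed
  then show False using nML by blast
 qed
 have "pv L M" unfolding pv_def
 proof (intro conjI allI impI sM nML, rule ccontr)
  fix S assume S: "sb S Rl" "wle S M" "wle (cmp S) M" "~S:L"
  obtain g where g: "ct (ap g)" "!!x. x:Rl ==> x:S <-> g$x:M" using wleE[OF S(2)] by metis
  obtain h where h: "ct (ap h)" "!!x. x:Rl ==> x:cmp S <-> h$x:M" using wleE[OF S(3)] by metis
  have h2: "~x:S <-> h$x:M" if "x:Rl" for x using h(2)[OF that] that by simp
  obtain Dt where k: "Op L (kk j (ap g) (ap h)) (UU U) Dt S" "wle Dt D" "wle Dt (cmp D)"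
   using piv_small[OF seg jcl opm g(1) h(1) S(1) g(2) h2 EE_ne[OF seg jcl opm g(1) h(1) S(1) g(2) h2 S(4)] sD] by blast
  then show False using min[OF seg_wle[OF seg DL k(2)] less_of[OF k(2,3) nsd sD] k(1)] S(4) by blast
 qed
 then show ?thesis using DL nsd opm min by blast
qed

section \<open>Ranks are good digits\<close>

text \<open>Zero if there is no witness, and otherwise the successor of the least one.\<close>

definition LS where "LS P = (if EX e. e:om & P e then sc (lst (%e. e:om & P e)) else emp)"
lemma dt_LS [simp]: assumes "dp (%s. P (%n. s (Suc n)) (s 0))" shows "dt (%s. LS (P s))"
 unfolding LS_def using assms by simp

lemma LS_lst: assumes "dp (%s. P (s 0))" "e:om" "P e"
 shows "lst (%e. e:om & P e):om" "P (lst (%e. e:om & P e))"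
  "d:lst (%e. e:om & P e) ==> ~P d"
proof -
 have dd: "dp (%s. s 0:om & P (s 0))" using assms by simp
 have *: "e:om & P e" using assms by simp
 note l = lst[of "%e. e:om & P e", OF dd nat_Ord[OF assms(2)] *]
 show "lst (%e. e:om & P e):om" "P (lst (%e. e:om & P e))" using l(2) by blast+
 then show "d:lst (%e. e:om & P e) ==> ~P d" using l(4) nat_in by blast
qed

lemma LS_emp: "LS P = emp <-> (ALL e. e:om --> ~P e)" unfolding LS_def by auto

lemma LS_sc: assumes d: "dp (%s. P (s 0))" and e: "e:om" shows "LS P = sc e <-> P e & (ALL d. d:e --> ~P d)"
proof
 assume *: "LS P = sc e"
 then obtain e' where e': "e':om" "P e'" unfolding LS_def by (auto split: if_splits)
 then have "lst (%e. e:om & P e) = e" using * unfolding LS_def by (auto split: if_splits)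
 then show "P e & (ALL d. d:e --> ~P d)" using LS_lst[OF d e'] by auto
next
 assume *: "P e & (ALL d. d:e --> ~P d)"
 let ?l = "lst (%e. e:om & P e)"
 note l = LS_lst[OF d e, OF *[THEN conjunct1]]
 have "?l = e" using nat_lin[OF l(1) e] l * by blast
 then show "LS P = sc e" unfolding LS_def using * e by auto
qed

lemma LS_om [simp]: assumes d: "dp (%s. P (s 0))" shows "LS P:om"
 unfolding LS_def using LS_lst(1)[OF d] by auto

lemma bnd:
 assumes T: "dp (%s. T (s 0) (s 1))" and ex: "!!e. e:om ==> EX n. n:om & T e n"
  and mono: "!!e n n'. T e n ==> sb n n' ==> n':om ==> T e n'" and m: "m:om"
 shows "EX n. n:om & (ALL e. e:m --> T e n)"
proof (rule nat_ind[OF m, of "%m. EX n. n:om & (ALL e. e:m --> T e n)"])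
 have "dp (%s. T (a s) (b s))" if "dt a" "dt b" for a b using dp_sub2[OF T that] .
 then show "dp (%s. EX n. n:om & (ALL e. e:s 0 --> T e n))" by simp
 show "EX n. n:om & (ALL e. e:emp --> T e n)" by (rule exI[of _ emp]) simp
 fix m assume m: "m:om" and "EX n. n:om & (ALL e. e:m --> T e n)"
 then obtain n where n: "n:om" "!!e. e:m ==> T e n" by blast
 obtain n' where n': "n':om" "T m n'" using ex[OF m] by blast
 obtain l where l: "l:om" "sb n l" "sb n' l" by (rule nat_max[OF n(1) n'(1)])
 have "T e l" if "e:sc m" for e
  using that mono[OF n(2) l(2,1)] mono[OF n'(2) l(3,1)] by auto
 then show "EX n. n:om & (ALL e. e:sc m --> T e n)" using l(1) by blast
qed

lemma LS_local:
 assumes dP: "dp (%s. P (s 0))" and dQ: "dp (%s. Q (s 0))"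
  and e: "e:om" and PQ: "!!d. d:sc e ==> P d <-> Q d"
 shows "LS P = sc e <-> LS Q = sc e"
 unfolding LS_sc[OF dP e] LS_sc[OF dQ e] using PQ by auto

text \<open>Successor values of \<open>LS\<close> are locally constant along the code and are taken
  on an open set; elsewhere the value is \<open>emp\<close>. So the partition along this digit is an
  open operation, with \<open>Q$emp\<close> read off outside.\<close>

lemma stepS:
 assumes seg: "seg L" and jcl: "jcl L" and ocl: "ocl L" and j: "code L j" and dW: "dp (%s. W (s 0) (s 1))"
  and loc: "!!z e. z:Rl ==> e:om ==> EX n. n:om & (ALL z'. z':Rl --> eqn n (jh j z) (jh j z') --> (W z e <-> W z' e))"
 shows "gd L (%z. LS (W z))"
 unfolding gd_def
proof (intro allI impI)
 fix g Q assume g: "Ct g" and Q: "fn Q om L"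
 note cg = Ct_ct[OF g]
 have dW': "dp (%s. W (a s) (b s))" if "dt a" "dt b" for a b using dp_sub2[OF dW that] .
 define k where "k = Lam Rl (%z. pr (jh j (g$z)) (jh j (g$z)))"
 have k: "code L k" unfolding k_def by (rule code_pair[OF seg jcl j cg cg])
 have jhk: "jh k z = pr z (pr (jh j (g$z)) (jh j (g$z)))" if "z:Rl" for z
  using that by (simp add: jh_def[of k], simp add: k_def)
 have R: "jh j (g$z):Rl" if "z:Rl" for z using jh_Rl[OF j] ct_Rl[OF cg] that by auto
 have ek: "eqn n (jh j (g$z)) (jh j (g$z'))" if "z:Rl" "z':Rl" "n:om" "eqn n (jh k z) (jh k z')" for z z' n
 proof -
  have "fs (sn (jh k z)) = jh j (g$z)" if "z:Rl" for z unfolding jhk[OF that] using that R[OF that] by simp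
  then show ?thesis using eqn_fs[OF that(3) eqn_sn[OF that(3,4)]] that(1,2) by metis
 qed
 define U where "U = Sep om (%u. EX e. e:om & (ALL z. z:Rl --> kap (jh k z) (ln u) = u --> LS (W (g$z)) = sc e))"
 have mU: "u:U <-> u:om & (EX e. e:om & (ALL z. z:Rl --> kap (jh k z) (ln u) = u --> LS (W (g$z)) = sc e))" for u
  unfolding U_def by (simp add: dW')
 define S where "S = Sep Rl (%z. z:Q$(LS (W (g$z))))"
 have mS: "z:S <-> z:Rl & z:Q$(LS (W (g$z)))" for z unfolding S_def by (simp add: dW')
 define D where "D = Sep Rl (%y. fs y:Q$emp)"
 have mD: "y:D <-> y:Rl & fs y:Q$emp" for y unfolding D_def by simp
 have D: "D:L" unfolding D_def by (rule seg_inv[OF seg ct_fs[OF ct_id] fn_ap(2)[OF Q emp_om]])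
 have "Op L k U D S" unfolding Op_def
 proof (intro conjI allI impI k)
  show "sb U om" "sb S Rl" by (auto simp: sb_def mU mS)
  fix u assume u: "u:U"
  then obtain e where e: "u:om" "e:om" "!!z. z:Rl ==> kap (jh k z) (ln u) = u ==> LS (W (g$z)) = sc e" unfolding mU by blast
  have "cone k S u = cone k (Q$(sc e)) u" by (rule ext) (use e(3) in \<open>auto simp: mS\<close>)
  then show "cone k S u:L" using G2[OF seg jcl k fn_ap(2)[OF Q sc_om[OF e(2)]] e(1)] by simp
 next
  fix z assume z: "z:Rl" and nh: "~hit k U z"
  have "LS (W (g$z)) = emp"
  proof (rule ccontr)
   assume "LS (W (g$z)) ~= emp"
   then obtain e where e: "e:om" "LS (W (g$z)) = sc e"
    by (rule_tac nat_cases[OF LS_om[of "W (g$z)"]]) (use dW' in auto)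
   let ?T = "%d n. ALL z'. z':Rl --> eqn n (jh j (g$z)) (jh j z') --> (W (g$z) d <-> W z' d)"
   have "EX n. n:om & (ALL d. d:sc e --> ?T d n)"
   proof (rule bnd)
    show "dp (%s. ?T (s 0) (s 1))" by (simp add: dW')
    show "EX n. n:om & ?T d n" if "d:om" for d using loc[OF ct_Rl[OF cg z] that] .
    show "?T d n'" if "?T d n" "sb n n'" "n':om" for d n n' using that eqn_mono by blast
   qed (use e in simp)
   then obtain n where n: "n:om" "!!d z'. d:sc e ==> z':Rl ==> eqn n (jh j (g$z)) (jh j z') ==> W (g$z) d <-> W z' d" by blast
   let ?u = "kap (jh k z) n"
   have kz: "jh k z:Rl" using jh_Rl[OF k z] .
   have "?u:U" unfolding mU
   proof (intro conjI exI[of _ e] allI impI)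
    fix z' assume z': "z':Rl" "kap (jh k z') (ln ?u) = ?u"
    then have "eqn n (jh k z) (jh k z')" using kap_eq_iff[OF n(1) kz jh_Rl[OF k z'(1)]] kz n(1) by simp
    then have "eqn n (jh j (g$z)) (jh j (g$z'))" using ek z z' n by blast
    then have "W (g$z) d <-> W (g$z') d" if "d:sc e" for d using n(2) that ct_Rl[OF cg z'(1)] by blast
    then show "LS (W (g$z')) = sc e"
     using LS_local[of "W (g$z)" "W (g$z')" e] dW' e by simp
   qed (use kz n e in auto)
   then have "hit k U z" unfolding hit_def using kz n by (intro exI[of _ ?u]) simp
   then show False using nh by blast
  qed
  then show "z:S <-> jh k z:D" unfolding mS mD using z jh_Rl[OF k z] jhk[OF z] R[OF z] by simp
 qed
 then have "S:L" using ocl D unfolding ocl_def by blast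
 then show "Sep Rl (%z. z:Q$(LS (W (g$z)))):L" unfolding S_def .
qed

text \<open>\<open>lq x w u\<close> is the set of the nodes whose rank in \<open>x\<close> is at most the rank of \<open>u\<close> in the well-founded
 tree \<open>w\<close>.\<close>

definition lq where "lq x w u = wr om (ch w) (%u f. Sep om (%s. ALL s'. ch x s' s --> (EX u'. ch w u' u & s':f$u'))) u"
lemma dt_lq [simp]: "dt a ==> dt b ==> dt c ==> dt (%s. lq (a s) (b s) (c s))"
 by (rule dt_lift3) (simp_all add: lq_def)

section \<open>Comparison of ranks with a fixed well-founded tree\<close>

lemma mem_lq: assumes w: "w:WF" and u: "u:om"
 shows "s:lq x w u <-> s:om & (ALL s'. ch x s' s --> (EX u'. ch w u' u & s':lq x w u'))"
proof -
 define f where "f = Lam (Sep om (%y. ch w y u)) (lq x w)"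
 have e: "lq x w u = Sep om (%s. ALL s'. ch x s' s --> (EX u'. ch w u' u & s':f$u'))"
  unfolding lq_def f_def by (subst wr_unfold[OF wf_ch[OF w] dp_chv _ u]) simp_all
 have fu: "f$u' = lq x w u'" if "ch w u' u" for u'
  using that ch_om[OF that u] by (simp add: f_def)
 have "s:lq x w u <-> s:om & (ALL s'. ch x s' s --> (EX u'. ch w u' u & s':f$u'))" unfolding e by simp
 then show ?thesis using fu by metis
qed

lemma lq_mono: assumes w: "w:WF" "w':WF" and u: "u:om"
 shows "ALL u' s. u':om --> sb (rW w u) (rW w' u') --> s:lq x w u --> s:lq x w' u'"
proof (rule wf_ind[OF wf_ch[OF w(1)] u, of "%u. ALL u' s. u':om --> sb (rW w u) (rW w' u') --> s:lq x w u --> s:lq x w' u'"])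
 fix u assume u: "u:om" and IH: "!!y. y:om ==> ch w y u ==> ALL u' s. u':om --> sb (rW w y) (rW w' u') --> s:lq x w y --> s:lq x w' u'"
 show "ALL u' s. u':om --> sb (rW w u) (rW w' u') --> s:lq x w u --> s:lq x w' u'"
 proof (intro allI impI)
  fix u' s assume u': "u':om" "sb (rW w u) (rW w' u')" "s:lq x w u"
  have "EX v'. ch w' v' u' & s':lq x w' v'" if s': "ch x s' s" for s'
  proof -
   obtain v where v: "ch w v u" "s':lq x w v" using u'(3) s' unfolding mem_lq[OF w(1) u] by blast
   note vo = ch_om[OF v(1) u]
   have "rW w v:rW w' u'" using rW_mono[OF w(1) u vo v(1)] u'(2) sbD by blast
   then obtain v' where v': "v':om" "ch w' v' u'" "rW w v:rW w' v' | rW w v = rW w' v'"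
    unfolding rW_def using mem_rk[OF wf_ch[OF w(2)] dp_chv u'(1)] by blast
   have "sb (rW w v) (rW w' v')" using v'(3) Ord_sb[OF Ord_rW[OF w(2) v'(1)]] by auto
   then show ?thesis using IH[OF vo v(1)] v' v(2) by blast
  qed
  then show "s:lq x w' u'" unfolding mem_lq[OF w(2) u'(1)] using u'(3) mem_lq[OF w(1) u] by blast
 qed
qed simp

lemma lq_WF: assumes w: "w:WF" and u: "u:om" and x: "x:WF" and s: "s:om"
 shows "s:lq x w u <-> sb (rW x s) (rW w u)"
proof
 assume *: "s:lq x w u"
 show "sb (rW x s) (rW w u)"
 proof (rule simul[OF x w _ s u, of "%s u. s:lq x w u"])
  show "EX v'. ch w v' v & u':lq x w v'" if "t:lq x w v" "v:om" "ch x u' t" for t v u'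
   using that mem_lq[OF w that(2)] by blast
 qed (use * in auto)
next
 have "ALL s. s:om --> sb (rW x s) (rW w u) --> s:lq x w u"
 proof (rule wf_ind[OF wf_ch[OF w] u])
  fix u assume u: "u:om" and IH: "!!y. y:om ==> ch w y u ==> ALL s. s:om --> sb (rW x s) (rW w y) --> s:lq x w y"
  show "ALL s. s:om --> sb (rW x s) (rW w u) --> s:lq x w u"
  proof (intro allI impI)
   fix s assume s: "s:om" "sb (rW x s) (rW w u)"
   have "EX u'. ch w u' u & s':lq x w u'" if s': "ch x s' s" for s'
   proof -
    note so = ch_om[OF s' s(1)]
    have "rW x s':rW w u" using rW_mono[OF x s(1) so s'] s(2) sbD by blast
    then obtain v' where v': "v':om" "ch w v' u" "rW x s':rW w v' | rW x s' = rW w v'"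
     unfolding rW_def using mem_rk[OF wf_ch[OF w] dp_chv u] by blast
    have "sb (rW x s') (rW w v')" using v'(3) Ord_sb[OF Ord_rW[OF w v'(1)]] by auto
    then show ?thesis using IH[OF v'(1,2)] v' so by blast
   qed
   then show "s:lq x w u" unfolding mem_lq[OF w u] using s(1) by blast
  qed
 qed simp
 then show "sb (rW x s) (rW w u) ==> s:lq x w u" using s by blast
qed

text \<open>By induction along \<open>w\<close>, no node on an infinite branch of \<open>x\<close>
  belongs to \<open>lq x w u\<close>.\<close>

lemma lq_root: assumes w: "w:WF" and u: "u:om" and x: "x:Rl" and l: "emp:lq x w u" shows "x:WF"
 unfolding mem_WF
proof (intro conjI x allI impI, rule ccontr)
 fix b assume b: "b:Rl" and nb: "~(EX n. n:om & ~inn x b n)"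
 have "ALL n. n:om --> ~kap b n:lq x w u"
 proof (rule wf_ind[OF wf_ch[OF w] u])
  fix u assume u: "u:om" and IH: "!!y. y:om ==> ch w y u ==> ALL n. n:om --> ~kap b n:lq x w y"
  show "ALL n. n:om --> ~kap b n:lq x w u"
  proof (intro allI impI notI)
   fix n assume n: "n:om" "kap b n:lq x w u"
   have "ch x (kap b (sc n)) (kap b n)" using ch_kapI[OF b n(1)] nb sc_om[OF n(1)] by blast
   then obtain u' where "ch w u' u" "kap b (sc n):lq x w u'" using n(2) mem_lq[OF w u] by blast
   then show False using IH ch_om u sc_om[OF n(1)] by blast
  qed
 qed simp
 then show False using l emp_om kap_0 by metis
qed

text \<open>Least witnesses in the comparison: \<open>pd\<close> names a child of \<open>u\<close>
  bounding \<open>s\<close>, and \<open>qd\<close> names a child of \<open>s\<close> bounded by no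
  child of \<open>u\<close>. The statement searched by \<open>pd\<close> is decided by
  \<open>qd\<close> at children of \<open>u\<close>, the one searched by \<open>qd\<close> by
  \<open>pd\<close> at \<open>u\<close> itself.\<close>

definition pd where "pd x w s u = LS (%e. ch w (chd u e) u & s:lq x w (chd u e))"
definition qd where "qd x w s u = LS (%d. ch x (chd s d) s & pd x w (chd s d) u = emp)"
lemma dt_pd [simp]: "dt a ==> dt b ==> dt c ==> dt d ==> dt (%s. pd (a s) (b s) (c s) (d s))"
 by (rule dt_lift4) (simp_all add: pd_def)
lemma dt_qd [simp]: "dt a ==> dt b ==> dt c ==> dt d ==> dt (%s. qd (a s) (b s) (c s) (d s))"
 by (rule dt_lift4) (simp_all add: qd_def)
lemma pd_om [simp]: "pd x w s u:om" unfolding pd_def by (rule LS_om) simp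
lemma qd_om [simp]: "qd x w s u:om" unfolding qd_def by (rule LS_om) simp

lemma pd_emp: "u:om ==> pd x w s u = emp <-> (ALL u'. ch w u' u --> ~s:lq x w u')"
 unfolding pd_def LS_emp by (auto simp: ch_def)
lemma qd_emp: assumes w: "w:WF" and u: "u:om" and s: "s:om" shows "qd x w s u = emp <-> s:lq x w u"
 unfolding qd_def LS_emp pd_emp[OF u] mem_lq[OF w u] using s by (auto simp: ch_def)

lemma ch_ct: assumes "s:om" "d:om"
 shows "EX m. m:om & (ALL z z'. eqn m z z' --> ch z (chd s d) s = ch z' (chd s d) s)"
proof -
 obtain m where "m:om" "!!w w'. eqn m w w' ==> inn w (ex (chd s d)) (ln (chd s d)) = inn w' (ex (chd s d)) (ln (chd s d))"
  using inn_ct[of "ex (chd s d)" "ln (chd s d)"] ex[of "chd s d"] assms by auto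
 then show ?thesis unfolding ch_def tree_def by blast
qed

text \<open>One real with all digits \<open>qd\<close> at nodes of \<open>A\<close> and
  \<open>pd\<close> at nodes of \<open>B\<close>, told apart by the first component of the index.
  The two sets of nodes allow for the alternation: after \<open>qd\<close> at the smaller ranks
  comes \<open>pd\<close> one rank further, then \<open>qd\<close> there.\<close>

definition Jc where "Jc w A B = Lam Rl (%z. Lam om (%m. if q1 m = emp
 then (if q2 (q2 m):A then qd z w (q1 (q2 m)) (q2 (q2 m)) else emp)
 else (if q2 (q2 m):B then pd z w (q1 (q2 m)) (q2 (q2 m)) else emp)))"

lemma Jc_ap: assumes "z:Rl" "m:om" shows "Jc w A B$z$m = (if q1 m = emp
 then (if q2 (q2 m):A then qd z w (q1 (q2 m)) (q2 (q2 m)) else emp)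
 else (if q2 (q2 m):B then pd z w (q1 (q2 m)) (q2 (q2 m)) else emp))"
 using assms by (simp add: Jc_def)

lemma Jc_q: "z:Rl ==> s:om ==> v:om ==> v:A ==> Jc w A B$z$(pi emp (pi s v)) = qd z w s v"
 by (subst Jc_ap) (simp_all del: pi_0 pi_sc)
lemma Jc_p: "z:Rl ==> s:om ==> v:om ==> v:B ==> Jc w A B$z$(pi (sc emp) (pi s v)) = pd z w s v"
 by (subst Jc_ap) (simp_all del: pi_0 pi_sc)

lemma Jc_fn: "fn (Jc w A B) Rl Rl"
 unfolding Jc_def by (rule fn_Lam) (auto intro!: RlI)

text \<open>Finitely many of the statements \<open>P z e\<close> at a time are shared by points
  close enough to the limit, so least witnesses pass to the limit.\<close>

lemma LS_lim:
 assumes dP: "dp (%s. P (s 0) (s 1))" and i: "i:om" and z: "z:Rl" and y: "y:Rl"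
  and J: "!!z'. z':Rl ==> J$z'$i = LS (P z')"
  and ap: "!!n. n:om ==> EX z'. z':Rl & eqn n z z' & eqn n y (J$z')"
  and T: "!!e. e:om ==> EX n. n:om & (ALL z'. z':Rl --> eqn n z z' --> eqn n y (J$z') --> (P z e <-> P z' e))"
 shows "y$i = LS (P z)"
proof -
 have dP': "dp (%s. P (a s) (b s))" if "dt a" "dt b" for a b using dp_sub2[OF dP that] .
 have T': "EX z'. z':Rl & LS (P z') = y$i & (ALL e. e:m --> (P z e <-> P z' e))" if m: "m:om" for m
 proof -
  let ?T = "%e n. ALL z'. z':Rl --> eqn n z z' --> eqn n y (J$z') --> (P z e <-> P z' e)"
  have "EX n. n:om & (ALL e. e:m --> ?T e n)"
  proof (rule bnd[OF _ T _ m])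
   show "dp (%s. ?T (s 0) (s 1))" by (simp add: dP')
   show "?T e n'" if "?T e n" "sb n n'" "n':om" for e n n' using that eqn_mono by blast
  qed
  then obtain n where n: "n:om" "!!e. e:m ==> ?T e n" by blast
  obtain l where l: "l:om" "sb n l" "sb (sc i) l" by (rule nat_max[OF n(1) sc_om[OF i]])
  obtain z' where z': "z':Rl" "eqn l z z'" "eqn l y (J$z')" using ap[OF l(1)] by blast
  have "LS (P z') = y$i" using eqn_in[OF z'(3), of i] l(3) J[OF z'(1)] by (simp add: sb_def)
  then show ?thesis using z' n(2) eqn_mono[OF z'(2) l(2)] eqn_mono[OF z'(3) l(2)] by blast
 qed
 have yi: "y$i:om" using y i by simp
 show ?thesis
 proof (rule nat_cases[OF yi])
  assume e: "y$i = emp"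
  have "~P z d" if d: "d:om" for d
  proof -
   obtain z' where "LS (P z') = emp" "!!e. e:sc d ==> P z e <-> P z' e" using T'[OF sc_om[OF d]] e by metis
   then show ?thesis using d unfolding LS_emp by auto
  qed
  then show ?thesis unfolding e using LS_emp[of "P z"] by simp
 next
  fix e assume e: "e:om" "y$i = sc e"
  obtain z' where z': "LS (P z') = sc e" "!!d. d:sc e ==> P z d <-> P z' d" using T'[OF sc_om[OF e(1)]] e(2) by metis
  then show ?thesis using LS_local[of "P z" "P z'" e] dP' e by simp
 qed
qed

context
 fixes w A B assumes w: "w:WF" and A: "sb A om" and B: "sb B om" and AB: "sb A B"
  and cA: "!!v v'. v:B ==> ch w v' v ==> v':A"
begin

lemma Jc_cgr: "cgr (Jc w A B)"
 unfolding cgr_def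
proof (intro allI impI)
 let ?J = "Jc w A B"
 fix z y assume z: "z:Rl" and y: "y:Rl" and ap0: "ALL n. n:om --> (EX z'. z':Rl & eqn n z z' & eqn n y (?J$z'))"
 then have ap: "EX z'. z':Rl & eqn n z z' & eqn n y (?J$z')" if "n:om" for n using that by blast
 \<comment> \<open>Induction along \<open>w\<close>: in the limit, \<open>pd\<close> at
   \<open>v\<close> is settled by \<open>qd\<close> at the children of \<open>v\<close>, and then
   \<open>qd\<close> at \<open>v\<close> by \<open>pd\<close> at \<open>v\<close>.\<close>
 have main: "ALL s. s:om --> (v:A --> y$(pi emp (pi s v)) = qd z w s v) & (v:B --> y$(pi (sc emp) (pi s v)) = pd z w s v)" (is "?M v")
  if v: "v:om" for v
 proof (rule wf_ind[OF wf_ch[OF w] v, of ?M])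
  fix v assume v: "v:om" and IH: "!!u. u:om ==> ch w u v ==> ?M u"
  have p: "y$(pi (sc emp) (pi s v)) = pd z w s v" if s: "s:om" and vB: "v:B" for s
   unfolding pd_def
  proof (rule LS_lim[of "%z e. ch w (chd v e) v & s:lq z w (chd v e)" _ z y ?J, OF _ _ z y _ ap])
   fix z' assume "z':Rl"
   then show "?J$z'$(pi (sc emp) (pi s v)) = LS (%e. ch w (chd v e) v & s:lq z' w (chd v e))"
    using Jc_p[OF _ s v vB] by (simp add: pd_def del: pi_sc)
  next
   fix e assume e: "e:om"
   show "EX n. n:om & (ALL z'. z':Rl --> eqn n z z' --> eqn n y (?J$z') -->
    ((ch w (chd v e) v & s:lq z w (chd v e)) <-> (ch w (chd v e) v & s:lq z' w (chd v e))))"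
   proof (cases "ch w (chd v e) v")
    case True
    have cA': "chd v e:A" using cA[OF vB True] .
    have co: "chd v e:om" using v e by simp
    let ?i = "pi emp (pi s (chd v e))"
    have io: "?i:om" using s co by (simp del: pi_0)
    have yi: "y$?i = qd z w s (chd v e)" using IH[OF co True] s cA' by blast
    have "s:lq z w (chd v e) <-> s:lq z' w (chd v e)" if z': "z':Rl" "eqn (sc ?i) y (?J$z')" for z'
    proof -
     have "y$?i = qd z' w s (chd v e)" using eqn_in[OF z'(2), of ?i] Jc_q[OF z'(1) s co cA'] by simp
     then show ?thesis using yi qd_emp[OF w co s] by metis
    qed
    then show ?thesis using sc_om[OF io] by blast
   next
    case False then show ?thesis by (intro exI[of _ emp]) simp
   qed
  qed (use s v in simp_all)
  have q: "y$(pi emp (pi s v)) = qd z w s v" if s: "s:om" and vA: "v:A" for s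
   unfolding qd_def
  proof (rule LS_lim[of "%z d. ch z (chd s d) s & pd z w (chd s d) v = emp" _ z y ?J, OF _ _ z y _ ap])
   fix z' assume "z':Rl"
   then show "?J$z'$(pi emp (pi s v)) = LS (%d. ch z' (chd s d) s & pd z' w (chd s d) v = emp)"
    using Jc_q[OF _ s v vA] by (simp add: qd_def del: pi_0)
  next
   fix d assume d: "d:om"
   obtain m where m: "m:om" "!!z z'. eqn m z z' ==> ch z (chd s d) s = ch z' (chd s d) s" using ch_ct[OF s d] by blast
   let ?i = "pi (sc emp) (pi (chd s d) v)"
   have co: "chd s d:om" using s d by simp
   have io: "?i:om" using co v by (simp del: pi_sc)
   obtain l where l: "l:om" "sb m l" "sb (sc ?i) l" by (rule nat_max[OF m(1) sc_om[OF io]])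
   have vB: "v:B" using vA AB sbD by blast
   have "(ch z (chd s d) s & pd z w (chd s d) v = emp) <-> (ch z' (chd s d) s & pd z' w (chd s d) v = emp)"
    if z': "z':Rl" "eqn l z z'" "eqn l y (?J$z')" for z'
   proof -
    have "y$?i = pd z' w (chd s d) v" using eqn_in[OF eqn_mono[OF z'(3) l(3)], of ?i] Jc_p[OF z'(1) co v vB] by simp
    then show ?thesis using p[OF co vB] m(2)[OF eqn_mono[OF z'(2) l(2)]] by metis
   qed
   then show "EX n. n:om & (ALL z'. z':Rl --> eqn n z z' --> eqn n y (?J$z') -->
    ((ch z (chd s d) s & pd z w (chd s d) v = emp) <-> (ch z' (chd s d) s & pd z' w (chd s d) v = emp)))" using l(1) by blast
  qed (use s v in simp_all)
  show "?M v" using p q by blast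
 qed simp
 show "?J$z = y"
 proof (rule Rl_ext[OF fn_ap(2)[OF Jc_fn z] y])
  fix m assume m: "m:om"
  define c s v where "c = q1 m" and "s = q1 (q2 m)" and "v = q2 (q2 m)"
  have csv: "c:om" "s:om" "v:om" and me: "m = pi c (pi s v)" using m by (simp_all add: c_def s_def v_def)
  have Jm: "?J$z'$m = (if c = emp then (if v:A then qd z' w s v else emp) else (if v:B then pd z' w s v else emp))"
   if "z':Rl" for z' using Jc_ap[OF that m] by (simp add: c_def s_def v_def)
  obtain z' where z': "z':Rl" "eqn (sc m) y (?J$z')" using ap[OF sc_om[OF m]] by blast
  have ym: "y$m = ?J$z'$m" using eqn_in[OF z'(2)] by simp
  \<comment> \<open>The first component \<open>c\<close> of the index may be any nonzero number; the
    entry is compared with the one at the canonical index, where \<open>c\<close> is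
    \<open>sc emp\<close>.\<close>
  have pB: "y$m = pd z w s v" if "c ~= emp" "v:B"
  proof -
   let ?m = "pi (sc emp) (pi s v)"
   have mo: "?m:om" using csv by (simp del: pi_sc)
   obtain l where l: "l:om" "sb (sc m) l" "sb (sc ?m) l" by (rule nat_max[OF sc_om[OF m] sc_om[OF mo]])
   obtain z1 where z1: "z1:Rl" "eqn l y (?J$z1)" using ap[OF l(1)] by blast
   have "y$m = ?J$z1$m" "y$?m = ?J$z1$?m" using eqn_in[OF eqn_mono[OF z1(2) l(2)]] eqn_in[OF eqn_mono[OF z1(2) l(3)]] by simp_all
   then show ?thesis using Jm[OF z1(1)] Jc_p[OF z1(1) csv(2,3) that(2)] that main[OF csv(3)] csv(2) by metis
  qed
  have "y$m = qd z w s v" if "c = emp" "v:A" using main[OF csv(3)] csv(2) that me by metis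
  then show "?J$z$m = y$m" using pB Jm[OF z] Jm[OF z'(1)] ym by auto
 qed
qed

lemma Jc_code: assumes "seg L" "jcl L" "!!s v. s:om ==> v:A ==> gd L (%z. qd z w s v)" "!!s v. s:om ==> v:B ==> gd L (%z. pd z w s v)"
 shows "code L (Jc w A B)"
 unfolding code_def
proof (intro conjI allI impI Jc_fn Jc_cgr)
 fix m assume m: "m:om"
 have ge: "gd L (%z. emp)" unfolding gd_def
 proof (intro allI impI)
  fix g Q assume Q: "fn Q om L"
  have "Sep Rl (%z. z:Q$emp):L" using seg_inv[OF assms(1) ct_id fn_ap(2)[OF Q emp_om]] .
  then show "Sep Rl (%z. z:Q$emp):L" .
 qed
 have *: "gd L (%z. if q1 m = emp then (if q2 (q2 m):A then qd z w (q1 (q2 m)) (q2 (q2 m)) else emp)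
  else (if q2 (q2 m):B then pd z w (q1 (q2 m)) (q2 (q2 m)) else emp))"
  by (cases "q1 m = emp"; cases "q2 (q2 m):A"; cases "q2 (q2 m):B") (use assms(3,4) ge m in simp_all)
 show "gd L (%z. Jc w A B$z$m)" unfolding gd_def
 proof (intro allI impI)
  fix g Q assume g: "Ct g" and Q: "fn Q om L"
  have "Sep Rl (%z. z:Q$(Jc w A B$(g$z)$m)) = Sep Rl (%z. z:Q$(if q1 m = emp then (if q2 (q2 m):A then qd (g$z) w (q1 (q2 m)) (q2 (q2 m)) else emp)
  else (if q2 (q2 m):B then pd (g$z) w (q1 (q2 m)) (q2 (q2 m)) else emp)))"
   by (rule RlSep_eqI) (use Jc_ap[OF _ m] ct_Rl[OF Ct_ct[OF g]] in \<open>auto simp: sb_def\<close>)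
  then show "Sep Rl (%z. z:Q$(Jc w A B$(g$z)$m)):L" using * g Q unfolding gd_def by simp
 qed
qed

end

text \<open>Induction on the rank \<alpha> of \<open>u\<close>. With the nodes of smaller rank the
  code \<open>Jc w A A\<close> makes \<open>pd\<close> good at \<alpha> by \<open>stepS\<close>;
  adding these digits, \<open>Jc w A B\<close> makes \<open>qd\<close> good at \<alpha>.\<close>

lemma gd_rank:
 assumes seg: "seg L" and jcl: "jcl L" and ocl: "ocl L" and w: "w:WF" and u: "u:om"
 shows "ALL s. s:om --> gd L (%z. pd z w s u) & gd L (%z. qd z w s u)"
proof -
 let ?P = "%\<alpha>. ALL u s. u:om --> rW w u = \<alpha> --> s:om --> gd L (%z. pd z w s u) & gd L (%z. qd z w s u)"
 have "?P (rW w u)"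
 proof (rule Ord_ind[of "rW w u" ?P])
  fix \<alpha> assume a: "Ord \<alpha>" and IH: "!!\<beta>. \<beta>:\<alpha> ==> ?P \<beta>"
  define A where "A = Sep om (%v. rW w v:\<alpha>)"
  define B where "B = Sep om (%v. rW w v:sc \<alpha>)"
  have mA: "v:A <-> v:om & rW w v:\<alpha>" and mB: "v:B <-> v:om & rW w v:sc \<alpha>" for v
   by (simp_all add: A_def B_def)
  have cB: "v':A" if "v:B" "ch w v' v" for v v'
  proof -
   have v: "v:om" "v':om" using that mB ch_om by blast+
   have "rW w v':rW w v" using rW_mono[OF w v that(2)] .
   then have "rW w v':\<alpha>" using that(1) Ord_trans[OF a] by (auto simp: mB)
   then show ?thesis using v mA by simp
  qed
  have cA: "v':A" if "v:A" "ch w v' v" for v v' using cB[of v v'] that mA mB by simp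
  have sAB: "sb A om" "sb B om" "sb A B" by (auto simp: sb_def mA mB)
  have gA: "gd L (%z. pd z w s v) & gd L (%z. qd z w s v)" if "s:om" "v:A" for s v
   using IH that mA by blast
  have J1: "code L (Jc w A A)"
   by (rule Jc_code[OF w sAB(1) sAB(1) sb_refl cA seg jcl]) (use gA in blast)+
  have p: "gd L (%z. pd z w s u)" if u: "u:om" "rW w u = \<alpha>" "s:om" for u s
   unfolding pd_def
  proof (rule stepS[OF seg jcl ocl J1, of "%z e. ch w (chd u e) u & s:lq z w (chd u e)"])
   fix z e assume z: "z:Rl" and e: "e:om"
   show "EX n. n:om & (ALL z'. z':Rl --> eqn n (jh (Jc w A A) z) (jh (Jc w A A) z') -->
    ((ch w (chd u e) u & s:lq z w (chd u e)) <-> (ch w (chd u e) u & s:lq z' w (chd u e))))"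
   proof (cases "ch w (chd u e) u")
    case True
    have co: "chd u e:om" using u e by simp
    have cA': "chd u e:A" by (rule cB[OF _ True]) (use u mB in simp)
    let ?i = "pi emp (pi s (chd u e))"
    have io: "?i:om" using u co by (simp del: pi_0)
    have "s:lq z w (chd u e) <-> s:lq z' w (chd u e)"
     if z': "z':Rl" "eqn (sc ?i) (jh (Jc w A A) z) (jh (Jc w A A) z')" for z'
    proof -
     have "eqn (sc ?i) (Jc w A A$z) (Jc w A A$z')"
      using eqn_sn[OF sc_om[OF io] z'(2)] z z'(1) code_Rl[OF J1] by (simp add: jh_def)
     then have "Jc w A A$z$?i = Jc w A A$z'$?i" by (rule eqn_in) simp
     then have "qd z w s (chd u e) = qd z' w s (chd u e)"
      using Jc_q[OF z u(3) co cA'] Jc_q[OF z'(1) u(3) co cA'] by metis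
     then show ?thesis using qd_emp[OF w co u(3)] by metis
    qed
    then show ?thesis using sc_om[OF io] by blast
   next
    case False then show ?thesis by (intro exI[of _ emp]) simp
   qed
  qed simp
  have gB: "gd L (%z. pd z w s v)" if "s:om" "v:B" for s v
   using that p[of v s] gA[of s v] by (auto simp: mA mB)
  have J2: "code L (Jc w A B)"
   by (rule Jc_code[OF w sAB cB seg jcl]) (use gA gB in blast)+
  have "gd L (%z. qd z w s u)" if u: "u:om" "rW w u = \<alpha>" "s:om" for u s
   unfolding qd_def
  proof (rule stepS[OF seg jcl ocl J2, of "%z d. ch z (chd s d) s & pd z w (chd s d) u = emp"])
   fix z d assume z: "z:Rl" and d: "d:om"
   obtain m where m: "m:om" "!!z z'. eqn m z z' ==> ch z (chd s d) s = ch z' (chd s d) s" using ch_ct[OF u(3) d] by blast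
   have co: "chd s d:om" using u d by simp
   have uB: "u:B" using u mB by simp
   let ?i = "pi (sc emp) (pi (chd s d) u)"
   have io: "?i:om" using u co by (simp del: pi_sc)
   obtain l where l: "l:om" "sb m l" "sb (sc ?i) l" by (rule nat_max[OF m(1) sc_om[OF io]])
   have "(ch z (chd s d) s & pd z w (chd s d) u = emp) <-> (ch z' (chd s d) s & pd z' w (chd s d) u = emp)"
    if z': "z':Rl" "eqn l (jh (Jc w A B) z) (jh (Jc w A B) z')" for z'
   proof -
    have e: "eqn l z z'" "eqn l (Jc w A B$z) (Jc w A B$z')"
     using eqn_fs[OF l(1) z'(2)] eqn_sn[OF l(1) z'(2)] z z'(1) code_Rl[OF J2] by (simp_all add: jh_def)
    have "pd z w (chd s d) u = pd z' w (chd s d) u"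
     using eqn_in[OF eqn_mono[OF e(2) l(3)], of ?i] Jc_p[OF z co u(1) uB] Jc_p[OF z'(1) co u(1) uB] by simp
    then show ?thesis using m(2)[OF eqn_mono[OF e(1) l(2)]] by metis
   qed
   then show "EX n. n:om & (ALL z'. z':Rl --> eqn n (jh (Jc w A B) z) (jh (Jc w A B) z') -->
    ((ch z (chd s d) s & pd z w (chd s d) u = emp) <-> (ch z' (chd s d) s & pd z' w (chd s d) u = emp)))" using l(1) by blast
  qed simp
  then show "?P \<alpha>" using p by blast
 qed (use w u in simp_all)
 then show ?thesis using u by blast
qed

text \<open>\<open>X\<close> is outside \<open>L\<close>, but all its parts of bounded rank are in \<open>L\<close>; such an \<open>X\<close> is a pivot because the
 minimum of two ranks, one of which is always defined, is bounded by a single countable ordinal.\<close>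

definition C2 where "C2 L X f <-> sb X Rl & ~X:L & Ct f & (ALL x. x:X --> f$x:WF) &
 (ALL w. w:WF --> Sep X (%x. emp:lq (f$x) w emp):L)"

lemma case2:
 assumes seg: "seg L" and jcl: "jcl L" and ocl: "ocl L" and C: "C2 L X f"
 shows "pv L X"
 unfolding pv_def
proof (intro conjI allI impI)
 have X: "sb X Rl" "~X:L" and f: "Ct f" and XW: "!!x. x:X ==> f$x:WF"
  and XL: "!!w. w:WF ==> Sep X (%x. emp:lq (f$x) w emp):L" using C unfolding C2_def by blast+
 show "sb X Rl" "~X:L" using X .
 note cf = Ct_ct[OF f]
 fix S assume S: "sb S Rl" "wle S X" "wle (cmp S) X"
 obtain g where g: "ct (ap g)" "!!x. x:Rl ==> x:S <-> g$x:X" using wleE[OF S(2)] by metis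
 obtain h where h: "ct (ap h)" "!!x. x:Rl ==> x:cmp S <-> h$x:X" using wleE[OF S(3)] by metis
 have c1: "ct (%z. f$(g$z))" and c2: "ct (%z. f$(h$z))" using ct_comp[OF cf g(1)] ct_comp[OF cf h(1)] .
 let ?F = "%z. prt (f$(g$z)) (f$(h$z))"
 have R: "f$(g$z):Rl" "f$(h$z):Rl" if "z:Rl" for z using ct_Rl[OF c1 that] ct_Rl[OF c2 that] .
 have W: "?F z:WF" if z: "z:Rl" for z
 proof -
  have "f$(g$z):WF | f$(h$z):WF" using g(2)[OF z] h(2)[OF z] XW z by auto
  then show ?thesis unfolding mem_WF using prt fs_Rl sn_Rl by metis
 qed
 obtain B where B: "B:WF" "!!z. z:Rl ==> sb (rw (?F z)) (rw B)" using Bound[OF ct_prt[OF c1 c2] W] by blast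
 define XB where "XB = Sep X (%x. emp:lq (f$x) B emp)"
 have mX: "x:XB <-> x:X & emp:lq (f$x) B emp" for x by (simp add: XB_def)
 have XB: "XB:L" unfolding XB_def by (rule XL[OF B(1)])
 \<comment> \<open>If the tree at \<open>g$z\<close> is within the bound, \<open>S\<close> is read
   off from \<open>g$z\<close>; otherwise the tree at \<open>h$z\<close> is, and \<open>S\<close> is
   the negation of what \<open>h$z\<close> says.\<close>
 define Q where "Q n = (if n = emp then Sep Rl (%z. g$z:XB) else cmp (Sep Rl (%z. h$z:XB)))" for n
 have mQ: "z:Q n <-> z:Rl & (if n = emp then g$z:XB else ~h$z:XB)" for z n by (auto simp: Q_def)
 have QL: "Q n:L" for n unfolding Q_def using seg_inv[OF seg g(1) XB] seg_cmp[OF seg seg_inv[OF seg h(1) XB]] by simp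
 have dq: "dt (%s. Q (s 0))" unfolding Q_def by simp
 have "Sep Rl (%z. z:Q (qd (f$(g$z)) B emp emp)):L"
  by (rule gd_use[OF _ _ c1, of L "%x. qd x B emp emp" Q]) (use gd_rank[OF seg jcl ocl B(1) emp_om] dq QL in auto)
 moreover have "S = Sep Rl (%z. z:Q (qd (f$(g$z)) B emp emp))"
 proof (rule RlSep_eqI[OF _ S(1)])
  show "dp (%s. s 0:Q (qd (f$(g$s 0)) B emp emp))" unfolding mQ by simp
  fix z assume z: "z:Rl"
  have c: "f$(g$z):WF & sb (rw (f$(g$z))) (rw B) | f$(h$z):WF & sb (rw (f$(h$z))) (rw B)"
   using prt_min[OF R[OF z] W[OF z]] B(2)[OF z] sb_trans by blast
  have i: "emp:lq x B emp" if "x:WF" "sb (rw x) (rw B)" for x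
   using lq_WF[OF B(1) emp_om that(1) emp_om] that(2) by (simp add: rw_def)
  show "z:S <-> z:Q (qd (f$(g$z)) B emp emp)"
  proof (cases "emp:lq (f$(g$z)) B emp")
   case True
   then show ?thesis unfolding mQ using qd_emp[OF B(1) emp_om emp_om] mX g(2)[OF z] z by auto
  next
   case False
   then have "emp:lq (f$(h$z)) B emp" using c i by blast
   then show ?thesis unfolding mQ using False qd_emp[OF B(1) emp_om emp_om] mX h(2)[OF z] z by auto
  qed
 qed
 ultimately show "S:L" by simp
qed

section \<open>A segment without a set just above it contains the difference class\<close>

text \<open>The class \<open>\<Delta>(D\<^sup>*\<^sub>\<omega>(\<Pi>\<^sup>1\<^sub>1))\<close>: the membership of \<open>x\<close> depends on the least \<open>i\<close> at which the \<open>i\<close>-th tree attached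
 to \<open>x\<close> is ill-founded, and there always is such an \<open>i\<close>.\<close>

definition DC where "DC A <-> sb A Rl & (EX f v. Ct f & v:Rl & (ALL x. x:Rl --> (EX i. i:om & ~cl (f$x) i:WF)) &
 (ALL x. x:Rl --> (x:A <-> v$(lst (%i. i:om & ~cl (f$x) i:WF)) = emp)))"
lemma dp_DC [simp]: "dt a ==> dp (%s. DC (a s))" by (rule dp_lift1) (simp_all add: DC_def)

text \<open>By \<open>rle_rW\<close> the tree \<open>w\<close> and the node \<open>u\<close>
  representing \<alpha> do not matter, so ranks can be minimized as ordinals.\<close>

definition rle where "rle x s \<alpha> <-> (EX w u. w:WF & u:om & rW w u = \<alpha> & s:lq x w u)"
lemma dp_rle [simp]: "dt a ==> dt b ==> dt c ==> dp (%s. rle (a s) (b s) (c s))"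
 by (rule dp_lift3) (simp_all add: rle_def)

lemma rle_rW: assumes "w:WF" "u:om" shows "rle x s (rW w u) <-> s:lq x w u"
 unfolding rle_def using assms lq_mono[OF _ assms(1)] sb_refl by metis

lemma rW_le_root: assumes x: "x:WF" and s: "s:om" shows "sb (rW x s) (rw x)"
proof -
 have *: "sb (rW x (kap b n)) (rw x)" if b: "b:Rl" and n: "n:om" for b n
 proof (rule nat_ind[OF n])
  show "sb (rW x (kap b emp)) (rw x)" by (simp add: rw_def)
  fix n assume n: "n:om" and IH: "sb (rW x (kap b n)) (rw x)"
  have k: "kap b n:om" "kap b (sc n):om" using b n by (simp_all del: kap_sc)
  show "sb (rW x (kap b (sc n))) (rw x)"
  proof (cases "inn x b (sc n)")
   case True
   have "rW x (kap b (sc n)):rW x (kap b n)" by (rule rW_mono[OF x k ch_kapI[OF b n True]])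
   then show ?thesis using Ord_sb[OF Ord_rW[OF x k(1)]] IH sb_trans by blast
  next
   case False
   have "sb (rW x (kap b (sc n))) emp" unfolding rW_def
   proof (rule rW_facts(3)[OF x k(2)])
    fix y assume "y:om" "ch x y (kap b (sc n))"
    then obtain b' where b': "b':Rl" "eqn (sc n) b' b" "inn x b' (sc (sc n))" using ch_kapD[OF _ b sc_om[OF n]] by metis
    then have "inn x b (sc n)" using inn_cong[OF sc_om[OF n] b'(2), of x] b'(3) unfolding inn_sc[of x b' "sc n"] by blast
    then show "rk om (ch x) y:emp" using False by blast
   qed simp
   then show ?thesis by (simp add: sb_def)
  qed
 qed simp
 show ?thesis using *[OF ex(1)[OF s] ln_om[OF s]] ex(2)[OF s] by simp
qed

lemma Sep_Sep_sub: "sb K R ==> Sep K (%x. x:Sep R (%x. x:A)) = Sep K (%x. x:A)"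
 by (rule ext) (auto simp: sb_def)

section \<open>Shrinking sets on which \<open>A\<close> stays outside the segment\<close>

context
 fixes L A f v
 assumes seg: "seg L" and jcl: "jcl L" and ocl: "ocl L" and no2: "!!X f. ~C2 L X f"
  and A: "sb A Rl" and f: "Ct f" and v: "v:Rl" and fW: "!!x. x:Rl ==> EX i. i:om & ~cl (f$x) i:WF"
  and fA: "!!x. x:Rl ==> x:A <-> v$(lst (%i. i:om & ~cl (f$x) i:WF)) = emp"
begin

definition chi where "chi N x = (if x:N then emp else sc emp)"

text \<open>If \<open>A\<close> of the difference class is outside \<open>L\<close>, the sets \<open>Nn n\<close> shrink to a single real \<open>x\<close>,
 staying outside \<open>L\<close> and fixing more and more ranks of nodes of the trees attached to \<open>x\<close>. So these trees
 are all well-founded, a contradiction.\<close>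

definition IN where "IN N <-> sb N Rl & gd L (chi N) & ~Sep N (%x. x:A):L"
lemma dt_chi [simp]: "dt a ==> dt b ==> dt (%s. chi (a s) (b s))" unfolding chi_def by simp
lemma chi_om [simp]: "chi N x:om" by (simp add: chi_def)
lemma dp_IN [simp]: "dt a ==> dp (%s. IN (a s))"
 by (rule dp_lift1) (simp_all add: IN_def)

lemma gd_chi: assumes "gd L (chi N)" "gd L a" "dt (%s. a (s 0))" "!!z. z:Rl ==> a z:om"
 shows "gd L (chi (Sep N (%x. a x = e)))"
proof -
 have "gd L (%x. (%m n. if m = emp & n = e then emp else sc emp) (chi N x) (a x))"
  by (rule gd_comb[OF assms(1) _ _ assms(2)]) (use assms in auto)
 moreover have "chi (Sep N (%x. a x = e)) = (%x. (%m n. if m = emp & n = e then emp else sc emp) (chi N x) (a x))"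
  using assms(3) by (auto simp: chi_def)
 ultimately show ?thesis by simp
qed

lemma restr: assumes "gd L (chi N)" "Y:L" "sb N Rl" shows "Sep N (%x. x:Y):L"
proof -
 have "Sep Rl (%z. z:(if chi N z = emp then Y else emp)):L"
  by (rule gd_use[OF assms(1) _ ct_id, of "%n. if n = emp then Y else emp"]) (use assms seg_emp[OF seg] in auto)
 moreover have "Sep Rl (%z. z:(if chi N z = emp then Y else emp)) = Sep N (%x. x:Y)"
  by (rule ext) (use assms(3) in \<open>auto simp: chi_def sb_def\<close>)
 ultimately show ?thesis by simp
qed

text \<open>Otherwise all pieces of the partition along \<open>a\<close> would give members of
  \<open>L\<close>, and so would their union, as \<open>a\<close> is good.\<close>

lemma IN_split: assumes N: "IN N" and a: "gd L a" "dt (%s. a (s 0))" "!!z. z:Rl ==> a z:om"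
 shows "EX e. e:om & IN (Sep N (%x. a x = e))"
proof (rule ccontr)
 assume no: "~?thesis"
 have da: "dt (%s. a (b s))" if "dt b" for b using dt_sub1[OF a(2) that] .
 have s: "sb N Rl" and g: "gd L (chi N)" using N IN_def by auto
 define Q where "Q e = Sep (Sep N (%x. a x = e)) (%x. x:A)" for e
 have mQ: "z:Q e <-> z:N & a z = e & z:A" for z e unfolding Q_def using da by simp
 have dQ: "dt (%s. Q (s 0))" unfolding Q_def using da by simp
 have "Q e:L" if "e:om" for e
  using no that gd_chi[OF g a, of e] s unfolding IN_def Q_def by (auto simp: sb_def da)
 then have "Sep Rl (%z. z:Q (a z)):L" using gd_use[OF a(1,2) ct_id dQ] a(3) by blast
 moreover have "Sep Rl (%z. z:Q (a z)) = Sep N (%x. x:A)"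
  by (rule ext) (use s da in \<open>auto simp: sb_def mQ\<close>)
 ultimately show False using N IN_def by simp
qed

lemma IN_flip: assumes N: "IN N" shows "~Sep N (%x. ~x:A):L"
proof
 assume Y: "Sep N (%x. ~x:A):L"
 have s: "sb N Rl" and g: "gd L (chi N)" using N IN_def by auto
 have "Sep N (%x. x:A) = Sep N (%x. x:cmp (Sep N (%x. ~x:A)))"
  by (rule ext) (use s in \<open>auto simp: sb_def\<close>)
 then show False using restr[OF g seg_cmp[OF seg Y] s] N IN_def by simp
qed

lemma IN_ne: assumes "IN N" shows "EX x. x:N"
proof (rule ccontr)
 assume "~?thesis"
 then have "Sep N (%x. x:A) = emp" unfolding emp_iff by simp
 then show False using assms seg_emp[OF seg] IN_def by simp
qed

definition rs where "rs N i s \<alpha> = Sep N (%x. rle (cl (f$x) i) s \<alpha>)"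
lemma dt_rs [simp]: "dt a ==> dt b ==> dt c ==> dt d ==> dt (%s. rs (a s) (b s) (c s) (d s))"
 by (rule dt_lift4) (simp_all add: rs_def)
lemma mem_rs [simp]: "x:rs N i s \<alpha> <-> x:N & rle (cl (f$x) i) s \<alpha>" by (simp add: rs_def)

lemma ct_col: "i:om ==> ct (%x. cl (f$x) i)" using ct_cl[OF Ct_ct[OF f]] .

lemma gd_rs: assumes "gd L (chi N)" "w:WF" "u:om" "i:om" "s:om" shows "gd L (chi (rs N i s (rW w u)))"
proof -
 have "gd L (%z. qd z w s u)" using gd_rank[OF seg jcl ocl assms(2,3)] assms(5) by blast
 then have "gd L (%x. qd (cl (f$x) i) w s u)" by (rule gd_comp[OF _ _ ct_col[OF assms(4)]]) simp
 then have "gd L (chi (Sep N (%x. qd (cl (f$x) i) w s u = emp)))" by (rule gd_chi[OF assms(1)]) simp_all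
 moreover have "Sep N (%x. qd (cl (f$x) i) w s u = emp) = rs N i s (rW w u)"
  by (rule ext) (use assms in \<open>simp add: rle_rW qd_emp\<close>)
 ultimately show ?thesis by simp
qed

text \<open>On the part \<open>X\<close> where \<open>A\<close> disagrees with the value prescribed
  for index \<open>n\<close>, the \<open>n\<close>-th tree cannot be the first ill-founded one, so
  it is well-founded. \<open>X\<close> is outside \<open>L\<close> but does not satisfy
  \<open>C2\<close>; hence a part of bounded rank is outside \<open>L\<close> already.\<close>

lemma IN_rank: assumes N: "IN N" and n: "n:om" and W: "!!x i. x:N ==> i:n ==> cl (f$x) i:WF"
 shows "EX \<alpha>. Ord \<alpha> & IN (rs N n emp \<alpha>)"
proof -
 have s: "sb N Rl" and g: "gd L (chi N)" and nL: "~Sep N (%x. x:A):L" using N IN_def by auto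
 define X where "X = Sep N (%x. x:A <-> v$n ~= emp)"
 have mX: "x:X <-> x:N & (x:A <-> v$n ~= emp)" for x by (simp add: X_def)
 have XL: "~X:L" using nL IN_flip[OF N] by (cases "v$n = emp") (simp_all add: X_def)
 have XW: "cl (f$x) n:WF" if x: "x:X" for x
 proof (rule ccontr)
  assume nw: "~cl (f$x) n:WF"
  have xN: "x:N" "x:Rl" using x mX s sbD by blast+
  let ?P = "%i. i:om & ~cl (f$x) i:WF"
  have d: "dp (%s. ?P (s 0))" by simp
  have P: "?P n" using n nw by simp
  note l = lst[of ?P, OF d nat_Ord[OF n] P]
  have "lst ?P = n" using l(2) W[OF xN(1)] nat_lin[of "lst ?P" n] n l(4) P by blast
  then show False using fA[OF xN(2)] x mX by simp
 qed
 have "~C2 L X (Lam Rl (%x. cl (f$x) n))" using no2 .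
 moreover have XR: "sb X Rl" using s by (auto simp: sb_def mX)
 moreover have ap: "Lam Rl (%x. cl (f$x) n)$x = cl (f$x) n" if "x:X" for x using XR sbD that by simp
 ultimately obtain w where w: "w:WF" "~Sep X (%x. emp:lq (Lam Rl (%x. cl (f$x) n)$x) w emp):L"
  unfolding C2_def using XL ct_Ct[OF ct_col[OF n]] XW by auto
 let ?N = "rs N n emp (rW w emp)"
 have e: "Sep X (%x. emp:lq (Lam Rl (%x. cl (f$x) n)$x) w emp) = Sep ?N (%x. x:A <-> v$n ~= emp)"
 proof (rule ext)
  fix x show "x:Sep X (%x. emp:lq (Lam Rl (%x. cl (f$x) n)$x) w emp) <-> x:Sep ?N (%x. x:A <-> v$n ~= emp)"
   using ap[of x] rle_rW[OF w(1) emp_om] mX[of x] by (cases "x:X") auto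
 qed
 have gN: "gd L (chi ?N)" by (rule gd_rs[OF g w(1) emp_om n emp_om])
 have sN: "sb ?N Rl" using s by (auto simp: sb_def)
 have "IN ?N" unfolding IN_def
 proof (intro conjI gN sN notI)
  assume Y: "Sep ?N (%x. x:A):L"
  show False
  proof (cases "v$n = emp")
   case True
   have "Sep ?N (%x. x:A <-> v$n ~= emp) = Sep ?N (%x. x:cmp (Sep ?N (%x. x:A)))"
    by (rule ext) (use True sN in \<open>auto simp: sb_def\<close>)
   then show False using restr[OF gN seg_cmp[OF seg Y] sN] w(2) e by simp
  next
   case False then show False using Y w(2) e by simp
  qed
 qed
 then show ?thesis using Ord_rW[OF w(1) emp_om] by blast
qed

text \<open>A bound for the root bounds every node, so there is some bound that preserves
  \<open>IN\<close>, and hence a least one.\<close>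

lemma IN_node: assumes N: "IN N" and s: "s:om" and r: "!!x. x:N ==> rle (cl (f$x) i) emp \<xi>" and i: "i:om"
 shows "IN (rs N i s \<xi>)" "Ord \<xi>"
proof -
 obtain x0 where x0: "x0:N" using IN_ne[OF N] by blast
 obtain w u where w: "w:WF" "u:om" "\<xi> = rW w u" using r[OF x0] unfolding rle_def by blast
 have NR: "sb N Rl" using N IN_def by simp
 have "rle (cl (f$x) i) s \<xi>" if x: "x:N" for x
 proof -
  have xR: "cl (f$x) i:Rl" using ct_Rl[OF ct_col[OF i]] x NR sbD by blast
  have l: "emp:lq (cl (f$x) i) w u" using r[OF x] unfolding w(3) rle_rW[OF w(1,2)] .
  have xW: "cl (f$x) i:WF" using lq_root[OF w(1,2) xR l] .
  have "sb (rW (cl (f$x) i) s) (rW w u)"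
   using rW_le_root[OF xW s] l lq_WF[OF w(1,2) xW emp_om] sb_trans by (simp add: rw_def)
  then show ?thesis unfolding w(3) rle_rW[OF w(1,2)] using lq_WF[OF w(1,2) xW s] by blast
 qed
 then have "rs N i s \<xi> = N" by (auto intro!: ext)
 then show "IN (rs N i s \<xi>)" "Ord \<xi>" using N w by simp_all
qed

definition cR where "cR N i s = rs N i s (lst (%\<alpha>. IN (rs N i s \<alpha>)))"
definition dg where "dg N n = lst (%d. d:om & IN (Sep N (%x. x$n = d)))"
definition cD where "cD N n = Sep N (%x. x$n = dg N n)"
lemma dt_cR [simp]: "dt a ==> dt b ==> dt c ==> dt (%s. cR (a s) (b s) (c s))"
 by (rule dt_lift3) (simp_all add: cR_def)
lemma dt_dg [simp]: "dt a ==> dt b ==> dt (%s. dg (a s) (b s))"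
 by (rule dt_lift2) (simp_all add: dg_def)
lemma dt_cD [simp]: "dt a ==> dt b ==> dt (%s. cD (a s) (b s))"
 by (rule dt_lift2) (simp_all add: cD_def)

lemma cR: assumes "Ord \<alpha>" "IN (rs N i s \<alpha>)" shows "IN (cR N i s)"
 "!!\<beta>. Ord \<beta> ==> IN (rs N i s \<beta>) ==> sb (lst (%\<alpha>. IN (rs N i s \<alpha>))) \<beta>" "Ord (lst (%\<alpha>. IN (rs N i s \<alpha>)))"
proof -
 have d: "dp (%t. IN (rs N i s (t 0)))" by simp
 show "IN (cR N i s)" "Ord (lst (%\<alpha>. IN (rs N i s \<alpha>)))" unfolding cR_def using lst(1,2)[of "%\<alpha>. IN (rs N i s \<alpha>)", OF d assms] by blast+
 show "sb (lst (%\<alpha>. IN (rs N i s \<alpha>))) \<beta>" if "Ord \<beta>" "IN (rs N i s \<beta>)" for \<beta>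
  using lst(3)[of "%\<alpha>. IN (rs N i s \<alpha>)", OF d that] .
qed

lemma cD: assumes N: "IN N" and n: "n:om" shows "IN (cD N n)" "dg N n:om"
proof -
 obtain d where d: "d:om" "IN (Sep N (%x. x$n = d))" using IN_split[OF N gd_digit[OF seg jcl n]] n by auto
 have dd: "dp (%s. s 0:om & IN (Sep N (%x. x$n = s 0)))" by simp
 have *: "d:om & IN (Sep N (%x. x$n = d))" using d by blast
 show "IN (cD N n)" "dg N n:om"
  using lst(2)[of "%d. d:om & IN (Sep N (%x. x$n = d))", OF dd nat_Ord[OF d(1)] *] unfolding cD_def dg_def by blast+
qed

text \<open>Stage \<open>n\<close> fixes digit \<open>n\<close>, bounds the rank of the
  \<open>n\<close>-th tree, and then minimizes the rank of node \<open>q2 n\<close> in tree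
  \<open>q1 n\<close>. Since \<open>q1 n\<close> is at most \<open>n\<close>, the root of that tree
  has been bounded by then.\<close>

definition mid where "mid n N = cR (cD N n) n emp"
definition nx where "nx n N = cR (mid n N) (q1 n) (q2 n)"
definition Nn where "Nn n = natrec Rl nx n"
lemma dt_mid [simp]: "dt a ==> dt b ==> dt (%s. mid (a s) (b s))" by (simp add: mid_def)
lemma dt_nx [simp]: "dt a ==> dt b ==> dt (%s. nx (a s) (b s))" by (simp add: nx_def)
lemma dt_Nn [simp]: "dt a ==> dt (%s. Nn (a s))" by (simp add: Nn_def)
lemma Nn_0: "Nn emp = Rl" and Nn_sc: "n:om ==> Nn (sc n) = nx n (Nn n)" by (simp_all add: Nn_def)

lemma cR_sb: "sb (cR N i s) N" by (simp add: cR_def sb_def)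
lemma cD_sb: "sb (cD N n) N" by (simp add: cD_def sb_def)
lemma nx_sb: "sb (nx n N) (mid n N)" "sb (mid n N) N"
 unfolding nx_def mid_def using cR_sb cD_sb sb_trans by blast+

definition inv where "inv n N <-> IN N & (ALL i. i:n --> (EX \<xi>. ALL x. x:N --> rle (cl (f$x) i) emp \<xi>))"

lemma rle_WF: assumes "x:Rl" "rle x emp \<xi>" shows "x:WF"
 using assms lq_root unfolding rle_def by blast

lemma step: assumes n: "n:om" and i: "inv n N"
 shows "inv (sc n) (nx n N)" "IN (mid n N)" "EX \<alpha>. Ord \<alpha> & IN (rs (mid n N) (q1 n) (q2 n) \<alpha>)"
proof -
 have N: "IN N" and r: "!!i. i:n ==> EX \<xi>. ALL x. x:N --> rle (cl (f$x) i) emp \<xi>" using i inv_def by auto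
 have W: "cl (f$x) i:WF" if x: "x:cD N n" and i: "i:n" for x i
 proof -
  have xN: "x:N" using x cD_sb sbD by blast
  have "x:Rl" using xN N sbD unfolding IN_def by blast
  then show ?thesis using rle_WF r[OF i] xN ct_Rl[OF ct_col[OF nat_in[OF n i]]] by blast
 qed
 obtain \<alpha> where "Ord \<alpha>" "IN (rs (cD N n) n emp \<alpha>)" using IN_rank[OF cD(1)[OF N n] n W] by blast
 then show m: "IN (mid n N)" unfolding mid_def by (rule cR(1))
 have r2: "EX \<xi>. ALL x. x:mid n N --> rle (cl (f$x) i) emp \<xi>" if i: "i:sc n" for i
 proof (cases "i = n")
  case True
  show ?thesis unfolding True by (rule exI[of _ "lst (%\<alpha>. IN (rs (cD N n) n emp \<alpha>))"]) (simp add: mid_def cR_def)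
 next
  case False then show ?thesis using i r[of i] nx_sb(2) sbD by (metis mem_sc)
 qed
 have "q1 n:sc (pi (q1 n) (q2 n))" by (rule pi_ge) (use n in simp_all)
 then have q1: "q1 n:sc n" using n by simp
 obtain \<xi> where \<xi>: "!!x. x:mid n N ==> rle (cl (f$x) (q1 n)) emp \<xi>" using r2[OF q1] by blast
 note nd = IN_node[OF m q2_om[OF n] \<xi> q1_om[OF n]]
 show "EX \<alpha>. Ord \<alpha> & IN (rs (mid n N) (q1 n) (q2 n) \<alpha>)" using nd by blast
 have "IN (nx n N)" unfolding nx_def by (rule cR(1)[OF nd(2,1)])
 then show "inv (sc n) (nx n N)" unfolding inv_def using r2 nx_sb(1) sbD by meson
qed

lemma nocase_in: "A:L"
proof (rule ccontr)
 assume AL: "~A:L"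
 have I0: "inv emp Rl"
 proof -
  have "gd L (chi Rl)" unfolding gd_def
  proof (intro allI impI)
   fix g Q assume g: "Ct g" and Q: "fn Q om L"
   have "Sep Rl (%z. z:Q$emp):L" using seg_inv[OF seg ct_id fn_ap(2)[OF Q emp_om]] .
   moreover have "Sep Rl (%z. z:Q$emp) = Sep Rl (%z. z:Q$(chi Rl (g$z)))"
    by (rule ext) (use ct_Rl[OF Ct_ct[OF g]] in \<open>auto simp: chi_def\<close>)
   ultimately show "Sep Rl (%z. z:Q$(chi Rl (g$z))):L" by simp
  qed
  moreover have "Sep Rl (%x. x:A) = A" by (rule ext) (use A in \<open>auto simp: sb_def\<close>)
  ultimately show ?thesis using AL by (simp add: inv_def IN_def)
 qed
 have I: "inv n (Nn n)" if n: "n:om" for n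
 proof (rule nat_ind[OF n])
  show "dp (%s. inv (s 0) (Nn (s 0)))" by (simp add: inv_def)
  show "inv emp (Nn emp)" using I0 Nn_0 by simp
  show "inv (sc n) (Nn (sc n))" if "n:om" "inv n (Nn n)" for n unfolding Nn_sc[OF that(1)] by (rule step(1)[OF that])
 qed
 have NI: "IN (Nn n)" if "n:om" for n using I[OF that] inv_def by blast
 have NR: "sb (Nn n) Rl" if "n:om" for n using NI[OF that] IN_def by blast
 have dec: "sb n m --> sb (Nn m) (Nn n)" if n: "n:om" and m: "m:om" for n m
 proof (rule nat_ind[OF m])
  show "sb n emp --> sb (Nn emp) (Nn n)" using sb_antisym[of n emp] by (auto simp: sb_def)
  fix m assume m: "m:om" and IH: "sb n m --> sb (Nn m) (Nn n)"
  have "n = sc m | sb n m" if "sb n (sc m)"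
   using that Ord_sb_iff[OF nat_Ord[OF n] nat_Ord[OF sc_om[OF m]]] Ord_sb[OF nat_Ord[OF m]] by auto
  moreover have "sb (Nn (sc m)) (Nn m)" unfolding Nn_sc[OF m] using nx_sb sb_trans by blast
  ultimately show "sb n (sc m) --> sb (Nn (sc m)) (Nn n)" using IH sb_trans sb_refl by metis
 qed simp
 define y where "y = Lam om (%n. dg (Nn n) n)"
 have y: "y:Rl" unfolding y_def by (rule RlI) (use cD(2)[OF NI] in auto)
 have yn: "x$n = y$n" if "n:om" "x:Nn (sc n)" for x n
 proof -
  have "x:cD (Nn n) n" using that(2) Nn_sc[OF that(1)] cR_sb sbD unfolding nx_def mid_def by metis
  then show ?thesis using that by (simp add: y_def cD_def)
 qed
 have ey: "eqn m y x" if m: "m:om" and x: "x:Nn m" for m x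
  unfolding eqn_def
 proof (intro allI impI)
  fix k assume k: "k:m"
  have ko: "k:om" using nat_in[OF m k] .
  have "sc k:sc m" using sc_mem_sc nat_Ord m k by blast
  then have "sb (sc k) m" using Ord_sb[OF nat_Ord[OF m]] by auto
  then have "x:Nn (sc k)" using dec[OF sc_om[OF ko] m] x sbD by blast
  then show "y$k = x$k" using yn[OF ko] by simp
 qed
 \<comment> \<open>The least rank bounds met on the way. They will be seen to decrease along the
   trees attached to the limit \<open>y\<close>.\<close>
 define a where "a n = lst (%\<alpha>. IN (rs (mid n (Nn n)) (q1 n) (q2 n) \<alpha>))" for n
 have da: "dt (%s. a (b s))" if "dt b" for b unfolding a_def using dt_pushes[OF that] by simp
 have aO: "Ord (a n)" and al: "!!\<beta>. Ord \<beta> ==> IN (rs (mid n (Nn n)) (q1 n) (q2 n) \<beta>) ==> sb (a n) \<beta>" if n: "n:om" for n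
 proof -
  obtain \<alpha> where "Ord \<alpha>" "IN (rs (mid n (Nn n)) (q1 n) (q2 n) \<alpha>)" using step(3)[OF n I[OF n]] by blast
  note c = cR(2,3)[OF this]
  show "Ord (a n)" unfolding a_def using c(2) .
  show "sb (a n) \<beta>" if "Ord \<beta>" "IN (rs (mid n (Nn n)) (q1 n) (q2 n) \<beta>)" for \<beta> unfolding a_def using c(1)[OF that] .
 qed
 have ar: "rle (cl (f$x) i) s (a (pi i s))" if "i:om" "s:om" "x:Nn (sc (pi i s))" for x i s
 proof -
  have p: "pi i s:om" using that by simp
  show ?thesis using that unfolding Nn_sc[OF p] nx_def cR_def a_def by simp
 qed
 have desc: "a (pi i s'):a (pi i s)" if i: "i:om" and s: "s:om" and c: "ch (cl (f$y) i) s' s" for i s s'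
 proof -
  have s': "s':om" using ch_om[OF c s] .
  obtain d where d: "d:om" "s' = chd s d" using c ch_def by blast
  have p: "pi i s:om" "pi i s':om" using i s s' by simp_all
  obtain m0 where m0: "m0:om" "!!z z'. eqn m0 z z' ==> ch z s' s = ch z' s' s" using ch_ct[OF s d(1)] d(2) by blast
  obtain m where m: "m:om" "!!x. x:Rl ==> eqn m y x ==> eqn m0 (cl (f$y) i) (cl (f$x) i)"
   using ct_eqn[OF ct_col[OF i] y m0(1)] by blast
  obtain l1 where l1: "l1:om" "sb m l1" "sb (sc (pi i s)) l1" by (rule nat_max[OF m(1) sc_om[OF p(1)]])
  obtain l where l: "l:om" "sb l1 l" "sb (sc (pi i s')) l" by (rule nat_max[OF l1(1) sc_om[OF p(2)]])
  let ?N = "Nn l"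
  have sub: "sb ?N (Nn (sc (pi i s)))" "sb ?N (Nn (sc (pi i s')))"
   using dec[OF sc_om[OF p(1)] l(1)] dec[OF sc_om[OF p(2)] l(1)] l l1 sb_trans by blast+
  have chx: "ch (cl (f$x) i) s' s" if x: "x:?N" for x
  proof -
   have "eqn m y x" using ey[OF l(1) x] eqn_mono l(2) l1(2) by blast
   then show ?thesis using m(2)[of x] m0(2) c x NR[OF l(1)] sbD by blast
  qed
  have rx: "rle (cl (f$x) i) s (a (pi i s))" if "x:?N" for x using ar[OF i s] sub(1) sbD that by blast
  obtain x0 where x0: "x0:?N" using IN_ne[OF NI[OF l(1)]] by blast
  obtain w u where w: "w:WF" "u:om" "rW w u = a (pi i s)" using rx[OF x0] rle_def by blast
  have pn: "pd (cl (f$x) i) w s' u ~= emp" if x: "x:?N" for x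
  proof -
   have "s:lq (cl (f$x) i) w u" using rx[OF x] w(3) rle_rW[OF w(1,2)] by metis
   then show ?thesis using chx[OF x] mem_lq[OF w(1,2)] pd_emp[OF w(2)] by metis
  qed
  have "gd L (%z. pd z w s' u)" using gd_rank[OF seg jcl ocl w(1,2)] s' by blast
  then have "gd L (%x. pd (cl (f$x) i) w s' u)" by (rule gd_comp[OF _ _ ct_col[OF i]]) simp
  \<comment> \<open>Each point of \<open>?N\<close> has a child of \<open>u\<close> witnessing that
    the rank of \<open>s'\<close> is below \<open>a (pi i s)\<close>; splitting along the witness
    makes it the same child for all points of \<open>?K\<close>.\<close>
  from IN_split[OF NI[OF l(1)] this] obtain e0 where e0: "e0:om" "IN (Sep ?N (%x. pd (cl (f$x) i) w s' u = e0))" by auto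
  let ?K = "Sep ?N (%x. pd (cl (f$x) i) w s' u = e0)"
  have mK: "x:?K <-> x:?N & pd (cl (f$x) i) w s' u = e0" for x by simp
  obtain x1 where x1: "x1:?K" using IN_ne[OF e0(2)] by blast
  obtain e where e: "e:om" "e0 = sc e" using nat_cases[OF e0(1)] x1 pn mK by metis
  have pe: "ch w (chd u e) u & s':lq (cl (f$x) i) w (chd u e)" if "x:?K" for x
  proof -
   have "LS (%e. ch w (chd u e) u & s':lq (cl (f$x) i) w (chd u e)) = sc e"
    using that mK[of x] e(2) unfolding pd_def[symmetric] by blast
   then show ?thesis using LS_sc[OF _ e(1), of "%e. ch w (chd u e) u & s':lq (cl (f$x) i) w (chd u e)"] by simp
  qed
  have ue: "chd u e:om" using w e by simp
  let ?b = "rW w (chd u e)"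
  have bm: "?b:a (pi i s)" using rW_mono[OF w(1,2) ue] pe[OF x1] w(3) by metis
  let ?M = "mid (pi i s') (Nn (pi i s'))"
  have q: "q1 (pi i s') = i" "q2 (pi i s') = s'" using i s' by simp_all
  have M: "IN ?M" by (rule step(2)[OF p(2) I[OF p(2)]])
  have gM: "gd L (chi (rs ?M i s' ?b))" by (rule gd_rs[OF _ w(1) ue i s']) (use M IN_def in blast)
  have KM: "sb ?K (rs ?M i s' ?b)"
  proof (rule sbI)
   fix x assume x: "x:?K"
   have "x:Nn (sc (pi i s'))" using x mK sub(2) sbD by blast
   then have "x:?M" unfolding Nn_sc[OF p(2)] using nx_sb(1) sbD by blast
   then show "x:rs ?M i s' ?b" using pe[OF x] rle_rW[OF w(1) ue] by simp
  qed
  \<comment> \<open>This set contains \<open>?K\<close>, on which \<open>A\<close> is outside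
    \<open>L\<close>. So \<open>?b\<close> was among the candidates when the minimum
    \<open>a (pi i s')\<close> was taken.\<close>
  have "IN (rs ?M i s' ?b)" unfolding IN_def
  proof (intro conjI gM notI)
   show "sb (rs ?M i s' ?b) Rl" using M unfolding IN_def by (auto simp: sb_def)
   assume Y: "Sep (rs ?M i s' ?b) (%x. x:A):L"
   have K2: "gd L (chi ?K)" "sb ?K Rl" "~Sep ?K (%x. x:A):L" using e0(2) IN_def by blast+
   have "Sep ?K (%x. x:Sep (rs ?M i s' ?b) (%x. x:A)) = Sep ?K (%x. x:A)"
    by (rule Sep_Sep_sub[OF KM])
   then show False using restr[OF K2(1) Y K2(2)] K2(3) by simp
  qed
  then have "sb (a (pi i s')) ?b" using al[OF p(2), of ?b] Ord_rW[OF w(1) ue] unfolding q by blast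
  then show ?thesis using Ord_sb_mem[OF aO[OF p(2)] aO[OF p(1)] _ bm] by blast
 qed
 have "cl (f$y) i:WF" if i: "i:om" for i
  unfolding mem_WF
 proof (intro conjI allI impI, rule ct_Rl[OF ct_col[OF i] y], rule ccontr)
  fix b assume b: "b:Rl" and nb: "~(EX n. n:om & ~inn (cl (f$y) i) b n)"
  define Z where "Z = Rep om (%n. a (pi i (kap b n)))"
  have mZ: "z:Z <-> (EX n. n:om & z = a (pi i (kap b n)))" for z unfolding Z_def by (simp add: da)
  have "a (pi i (kap b emp)):Z" unfolding mZ using emp_om by blast
  from foundation[OF this] obtain n where n: "n:om" "!!z. z:a (pi i (kap b n)) ==> ~z:Z" unfolding mZ by blast
  have "ch (cl (f$y) i) (kap b (sc n)) (kap b n)" using ch_kapI[OF b n(1)] nb sc_om[OF n(1)] by blast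
  from desc[OF i kap_om[OF b n(1)] this] n sc_om show False unfolding mZ by blast
 qed
 then show False using fW[OF y] by blast
qed

end

lemma nocase: "seg L ==> jcl L ==> ocl L ==> (!!X f. ~C2 L X f) ==> DC A ==> A:L"
 unfolding DC_def using nocase_in by blast

section \<open>Segments are unions of few bounded sets\<close>

text \<open>\<open>K\<close> is the union of at most \<open>\<omega>\<^sub>1\<close> many bounded sets.\<close>

definition cof1 where "cof1 K <-> (EX F.
 (ALL \<xi>. \<xi>:w1 --> (EX X. X:F$\<xi>) --> (EX Y. Y:K & (ALL X. X:F$\<xi> --> le2 X Y))) &
 (ALL X. X:K --> (EX \<xi>. \<xi>:w1 & X:F$\<xi>)))"
lemma dp_cof1 [simp]: "dt a ==> dp (%s. cof1 (a s))" by (rule dp_lift1) (simp_all add: cof1_def)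

lemma cof1I: assumes "dt (%s. G (s 0))" "!!\<xi> X. \<xi>:w1 ==> X:G \<xi> ==> EX Y. Y:K & (ALL X. X:G \<xi> --> le2 X Y)"
  "!!X. X:K ==> EX \<xi>. \<xi>:w1 & X:G \<xi>"
 shows "cof1 K"
 unfolding cof1_def
proof (rule exI[of _ "Lam w1 G"], intro conjI allI impI)
 fix \<xi> assume x: "\<xi>:w1" "EX X. X:Lam w1 G$\<xi>"
 then show "EX Y. Y:K & (ALL X. X:Lam w1 G$\<xi> --> le2 X Y)" using assms(2)[OF x(1)] ap_Lam[OF x(1) assms(1)] by auto
next
 fix X assume "X:K"
 then obtain \<xi> where x: "\<xi>:w1" "X:G \<xi>" using assms(3) by blast
 then show "EX \<xi>. \<xi>:w1 & X:Lam w1 G$\<xi>" using ap_Lam[OF x(1) assms(1)] by (intro exI[of _ \<xi>]) simp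
qed

lemma om_w1: "n:om ==> n:w1"
 unfolding w1_def mem_hart using nat_Ord img_sb[OF nat_sb_om] by blast

text \<open>A member of \<open>L\<close> that is below no \<open>Q$n\<close> is strictly above all
  of them, hence above their join, which is impossible.\<close>

lemma cof_join: assumes seg: "seg L" and Q: "fn Q om L" and n: "~Jn Q:L" shows "cof1 L"
proof (rule cof1I[of "%\<xi>. if \<xi>:om then Sep L (%X. le2 X (Q$\<xi>)) else emp"])
 fix \<xi> X assume "X:(if \<xi>:om then Sep L (%X. le2 X (Q$\<xi>)) else emp)"
 then have "\<xi>:om" by (auto split: if_splits)
 then show "EX Y. Y:L & (ALL X. X:(if \<xi>:om then Sep L (%X. le2 X (Q$\<xi>)) else emp) --> le2 X Y)"
  using fn_ap(2)[OF Q] by (intro exI[of _ "Q$\<xi>"]) simp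
next
 fix X assume X: "X:L"
 have "EX n. n:om & le2 X (Q$n)"
 proof (rule ccontr)
  assume no: "~?thesis"
  have "wle (Jn Q) X" by (rule join_le[OF seg_sb[OF seg X]]) (use no seg_sb[OF seg fn_ap(2)[OF Q]] in \<open>auto simp: less_def\<close>)
  then show False using n seg_wle[OF seg X] by blast
 qed
 then obtain n where n: "n:om" "le2 X (Q$n)" by blast
 then show "EX \<xi>. \<xi>:w1 & X:(if \<xi>:om then Sep L (%X. le2 X (Q$\<xi>)) else emp)"
  using om_w1 X by (intro exI[of _ n]) simp
qed simp

text \<open>\<open>UC\<close> requires a relation decreasing in the ordinal; therefore the strategy
  may answer for a tree \<open>w'\<close> of larger rank than the given one.\<close>

lemma UCred:
 assumes V: "dt (%s. V (s 0))" and S: "sb S Rl" and l: "!!w. w:WF ==> sb (V w) Rl & less (V w) S"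
 shows "EX e. e:Rl & (ALL w. w:WF --> (EX w'. w':WF & sb (rw w) (rw w') &
  (ALL x. x:Rl --> (x:V w' <-> lip (lip e w) x:S))))"
proof -
 have dV: "dt (%s. V (a s))" if "dt a" for a using dt_sub1[OF V that] .
 let ?R = "%\<xi> \<tau>. EX w'. w':WF & sb \<xi> (rw w') & (ALL x. x:Rl --> (x:V w' <-> lip \<tau> x:S))"
 have "EX e. e:Rl & (ALL w. w:WF --> ?R (rw w) (lip e w))"
 proof (rule UC)
  show "dp (%s. ?R (s 0) (s 1))" by (simp add: dV)
  show "EX y. y:Rl & ?R (rw w) y" if w: "w:WF" for w
   using less_wlx(1)[of "V w" S] l[OF w] S w unfolding wlx_def by (metis sb_refl)
  show "?R \<xi> y" if "sb \<xi> \<eta>" "?R \<eta> y" for \<xi> \<eta> y using that sb_trans by blast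
 qed
 then show ?thesis .
qed

lemma lq_cong: assumes "w:WF" "w':WF" "rw w = rw w'" shows "lq x w emp = lq x w' emp"
proof (rule ext)
 have e: "sb (rW w emp) (rW w' emp)" "sb (rW w' emp) (rW w emp)" using assms(3) by (simp_all add: rw_def)
 show "s:lq x w emp <-> s:lq x w' emp" for s
  using lq_mono[OF assms(1,2) emp_om] lq_mono[OF assms(2,1) emp_om] e emp_om by blast
qed

lemma lq_rw: "w:WF ==> x:WF ==> emp:lq x w emp <-> sb (rw x) (rw w)"
 using lq_WF[OF _ emp_om _ emp_om] by (simp add: rw_def)

text \<open>Trees of the same rank may give different sets \<open>V w\<close>. The covering
  condition asks for a bound by every tree of that rank, so any one of them bounds the sets
  collected at that rank.\<close>

lemma cof_family:
 assumes seg: "seg L" and V: "dt (%s. V (s 0))" and VL: "!!w. w:WF ==> V w:L"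
  and cov: "!!T. T:L ==> EX w0. w0:WF & (ALL w. w:WF --> rw w = rw w0 --> le2 T (V w))"
 shows "cof1 L"
proof -
 have dV: "dt (%s. V (a s))" if "dt a" for a using dt_sub1[OF V that] .
 let ?G = "%\<xi>. Sep L (%T. EX w0. w0:WF & rw w0 = \<xi> & (ALL w. w:WF --> rw w = rw w0 --> le2 T (V w)))"
 have mG: "T:?G \<xi> <-> T:L & (EX w0. w0:WF & rw w0 = \<xi> & (ALL w. w:WF --> rw w = rw w0 --> le2 T (V w)))" for T \<xi>
  by (simp add: dV)
 show ?thesis
 proof (rule cof1I[of ?G])
  show "dt (%s. ?G (s 0))" by (simp add: dV)
  fix \<xi> X assume "X:?G \<xi>"
  then obtain w where w: "w:WF" "rw w = \<xi>" unfolding mG by blast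
  show "EX Y. Y:L & (ALL X. X:?G \<xi> --> le2 X Y)" unfolding mG
   using VL[OF w(1)] w by metis
 next
  fix X assume X: "X:L"
  then obtain w where w: "w:WF" "ALL w'. w':WF --> rw w' = rw w --> le2 X (V w')" using cov by blast
  then show "EX \<xi>. \<xi>:w1 & X:?G \<xi>" unfolding mG using X rw_w1[OF w(1)] by blast
 qed
qed

definition WS where "WS S = Sep Rl (%z. fs z:WF & sn z:S)"
lemma mem_WS: "z:WS S <-> z:Rl & fs z:WF & sn z:S" by (simp add: WS_def)
lemma WS_sb: "sb (WS S) Rl" by (simp add: sb_def mem_WS)

context
 fixes L assumes seg: "seg L" and jcl: "jcl L" and ocl: "ocl L"
begin

lemma gd_split:
 assumes w: "w:WF" and G: "ct G" and P: "P:L" and N: "N:L"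
 shows "Sep Rl (%z. if emp:lq (G z) w emp then z:P else z:N):L"
proof -
 have "Sep Rl (%z. z:(if qd (G z) w emp emp = emp then P else N)):L"
  by (rule gd_use[OF _ _ G, of L "%x. qd x w emp emp" "%n. if n = emp then P else N"])
   (use gd_rank[OF seg jcl ocl w emp_om] P N in auto)
 moreover have "Sep Rl (%z. z:(if qd (G z) w emp emp = emp then P else N)) = Sep Rl (%z. if emp:lq (G z) w emp then z:P else z:N)"
  by (rule RlSep_eqI) (use ct_dt[OF G] in \<open>auto simp: sb_def qd_emp[OF w emp_om emp_om]\<close>)
 ultimately show ?thesis by simp
qed

lemma C2_WS: assumes T: "T:L" and n: "~WS T:L" shows "C2 L (WS T) (Lam Rl fs)"
 unfolding C2_def
proof (intro conjI allI impI WS_sb n ct_Ct[OF ct_fs[OF ct_id]])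
 fix w assume w: "w:WF"
 have P: "Sep Rl (%z. sn z:T):L" by (rule seg_inv[OF seg ct_sn[OF ct_id] T])
 have "Sep (WS T) (%z. emp:lq (Lam Rl fs$z) w emp) = Sep Rl (%z. if emp:lq (fs z) w emp then z:Sep Rl (%z. sn z:T) else z:emp)"
  by (rule RlSep_eqI) (use lq_root[OF w emp_om] in \<open>auto simp: sb_def mem_WS\<close>)
 then show "Sep (WS T) (%z. emp:lq (Lam Rl fs$z) w emp):L"
  using gd_split[OF w ct_fs[OF ct_id] P seg_emp[OF seg]] by simp
qed (simp add: mem_WS)

text \<open>If the bounded parts of \<open>X\<close> are not cofinal in \<open>L\<close>, some
  \<open>S\<close> in \<open>L\<close> is above all of them, uniformly by \<open>UCred\<close>, and
  \<open>X\<close> reduces to \<open>WS S\<close>. For \<open>T\<close> above both \<open>S\<close>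
  and its complement, \<open>WS T\<close> and \<open>WS (cmp T)\<close> reduce to
  \<open>WS S\<close>; running both reductions and bounding the rank of the faster one puts
  \<open>T\<close> below some \<open>V w\<close>.\<close>

lemma cof_c2: assumes C: "C2 L X f" shows "cof1 L"
proof (cases "EX S. S:L & (ALL w. w:WF --> ~le2 S (Sep X (%x. emp:lq (f$x) w emp)))")
 case False
 show ?thesis
 proof (rule cof_family[OF seg, of "%w. Sep X (%x. emp:lq (f$x) w emp)"])
  fix T assume "T:L"
  then obtain w0 where w0: "w0:WF" "le2 T (Sep X (%x. emp:lq (f$x) w0 emp))" using False by blast
  have "le2 T (Sep X (%x. emp:lq (f$x) w emp))" if w: "w:WF" "rw w = rw w0" for w
   using w0(2) lq_cong[OF w(1) w0(1) w(2)] by simp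
  then show "EX w0. w0:WF & (ALL w. w:WF --> rw w = rw w0 --> le2 T (Sep X (%x. emp:lq (f$x) w emp)))" using w0(1) by blast
 qed (use C in \<open>auto simp: C2_def\<close>)
next
 case True
 then obtain S where S: "S:L" and Sw: "!!w. w:WF ==> ~le2 S (Sep X (%x. emp:lq (f$x) w emp))" by blast
 have X: "sb X Rl" "~X:L" and f: "Ct f" and XW: "!!x. x:X ==> f$x:WF" using C unfolding C2_def by blast+
 note cf = Ct_ct[OF f]
 have sS: "sb S Rl" using seg_sb[OF seg S] .
 have "EX e. e:Rl & (ALL w. w:WF --> (EX w'. w':WF & sb (rw w) (rw w') &
  (ALL x. x:Rl --> (x:Sep X (%x. emp:lq (f$x) w' emp) <-> lip (lip e w) x:S))))"
  by (rule UCred[of "%w. Sep X (%x. emp:lq (f$x) w emp)", OF _ sS]) (use Sw X in \<open>auto simp: less_def sb_def\<close>)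
 then obtain e where e: "e:Rl" "!!w. w:WF ==> EX w'. w':WF & sb (rw w) (rw w') &
  (ALL x. x:Rl --> (x:X & emp:lq (f$x) w' emp <-> lip (lip e w) x:S))" by auto
 have red: "x:X <-> f$x:WF & lip (lip e (f$x)) x:S" if x: "x:Rl" for x
 proof (cases "f$x:WF")
  case True
  obtain w' where w': "w':WF" "sb (rw (f$x)) (rw w')" "x:X & emp:lq (f$x) w' emp <-> lip (lip e (f$x)) x:S"
   using e(2)[OF True] x by blast
  then show ?thesis using lq_rw[OF w'(1) True] True by blast
 qed (use XW in blast)
 have "wle X (WS S)"
  by (rule wleI[OF ct_pr[OF cf ct_lip[OF ct_lip[OF ct_const[OF e(1)] cf] ct_id]] X(1)])
   (use red ct_Rl[OF cf] e(1) in \<open>simp add: mem_WS\<close>)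
 then have nWS: "~WS S:L" using seg_wle[OF seg] X(2) by blast
 have piv: "pv L (WS T)" if "T:L" "~WS T:L" for T by (rule case2[OF seg jcl ocl C2_WS[OF that]])
 obtain x0 where x0: "x0:X" using X(2) seg_emp[OF seg] emp_iff by metis
 define w0 where "w0 = f$x0"
 have w0: "w0:WF" using XW[OF x0] w0_def by simp
 \<comment> \<open>The universal form of such a parallel run: a tree within the bound makes the
   first instance of \<open>S\<close> decide, otherwise the negation of the second one does.\<close>
 define V where "V w = Sep Rl (%z. if emp:lq (fs z) w emp then z:Sep Rl (%z. fs (sn z):S) else z:cmp (Sep Rl (%z. sn (sn z):S)))" for w
 have mV: "z:V w <-> z:Rl & (if emp:lq (fs z) w emp then fs (sn z):S else ~sn (sn z):S)" for z w
  unfolding V_def by auto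
 have VL: "V w:L" if "w:WF" for w unfolding V_def
  by (rule gd_split[OF that ct_fs[OF ct_id]], rule seg_inv[OF seg ct_fs[OF ct_sn[OF ct_id]] S],
    rule seg_cmp[OF seg seg_inv[OF seg ct_sn[OF ct_sn[OF ct_id]] S]])
 have dV: "dt (%s. V (s 0))" unfolding V_def by simp
 show ?thesis
 proof (rule cof_family[OF seg dV VL])
  have VV: "V w = V w'" if "w:WF" "w':WF" "rw w = rw w'" for w w' unfolding V_def using lq_cong[OF that] by simp
  fix T assume T: "T:L"
  have sT: "sb T Rl" using seg_sb[OF seg T] .
  have "EX w. w:WF & le2 T (V w)"
  proof (rule ccontr)
   assume no: "~(EX w. w:WF & le2 T (V w))"
   have ls: "less (V w0) T" using no w0 less_def by blast
   have "wle S (V w0)"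
    by (rule wleI[OF ct_pr[OF ct_const[OF WF_Rl[OF w0]] ct_pr[OF ct_id ct_id]] sS]) (use w0 lq_rw[OF w0 w0] in \<open>simp add: mV\<close>)
   moreover have "wle (V w0) T" "wle (V w0) (cmp T)"
    using less_wle[OF _ sT ls] wle_cmp2[of "V w0" T] seg_sb[OF seg VL[OF w0]] by blast+
   ultimately have ST: "wle S T" "wle S (cmp T)" using wle_trans by blast+
   \<comment> \<open>\<open>WS T'\<close> is a pivot above \<open>WS S\<close>, so the complement of
     \<open>WS S\<close> does not reduce to it, and Wadge's lemma gives the reduction in the other
     direction.\<close>
   have h: "EX e. e:Rl & (ALL x. x:Rl --> (x:WS T' <-> lip e x:WS S))" if T': "T':L" "wle S T'" for T'
   proof -
    obtain g where g: "ct (ap g)" "!!x. x:Rl ==> x:S <-> g$x:T'" using wleE[OF T'(2)] by metis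
    have W: "wle (WS S) (WS T')"
     by (rule wleI[OF ct_pr[OF ct_fs[OF ct_id] ct_comp[OF g(1) ct_sn[OF ct_id]]] WS_sb])
      (use g(2) ct_Rl[OF g(1)] in \<open>simp add: mem_WS\<close>)
    have "~WS T':L" using W nWS seg_wle[OF seg] by blast
    then have p: "pv L (WS T')" using piv T' by blast
    then have "~wle (cmp (WS S)) (WS T')" using W nWS WS_sb unfolding pv_def by blast
    then show ?thesis using Wadge[OF WS_sb WS_sb, of T' S] unfolding wlx_def by blast
   qed
   obtain a where a: "a:Rl" "!!x. x:Rl ==> x:WS T <-> lip a x:WS S" using h[OF T ST(1)] by blast
   obtain b where b: "b:Rl" "!!x. x:Rl ==> x:WS (cmp T) <-> lip b x:WS S" using h[OF seg_cmp[OF seg T] ST(2)] by blast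
   have w0R: "w0:Rl" using w0 by simp
   define H where "H c y = lip c (pr w0 y)" for c y
   have cH: "ct (H c)" if "c:Rl" for c unfolding H_def using ct_lip[OF ct_const[OF that] ct_pr[OF ct_const[OF w0R] ct_id]] .
   have HT: "y:T <-> H a y:WS S" "~y:T <-> H b y:WS S" if y: "y:Rl" for y
    using a(2)[of "pr w0 y"] b(2)[of "pr w0 y"] y w0 w0R by (auto simp: mem_WS H_def)
   let ?p = "%y. prt (fs (H a y)) (fs (H b y))"
   note cab = ct_fs[OF cH[OF a(1)]] ct_fs[OF cH[OF b(1)]]
   have pW: "?p y:WF" if y: "y:Rl" for y
   proof -
    have "fs (H a y):WF | fs (H b y):WF" using HT[OF y] mem_WS by blast
    then show ?thesis unfolding mem_WF using prt fs_Rl sn_Rl by metis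
   qed
   obtain B where B: "B:WF" "!!y. y:Rl ==> sb (rw (?p y)) (rw B)" using Bound[OF ct_prt[OF cab] pW] by blast
   have "wle T (V B)"
   proof (rule wleI[OF ct_pr[OF cab(1) ct_pr[OF ct_sn[OF cH[OF a(1)]] ct_sn[OF cH[OF b(1)]]]] sT])
    fix y assume y: "y:Rl"
    note Ra = ct_Rl[OF cH[OF a(1)] y] and Rb = ct_Rl[OF cH[OF b(1)] y]
    have "fs (H a y):WF & sb (rw (fs (H a y))) (rw B) | fs (H b y):WF & sb (rw (fs (H b y))) (rw B)"
     using prt_min[OF fs_Rl[OF Ra] fs_Rl[OF Rb] pW[OF y]] B(2)[OF y] sb_trans by blast
    then have c: "emp:lq (fs (H a y)) B emp | fs (H b y):WF" using lq_rw[OF B(1)] by blast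
    have d: "emp:lq (fs (H a y)) B emp ==> fs (H a y):WF" using lq_root[OF B(1) emp_om fs_Rl[OF Ra]] .
    show "y:T <-> pr (fs (H a y)) (pr (sn (H a y)) (sn (H b y))):V B"
     unfolding mV using Ra Rb HT[OF y] c d unfolding mem_WS by auto
   qed
   then show False using no B(1) wle_le2 by blast
  qed
  then show "EX w0. w0:WF & (ALL w. w:WF --> rw w = rw w0 --> le2 T (V w))" using VV by metis
 qed
qed

end

section \<open>Continuous functions with well-founded stopping times\<close>

text \<open>Evaluates the continuous function coded by \<open>c\<close> as soon as the stopping times have left the well-founded
 tree \<open>w\<close>. Every continuous function is obtained from all trees \<open>w\<close> of sufficiently large rank.\<close>

definition Phi where "Phi w c x = Lam om (%i. sn c$(pi i (kap x (lst (%n. n:om & ~inn w (lip (cl (fs c) i) x) n)))))"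
lemma dt_Phi [simp]: "dt a ==> dt b ==> dt c ==> dt (%s. Phi (a s) (b s) (c s))"
 by (rule dt_lift3) (simp_all add: Phi_def)

lemma exit: assumes w: "w:WF" and b: "b:Rl"
 shows "lst (%n. n:om & ~inn w b n):om" "~inn w b (lst (%n. n:om & ~inn w b n))"
  "m:lst (%n. n:om & ~inn w b n) ==> inn w b m"
proof -
 obtain n where n: "n:om" "~inn w b n" using w b mem_WF by blast
 have d: "dp (%s. s 0:om & ~inn w b (s 0))" by simp
 have *: "n:om & ~inn w b n" using n by blast
 note l = lst[of "%n. n:om & ~inn w b n", OF d nat_Ord[OF n(1)] *]
 show "lst (%n. n:om & ~inn w b n):om" "~inn w b (lst (%n. n:om & ~inn w b n))" using l(2) by blast+
 then show "m:lst (%n. n:om & ~inn w b n) ==> inn w b m" using l(4) nat_in by blast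
qed

lemma exit_cong: assumes w: "w:WF" and b: "b:Rl" "b':Rl" and e: "eqn (lst (%n. n:om & ~inn w b n)) b b'"
 shows "lst (%n. n:om & ~inn w b' n) = lst (%n. n:om & ~inn w b n)"
proof -
 let ?n = "lst (%n. n:om & ~inn w b n)" let ?n' = "lst (%n. n:om & ~inn w b' n)"
 note l = exit[OF w b(1)] and l' = exit[OF w b(2)]
 have 1: "~inn w b' ?n" using l(2) inn_cong[OF l(1) e] by blast
 have 2: "~?n':?n"
 proof
  assume *: "?n':?n"
  then have "eqn ?n' b b'" using e eqn_mono Ord_sb[OF nat_Ord[OF l(1)]] by blast
  then show False using l(3)[OF *] l'(2) inn_cong[OF l'(1)] by blast
 qed
 have "~?n:?n'" using l'(3)[of ?n] 1 by blast
 then show ?thesis using nat_lin[OF l(1) l'(1)] 2 by simp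
qed

lemma ct_Phi: assumes w: "w:WF" and F: "ct F" and G: "ct G" shows "ct (%x. Phi w (F x) (G x))"
proof (rule ct2[OF F G])
 show "dt (%s. Phi w (a s) (b s))" if "dt a" "dt b" for a b using that by simp
 show "Phi w x y:Rl" if "x:Rl" "y:Rl" for x y unfolding Phi_def
  by (rule RlI) (use that exit(1)[OF w] in auto)
 fix x y k assume x: "x:Rl" and y: "y:Rl" and k: "k:om"
 let ?J = "%p. lip (cl (fs (fs p)) k) (sn p)"
 have J: "ct ?J" by (rule ct_lip[OF ct_cl[OF ct_fs[OF ct_fs[OF ct_id]] k] ct_sn[OF ct_id]])
 let ?n = "lst (%n. n:om & ~inn w (lip (cl (fs x) k) y) n)"
 have R: "lip (cl (fs x) k) y:Rl" using x y k by simp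
 have n: "?n:om" using exit(1)[OF w R] .
 obtain m where m: "m:om" "!!p. p:Rl ==> eqn m (pr x y) p ==> eqn ?n (?J (pr x y)) (?J p)"
  using ct_eqn[OF J pr_Rl[OF x y] n] by blast
 let ?i = "pi k (kap y ?n)"
 have i: "?i:om" using k y n by simp
 obtain l1 where l1: "l1:om" "sb m l1" "sb ?n l1" by (rule nat_max[OF m(1) n])
 obtain l where l: "l:om" "sb l1 l" "sb (sc ?i) l" by (rule nat_max[OF l1(1) sc_om[OF i]])
 have "Phi w x y$k = Phi w x' y'$k" if x': "x':Rl" and y': "y':Rl" and e: "eqn l x x'" "eqn l y y'" for x' y'
 proof -
  have R': "lip (cl (fs x') k) y':Rl" using x' y' k by simp
  have "eqn m (pr x y) (pr x' y')" using eqn_pr[OF l(1) x y x' y'] e eqn_mono l(2) l1(2) by blast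
  then have "eqn ?n (lip (cl (fs x) k) y) (lip (cl (fs x') k) y')" using m(2)[of "pr x' y'"] x y x' y' by simp
  then have nn: "lst (%n. n:om & ~inn w (lip (cl (fs x') k) y') n) = ?n" by (rule exit_cong[OF w R R'])
  have ky: "kap y' ?n = kap y ?n" using kap_cong[OF n, of y y'] eqn_mono[OF e(2)] l(2) l1(3) sb_trans by metis
  have "eqn l (sn x) (sn x')" using eqn_sn[OF l(1) e(1)] .
  then have "sn x$?i = sn x'$?i" using eqn_in l(3) by (simp add: sb_def)
  then show ?thesis using k by (simp add: Phi_def nn ky)
 qed
 then show "EX m. m:om & (ALL x' y'. x':Rl --> y':Rl --> eqn m x x' --> eqn m y y' --> Phi w x y$k = Phi w x' y'$k)"
  using l(1) by blast
qed

text \<open>\<open>Q i\<close> is the tree of initial segments that leave entry \<open>i\<close> of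
  \<open>T x\<close> open, with the root always included. These trees have a common bound
  \<open>B\<close>. If \<open>w\<close> has at least that rank, strategies map all of them into
  \<open>w\<close>, and once the image has left \<open>w\<close> the entry is determined.\<close>

lemma Phi_all:
 assumes T: "ct T"
 shows "EX B. B:WF & (ALL w. w:WF --> sb (rw B) (rw w) --> (EX c. c:Rl & (ALL x. x:Rl --> Phi w c x = T x)))"
proof -
 have dT: "dt (%s. T (a s))" if "dt a" for a using ct_dt[OF T that] .
 define Q where "Q i x n <-> n = emp | (EX z z'. z:Rl & z':Rl & eqn n x z & eqn n x z' & T z$i ~= T z'$i)" for i x n
 have dQ: "dp (%s. Q (a s) (b s) (c s))" if "dt a" "dt b" "dt c" for a b c
  unfolding Q_def using dT dt_pushes[OF that(1)] dt_pushes[OF that(2)] dt_pushes[OF that(3)] by simp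
 define W where "W i = mkt (Q i)" for i
 have dW: "dt (%s. W (a s))" if "dt a" for a unfolding W_def mkt_def using dQ dt_pushes[OF that] by simp
 have c: "Q i b' n" if "eqn n b b'" "Q i b n" for i b b' n
  using that eqn_trans[OF eqn_sym] unfolding Q_def by blast
 have m: "Q i b n" if "Q i b (sc n)" for i b n using that unfolding Q_def eqn_sc by auto
 have WR: "W i:Rl" for i unfolding W_def
  by (rule mkt(1), rule dQ, simp, simp, simp, rule c, assumption, assumption, rule m, assumption) (simp add: Q_def)
 have WQ: "inn (W i) b n <-> Q i b n" if "b:Rl" "n:om" for i b n unfolding W_def
  by (rule mkt(2)[OF _ _ _ _ that], rule dQ, simp, simp, simp, rule c, assumption, assumption, rule m, assumption) (simp add: Q_def)
 have WW: "W i:WF" if i: "i:om" for i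
  unfolding mem_WF
 proof (intro conjI allI impI WR)
  fix b assume b: "b:Rl"
  obtain m where m: "m:om" "!!y. y:Rl ==> eqn m b y ==> T b$i = T y$i" using ctD[OF T b i] by blast
  have "~Q i b (sc m)" unfolding Q_def using m(2) eqn_sc sc_not_emp by metis
  then show "EX n. n:om & ~inn (W i) b n" using WQ[OF b sc_om[OF m(1)]] sc_om[OF m(1)] by blast
 qed
 have cW: "ct (%z. W (z$emp))" unfolding ct_def ctn_def
 proof (intro conjI allI impI WR)
  show "dt (%s. W (s 0$emp))" by (rule dW) simp
  fix x k show "EX m. m:om & (ALL y. y:Rl --> eqn m x y --> W (x$emp)$k = W (y$emp)$k)"
   by (rule exI[of _ "sc emp"]) (simp add: eqn_sc)
 qed
 obtain B where B: "B:WF" "!!z. z:Rl ==> sb (rw (W (z$emp))) (rw B)" using Bound[OF cW] WW by auto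
 have "EX c. c:Rl & (ALL x. x:Rl --> Phi w c x = T x)" if w: "w:WF" "sb (rw B) (rw w)" for w
 proof -
  have "EX e. e:Rl & (ALL b n. b:Rl --> n:om --> inn (W i) b n --> inn w (lip e b) n)" if i: "i:om" for i
  proof -
   have "sb (rw (W i)) (rw w)" using B(2)[of "cn i zr"] i w(2) sb_trans by simp
   from rank_lip[OF WW[OF i] w(1) this] show ?thesis .
  qed
  then obtain E where E: "E:Rl" "!!i. i:om ==> ALL b n. b:Rl --> n:om --> inn (W i) b n --> inn w (lip (cl E i) b) n"
   using CC[of "%i e. ALL b n. b:Rl --> n:om --> inn (W i) b n --> inn w (lip e b) n"] dW by auto
  define t where "t = Lam om (%p. T (ex (q2 p))$(q1 p))"
  have t: "t:Rl" unfolding t_def by (rule RlI) (use dT ct_Rl[OF T] ex(1) in auto)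
  have tp: "t$(pi i u) = T (ex u)$i" if "i:om" "u:om" for i u unfolding t_def using that dT by simp
  have "Phi w (pr E t) x = T x" if x: "x:Rl" for x
  proof (rule Rl_ext[OF _ ct_Rl[OF T x]])
   show "Phi w (pr E t) x:Rl" using ct_Rl[OF ct_Phi[OF w(1) ct_const[OF pr_Rl[OF E(1) t]] ct_id] x] .
   fix i assume i: "i:om"
   let ?n = "lst (%n. n:om & ~inn w (lip (cl E i) x) n)"
   have R: "lip (cl E i) x:Rl" using E(1) x i by simp
   note l = exit[OF w(1) R]
   have nQ: "~Q i x ?n" using E(2)[OF i] l(1,2) x WQ[OF x l(1)] by blast
   have k: "kap x ?n:om" using x l(1) by simp
   have "eqn ?n x (ex (kap x ?n))" using eqn_sym[OF eqn_ex[OF x l(1)]] .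
   then have "T (ex (kap x ?n))$i = T x$i" using nQ x ex(1)[OF k] unfolding Q_def by (meson eqn_refl)
   then show "Phi w (pr E t) x$i = T x$i" using i E(1) t tp[OF i k] by (simp add: Phi_def)
  qed
  then show ?thesis using pr_Rl[OF E(1) t] by blast
 qed
 then show ?thesis using B(1) by blast
qed

section \<open>The cofinality of the segment below an open operation\<close>

definition lo where "lo D = Sep (Pw Rl) (%X. less X D)"
lemma dt_lo [simp]: "dt a ==> dt (%s. lo (a s))" by (rule dt_lift1) (simp_all add: lo_def)
lemma mem_lo: "X:lo D <-> sb X Rl & less X D" by (simp add: lo_def)

lemma le2_cmp: "sb X Rl ==> sb Y Rl ==> le2 (cmp X) Y <-> le2 X Y" "sb Y Rl ==> le2 X (cmp Y) <-> le2 X Y"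
 unfolding le2_def using wle_cmp[of X Y] wle_cmp[of X "cmp Y"] wle_cmp[of "cmp X" Y] wle_cmp[of "cmp X" "cmp Y"] by auto
lemma less_cmp: "sb X Rl ==> sb Y Rl ==> less (cmp X) Y <-> less X Y" "sb X Rl ==> sb Y Rl ==> less X (cmp Y) <-> less X Y"
 unfolding less_def using le2_cmp by simp_all

text \<open>The join of \<open>R\<close> with its complement turns bounds for \<open>le2\<close>
  into bounds for \<open>wle\<close>.\<close>

definition dbj where "dbj R = Jn (Lam om (%n. if n = emp then R else cmp R))"
lemma mem_dbj: "x:dbj R <-> x:Rl & (if x$emp = emp then tl x:R else ~tl x:R)"
 by (auto simp: dbj_def)
lemma dbj_sb: "sb (dbj R) Rl" by (simp add: sb_def mem_dbj)

lemma le2_dbj: assumes "le2 X R" "sb X Rl" "sb R Rl" shows "wle X (dbj R)"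
proof -
 from assms(1) consider "wle X R" | "wle X (cmp R)" unfolding le2_def by blast
 then show ?thesis
 proof cases
  case 1
  obtain t where t: "ct (ap t)" "!!x. x:Rl ==> x:X <-> t$x:R" using wleE[OF 1] by metis
  show ?thesis by (rule wleI[OF ct_cn[OF t(1) emp_om] assms(2)]) (use t(2) ct_Rl[OF t(1)] in \<open>simp add: mem_dbj\<close>)
 next
  case 2
  obtain t where t: "ct (ap t)" "!!x. x:Rl ==> x:X <-> t$x:cmp R" using wleE[OF 2] by metis
  show ?thesis by (rule wleI[OF ct_cn[OF t(1) sc_om[OF emp_om]] assms(2)]) (use t(2) ct_Rl[OF t(1)] in \<open>simp add: mem_dbj\<close>)
 qed
qed

lemma dbj_less: assumes D: "sb D Rl" "~wle D (cmp D)" and R: "sb R Rl" "less R D" shows "less (dbj R) D"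
proof -
 have "wle (dbj R) D" unfolding dbj_def by (rule join_le[OF D(1)]) (use R D less_cmp in auto)
 moreover have "wle (dbj R) (cmp D)" unfolding dbj_def by (rule join_le[OF cmp_sb]) (use R D less_cmp in auto)
 ultimately show ?thesis using less_of D by blast
qed

lemma lst_local:
 assumes dP: "dp (%s. P (s 0))" and dQ: "dp (%s. Q (s 0))" and m: "m:om" and Pm: "P m"
  and PQ: "!!n. n:om ==> n:sc m ==> P n <-> Q n"
 shows "lst (%n. n:om & P n) = lst (%n. n:om & Q n)" "lst (%n. n:om & P n):sc m"
proof -
 have Qm: "Q m" using PQ[OF m] Pm by simp
 have d: "dp (%s. s 0:om & P (s 0))" "dp (%s. s 0:om & Q (s 0))" using dP dQ by simp_all
 have i: "m:om & P m" "m:om & Q m" using m Pm Qm by auto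
 note p = lst[of "%n. n:om & P n", OF d(1) nat_Ord[OF m] i(1)]
 note q = lst[of "%n. n:om & Q n", OF d(2) nat_Ord[OF m] i(2)]
 have a: "lst (%n. n:om & P n):sc m" "lst (%n. n:om & Q n):sc m"
  using Ord_sb_iff[OF p(1) nat_Ord[OF m]] Ord_sb_iff[OF q(1) nat_Ord[OF m]] p(3) q(3) by auto
 then show "lst (%n. n:om & P n):sc m" by blast
 have "Q (lst (%n. n:om & P n))" "P (lst (%n. n:om & Q n))" using p(2) q(2) PQ a by blast+
 then show "lst (%n. n:om & P n) = lst (%n. n:om & Q n)"
  using nat_lin[of "lst (%n. n:om & P n)" "lst (%n. n:om & Q n)"] p(2,4) q(2,4) by blast
qed

context
 fixes L j U D M
 assumes seg: "seg L" and jcl: "jcl L" and Op: "Op L j U D M"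
begin

section \<open>Universal sets for the open operation\<close>

definition k0 where "k0 = kk j fs (%z. fs (sn z))"
lemmas c12 = ct_fs[OF ct_id] ct_fs[OF ct_sn[OF ct_id]]
lemma k0: "code L k0" unfolding k0_def by (rule kk_code[OF seg jcl Op c12])
lemma jh0: "z:Rl ==> jh k0 z = pr z (pr (jh j (fs z)) (jh j (fs (sn z))))"
 unfolding k0_def by (rule jh_kk[OF seg jcl Op c12])
lemma jh0_R: "z:Rl ==> jh k0 z:Rl" using jh_Rl[OF k0] .
lemma hit0: "z:Rl ==> hit k0 (UU U) z <-> hit j U (fs z) | hit j U (fs (sn z))"
 unfolding k0_def by (rule hit_UU[OF seg jcl Op c12])
lemma jR: "z:Rl ==> jh j z:Rl" using jh_Rl Op_j[OF seg jcl Op] by blast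

definition tpe where "tpe u <-> (EX v. v:U & sb (ln v) (ln u) & kap (fs (sn (ex u))) (ln v) = v)"
definition sh where "sh z = lst (%n. n:om & kap (jh k0 z) n:UU U)"
text \<open>After a hit the answer is read off from \<open>M\<close>, positively from the first
  reduction or negatively from the second, according to which run was hit at the first hitting
  time.\<close>

definition ruleM where "ruleM z <-> (if tpe (kap (jh k0 z) (sh z)) then fs z:M else ~fs (sn z):M)"
lemma dp_tpe [simp]: "dt a ==> dp (%s. tpe (a s))" by (rule dp_lift1) (simp_all add: tpe_def)
lemma dt_sh [simp]: "dt a ==> dt (%s. sh (a s))" by (rule dt_lift1) (simp_all add: sh_def)
lemma dp_ruleM [simp]: "dt a ==> dp (%s. ruleM (a s))" by (rule dp_lift1) (simp_all add: ruleM_def)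

text \<open>All points in the cone of \<open>u\<close> have their first hit at the same node
  \<open>u0\<close>, and there a cone of \<open>M\<close> decides.\<close>

lemma rule_cone: assumes u: "u:UU U" and X: "!!z. z:Rl ==> kap (jh k0 z) (ln u) = u ==> z:X <-> ruleM z"
 shows "cone k0 X u:L"
proof -
 have uo: "u:om" using u mem_UU by blast
 define n0 where "n0 = lst (%n. n:om & kap (ex u) n:UU U)"
 define u0 where "u0 = kap (ex u) n0"
 have sh0: "kap (jh k0 z) (sh z) = u0" "n0:sc (ln u)" "u0:UU U" if z: "z:Rl" "kap (jh k0 z) (ln u) = u" for z
 proof -
  have e: "eqn (ln u) (jh k0 z) (ex u)"
   using kap_eq_iff[OF ln_om[OF uo] jh0_R[OF z(1)] ex(1)[OF uo]] z(2) ex(2)[OF uo] by simp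
  have PQ: "kap (ex u) n = kap (jh k0 z) n" if "n:sc (ln u)" for n
  proof -
   have n: "n:om" using nat_in[OF sc_om[OF ln_om[OF uo]] that] .
   have "sb n (ln u)" using that Ord_sb[OF nat_Ord[OF ln_om[OF uo]]] by auto
   then show ?thesis using kap_cong[OF n eqn_mono[OF e]] by simp
  qed
  have "lst (%n. n:om & kap (ex u) n:UU U) = lst (%n. n:om & kap (jh k0 z) n:UU U)"
   "lst (%n. n:om & kap (ex u) n:UU U):sc (ln u)"
   using lst_local[of "%n. kap (ex u) n:UU U" "%n. kap (jh k0 z) n:UU U" "ln u"] PQ ex(2)[OF uo] u uo by simp_all
  then show "kap (jh k0 z) (sh z) = u0" and n0: "n0:sc (ln u)" using PQ by (simp_all add: u0_def n0_def sh_def)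
  have d: "dp (%s. s 0:om & kap (ex u) (s 0):UU U)" by simp
  have m: "ln u:om & kap (ex u) (ln u):UU U" using u uo ex(2) by simp
  show "u0:UU U" using lst(2)[of "%n. n:om & kap (ex u) n:UU U", OF d nat_Ord[OF ln_om[OF uo]] m] unfolding u0_def n0_def by blast
 qed
 show ?thesis
 proof (cases "EX z. z:Rl & kap (jh k0 z) (ln u) = u")
  case False
  then have "cone k0 X u = emp" unfolding emp_iff by auto
  then show ?thesis using seg_emp[OF seg] by simp
 next
  case True
  then have u0: "u0:UU U" and n0: "n0:sc (ln u)" using sh0 by blast+
  have u0o: "u0:om" using u0 mem_UU by blast
  have n0o: "n0:om" using nat_in[OF sc_om[OF ln_om[OF uo]] n0] .
  have lu0: "ln u0 = n0" unfolding u0_def by (rule ln_kap[OF ex(1)[OF uo] n0o])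
  have ku0: "kap (jh k0 z) (ln u0) = u0" if z: "z:Rl" "kap (jh k0 z) (ln u) = u" for z
  proof -
   have e: "eqn (ln u) (jh k0 z) (ex u)"
    using kap_eq_iff[OF ln_om[OF uo] jh0_R[OF z(1)] ex(1)[OF uo]] z(2) ex(2)[OF uo] by simp
   have "sb n0 (ln u)" using n0 Ord_sb[OF nat_Ord[OF ln_om[OF uo]]] by auto
   then show ?thesis unfolding lu0 unfolding u0_def by (rule kap_cong[OF n0o eqn_mono[OF e]])
  qed
  note ic = in_cone_UU[OF seg jcl Op c12 _ u0o, folded k0_def]
  show ?thesis
  proof (cases "tpe u0")
   case True
   then obtain v where v: "v:U" "sb (ln v) (ln u0)" "kap (fs (sn (ex u0))) (ln v) = v" unfolding tpe_def by blast
   define Y where "Y = Sep Rl (%z. fs z:cone j M v)"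
   have "Y:L" unfolding Y_def by (rule seg_inv[OF seg c12(1) Op_cone[OF seg jcl Op v(1)]])
   moreover have "cone k0 X u = cone k0 Y u"
   proof (rule ext)
    fix z show "z:cone k0 X u <-> z:cone k0 Y u"
     using X[of z] sh0(1)[of z] True ku0[of z] ic(1)[of z v] v by (auto simp: ruleM_def Y_def)
   qed
   ultimately show ?thesis using G2[OF seg jcl k0 _ uo] by simp
  next
   case False
   then obtain v where v: "v:U" "sb (ln v) (ln u0)" "kap (sn (sn (ex u0))) (ln v) = v" using u0 unfolding tpe_def mem_UU by blast
   define Y where "Y = cmp (Sep Rl (%z. fs (sn z):cone j M v))"
   have "Y:L" unfolding Y_def by (rule seg_cmp[OF seg seg_inv[OF seg c12(2) Op_cone[OF seg jcl Op v(1)]]])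
   moreover have "cone k0 X u = cone k0 Y u"
   proof (rule ext)
    fix z show "z:cone k0 X u <-> z:cone k0 Y u"
     using X[of z] sh0(1)[of z] False ku0[of z] ic(2)[of z v] v by (auto simp: ruleM_def Y_def)
   qed
   ultimately show ?thesis using G2[OF seg jcl k0 _ uo] by simp
  qed
 qed
qed

text \<open>The intended arguments are \<open>pt G H z c\<close>: the values at \<open>z\<close> of
  the two reductions, \<open>z\<close> itself, and a code \<open>c\<close>. From such an argument
  \<open>KK\<close> recovers \<open>jh (kk j (ap G) (ap H)) z\<close>, by \<open>pt\<close>.\<close>

definition arg where "arg z = fs (sn (sn z))"
definition cde where "cde z = sn (sn (sn z))"
definition KK where "KK z = pr (arg z) (sn (jh k0 z))"
definition uKK where "uKK y = pr (arg (fs y)) (sn y)"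
lemma dt_arg [simp]: "dt a ==> dt (%s. arg (a s))" by (simp add: arg_def)
lemma dt_cde [simp]: "dt a ==> dt (%s. cde (a s))" by (simp add: cde_def)
lemma dt_KK [simp]: "dt a ==> dt (%s. KK (a s))" by (simp add: KK_def)
lemma dt_uKK [simp]: "dt a ==> dt (%s. uKK (a s))" by (simp add: uKK_def)
lemma ct_arg: "ct F ==> ct (%z. arg (F z))" and ct_cde: "ct F ==> ct (%z. cde (F z))"
 unfolding arg_def cde_def by (intro ct_intros | assumption)+
lemma ct_uKK: "ct uKK" using ct_pr[OF ct_arg[OF ct_fs[OF ct_id]] ct_sn[OF ct_id]] by (simp add: uKK_def[abs_def])
lemma uKK_jh: "z:Rl ==> uKK (jh k0 z) = KK z" "z:Rl ==> fs (jh k0 z) = z"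
 using jR by (simp_all add: uKK_def KK_def jh0)

definition pt where "pt G H z c = pr (G$z) (pr (H$z) (pr z c))"

text \<open>Meant to bound all sets that arise by the open operation from sets below
  \<open>R\<close>; the code of the reduction to \<open>R\<close> is part of the argument and is
  evaluated with stopping times in \<open>w\<close>.\<close>

definition BB where "BB R w = Sep Rl (%z. if hit k0 (UU U) z then ruleM z else Phi w (cde z) (KK z):R)"
lemma dt_BB [simp]: "dt a ==> dt b ==> dt (%s. BB (a s) (b s))"
 by (rule dt_lift2) (simp_all add: BB_def)
lemma mem_BB: "z:BB R w <-> z:Rl & (if hit k0 (UU U) z then ruleM z else Phi w (cde z) (KK z):R)"
 by (simp add: BB_def)

lemma BB_L:
 assumes min: "!!D' j' U' M'. D':L ==> less D' D ==> Op L j' U' D' M' ==> M':L"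
  and D: "D:L" and R: "less R D" "sb R Rl" and w: "w:WF"
 shows "BB R w:L"
proof -
 define Rt where "Rt = Sep Rl (%y. Phi w (cde (fs y)) (uKK y):R)"
 have cR: "ct (%y. Phi w (cde (fs y)) (uKK y))" by (rule ct_Phi[OF w ct_cde[OF ct_fs[OF ct_id]] ct_uKK])
 have mR: "y:Rt <-> y:Rl & Phi w (cde (fs y)) (uKK y):R" for y by (simp add: Rt_def)
 have sD: "sb D Rl" using seg_sb[OF seg D] .
 have sR: "sb Rt Rl" by (simp add: sb_def mR)
 have "wle Rt R" by (rule wleI[OF cR sR]) (simp add: mR)
 then have l: "less Rt D" using le2_less_trans[OF wle_le2 R(1) sR R(2) sD] by blast
 have "Op L k0 (UU U) Rt (BB R w)" unfolding Op_def
 proof (intro conjI allI impI k0)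
  show "sb (UU U) om" "sb (BB R w) Rl" by (auto simp: sb_def mem_UU mem_BB)
  fix u assume u: "u:UU U"
  show "cone k0 (BB R w) u:L" by (rule rule_cone[OF u]) (use u in \<open>auto simp: mem_BB hit_def\<close>)
 next
  fix z assume z: "z:Rl" "~hit k0 (UU U) z"
  then show "z:BB R w <-> jh k0 z:Rt" using uKK_jh jh0_R by (simp add: mem_BB mR)
 qed
 then show ?thesis using min[OF seg_wle[OF seg D less_wle(1)[OF sR sD l]] l] by blast
qed

text \<open>The counterpart of \<open>BB\<close> when every point is hit: only hits no later than
  the exit from \<open>w\<close> count.\<close>

definition CB where "CB w = Sep Rl (%z. (EX m. m:sc (lst (%n. n:om & ~inn w (lip (cde z) (KK z)) n)) & kap (jh k0 z) m:UU U) & ruleM z)"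
lemma dt_CB [simp]: "dt a ==> dt (%s. CB (a s))" by (rule dt_lift1) (simp_all add: CB_def)
lemma mem_CB: "z:CB w <-> z:Rl & (EX m. m:sc (lst (%n. n:om & ~inn w (lip (cde z) (KK z)) n)) & kap (jh k0 z) m:UU U) & ruleM z"
 by (simp add: CB_def)

lemma CB_L: assumes w: "w:WF" shows "CB w:L"
proof (rule G1[OF seg jcl k0])
 show "sb (CB w) Rl" by (simp add: sb_def mem_CB)
 fix z assume z: "z:Rl"
 define J where "J y = lip (cde (fs y)) (uKK y)" for y
 have J: "ct J" unfolding J_def by (rule ct_lip[OF ct_cde[OF ct_fs[OF ct_id]] ct_uKK])
 have Jz: "J (jh k0 z) = lip (cde z) (KK z)" if "z:Rl" for z using uKK_jh[OF that] by (simp add: J_def)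
 define n where "n = lst (%n. n:om & ~inn w (J (jh k0 z)) n)"
 have R: "J (jh k0 x):Rl" if "x:Rl" for x using ct_Rl[OF J jh0_R[OF that]] .
 have n: "n:om" unfolding n_def by (rule exit(1)[OF w R[OF z]])
 obtain m where m: "m:om" "!!y. y:Rl ==> eqn m (jh k0 z) y ==> eqn n (J (jh k0 z)) (J y)"
  using ct_eqn[OF J jh0_R[OF z] n] by blast
 obtain l where l: "l:om" "sb m l" "sb n l" by (rule nat_max[OF m(1) n])
 let ?u = "kap (jh k0 z) l"
 have uo: "?u:om" "ln ?u = l" using jh0_R[OF z] l(1) by simp_all
 have ex': "lst (%n. n:om & ~inn w (lip (cde x) (KK x)) n) = n" and kx: "!!i. i:sc n ==> kap (jh k0 x) i = kap (jh k0 z) i"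
  if x: "x:Rl" "kap (jh k0 x) l = ?u" for x
 proof -
  have e: "eqn l (jh k0 z) (jh k0 x)" using kap_eq_iff[OF l(1) jh0_R[OF z] jh0_R[OF x(1)]] x(2) by simp
  have "eqn n (J (jh k0 z)) (J (jh k0 x))" by (rule m(2)[OF jh0_R[OF x(1)] eqn_mono[OF e l(2)]])
  then show "lst (%n. n:om & ~inn w (lip (cde x) (KK x)) n) = n"
   using exit_cong[OF w R[OF z] R[OF x(1)]] Jz[OF x(1)] unfolding n_def by simp
  show "kap (jh k0 x) i = kap (jh k0 z) i" if i: "i:sc n" for i
  proof -
   have io: "i:om" using nat_in[OF sc_om[OF n] i] .
   have "sb i n" using i Ord_sb[OF nat_Ord[OF n]] by auto
   then have "sb i l" using l(3) sb_trans by blast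
   then show ?thesis using kap_cong[OF io eqn_sym[OF eqn_mono[OF e]]] by blast
  qed
 qed
 show "EX m. m:om & cone k0 (CB w) (kap (jh k0 z) m):L"
 proof (cases "EX m. m:sc n & kap (jh k0 z) m:UU U")
  case False
  have "cone k0 (CB w) ?u = emp" unfolding emp_iff mem_cone mem_CB uo(2) using ex' kx False by metis
  then show ?thesis using seg_emp[OF seg] l(1) by (intro exI[of _ l]) simp
 next
  case True
  then obtain i where i: "i:sc n" "kap (jh k0 z) i:UU U" by blast
  let ?u1 = "kap (jh k0 z) i"
  have io: "i:om" using nat_in[OF sc_om[OF n] i(1)] .
  have l1: "ln ?u1 = i" using jh0_R[OF z] io by simp
  define RU where "RU = Sep Rl (%z. ruleM z)"
  have mRU: "x:RU <-> x:Rl & ruleM x" for x by (simp add: RU_def)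
  have c1: "cone k0 RU ?u1:L" by (rule rule_cone[OF i(2)]) (use mRU in blast)
  have "cone k0 (CB w) ?u = cone k0 (cone k0 RU ?u1) ?u"
  proof (rule ext)
   fix x show "x:cone k0 (CB w) ?u <-> x:cone k0 (cone k0 RU ?u1) ?u"
   proof (cases "x:Rl & kap (jh k0 x) l = ?u")
    case True
    then have e: "lst (%n. n:om & ~inn w (lip (cde x) (KK x)) n) = n" and k: "kap (jh k0 x) i = ?u1" using ex' kx i by blast+
    show ?thesis unfolding mem_cone mem_CB mRU uo(2) l1 e using k i True by metis
   qed (unfold mem_cone uo(2), blast)
  qed
  then show ?thesis using G2[OF seg jcl k0 c1 uo(1)] l(1) by (intro exI[of _ l]) simp
 qed
qed

lemma UU_kap: assumes y: "y:Rl" "y':Rl" and m: "m:om" and s: "sn y = sn y'"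
 shows "kap y m:UU U <-> kap y' m:UU U"
proof -
 have *: "kap x m:UU U <-> (EX v. v:U & sb (ln v) m & (kap (fs (sn x)) (ln v) = v | kap (sn (sn x)) (ln v) = v))" if x: "x:Rl" for x
 proof -
  have e: "eqn m (fs (sn (ex (kap x m)))) (fs (sn x))" "eqn m (sn (sn (ex (kap x m)))) (sn (sn x))"
   using eqn_fs[OF m eqn_sn[OF m eqn_ex[OF x m]]] eqn_sn[OF m eqn_sn[OF m eqn_ex[OF x m]]] .
  have "kap (fs (sn (ex (kap x m)))) (ln v) = kap (fs (sn x)) (ln v)" "kap (sn (sn (ex (kap x m)))) (ln v) = kap (sn (sn x)) (ln v)"
   if "v:U" "sb (ln v) m" for v
   using kap_cong[OF _ eqn_mono[OF e(1) that(2)]] kap_cong[OF _ eqn_mono[OF e(2) that(2)]] ln_om sbD[OF Op_U[OF seg jcl Op] that(1)] by blast+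
  then show ?thesis unfolding mem_UU using x m by (auto simp: ln_kap[OF x m])
 qed
 show ?thesis unfolding *[OF y(1)] *[OF y(2)] s by simp
qed

context
 fixes S G H assumes S: "sb S Rl" and G: "ct (ap G)" and H: "ct (ap H)"
  and SG: "!!z. z:Rl ==> z:S <-> G$z:M" and SH: "!!z. z:Rl ==> ~z:S <-> H$z:M"
begin

lemma pt: assumes z: "z:Rl" and c: "c:Rl"
 shows "pt G H z c:Rl" "cde (pt G H z c) = c" "KK (pt G H z c) = jh (kk j (ap G) (ap H)) z"
  "hit k0 (UU U) (pt G H z c) <-> hit (kk j (ap G) (ap H)) (UU U) z" "ruleM (pt G H z c) <-> z:S"
  "sn (jh k0 (pt G H z c)) = sn (jh (kk j (ap G) (ap H)) z)"
proof -
 note R = ct_Rl[OF G z] ct_Rl[OF H z]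
 show p: "pt G H z c:Rl" using R z c by (simp add: pt_def)
 show "cde (pt G H z c) = c" using R z c by (simp add: pt_def cde_def)
 have a: "fs (pt G H z c) = G$z" "fs (sn (pt G H z c)) = H$z" "arg (pt G H z c) = z" using R z c by (simp_all add: pt_def arg_def)
 have j0: "jh k0 (pt G H z c) = pr (pt G H z c) (pr (jh j (G$z)) (jh j (H$z)))" using jh0[OF p] a by simp
 have jk: "jh (kk j (ap G) (ap H)) z = pr z (pr (jh j (G$z)) (jh j (H$z)))" by (rule jh_kk[OF seg jcl Op G H z])
 show "sn (jh k0 (pt G H z c)) = sn (jh (kk j (ap G) (ap H)) z)" unfolding j0 jk using p z R jR by simp
 show "KK (pt G H z c) = jh (kk j (ap G) (ap H)) z" unfolding KK_def j0 jk a(3) using p R jR by simp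
 show "hit k0 (UU U) (pt G H z c) <-> hit (kk j (ap G) (ap H)) (UU U) z"
  unfolding hit0[OF p] a hit_UU[OF seg jcl Op G H z] by simp
 show "ruleM (pt G H z c) <-> z:S" unfolding ruleM_def a using SG[OF z] SH[OF z] by (cases "G$z:M") simp_all
qed

lemma ct_pt: "c:Rl ==> ct (%z. pt G H z c)"
 unfolding pt_def by (rule ct_pr[OF G ct_pr[OF H ct_pr[OF ct_id ct_const]]])

text \<open>The argument carries a code \<open>c\<close> of the reduction of \<open>Dt\<close> to
  \<open>R\<close>, which \<open>Phi w\<close> evaluates correctly once the rank of \<open>w\<close>
  is large enough.\<close>

lemma S_BB:
 assumes Dt: "!!z. z:Rl ==> ~hit (kk j (ap G) (ap H)) (UU U) z ==> z:S <-> jh (kk j (ap G) (ap H)) z:Dt" and DR: "wle Dt R"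
 shows "EX B. B:WF & (ALL w. w:WF --> sb (rw B) (rw w) --> wle S (BB R w))"
proof -
 obtain t where t: "ct (ap t)" "!!x. x:Rl ==> x:Dt <-> t$x:R" using wleE[OF DR] by metis
 obtain B where B: "B:WF" "!!w. w:WF ==> sb (rw B) (rw w) ==> EX c. c:Rl & (ALL x. x:Rl --> Phi w c x = t$x)"
  using Phi_all[OF t(1)] by blast
 have "wle S (BB R w)" if w: "w:WF" "sb (rw B) (rw w)" for w
 proof -
  obtain c where c: "c:Rl" "!!x. x:Rl ==> Phi w c x = t$x" using B(2)[OF w] by blast
  show ?thesis
  proof (rule wleI[OF ct_pt[OF c(1)] S])
   fix z assume z: "z:Rl"
   note p = pt[OF z c(1)]
   have jz: "jh (kk j (ap G) (ap H)) z:Rl" by (rule jh_Rl[OF kk_code[OF seg jcl Op G H] z])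
   show "z:S <-> pt G H z c:BB R w"
    unfolding mem_BB p(2,3,4,5) using p(1) Dt[OF z] c(2)[OF jz] t(2)[OF jz] by auto
  qed
 qed
 then show ?thesis using B(1) by blast
qed

text \<open>As every point is hit and the graph of the code is closed, the tree of nodes not yet hit
  is well-founded. A strategy mapping it into \<open>w\<close> turns the exit from \<open>w\<close>
  into a bound for the time of the hit.\<close>

lemma S_CB:
 assumes h: "!!z. z:Rl ==> hit (kk j (ap G) (ap H)) (UU U) z"
 shows "EX B. B:WF & (ALL w. w:WF --> sb (rw B) (rw w) --> wle S (CB w))"
proof -
 let ?k = "kk j (ap G) (ap H)"
 have kc: "code L ?k" by (rule kk_code[OF seg jcl Op G H])
 define Q where "Q b n <-> n = emp | (EX z. z:Rl & eqn n (jh ?k z) b) & (ALL m. m:n --> ~kap b m:UU U)" for b n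
 have dQ: "dp (%s. Q (s 0) (s 1))" unfolding Q_def by simp
 have c: "Q b' n" if "n:om" "eqn n b b'" "Q b n" for b b' n
 proof -
  have "kap b m = kap b' m" if "m:n" for m
   using kap_cong[OF nat_in[OF \<open>n:om\<close> that] eqn_mono[OF \<open>eqn n b b'\<close> Ord_sb[OF nat_Ord[OF \<open>n:om\<close>] that]]] .
  then show ?thesis using that(3) eqn_trans[OF _ that(2)] unfolding Q_def by metis
 qed
 have m: "Q b n" if "Q b (sc n)" for b n using that unfolding Q_def eqn_sc by auto
 have WR: "mkt Q:Rl" by (rule mkt(1)[OF dQ], rule c, assumption+, rule m, assumption) (simp add: Q_def)
 have WQ: "inn (mkt Q) b n <-> Q b n" if "b:Rl" "n:om" for b n
  by (rule mkt(2)[OF dQ _ _ _ that], rule c, assumption+, rule m, assumption) (simp add: Q_def)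
 have WW: "mkt Q:WF" unfolding mem_WF
 proof (intro conjI allI impI WR, rule ccontr)
  fix b assume b: "b:Rl" and nb: "~(EX n. n:om & ~inn (mkt Q) b n)"
  have Qb: "(EX z. z:Rl & eqn (sc n) (jh ?k z) b) & (ALL m. m:sc n --> ~kap b m:UU U)" if "n:om" for n
  proof -
   have "Q b (sc n)" using nb WQ[OF b sc_om[OF that]] sc_om[OF that] by blast
   then show ?thesis unfolding Q_def by auto
  qed
  have "?k$(fs b) = sn b"
  proof -
   have "EX z'. z':Rl & eqn n (fs b) z' & eqn n (sn b) (?k$z')" if n: "n:om" for n
   proof -
    obtain z where z: "z:Rl" "eqn n b (jh ?k z)" using Qb[OF n] eqn_sym unfolding eqn_sc by blast
    show ?thesis using eqn_fs[OF n z(2)] eqn_sn[OF n z(2)] z(1) code_Rl[OF kc] by (auto simp: jh_def)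
   qed
   then show ?thesis using kc fs_Rl[OF b] sn_Rl[OF b] unfolding code_def cgr_def by blast
  qed
  then have jb: "jh ?k (fs b) = b" using b by (simp add: jh_def)
  obtain u where u: "u:UU U" "kap b (ln u) = u" using h[OF fs_Rl[OF b]] unfolding hit_def jb by blast
  have "ln u:om" using u(1) mem_UU by simp
  then show False using Qb u by (metis mem_sc)
 qed
 have "wle S (CB w)" if w: "w:WF" "sb (rw (mkt Q)) (rw w)" for w
 proof -
  obtain e where e: "e:Rl" "!!b n. b:Rl ==> n:om ==> inn (mkt Q) b n ==> inn w (lip e b) n" using rank_lip[OF WW w] by blast
  show ?thesis
  proof (rule wleI[OF ct_pt[OF e(1)] S])
   fix z assume z: "z:Rl"
   note p = pt[OF z e(1)]
   let ?b = "jh ?k z"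
   have b: "?b:Rl" by (rule jh_Rl[OF kc z])
   have R: "lip e ?b:Rl" using e(1) b by simp
   let ?n = "lst (%n. n:om & ~inn w (lip e ?b) n)"
   note l = exit[OF w(1) R]
   have "~Q ?b ?n" using e(2)[OF b l(1)] l(2) WQ[OF b l(1)] by blast
   then obtain i where i: "i:?n" "kap ?b i:UU U" unfolding Q_def using z by auto
   have io: "i:om" using nat_in[OF l(1) i(1)] .
   have "kap (jh k0 (pt G H z e)) i:UU U" using UU_kap[OF jh0_R[OF p(1)] b io p(6)] i(2) by simp
   then have "EX m. m:sc ?n & kap (jh k0 (pt G H z e)) m:UU U" using i(1) by (intro exI[of _ i]) simp
   then show "z:S <-> pt G H z e:CB w"
    unfolding mem_CB p(2,3,5) using p(1) by auto
  qed
 qed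
 then show ?thesis using WW by blast
qed

end

definition rep where "rep S Dt <-> (EX G H. Ct G & Ct H & (ALL z. z:Rl --> (z:S <-> G$z:M)) & (ALL z. z:Rl --> (~z:S <-> H$z:M)) &
 (ALL z. z:Rl --> ~hit (kk j (ap G) (ap H)) (UU U) z --> (z:S <-> jh (kk j (ap G) (ap H)) z:Dt)))"
definition allhit where "allhit S <-> (EX G H. Ct G & Ct H & (ALL z. z:Rl --> (z:S <-> G$z:M)) & (ALL z. z:Rl --> (~z:S <-> H$z:M)) &
 (ALL z. z:Rl --> hit (kk j (ap G) (ap H)) (UU U) z))"
lemma dt_kk [simp]: "dt a ==> dt b ==> dt (%s. kk j (ap (a s)) (ap (b s)))"
 by (rule dt_lift2[of "%a b. kk j (ap a) (ap b)"]) (simp_all add: kk_def[OF seg jcl Op])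
lemma dp_rep [simp]: "dt a ==> dt b ==> dp (%s. rep (a s) (b s))"
 by (rule dp_lift2) (simp_all add: rep_def)
lemma dp_allhit [simp]: "dt a ==> dp (%s. allhit (a s))"
 by (rule dp_lift1) (simp_all add: allhit_def)

lemma rep_ex: assumes pv: "pv L M" and D: "sb D Rl" "~wle D (cmp D)" and S: "S:L"
 shows "allhit S | (EX Dt. Dt:lo D & rep S Dt)"
proof -
 have sM: "sb M Rl" "~M:L" using pv pv_def by auto
 have sS: "sb S Rl" using seg_sb[OF seg S] .
 have ls: "less S M" using seg_less[OF seg S sM(2)] .
 obtain G where G: "Ct G" "ct (ap G)" "!!x. x:Rl ==> x:S <-> G$x:M" using wleE[OF less_wle(1)[OF sS sM(1) ls]] by metis
 obtain H where H: "Ct H" "ct (ap H)" "!!x. x:Rl ==> x:cmp S <-> H$x:M" using wleE[OF less_wle(2)[OF sS sM(1) ls]] by metis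
 have H3: "~x:S <-> H$x:M" if "x:Rl" for x using H(3)[OF that] that by simp
 note c = seg jcl Op G(2) H(2) sS G(3) H3
 show ?thesis
 proof (cases "EE j U (ap G) (ap H) = emp")
  case True
  have "hit (kk j (ap G) (ap H)) (UU U) z" if "z:Rl" for z
   using True that mem_EE[OF c] unfolding emp_iff by blast
  then have "allhit S" unfolding allhit_def using G H H3 by blast
  then show ?thesis ..
 next
  case False
  obtain Dt where Dt: "Op L (kk j (ap G) (ap H)) (UU U) Dt S" "wle Dt D" "wle Dt (cmp D)" using piv_small[OF c False D(1)] by blast
  have "Dt:lo D" unfolding mem_lo using less_of[OF Dt(2,3) D(2,1)] wle_sb[OF Dt(2)] by blast
  moreover have "rep S Dt" unfolding rep_def using G H H3 Op_def'[OF seg jcl Dt(1)] by blast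
  ultimately show ?thesis by blast
 qed
qed

lemma allhit_rep: "allhit S ==> rep S Dt" unfolding allhit_def rep_def by blast

text \<open>The covering of \<open>lo D\<close> induces a covering of \<open>L\<close> by the sets
  \<open>A \<xi>\<close>. Either all of them are bounded in \<open>L\<close>, or one of them is
  unbounded; the latter uses only sets below a single \<open>R0\<close>, and then the sets
  \<open>BB (dbj R0) w\<close> are cofinal.\<close>

lemma cof_c1:
 assumes pv: "pv L M" and D: "D:L" "~wle D (cmp D)" and IH: "cof1 (lo D)"
  and min: "!!D' j' U' M'. D':L ==> less D' D ==> Op L j' U' D' M' ==> M':L"
 shows "cof1 L"
proof -
 have sD: "sb D Rl" using seg_sb[OF seg D(1)] .
 have sL: "sb S Rl" if "S:L" for S using seg_sb[OF seg that] .
 show ?thesis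
 proof (cases "EX X. X:lo D")
  case False
  show ?thesis
  proof (rule cof_family[OF seg, of CB])
   show "dt (%s. CB (s 0))" by simp
   show "CB w:L" if "w:WF" for w using CB_L[OF that] .
   fix T assume T: "T:L"
   have "allhit T" using rep_ex[OF pv sD D(2) T] False by blast
   then obtain G H where GH: "Ct G" "Ct H" "!!z. z:Rl ==> (z:T <-> G$z:M)" "!!z. z:Rl ==> (~z:T <-> H$z:M)"
    "!!z. z:Rl ==> hit (kk j (ap G) (ap H)) (UU U) z" unfolding allhit_def by blast
   obtain B where B: "B:WF" "!!w. w:WF ==> sb (rw B) (rw w) ==> wle T (CB w)"
    using S_CB[OF sL[OF T] Ct_ct[OF GH(1)] Ct_ct[OF GH(2)] GH(3-5)] by blast
   then have "le2 T (CB w)" if "w:WF" "rw w = rw B" for w using that wle_le2 by simp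
   then show "EX w0. w0:WF & (ALL w. w:WF --> rw w = rw w0 --> le2 T (CB w))" using B(1) by blast
  qed
 next
  case True
  then obtain X0 where X0: "X0:lo D" by blast
  obtain F where F: "!!\<xi>. \<xi>:w1 ==> (EX X. X:F$\<xi>) ==> (EX Y. Y:lo D & (ALL X. X:F$\<xi> --> le2 X Y))"
   "!!X. X:lo D ==> EX \<xi>. \<xi>:w1 & X:F$\<xi>" using IH unfolding cof1_def by blast
  define A where "A \<xi> = Sep L (%S. allhit S | (EX Dt. Dt:F$\<xi> & sb Dt Rl & rep S Dt))" for \<xi>
  have mA: "S:A \<xi> <-> S:L & (allhit S | (EX Dt. Dt:F$\<xi> & sb Dt Rl & rep S Dt))" for S \<xi> by (simp add: A_def)
  have dA: "dt (%s. A (s 0))" unfolding A_def by simp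
  show ?thesis
  proof (cases "ALL \<xi>. \<xi>:w1 --> (EX Y. Y:L & (ALL S. S:A \<xi> --> le2 S Y))")
   case True
   show ?thesis
   proof (rule cof1I[OF dA])
    fix S assume S: "S:L"
    have e: "emp:w1" using om_w1 by simp
    show "EX \<xi>. \<xi>:w1 & S:A \<xi>"
     using rep_ex[OF pv sD D(2) S] F(2) e S unfolding mA mem_lo by metis
   qed (use True in blast)
  next
   case False
   then obtain \<xi> where \<xi>: "\<xi>:w1" "!!Y. Y:L ==> EX S. S:A \<xi> & ~le2 S Y" by blast
   obtain R0 where R0: "R0:lo D" "!!X. X:F$\<xi> ==> le2 X R0" using F(1)[OF \<xi>(1)] X0 by blast
   have sR0: "sb R0 Rl" "less R0 D" using R0(1) mem_lo by auto
   let ?R = "dbj R0"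
   have R: "less ?R D" "sb ?R Rl" using dbj_less[OF sD D(2) sR0] dbj_sb by auto
   show ?thesis
   proof (rule cof_family[OF seg, of "BB ?R"])
    show "dt (%s. BB ?R (s 0))" by simp
    show "BB ?R w:L" if "w:WF" for w by (rule BB_L[OF min D(1) R that])
    fix T assume T: "T:L"
    obtain S where S: "S:L" "allhit S | (EX Dt. Dt:F$\<xi> & sb Dt Rl & rep S Dt)" "~le2 S T" using \<xi>(2)[OF T] unfolding mA by blast
    have TS: "le2 T S" using less_le2[OF sL[OF T] sL[OF S(1)]] S(3) less_def by blast
    obtain Dt where Dt: "wle Dt ?R" "rep S Dt"
     using S(2) allhit_rep[of S ?R] wle_refl[OF R(2)] le2_dbj[OF R0(2) _ sR0(1)] by blast
    obtain G H where GH: "Ct G" "Ct H" "!!z. z:Rl ==> (z:S <-> G$z:M)" "!!z. z:Rl ==> (~z:S <-> H$z:M)"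
     "!!z. z:Rl ==> ~hit (kk j (ap G) (ap H)) (UU U) z ==> (z:S <-> jh (kk j (ap G) (ap H)) z:Dt)" using Dt(2) unfolding rep_def by blast
    obtain B where B: "B:WF" "!!w. w:WF ==> sb (rw B) (rw w) ==> wle S (BB ?R w)"
     using S_BB[OF sL[OF S(1)] Ct_ct[OF GH(1)] Ct_ct[OF GH(2)] GH(3-5) Dt(1)] by blast
    have "le2 T (BB ?R w)" if "w:WF" "rw w = rw B" for w
     using le2_trans[OF TS wle_le2[OF B(2)] sL[OF S(1)]] that by (simp add: sb_def mem_BB)
    then show "EX w0. w0:WF & (ALL w. w:WF --> rw w = rw w0 --> le2 T (BB ?R w))" using B(1) by blast
   qed
  qed
 qed
qed

end

section \<open>The union of the good segments\<close>

text \<open>Any two such segments are comparable, so their union \<open>Ls\<close> is again one. It contains the difference class,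
 for otherwise the least set above it could be added to it.\<close>

definition HG where "HG L <-> seg L & wf L less & (ALL D. D:L --> SDp D & cof1 (lo D))"
lemma dp_HG [simp]: "dt a ==> dp (%s. HG (a s))" by (rule dp_lift1) (simp_all add: HG_def)

lemma HG_D: "HG L ==> seg L" "HG L ==> wf L less" "HG L ==> D:L ==> SDp D" "HG L ==> D:L ==> cof1 (lo D)"
 unfolding HG_def by blast+

text \<open>Only one degree is added, up to complements, and exactly \<open>L\<close> lies below
  each new set; so \<open>cof1 L\<close> is what the new sets require. A new selfdual set can occur
  only when \<open>N\<close> is a join, which provides \<open>SDp\<close>.\<close>

lemma HG_ext:
 assumes HG: "HG L" and ab: "abv L N" and co: "cof1 L" and sd: "~wle N (cmp N) | (EX Q. fn Q om L & N = Jn Q)"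
 shows "HG (Sep (Pw Rl) (%X. le2 X N))"
proof -
 note seg = HG_D(1)[OF HG] and wf = HG_D(2)[OF HG]
 have N: "sb N Rl" "~N:L" "!!S. sb S Rl ==> ~S:L ==> le2 N S" using ab abv_def by auto
 define L' where "L' = Sep (Pw Rl) (%X. le2 X N)"
 have mL: "X:L' <-> sb X Rl & le2 X N" for X by (simp add: L'_def)
 have LL: "X:L'" if "X:L" for X
  unfolding mL using seg_sb[OF seg that] less_le2[OF _ N(1) seg_less[OF seg that N(2)]] by blast
 have sg: "seg L'" unfolding seg_def
 proof (intro conjI allI impI)
  show "emp:L'" using LL seg_emp[OF seg] by blast
  show "sb X Rl" if "X:L'" for X using that mL by blast
  show "cmp X:L'" if "X:L'" for X using that le2_cmp(1)[OF _ N(1)] mL by simp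
  show "X:L'" if "Y:L'" "wle X Y" for X Y using that le2_trans[OF wle_le2[OF that(2)]] N(1) wle_sb unfolding mL by blast
 qed
 have eqv: "le2 N X" if "X:L'" "~X:L" for X using N(3) that mL by blast
 have w: "wf L' less" unfolding wf_def
 proof (intro allI impI)
  fix Z assume Z: "sb Z L' & (EX x. x:Z)"
  show "EX x. x:Z & (ALL y. y:Z --> ~less y x)"
  proof (cases "EX x. x:Z & x:L")
   case True
   define Z' where "Z' = Sep Z (%x. x:L)"
   have mZ: "x:Z' <-> x:Z & x:L" for x by (simp add: Z'_def)
   have "sb Z' L" "EX x. x:Z'" using True by (auto simp: sb_def mZ)
   then obtain x where x: "x:Z'" "!!y. y:Z' ==> ~less y x" using wf unfolding wf_def by blast
   have "~less y x" if y: "y:Z" for y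
   proof
    assume l: "less y x"
    have "y:L'" "x:L'" using Z y x(1) sbD mZ by blast+
    then have "sb y Rl" "sb x Rl" using mL by blast+
    then have "y:L" using seg_le2[OF seg _ less_le2[OF _ _ l]] x(1) mZ by blast
    then show False using x(2) y l mZ by blast
   qed
   then show ?thesis using x(1) mZ by blast
  next
   case False
   obtain x where x: "x:Z" using Z by blast
   have "~less y x" if y: "y:Z" for y
   proof -
    have xy: "x:L'" "y:L'" using Z x y sbD by blast+
    have "le2 x y" using le2_trans[of x N y] xy eqv[OF xy(2)] False y N(1) unfolding mL by blast
    then show ?thesis by (simp add: less_def)
   qed
   then show ?thesis using x by blast
  qed
 qed
 have "SDp D & cof1 (lo D)" if D: "D:L'" for D
 proof (cases "D:L")
  case True then show ?thesis using HG_D[OF HG] by blast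
 next
  case False
  have sD: "sb D Rl" and DN: "le2 D N" using D mL by auto
  have ND: "le2 N D" using eqv[OF D False] .
  have "lo D = L"
  proof (rule ext)
   fix X
   have "X:L" if "sb X Rl" "less X D"
   proof (rule ccontr)
    assume "~X:L"
    then have "le2 D X" using le2_trans[OF DN N(3)[OF that(1)]] N(1) that by blast
    then show False using that less_def by blast
   qed
   then show "X:lo D <-> X:L" unfolding mem_lo using seg_less[OF seg _ False] seg_sb[OF seg] by blast
  qed
  moreover have "SDp D" unfolding SDp_def
  proof
   assume dd: "wle D (cmp D)"
   have ND': "wle N D" using ND wle_trans[OF _ wle_cmp1[OF sD dd sD]] unfolding le2_def by blast
   show "EX f Q. Ct f & fn Q om (Pw Rl) & (ALL n. n:om --> less (Q$n) D) & (ALL x. x:Rl --> (x:D <-> f$x:Jn Q))"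
    using sd
   proof
    assume nsd: "~wle N (cmp N)"
    have False using DN unfolding le2_def
    proof
     assume "wle D N" then show False using nsd wle_trans[OF ND' wle_trans[OF dd wle_cmp]] by blast
    next
     assume "wle D (cmp N)" then show False using nsd wle_trans[OF ND'] by blast
    qed
    then show ?thesis ..
   next
    assume "EX Q. fn Q om L & N = Jn Q"
    then obtain Q where Q: "fn Q om L" "N = Jn Q" by blast
    have lQ: "less (Q$n) D" "sb (Q$n) Rl" if "n:om" for n
     using seg_less[OF seg fn_ap(2)[OF Q(1) that] False] seg_sb[OF seg fn_ap(2)[OF Q(1) that]] .
    define Q' where "Q' = Lam om (%n. cmp (Q$n))"
    have Q'n: "Q'$n = cmp (Q$n)" if "n:om" for n using that by (simp add: Q'_def)
    have fQ': "fn Q' om (Pw Rl)" unfolding Q'_def by (rule fn_Lam) auto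
    have fQ: "fn (Lam om (%n. Q$n)) om (Pw Rl)" by (rule fn_Lam) (use lQ in auto)
    from DN show ?thesis unfolding le2_def
    proof
     assume "wle D N"
     then obtain f where f: "Ct f" "!!x. x:Rl ==> x:D <-> f$x:N" using wleE by metis
     have "f$x:Jn (Lam om (%n. Q$n)) <-> f$x:Jn Q" if "x:Rl" for x
      using ct_Rl[OF Ct_ct[OF f(1)] that] by simp
     then show ?thesis using f fQ lQ Q(2) by (intro exI[of _ f] exI[of _ "Lam om (%n. Q$n)"]) simp
    next
     assume "wle D (cmp N)"
     then obtain f where f: "Ct f" "!!x. x:Rl ==> x:D <-> f$x:cmp N" using wleE by metis
     have "f$x:Jn Q' <-> f$x:cmp (Jn Q)" if "x:Rl" for x
      using ct_Rl[OF Ct_ct[OF f(1)] that] Q'n by auto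
     moreover have "less (Q'$n) D" if "n:om" for n using lQ[OF that] less_cmp(1)[OF _ sD] Q'n[OF that] by simp
     ultimately show ?thesis using f fQ' Q(2) by (intro exI[of _ f] exI[of _ Q']) auto
    qed
   qed
  qed
  ultimately show ?thesis using co by simp
 qed
 then show ?thesis using sg w unfolding HG_def L'_def by blast
qed

lemma cof_emp: "cof1 emp" by (rule cof1I[of "%_. emp"]) auto

lemma triv: assumes "sb X Rl" shows "le2 emp X" "le2 Rl X"
proof -
 have "le2 emp X"
 proof (cases "X = Rl")
  case True
  have "wle emp (cmp X)" by (rule wleI[OF ct_id]) (auto simp: True sb_def)
  then show ?thesis by (simp add: le2_def)
 next
  case False
  then obtain x where x: "x:Rl" "~x:X" using sb_antisym[OF assms] unfolding sb_def by blast
  have "wle emp X" by (rule wleI[OF ct_const[OF x(1)]]) (use x in \<open>auto simp: sb_def\<close>)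
  then show ?thesis by (simp add: le2_def)
 qed
 moreover have "cmp emp = Rl" by (rule ext) simp
 ultimately show "le2 emp X" "le2 Rl X" using le2_cmp(1)[of emp X] assms by (auto simp: sb_def)
qed

lemma HG_0: "HG (Sep (Pw Rl) (%X. X = emp | X = Rl))"
proof -
 define L where "L = Sep (Pw Rl) (%X. X = emp | X = Rl)"
 have mL: "X:L <-> X = emp | X = Rl" for X by (auto simp: L_def sb_def)
 have ne: "emp ~= Rl" using zr_Rl mem_emp by metis
 have c: "cmp emp = Rl" "cmp Rl = emp" by (rule ext, simp)+
 have w: "X = emp" if "wle X emp" for X using that unfolding wle_def emp_iff by auto
 have w2: "X = Rl" if X: "wle X Rl" for X
 proof (rule ext)
  obtain f where "ct (ap f)" "!!x. x:Rl ==> x:X <-> f$x:Rl" using wleE[OF X] by metis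
  then show "x:X <-> x:Rl" for x using ct_Rl wle_sb[OF X] sbD by blast
 qed
 have "seg L" unfolding seg_def mL using c w w2 by (auto simp: sb_def)
 moreover have nl: "~less X D" if "sb X Rl" "D:L" for X D using triv[OF that(1)] that(2) unfolding less_def mL by auto
 then have "wf L less" unfolding wf_def mL using mL by (metis sbD sb_refl emp_iff mem_emp sbI)
 moreover have "SDp D & cof1 (lo D)" if D: "D:L" for D
 proof
  have "lo D = emp" unfolding emp_iff mem_lo using nl D by blast
  then show "cof1 (lo D)" using cof_emp by simp
  have "~wle D (cmp D)" using D w w2 c ne unfolding mL by metis
  then show "SDp D" unfolding SDp_def by blast
 qed
 ultimately show ?thesis unfolding HG_def L_def by blast
qed

definition Ls where "Ls = Sep (Pw Rl) (%X. EX L. HG L & X:L)"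
lemma mem_Ls: "X:Ls <-> (EX L. HG L & X:L)"
 using HG_D(1) seg_sb by (auto simp: Ls_def)

lemma HG_Ls: "HG Ls"
proof -
 have "seg Ls" unfolding seg_def
 proof (intro conjI allI impI)
  show "emp:Ls" unfolding mem_Ls using HG_0 seg_emp[OF HG_D(1)[OF HG_0]] by blast
  show "sb X Rl" "cmp X:Ls" if "X:Ls" for X using that HG_D(1) seg_sb seg_cmp unfolding mem_Ls by blast+
  show "X:Ls" if "Y:Ls" "wle X Y" for X Y using that HG_D(1) seg_wle unfolding mem_Ls by blast
 qed
 moreover have "wf Ls less" unfolding wf_def
 proof (intro allI impI)
  fix Z assume Z: "sb Z Ls & (EX x. x:Z)"
  then obtain x L where x: "x:Z" "HG L" "x:L" using sbD mem_Ls by metis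
  note sg = HG_D(1)[OF x(2)]
  define Z' where "Z' = Sep Z (%x. x:L)"
  have mZ: "x:Z' <-> x:Z & x:L" for x by (simp add: Z'_def)
  have "sb Z' L" "EX x. x:Z'" using x by (auto simp: sb_def mZ)
  then obtain m where m: "m:Z'" "!!y. y:Z' ==> ~less y m" using HG_D(2)[OF x(2)] unfolding wf_def by blast
  have "~less y m" if y: "y:Z" for y
  proof
   assume l: "less y m"
   have "sb y Rl" using Z y sbD seg_sb[OF \<open>seg Ls\<close>] by blast
   then have "y:L" using seg_le2[OF sg _ less_le2[OF _ _ l]] m(1) mZ seg_sb[OF sg] by blast
   then show False using m(2) y l mZ by blast
  qed
  then show "EX x. x:Z & (ALL y. y:Z --> ~less y x)" using m(1) mZ by blast
 qed
 moreover have "SDp D & cof1 (lo D)" if "D:Ls" for D using that HG_D(3,4) unfolding mem_Ls by blast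
 ultimately show ?thesis unfolding HG_def by blast
qed

lemma Ls_max: assumes "abv Ls N" "cof1 Ls" "~wle N (cmp N) | (EX Q. fn Q om Ls & N = Jn Q)" shows False
proof -
 have s: "sb N Rl" "~N:Ls" using assms(1) abv_def by auto
 have "N:Ls" unfolding mem_Ls using HG_ext[OF HG_Ls assms] s(1) by (intro exI[of _ "Sep (Pw Rl) (%X. le2 X N)"]) simp
 then show False using s(2) by blast
qed

lemma DC_Ls: assumes "DC A" shows "A:Ls"
proof -
 note seg = HG_D(1)[OF HG_Ls]
 have jcl: "jcl Ls" unfolding jcl_def
 proof (intro allI impI, rule ccontr)
  fix Q assume Q: "fn Q om Ls" and n: "~Jn Q:Ls"
  show False using Ls_max[OF join_abv[OF seg Q n] cof_join[OF seg Q n]] Q by blast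
 qed
 have ocl: "ocl Ls" unfolding ocl_def
 proof (intro allI impI, rule ccontr)
  fix D j U S assume D: "D:Ls" "Op Ls j U D S" "~S:Ls"
  obtain D j U M where M: "D:Ls" "~wle D (cmp D)" "Op Ls j U D M" "pv Ls M"
   "!!D' j' U' M'. D':Ls ==> less D' D ==> Op Ls j' U' D' M' ==> M':Ls"
   using case1[OF seg jcl HG_D(2)[OF HG_Ls] HG_D(3)[OF HG_Ls] D] by blast
  have "cof1 Ls" by (rule cof_c1[OF seg jcl M(3,4,1,2) HG_D(4)[OF HG_Ls M(1)] M(5)])
  then show False using Ls_max[OF pv_abv[OF M(4)]] pv_not_sd[OF M(4)] by blast
 qed
 have "~C2 Ls X f" for X f
 proof
  assume C: "C2 Ls X f"
  note p = case2[OF seg jcl ocl C]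
  show False using Ls_max[OF pv_abv[OF p] cof_c2[OF seg jcl ocl C]] pv_not_sd[OF p] by blast
 qed
 then show ?thesis using nocase[OF seg jcl ocl _ assms] by blast
qed

section \<open>The second uncountable cardinal is regular\<close>

text \<open>\<open>YY\<close> is the least set of codes for ordinals that is closed under suprema of families indexed by the well-founded
 trees. Boundedness for strategies codes the families of length \<open>\<omega>\<^sub>1\<close>, and as in the Kunen-Martin theorem a relation on
 \<open>\<omega>\<^sub>1\<close> bounds the ranks of the codes below \<open>\<omega>\<^sub>2\<close>. This replaces the usual argument for the regularity of
 \<open>\<omega>\<^sub>2\<close>, which needs choice.\<close>

definition YY where "YY = Sep Rl (%y. ALL Z. (ALL y. y:Rl --> y$emp = emp | (ALL w. w:WF --> lip (tl y) w:Z) --> y:Z) --> y:Z)"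
definition yr where "yr b a <-> a$emp ~= emp & (EX w. w:WF & b = lip (tl a) w)"
definition yk where "yk y = rk YY yr y"
lemma dp_yr [simp]: "dt a ==> dt b ==> dp (%s. yr (a s) (b s))" by (rule dp_lift2) (simp_all add: yr_def)
lemma dt_yk [simp]: "dt a ==> dt (%s. yk (a s))" by (rule dt_lift1) (simp_all add: yk_def)

lemma mem_YY: "y:YY <-> y:Rl & (ALL Z. (ALL y. y:Rl --> y$emp = emp | (ALL w. w:WF --> lip (tl y) w:Z) --> y:Z) --> y:Z)"
 by (simp add: YY_def)
lemma YY_Rl: "y:YY ==> y:Rl" by (simp add: mem_YY)

lemma YY_ind: "y:YY ==> (!!y. y:Rl ==> y$emp = emp | (ALL w. w:WF --> lip (tl y) w:Z) ==> y:Z) ==> y:Z"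
 unfolding mem_YY by blast

lemma YYI: assumes "y:Rl" "y$emp = emp | (ALL w. w:WF --> lip (tl y) w:YY)" shows "y:YY"
 unfolding mem_YY
proof (intro conjI allI impI assms(1))
 fix Z assume Z: "ALL y. y:Rl --> y$emp = emp | (ALL w. w:WF --> lip (tl y) w:Z) --> y:Z"
 have "x:Z" if "x:YY" for x by (rule YY_ind[OF that]) (use Z in blast)
 then show "y:Z" using Z assms by blast
qed

lemma YY_inv: assumes "y:YY" "yr b y" shows "b:YY"
proof -
 define Z where "Z = Sep YY (%y. ALL b. yr b y --> b:YY)"
 have mZ: "x:Z <-> x:YY & (ALL b. yr b x --> b:YY)" for x by (simp add: Z_def)
 have "y:Z"
 proof (rule YY_ind[OF assms(1)])
  fix y assume y: "y:Rl" "y$emp = emp | (ALL w. w:WF --> lip (tl y) w:Z)"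
  then have "y$emp = emp | (ALL w. w:WF --> lip (tl y) w:YY)" using mZ by blast
  then show "y:Z" unfolding mZ using YYI[OF y(1)] unfolding yr_def by blast
 qed
 then show ?thesis using assms(2) mZ by blast
qed

lemma wf_YY: "wf YY yr"
 unfolding wf_def
proof (intro allI impI, rule ccontr)
 fix Z assume Z: "sb Z YY & (EX x. x:Z)" and no: "~(EX x. x:Z & (ALL y. y:Z --> ~yr y x))"
 define Z' where "Z' = cmp Z"
 have mZ: "x:Z' <-> x:Rl & ~x:Z" for x by (simp add: Z'_def)
 have "x:Z'" if "x:YY" for x
 proof (rule YY_ind[OF that])
  fix y assume "y:Rl" "y$emp = emp | (ALL w. w:WF --> lip (tl y) w:Z')"
  then show "y:Z'" using no unfolding mZ yr_def by blast
 qed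
 then show False using Z sbD mZ by blast
qed

lemma dp_yrv: "dp (%s. yr (s 1) (s 0))" by simp

lemma Ord_yk: "y:YY ==> Ord (yk y)" unfolding yk_def by (rule Ord_rk[OF wf_YY dp_yrv])
lemma yk_mono: "y:YY ==> yr b y ==> yk b:yk y"
 unfolding yk_def using rk_mono[OF wf_YY dp_yrv] YY_inv by blast

lemma zr_YY: "zr:YY" by (rule YYI[OF zr_Rl]) (simp add: zr_def)

definition one where "one = Lam om (%n. sc emp)"
lemma one: "one:Rl" "n:om ==> one$n = sc emp" unfolding one_def by (rule RlI) auto

text \<open>The entry at the root is never tested, so it can carry \<open>n\<close>; all other
  entries exclude their nodes.\<close>

lemma WF_cn: assumes "n:om" shows "cn n one:WF"
 unfolding mem_WF
proof (intro conjI allI impI)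
 show "cn n one:Rl" using one assms by simp
 fix b assume b: "b:Rl"
 have "cn n one$(kap b (sc emp)) = sc emp" using one b by simp
 then have "~inn (cn n one) b (sc emp)" unfolding inn_sc by (simp del: kap_sc)
 then show "EX n'. n':om & ~inn (cn n one) b n'" by (intro exI[of _ "sc emp"]) simp
qed

lemma YY_cn: assumes e: "e:Rl" and Y: "!!w. w:WF ==> lip e w:YY"
 shows "cn (sc emp) e:YY" "w:WF ==> yk (lip e w):yk (cn (sc emp) e)"
proof -
 show y: "cn (sc emp) e:YY" by (rule YYI) (use e Y in auto)
 show "w:WF ==> yk (lip e w):yk (cn (sc emp) e)"
  by (rule yk_mono[OF y]) (use e in \<open>auto simp: yr_def\<close>)
qed

text \<open>The tree of descending sequences in \<xi>, written through an enumeration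
  \<open>f\<close> of \<xi>. A node whose last entry names \<alpha> has rank at least
  \<alpha>.\<close>

lemma WF_unb: assumes "\<xi>:w1" shows "EX w. w:WF & sb \<xi> (rw w)"
proof -
 obtain f where f: "!!y. y:\<xi> ==> EX x. x:om & f$x = y" using assms unfolding w1_def mem_hart img_def by blast
 have O: "Ord \<xi>" using assms unfolding w1_def mem_hart by blast
 define Q where "Q b n <-> (ALL k. k:n --> f$(b$k):\<xi>) & (ALL k. sc k:n --> f$(b$(sc k)):f$(b$k))" for b n
 have dQ: "dp (%s. Q (s 0) (s 1))" unfolding Q_def by simp
 have c: "Q b' n" if n: "n:om" and e: "eqn n b b'" and q: "Q b n" for b b' n
 proof -
  have "b$k = b'$k" if "k:n" for k using eqn_in[OF e that] .
  moreover have "k:n" if "sc k:n" for k using nat_trans[OF _ that n] by simp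
  ultimately show ?thesis using q unfolding Q_def by metis
 qed
 have m: "Q b n" if "Q b (sc n)" for b n using that unfolding Q_def by auto
 have 0: "Q b emp" for b unfolding Q_def by simp
 let ?w = "mkt Q"
 have WR: "?w:Rl" by (rule mkt(1)[OF dQ], rule c, assumption+, rule m, assumption, rule 0)
 have WQ: "inn ?w b n <-> Q b n" if "b:Rl" "n:om" for b n
  by (rule mkt(2)[OF dQ _ _ _ that], rule c, assumption+, rule m, assumption, rule 0)
 have W: "?w:WF" unfolding mem_WF
 proof (intro conjI allI impI WR, rule ccontr)
  fix b assume b: "b:Rl" and "~(EX n. n:om & ~inn ?w b n)"
  then have Qb: "Q b n" if "n:om" for n using WQ[OF b that] that by blast
  define Z where "Z = Rep om (%n. f$(b$n))"
  have mZ: "z:Z <-> (EX n. n:om & z = f$(b$n))" for z by (simp add: Z_def)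
  have "f$(b$emp):Z" unfolding mZ using emp_om by blast
  from foundation[OF this] obtain n where n: "n:om" "!!z. z:f$(b$n) ==> ~z:Z" unfolding mZ by blast
  have "f$(b$(sc n)):f$(b$n)" using Qb[of "sc (sc n)"] n(1) unfolding Q_def by auto
  then show False using n mZ sc_om by blast
 qed
 have main: "ALL b n. b:Rl --> n:om --> Q b (sc n) --> f$(b$n) = \<alpha> --> sb \<alpha> (rW ?w (kap b (sc n)))" if "\<alpha>:\<xi>" for \<alpha>
 proof (rule Ord_ind[OF Ord_in[OF O that], of "%\<alpha>. ALL b n. b:Rl --> n:om --> Q b (sc n) --> f$(b$n) = \<alpha> --> sb \<alpha> (rW ?w (kap b (sc n)))"])
  show "dp (%s. ALL b n. b:Rl --> n:om --> Q b (sc n) --> f$(b$n) = s 0 --> sb (s 0) (rW ?w (kap b (sc n))))"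
   using dp_sub2[OF dQ] by simp
  fix \<alpha> assume a: "Ord \<alpha>" and IH: "!!\<beta>. \<beta>:\<alpha> ==> ALL b n. b:Rl --> n:om --> Q b (sc n) --> f$(b$n) = \<beta> --> sb \<beta> (rW ?w (kap b (sc n)))"
  show "ALL b n. b:Rl --> n:om --> Q b (sc n) --> f$(b$n) = \<alpha> --> sb \<alpha> (rW ?w (kap b (sc n)))"
  proof (intro allI impI, rule sbI)
   fix b n \<beta> assume b: "b:Rl" and n: "n:om" and Q: "Q b (sc n)" and fb: "f$(b$n) = \<alpha>" and be: "\<beta>:\<alpha>"
   have "\<alpha>:\<xi>" using Q fb unfolding Q_def by auto
   then obtain x where x: "x:om" "f$x = \<beta>" using f Ord_trans[OF O be] by blast
   define b' where "b' = upd b (sc n) x"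
   have b': "b':Rl" "b'$(sc n) = x" "eqn (sc n) b' b" using b n x eqn_upd by (simp_all add: b'_def)
   have Qs: "Q b' (sc n)" using c[OF sc_om[OF n] eqn_sym[OF b'(3)] Q] .
   have bn: "b'$n = b$n" using eqn_in[OF b'(3)] by simp
   have Q': "Q b' (sc (sc n))" using Qs bn b'(2) x(2) fb be Ord_trans[OF O be \<open>\<alpha>:\<xi>\<close>] unfolding Q_def by auto
   have k: "kap b' (sc n) = kap b (sc n)" using kap_cong[OF sc_om[OF n] b'(3)] .
   have chw: "ch ?w (kap b' (sc (sc n))) (kap b (sc n))" using ch_kapI[OF b'(1) sc_om[OF n]] WQ[OF b'(1)] Q' n k by simp
   have o: "kap b (sc n):om" "kap b' (sc (sc n)):om" using b b'(1) n by (simp_all del: kap_sc)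
   have "sb \<beta> (rW ?w (kap b' (sc (sc n))))" by (rule IH[OF be, rule_format, OF b'(1) sc_om[OF n] Q']) (use b'(2) x(2) in simp)
   then show "\<beta>:rW ?w (kap b (sc n))"
    using Ord_sb_mem[OF Ord_in[OF a be] Ord_rW[OF W o(1)] _ rW_mono[OF W o chw]] by blast
  qed
 qed
 have "sb \<xi> (rw ?w)"
 proof (rule sbI)
  fix \<alpha> assume a: "\<alpha>:\<xi>"
  obtain x where x: "x:om" "f$x = \<alpha>" using f[OF a] by blast
  have b: "cn x zr:Rl" using x by simp
  have Q: "Q (cn x zr) (sc emp)" using a x unfolding Q_def by auto
  have s: "sb \<alpha> (rW ?w (kap (cn x zr) (sc emp)))" using main[OF a] b Q x by (metis cn_0 emp_om)
  have "ch ?w (kap (cn x zr) (sc emp)) (kap (cn x zr) emp)" by (rule ch_kapI[OF b emp_om]) (use WQ[OF b] Q in simp)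
  then have chw: "ch ?w (kap (cn x zr) (sc emp)) emp" by (simp del: kap_sc)
  have o: "kap (cn x zr) (sc emp):om" using b by (simp del: kap_sc)
  show "\<alpha>:rw ?w" unfolding rw_def
   using Ord_sb_mem[OF Ord_in[OF O a] Ord_rW[OF W emp_om] s rW_mono[OF W emp_om o chw]] .
 qed
 then show ?thesis using W by blast
qed

definition Acc where "Acc \<alpha> <-> (EX y. y:YY & sb \<alpha> (yk y))"
lemma dp_Acc [simp]: "dt a ==> dp (%s. Acc (a s))" by (rule dp_lift1) (simp_all add: Acc_def)

lemma acc_cnt:
 assumes f: "!!\<xi>. \<xi>:w1 ==> Acc (f$\<xi>)" and \<eta>: "\<eta>:w1"
 shows "EX y. y:YY & (ALL \<xi>. \<xi>:\<eta> --> sb (f$\<xi>) (yk y))"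
proof -
 obtain h where h: "!!y. y:\<eta> ==> EX x. x:om & h$x = y" using \<eta> unfolding w1_def mem_hart img_def by blast
 have "EX z. z:Rl & (ALL n. n:om --> cl z n:YY & (h$n:w1 --> sb (f$(h$n)) (yk (cl z n))))"
 proof (rule CC[of "%n y. y:YY & (h$n:w1 --> sb (f$(h$n)) (yk y))"])
  fix n assume "n:om"
  show "EX y. y:Rl & y:YY & (h$n:w1 --> sb (f$(h$n)) (yk y))"
   using f[of "h$n"] zr_YY YY_Rl unfolding Acc_def by blast
 qed simp
 then obtain z where z: "z:Rl" "!!n. n:om ==> cl z n:YY" "!!n. n:om ==> h$n:w1 ==> sb (f$(h$n)) (yk (cl z n))" by blast
 \<comment> \<open>This strategy looks only at the first entry of the tree and answers with the
   corresponding column of \<open>z\<close>.\<close>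
 define e where "e = Lam om (%u. cl z (ex u$emp)$(Uni (ln u)))"
 have e: "e:Rl" unfolding e_def by (rule RlI) (use z ex(1) in auto)
 have le: "lip e w = cl z (w$emp)" if w: "w:Rl" for w
 proof (rule Rl_ext)
  fix k assume k: "k:om"
  have u: "kap w (sc k):om" "ln (kap w (sc k)) = sc k" using w k ln_kap[OF w sc_om[OF k]] by (simp_all del: kap_sc)
  have "ex (kap w (sc k))$emp = w$emp" using eqn_in[OF eqn_ex[OF w sc_om[OF k]] emp_mem_sc[OF k]] .
  then have "e$(kap w (sc k)) = cl z (w$emp)$k" using u k by (simp add: e_def Uni_sc nat_Ord del: kap_sc)
  then show "lip e w$k = cl z (w$emp)$k" using k by (simp del: kap_sc)
 qed (use e w z in auto)
 have Y: "lip e w:YY" if "w:WF" for w using le[OF WF_Rl[OF that]] z(2) WF_Rl[OF that] by simp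
 have y1: "cn (sc emp) e:YY" by (rule YY_cn(1)[OF e Y])
 have y2: "yk (lip e w):yk (cn (sc emp) e)" if "w:WF" for w by (rule YY_cn(2)[OF e Y that])
 note y = y1 y2
 have "sb (f$\<xi>) (yk (cn (sc emp) e))" if x: "\<xi>:\<eta>" for \<xi>
 proof -
  obtain n where n: "n:om" "h$n = \<xi>" using h[OF x] by blast
  have "\<xi>:w1" using Ord_trans[OF Ord_w1 x \<eta>] .
  then have s: "sb (f$\<xi>) (yk (cl z n))" using z(3)[OF n(1)] n(2) by simp
  have "lip e (cn n one) = cl z n" using le[OF WF_Rl[OF WF_cn[OF n(1)]]] by simp
  then have "yk (cl z n):yk (cn (sc emp) e)" using y(2)[OF WF_cn[OF n(1)]] by simp
  then show ?thesis using s Ord_sb[OF Ord_yk[OF y(1)]] sb_trans by blast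
 qed
 then show ?thesis using y(1) by blast
qed

text \<open>\<open>acc_cnt\<close> bounds the values up to any countable ordinal. Bounds for more
  values are bounds for fewer, so \<open>UC\<close> chooses them by one strategy, and the code built
  from it is above all of them.\<close>

lemma acc_sup:
 assumes f: "!!\<xi>. \<xi>:w1 ==> Acc (f$\<xi>)" and fO: "!!\<xi>. \<xi>:w1 ==> Ord (f$\<xi>)"
 shows "EX y. y:YY & (ALL \<xi>. \<xi>:w1 --> f$\<xi>:yk y)"
proof -
 let ?R = "%\<eta> y. y:YY & (ALL \<xi>. \<xi>:w1 --> sb \<xi> \<eta> --> sb (f$\<xi>) (yk y))"
 have "EX e. e:Rl & (ALL w. w:WF --> ?R (rw w) (lip e w))"
 proof (rule UC)
  fix w assume w: "w:WF"
  obtain y where y: "y:YY" "!!\<xi>. \<xi>:sc (rw w) ==> sb (f$\<xi>) (yk y)" using acc_cnt[OF f sc_w1[OF rw_w1[OF w]]] by blast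
  have "\<xi>:sc (rw w)" if "\<xi>:w1" "sb \<xi> (rw w)" for \<xi>
   using Ord_sb_iff[OF Ord_in[OF Ord_w1 that(1)] Ord_rw[OF w]] that(2) by simp
  then show "EX y. y:Rl & ?R (rw w) y" using y YY_Rl by blast
 next
  show "?R \<xi> y" if "sb \<xi> \<eta>" "?R \<eta> y" for \<xi> \<eta> y using that sb_trans by blast
 qed simp
 then obtain e where e: "e:Rl" "!!w. w:WF ==> lip e w:YY"
  "!!w \<xi>. w:WF ==> \<xi>:w1 ==> sb \<xi> (rw w) ==> sb (f$\<xi>) (yk (lip e w))" by blast
 have y1: "cn (sc emp) e:YY" by (rule YY_cn(1)[OF e(1,2)])
 have y2: "yk (lip e w):yk (cn (sc emp) e)" if "w:WF" for w by (rule YY_cn(2)[OF e(1,2) that])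
 note y = y1 y2
 have "f$\<xi>:yk (cn (sc emp) e)" if x: "\<xi>:w1" for \<xi>
 proof -
  obtain w where w: "w:WF" "sb \<xi> (rw w)" using WF_unb[OF x] by blast
  show ?thesis using Ord_sb_mem[OF fO[OF x] Ord_yk[OF y(1)] e(3)[OF w(1) x w(2)] y(2)[OF w(1)]] .
 qed
 then show ?thesis using y(1) by blast
qed

lemma w2_Acc: assumes "\<alpha>:w2" shows "Acc \<alpha>"
proof -
 have "\<alpha>:w2 --> Acc \<alpha>"
 proof (rule Ord_ind[OF Ord_in[OF Ord_w2 assms], of "%\<alpha>. \<alpha>:w2 --> Acc \<alpha>"])
  fix \<alpha> assume a: "Ord \<alpha>" and IH: "!!\<beta>. \<beta>:\<alpha> ==> \<beta>:w2 --> Acc \<beta>"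
  show "\<alpha>:w2 --> Acc \<alpha>"
  proof
   assume aw: "\<alpha>:w2"
   then obtain g where g: "!!y. y:\<alpha> ==> EX x. x:w1 & g$x = y" unfolding w2_def mem_hart img_def by blast
   define f where "f = Lam w1 (%\<xi>. if g$\<xi>:\<alpha> then g$\<xi> else emp)"
   have fx: "f$\<xi> = (if g$\<xi>:\<alpha> then g$\<xi> else emp)" if "\<xi>:w1" for \<xi> using that by (simp add: f_def)
   have "Acc emp" unfolding Acc_def using zr_YY by (auto simp: sb_def)
   then have "Acc (f$\<xi>)" "Ord (f$\<xi>)" if "\<xi>:w1" for \<xi>
    using fx[OF that] IH Ord_trans[OF Ord_w2 _ aw] Ord_in[OF a] by auto
   then obtain y where y: "y:YY" "!!\<xi>. \<xi>:w1 ==> f$\<xi>:yk y" using acc_sup[of f] by blast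
   have "sb \<alpha> (yk y)"
   proof (rule sbI)
    fix \<beta> assume b: "\<beta>:\<alpha>"
    obtain x where "x:w1" "g$x = \<beta>" using g[OF b] by blast
    then show "\<beta>:yk y" using y(2)[of x] fx[of x] b by simp
   qed
   then show "Acc \<alpha>" unfolding Acc_def using y(1) by blast
  qed
 qed simp
 then show ?thesis using assms by blast
qed

subsection \<open>Pairing of countable ordinals\<close>

definition mx where "mx p = un (p1 p) (p2 p)"
text \<open>Goedel's order of pairs, by the maximum and then lexicographically; it makes the
  predecessors of a pair of countable ordinals countable.\<close>

definition gr where "gr q p <-> mx q:mx p | mx q = mx p & (p1 q:p1 p | p1 q = p1 p & p2 q:p2 p)"
definition PA where "PA = Prd w1 w1"
definition gp where "gp a b = rk PA gr (opr a b)"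
lemma dt_mx [simp]: "dt a ==> dt (%s. mx (a s))" by (simp add: mx_def)
lemma dp_gr [simp]: "dt a ==> dt b ==> dp (%s. gr (a s) (b s))" by (rule dp_lift2) (simp_all add: gr_def)
lemma dt_gp [simp]: "dt a ==> dt b ==> dt (%s. gp (a s) (b s))" by (rule dt_lift2) (simp_all add: gp_def)

lemma mem_PA: "p:PA <-> (EX a b. a:w1 & b:w1 & p = opr a b)" by (simp add: PA_def)
lemma w1_Ord: "\<xi>:w1 ==> Ord \<xi>" using Ord_in[OF Ord_w1] .
lemma un_max: assumes "a:w1" "b:w1" shows "un a b:w1" "sb a (un a b)" "sb b (un a b)"
proof -
 have "un a b = a | un a b = b"
 proof -
  have "sb a b | sb b a" using Ord_linear[OF w1_Ord[OF assms(1)] w1_Ord[OF assms(2)]] Ord_sb w1_Ord assms sb_refl by metis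
  then show ?thesis
  proof
   assume "sb a b" then have "un a b = b" by (intro ext) (auto simp: sb_def) then show ?thesis ..
  next
   assume "sb b a" then have "un a b = a" by (intro ext) (auto simp: sb_def) then show ?thesis ..
  qed
 qed
 then show "un a b:w1" using assms by auto
qed (auto simp: sb_def)

lemma wf_gr: "wf PA gr"
 unfolding wf_def
proof (intro allI impI)
 fix Z assume Z: "sb Z PA & (EX x. x:Z)"
 have ab: "Ord (mx p) & Ord (p1 p) & Ord (p2 p)" if pZ: "p:Z" for p
 proof -
  obtain a b where "a:w1" "b:w1" "p = opr a b" using sbD[OF Z[THEN conjunct1] pZ] unfolding mem_PA by blast
  then show ?thesis using un_max w1_Ord by (simp add: mx_def)
 qed
 obtain p0 where p0: "p0:Z" using Z by blast
 let ?A = "%a. EX p. p:Z & mx p = a"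
 have dA: "dp (%s. ?A (s 0))" by simp
 have A0: "?A (mx p0)" using p0 by blast
 note la = lst[of ?A, OF dA ab[OF p0, THEN conjunct1] A0]
 obtain p1' where q1: "p1':Z" "mx p1' = lst ?A" using la(2) by blast
 let ?B = "%b. EX p. p:Z & mx p = lst ?A & p1 p = b"
 have dB: "dp (%s. ?B (s 0))" by simp
 have B0: "?B (p1 p1')" using q1 by blast
 note lb = lst[of ?B, OF dB ab[OF q1(1), THEN conjunct2, THEN conjunct1] B0]
 obtain p2' where q2: "p2':Z" "mx p2' = lst ?A" "p1 p2' = lst ?B" using lb(2) by blast
 let ?C = "%b. EX p. p:Z & mx p = lst ?A & p1 p = lst ?B & p2 p = b"
 have dC: "dp (%s. ?C (s 0))" by simp
 have C0: "?C (p2 p2')" using q2 by blast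
 note lc = lst[of ?C, OF dC ab[OF q2(1), THEN conjunct2, THEN conjunct2] C0]
 obtain p3 where q3: "p3:Z" "mx p3 = lst ?A" "p1 p3 = lst ?B" "p2 p3 = lst ?C" using lc(2) by blast
 have "~gr q p3" if q: "q:Z" for q
 proof
  assume "gr q p3"
  then show False unfolding gr_def q3(2-4) using la(4)[of "mx q"] lb(4)[of "p1 q"] lc(4)[of "p2 q"] q by blast
 qed
 then show "EX x. x:Z & (ALL y. y:Z --> ~gr y x)" using q3(1) by blast
qed

lemma dp_grv: "dp (%s. gr (s 1) (s 0))" by simp

lemma gr_total: assumes "p:PA" "q:PA" "p ~= q" shows "gr p q | gr q p"
proof -
 obtain a b c d where ab: "a:w1" "b:w1" "p = opr a b" and cd: "c:w1" "d:w1" "q = opr c d"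
  using assms(1,2) unfolding mem_PA by blast
 have m: "Ord (mx p)" "Ord (mx q)" using ab cd un_max w1_Ord by (simp_all add: mx_def)
 show ?thesis using Ord_linear[OF m] Ord_linear[OF w1_Ord[OF ab(1)] w1_Ord[OF cd(1)]] Ord_linear[OF w1_Ord[OF ab(2)] w1_Ord[OF cd(2)]] assms(3)
  unfolding gr_def ab(3) cd(3) p1_opr p2_opr opr_eq by auto
qed

lemma gp_inj: assumes "a:w1" "b:w1" "c:w1" "d:w1" "gp a b = gp c d" shows "a = c" "b = d"
proof -
 have A: "opr a b:PA" "opr c d:PA" using assms mem_PA by blast+
 have "opr a b = opr c d"
 proof (rule ccontr)
  assume "opr a b ~= opr c d"
  from gr_total[OF A this] show False
   using rk_mono[OF wf_gr dp_grv A] rk_mono[OF wf_gr dp_grv A(2,1)] assms(5) mem_irrefl unfolding gp_def by metis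
 qed
 then show "a = c" "b = d" by simp_all
qed

lemma gp_w1: assumes "a:w1" "b:w1" shows "gp a b:w1"
proof -
 have p: "opr a b:PA" using assms mem_PA by blast
 let ?m = "un a b"
 have m: "?m:w1" using un_max assms by blast
 obtain g where g: "!!y. y:sc ?m ==> EX x. x:om & g$x = y" using sc_w1[OF m] unfolding w1_def mem_hart img_def by blast
 have "img om (gp a b)"
 proof (rule imgI[of "%n. rk PA gr (opr (g$(q1 n)) (g$(q2 n)))"])
  show "dt (%s. rk PA gr (opr (g$(q1 (s 0))) (g$(q2 (s 0)))))" by simp
  fix v assume v: "v:gp a b"
  then obtain q where q: "q:PA" "rk PA gr q = v" using rk_onto[OF wf_gr dp_grv p] unfolding gp_def by blast
  obtain c d where cd: "c:w1" "d:w1" "q = opr c d" using q(1) mem_PA by blast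
  have "~gr (opr a b) q"
  proof
   assume "gr (opr a b) q"
   then have "gp a b:v" using rk_mono[OF wf_gr dp_grv q(1) p] q(2) unfolding gp_def by simp
   then show False using v mem_asym by blast
  qed
  moreover have "q ~= opr a b" using q(2) v mem_irrefl unfolding gp_def by metis
  ultimately have "gr q (opr a b)" using gr_total[OF q(1) p] by blast
  then have "mx q:sc ?m" unfolding gr_def by (auto simp: mx_def)
  then have mq: "sb (un c d) ?m" using Ord_sb[OF w1_Ord[OF m]] unfolding cd(3) mx_def by auto
  have "c:sc ?m" "d:sc ?m"
   using Ord_sb_iff[OF w1_Ord[OF cd(1)] w1_Ord[OF m]] Ord_sb_iff[OF w1_Ord[OF cd(2)] w1_Ord[OF m]] un_max(2,3)[OF cd(1,2)] mq sb_trans by auto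
  then obtain i k where ik: "i:om" "g$i = c" "k:om" "g$k = d" using g by metis
  then show "EX x. x:om & rk PA gr (opr (g$(q1 x)) (g$(q2 x))) = v"
   using q(2) cd(3) by (intro exI[of _ "pi i k"]) simp
 qed
 moreover have "Ord (gp a b)" unfolding gp_def using Ord_rk[OF wf_gr dp_grv p] .
 ultimately show ?thesis unfolding w1_def mem_hart by blast
qed

subsection \<open>Ranks of codes are below the second uncountable cardinal\<close>

text \<open>A real \<open>d\<close> describes a path downwards from \<open>y\<close> in
  \<open>YY\<close>: its columns are the trees at which the successive strategies are
  evaluated.\<close>

definition yc where "yc y d i = natrec y (%i v. lip (tl v) (cl d i)) i"
definition adm where "adm y d k <-> (ALL i. i:k --> cl d i:WF & yc y d i$emp ~= emp)"
definition od where "od d p = rW (cl d (q1 p)) (q2 p)"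
definition cd where "cd d k = natrec emp (%p v. gp v (gp (d$p) (od d p))) k"
text \<open>One countable ordinal for the finite information at stage \<open>k\<close>: the stage,
  the entries of \<open>d\<close> below it, and the ranks of the tree nodes with index below it. The
  ranks are recorded so that the trees of a limit stay well-founded.\<close>

definition nd where "nd d k = gp k (cd d k)"
lemma dt_yc [simp]: "dt a ==> dt b ==> dt c ==> dt (%s. yc (a s) (b s) (c s))"
 by (rule dt_lift3) (simp_all add: yc_def)
lemma dp_adm [simp]: "dt a ==> dt b ==> dt c ==> dp (%s. adm (a s) (b s) (c s))"
 by (rule dp_lift3) (simp_all add: adm_def)
lemma dt_od [simp]: "dt a ==> dt b ==> dt (%s. od (a s) (b s))" by (simp add: od_def)
lemma dt_cd [simp]: "dt a ==> dt b ==> dt (%s. cd (a s) (b s))"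
 by (rule dt_lift2) (simp_all add: cd_def)
lemma dt_nd [simp]: "dt a ==> dt b ==> dt (%s. nd (a s) (b s))" by (simp add: nd_def)

lemma yc_0 [simp]: "yc y d emp = y" and yc_sc [simp]: "i:om ==> yc y d (sc i) = lip (tl (yc y d i)) (cl d i)"
 by (simp_all add: yc_def)
lemma cd_0 [simp]: "cd d emp = emp" and cd_sc [simp]: "k:om ==> cd d (sc k) = gp (cd d k) (gp (d$k) (od d k))"
 by (simp_all add: cd_def)

lemma adm_mono: "adm y d k ==> sb k' k ==> adm y d k'" unfolding adm_def sb_def by blast

lemma nat_sbI: "k:om ==> p:k ==> sb (sc p) k" using Ord_sb[OF nat_Ord] by (auto simp: sb_def)

lemma q1_le: "p:om ==> q1 p:sc p" using pi_ge[of "q1 p" "q2 p"] by simp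

lemma od_w1: assumes "adm y d k" "k:om" "p:k" shows "od d p:w1"
proof -
 have p: "p:om" using nat_in assms by blast
 have "q1 p:k" using sbD[OF nat_sbI[OF assms(2,3)] q1_le[OF p]] .
 then have "cl d (q1 p):WF" using assms(1) adm_def by blast
 then show ?thesis unfolding od_def rW_def using img_rk_w1[OF wf_ch dp_chv q2_om[OF p]] by blast
qed

lemma cd_w1: assumes d: "d:Rl" and k: "k:om" shows "adm y d k --> cd d k:w1"
proof (rule nat_ind[OF k])
 show "adm y d emp --> cd d emp:w1" using om_w1 by simp
 fix k assume k: "k:om" and IH: "adm y d k --> cd d k:w1"
 show "adm y d (sc k) --> cd d (sc k):w1"
 proof
  assume a: "adm y d (sc k)"
  have "od d k:w1" by (rule od_w1[OF a sc_om[OF k]]) simp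
  moreover have "adm y d k" by (rule adm_mono[OF a]) (simp add: sb_def)
  ultimately show "cd d (sc k):w1" using IH gp_w1 om_w1 d k by simp
 qed
qed simp

lemma nd_w1: "d:Rl ==> k:om ==> adm y d k ==> nd d k:w1"
 unfolding nd_def using gp_w1 om_w1 cd_w1 by blast

lemma cd_inj: assumes d: "d:Rl" "d':Rl" and k: "k:om"
 shows "adm y d k --> adm y d' k --> cd d k = cd d' k --> (ALL p. p:k --> d$p = d'$p & od d p = od d' p)"
proof (rule nat_ind[OF k])
 fix k assume k: "k:om" and IH: "adm y d k --> adm y d' k --> cd d k = cd d' k --> (ALL p. p:k --> d$p = d'$p & od d p = od d' p)"
 show "adm y d (sc k) --> adm y d' (sc k) --> cd d (sc k) = cd d' (sc k) --> (ALL p. p:sc k --> d$p = d'$p & od d p = od d' p)"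
 proof (intro impI)
  assume a: "adm y d (sc k)" "adm y d' (sc k)" and e: "cd d (sc k) = cd d' (sc k)"
  have s: "sb k (sc k)" by (simp add: sb_def)
  note ak = adm_mono[OF a(1) s] adm_mono[OF a(2) s]
  have o: "od d k:w1" "od d' k:w1" using od_w1[OF a(1) sc_om[OF k]] od_w1[OF a(2) sc_om[OF k]] by simp_all
  have c: "cd d k:w1" "cd d' k:w1" using cd_w1 d k ak by blast+
  have x: "d$k:w1" "d'$k:w1" using om_w1 d k by simp_all
  have e': "gp (cd d k) (gp (d$k) (od d k)) = gp (cd d' k) (gp (d'$k) (od d' k))" using e k by simp
  note i = gp_inj[OF c(1) gp_w1[OF x(1) o(1)] c(2) gp_w1[OF x(2) o(2)] e']
  note i2 = gp_inj[OF x(1) o(1) x(2) o(2) i(2)]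
  show "ALL p. p:sc k --> d$p = d'$p & od d p = od d' p" using IH ak i(1) i2 by (metis mem_sc)
 qed
qed simp_all

lemma nd_inj: assumes "d:Rl" "d':Rl" "k:om" "k':om" "adm y d k" "adm y d' k'" "nd d k = nd d' k'"
 shows "k = k'" "p:k ==> d$p = d'$p & od d p = od d' p"
proof -
 note i = gp_inj[OF om_w1[OF assms(3)] _ om_w1[OF assms(4)] _ assms(7)[unfolded nd_def]]
 have c: "cd d k:w1" "cd d' k':w1" using cd_w1 assms by blast+
 show kk: "k = k'" using i(1) c by blast
 show "p:k ==> d$p = d'$p & od d p = od d' p" using i(2)[OF c] cd_inj[OF assms(1,2,3), of y] assms(5,6) kk by blast
qed

lemma ct_yc: assumes y: "y:Rl" and i: "i:om" shows "ct (%d. yc y d i)"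
proof -
 have "ctn (%d. yc y d i)"
 proof (rule nat_ind[OF i])
  show "dp (%s. ctn (%d. yc y d (s 0)))" by simp
  show "ctn (%d. yc y d emp)" using ct_const[OF y] by (simp add: ct_def)
  fix n assume n: "n:om" and IH: "ctn (%d. yc y d n)"
  have c: "ct (%d. yc y d n)" unfolding ct_def using IH by simp
  have "ct (%d. lip (tl (yc y d n)) (cl d n))" by (rule ct_lip[OF ct_tl[OF c] ct_cl[OF ct_id n]])
  then show "ctn (%d. yc y d (sc n))" using n by (simp add: ct_def)
 qed
 then show ?thesis unfolding ct_def by simp
qed

context
 fixes y assumes y: "y:YY"
begin

definition kr where "kr b a <-> (EX d k. d:Rl & k:om & adm y d (sc k) & b = nd d (sc k) & a = nd d k)"
lemma dp_kr [simp]: "dt a ==> dt b ==> dp (%s. kr (a s) (b s))" by (rule dp_lift2) (simp_all add: kr_def)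
lemma dp_krv: "dp (%s. kr (s 1) (s 0))" by simp

text \<open>From a descending sequence one reads off a limit real \<open>D\<close> and limit ranks.
  The ranks show that all columns of \<open>D\<close> are well-founded, so \<open>D\<close>
  describes an infinite descending path in \<open>YY\<close>.\<close>

lemma wf_kr: "wf w1 kr"
 unfolding wf_def
proof (intro allI impI, rule ccontr)
 fix Z assume Z: "sb Z w1 & (EX x. x:Z)" and no: "~(EX x. x:Z & (ALL y. y:Z --> ~kr y x))"
 have yR: "y:Rl" using YY_Rl[OF y] .
 obtain a0 where a0: "a0:Z" using Z by blast
 define nx where "nx a = lst (%b. b:Z & kr b a)" for a
 have dnx: "dt (%s. nx (a s))" if "dt a" for a unfolding nx_def using dt_pushes[OF that] by simp
 have nx: "nx a:Z & kr (nx a) a" if aZ: "a:Z" for a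
 proof -
  obtain b where b: "b:Z" "kr b a" using no aZ by blast
  have d: "dp (%s. s 0:Z & kr (s 0) a)" by simp
  have "b:Z & kr b a" using b by blast
  from lst(2)[of "%b. b:Z & kr b a", OF d _ this] show ?thesis unfolding nx_def using w1_Ord Z b(1) sbD by blast
 qed
 define V where "V n = natrec a0 (%_ a. nx a) n" for n
 have dV: "dt (%s. V (a s))" if "dt a" for a unfolding V_def by (rule dt_natrec) (use dnx that in auto)
 have V0: "V emp = a0" and Vs: "n:om ==> V (sc n) = nx (V n)" for n unfolding V_def using dnx by simp_all
 have VZ: "V n:Z" if "n:om" for n by (rule nat_ind[OF that]) (use dV V0 Vs a0 nx in auto)
 have Vr: "kr (V (sc n)) (V n)" if "n:om" for n using Vs[OF that] nx[OF VZ[OF that]] by simp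
 define rep where "rep n d k <-> d:Rl & k:om & adm y d k & V n = nd d k" for n d k
 have drep: "dp (%s. rep (a s) (b s) (c s))" if "dt a" "dt b" "dt c" for a b c unfolding rep_def using dV that by simp
 have rs: "EX d k. rep n d k & rep (sc n) d (sc k)" if n: "n:om" for n
 proof -
  obtain d k where dk: "d:Rl" "k:om" "adm y d (sc k)" "V (sc n) = nd d (sc k)" "V n = nd d k" using Vr[OF n] kr_def by blast
  have "adm y d k" by (rule adm_mono[OF dk(3)]) (simp add: sb_def)
  then show ?thesis unfolding rep_def using dk sc_om by blast
 qed
 \<comment> \<open>Different reals may represent the same term of the sequence, but the ordinal
   determines their length, entries and ranks.\<close>
 have reps: "k = k' & (ALL p. p:k --> d$p = d'$p & od d p = od d' p)" if "rep n d k" "rep n d' k'" for n d k d' k'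
  using that nd_inj[of d d' k k' y] unfolding rep_def by simp
 have coh: "ALL d k d' k'. rep n d k --> rep m d' k' --> sb n m --> sb k k' & (ALL p. p:k --> d$p = d'$p & od d p = od d' p)" (is "?C m")
  if n: "n:om" and m: "m:om" for n m
 proof (rule nat_ind[OF m, of ?C])
  show "dp (%s. ?C (s 0))" by (simp add: drep)
  show "?C emp"
  proof (intro allI impI)
   fix d k d' k' assume r: "rep n d k" "rep emp d' k'" "sb n emp"
   have "n = emp" using r(3) sb_antisym[of n emp] by (simp add: sb_def)
   then show "sb k k' & (ALL p. p:k --> d$p = d'$p & od d p = od d' p)" using reps[of emp d k d' k'] r by simp
  qed
  fix m assume m: "m:om" and IH: "?C m"
  show "?C (sc m)"
  proof (intro allI impI)
   fix d k d' k' assume r: "rep n d k" "rep (sc m) d' k'" "sb n (sc m)"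
   have "n = sc m | sb n m" using r(3) Ord_sb_iff[OF nat_Ord[OF n] nat_Ord[OF sc_om[OF m]]] Ord_sb[OF nat_Ord[OF m]] by auto
   then show "sb k k' & (ALL p. p:k --> d$p = d'$p & od d p = od d' p)"
   proof
    assume "n = sc m" then show ?thesis using reps[of "sc m" d k d' k'] r by simp
   next
    assume nm: "sb n m"
    obtain e l where el: "rep m e l" "rep (sc m) e (sc l)" using rs[OF m] by blast
    have 1: "sb k l & (ALL p. p:k --> d$p = e$p & od d p = od e p)" using IH r(1) el(1) nm by blast
    have 2: "sc l = k' & (ALL p. p:sc l --> e$p = d'$p & od e p = od d' p)" using reps[OF el(2) r(2)] .
    have "sb k k'" using 1 2 by (auto simp: sb_def)
    moreover have "d$p = d'$p & od d p = od d' p" if p: "p:k" for p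
    proof -
     have "p:sc l" using 1 p by (simp add: sb_def)
     then show ?thesis using 1 2 p by metis
    qed
    ultimately show ?thesis by blast
   qed
  qed
 qed
 have long: "EX n d k. n:om & rep n d k & p:k" if p: "p:om" for p
 proof (rule nat_ind[OF p])
  show "dp (%s. EX n d k. n:om & rep n d k & s 0:k)" by (simp add: drep)
  obtain d k where "rep emp d k" "rep (sc emp) d (sc k)" using rs[OF emp_om] by blast
  moreover have "emp:sc k" using calculation(1) emp_mem_sc unfolding rep_def by blast
  ultimately show "EX n d k. n:om & rep n d k & emp:k" using sc_om[OF emp_om] by blast
  fix p assume p: "p:om" and "EX n d k. n:om & rep n d k & p:k"
  then obtain n d k where n: "n:om" "rep n d k" "p:k" by blast
  obtain e l where el: "rep n e l" "rep (sc n) e (sc l)" using rs[OF n(1)] by blast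
  have "k = l" using reps[OF n(2) el(1)] by blast
  then have "sc p:sc l" using sc_mem_sc[OF nat_Ord] n(3) el(1) unfolding rep_def by blast
  then show "EX n d k. n:om & rep n d k & sc p:k" using el(2) sc_om[OF n(1)] by blast
 qed
 define DD where "DD p = tht (%m. EX n d k. n:om & rep n d k & p:k & m = d$p)" for p
 have dDD: "dt (%s. DD (s 0))" unfolding DD_def by (simp add: drep)
 define D where "D = Lam om DD"
 have Dp: "D$p = DD p" if "p:om" for p unfolding D_def by (rule ap_Lam[OF that dDD])
 define orp where "orp p = tht (%m. EX n d k. n:om & rep n d k & p:k & m = od d p)" for p
 have dorp: "dt (%s. orp (a s))" if "dt a" for a unfolding orp_def using dt_pushes[OF that] by (simp add: drep)
 have uq: "d$p = d'$p & od d p = od d' p" if "n:om" "rep n d k" "p:k" "n':om" "rep n' d' k'" "p:k'" for n d k n' d' k' p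
 proof -
  have "sb n n' | sb n' n" using Ord_linear[OF nat_Ord[OF that(1)] nat_Ord[OF that(4)]] Ord_sb nat_Ord that(1,4) sb_refl by metis
  then show ?thesis using coh[OF that(1,4)] coh[OF that(4,1)] that by metis
 qed
 have DO: "D$p = d$p" "orp p = od d p" if r: "n:om" "rep n d k" "p:k" for n d k p
 proof -
  have p: "p:om" using r nat_in unfolding rep_def by blast
  have "D$p = DD p" by (rule Dp[OF p])
  also have "\<dots> = d$p" unfolding DD_def by (rule tht_eq) (use r uq in \<open>blast, metis\<close>)
  finally show "D$p = d$p" .
  show "orp p = od d p" unfolding orp_def by (rule tht_eq) (use r uq in \<open>blast, metis\<close>)
 qed
 have D: "D:Rl"
 proof -
  have "DD p:om" if p: "p:om" for p
  proof -
   obtain n d k where r: "n:om" "rep n d k" "p:k" using long[OF p] by blast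
   show ?thesis using DO(1)[OF r] r(2) p Dp[OF p] unfolding rep_def by simp
  qed
  then show ?thesis unfolding D_def by (intro RlI dDD)
 qed
 have apx: "EX n d k. n:om & rep n d k & sb M k & eqn M D d" if M: "M:om" for M
 proof -
  obtain n d k where r: "n:om" "rep n d k" "M:k" using long[OF M] by blast
  have s: "sb M k" using r(2,3) Ord_sb[OF nat_Ord] unfolding rep_def by blast
  then have "eqn M D d" unfolding eqn_def using DO(1)[OF r(1,2)] sbD by blast
  then show ?thesis using r s by blast
 qed
 have W: "cl D i:WF" if i: "i:om" for i
  unfolding mem_WF
 proof (intro conjI allI impI, rule cl_Rl[OF D i], rule ccontr)
  fix b assume b: "b:Rl" and nb: "~(EX n. n:om & ~inn (cl D i) b n)"
  have desc: "orp (pi i (kap b (sc n))):orp (pi i (kap b n))" if n: "n:om" for n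
  proof -
   obtain m where m: "m:om" "!!w w'. eqn m w w' ==> inn w b (sc n) = inn w' b (sc n)" using inn_ct[OF b sc_om[OF n]] by blast
   obtain M where M: "M:om" "!!x. x:Rl ==> eqn M D x ==> eqn m (cl D i) (cl x i)" using ct_eqn[OF ct_cl[OF ct_id i] D m(1)] by blast
   let ?p = "pi i (kap b (sc n))" and ?q = "pi i (kap b n)"
   have ko: "kap b (sc n):om" "kap b n:om" using b n by (simp_all del: kap_sc)
   then have po: "?p:om" "?q:om" using i by simp_all
   obtain l1 where l1: "l1:om" "sb M l1" "sb (sc ?p) l1" by (rule nat_max[OF M(1) sc_om[OF po(1)]])
   obtain l2 where l2: "l2:om" "sb l1 l2" "sb (sc ?q) l2" by (rule nat_max[OF l1(1) sc_om[OF po(2)]])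
   obtain l where l: "l:om" "sb l2 l" "sb (sc i) l" by (rule nat_max[OF l2(1) sc_om[OF i]])
   obtain N d k where r: "N:om" "rep N d k" "sb l k" "eqn l D d" using apx[OF l(1)] by blast
   have dR: "d:Rl" "adm y d k" using r(2) rep_def by auto
   have mem: "?p:k" "?q:k" "i:k" using l1 l2 l r(3) unfolding sb_def by (meson mem_sc)+
   have w: "cl d i:WF" using dR(2) mem(3) adm_def by blast
   have "eqn m (cl D i) (cl d i)" by (rule M(2)[OF dR(1)]) (use r(4) eqn_mono l l1 l2 sb_trans in blast)
   then have "inn (cl d i) b (sc n)" using m(2) nb sc_om[OF n] by blast
   then have "rW (cl d i) (kap b (sc n)):rW (cl d i) (kap b n)" using rW_mono[OF w ko(2,1) ch_kapI[OF b n]] by blast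
   then show ?thesis unfolding DO(2)[OF r(1,2) mem(1)] DO(2)[OF r(1,2) mem(2)] od_def using i ko by simp
  qed
  define T where "T = Rep om (%n. orp (pi i (kap b n)))"
  have mT: "z:T <-> (EX n. n:om & z = orp (pi i (kap b n)))" for z unfolding T_def by (simp add: dorp)
  have "orp (pi i (kap b emp)):T" unfolding mT using emp_om by blast
  from foundation[OF this] obtain n where n: "n:om" "!!z. z:orp (pi i (kap b n)) ==> ~z:T" unfolding mT by blast
  show False using n(2)[OF desc[OF n(1)]] sc_om[OF n(1)] unfolding mT by blast
 qed
 have ne: "yc y D i$emp ~= emp" if i: "i:om" for i
 proof -
  obtain M where M: "M:om" "!!x. x:Rl ==> eqn M D x ==> yc y D i$emp = yc y x i$emp" using ctD[OF ct_yc[OF yR i] D emp_om] by blast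
  obtain l where l: "l:om" "sb M l" "sb (sc i) l" by (rule nat_max[OF M(1) sc_om[OF i]])
  obtain N d k where r: "N:om" "rep N d k" "sb l k" "eqn l D d" using apx[OF l(1)] by blast
  have "i:k" using l(3) r(3) by (auto simp: sb_def)
  then have "yc y d i$emp ~= emp" using r(2) unfolding rep_def adm_def by blast
  then show ?thesis using M(2)[of d] eqn_mono[OF r(4) l(2)] r(2) unfolding rep_def by simp
 qed
 have st: "yr (yc y D (sc i)) (yc y D i)" if "i:om" for i using ne[OF that] W[OF that] that unfolding yr_def by auto
 have inY: "yc y D i:YY" if "i:om" for i
  by (rule nat_ind[OF that]) (use y st YY_inv in \<open>auto simp del: yc_sc\<close>)
 define T where "T = Rep om (%i. yc y D i)"
 have mT: "z:T <-> (EX n. n:om & z = yc y D n)" for z unfolding T_def by simp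
 have "sb T YY" using inY by (auto simp: sb_def mT)
 moreover have "yc y D emp:T" unfolding mT using emp_om by blast
 ultimately obtain x where x: "x:T" "!!z. z:T ==> ~yr z x" using wf_YY unfolding wf_def by blast
 obtain i where i: "i:om" "x = yc y D i" using x(1) mT by blast
 show False using x(2)[of "yc y D (sc i)"] st[OF i(1)] i sc_om mT by blast
qed

text \<open>A step from \<open>v\<close> to \<open>u\<close> by a tree \<open>w\<close> is simulated
  by putting \<open>w\<close> into column \<open>k\<close> of \<open>d\<close>. Entries with index
  \<open>p\<close> below \<open>k\<close> lie in columns \<open>q1 p\<close> below \<open>k\<close>,
  so the ordinal \<open>nd d k\<close> does not change.\<close>

lemma yk_kr: assumes "v:YY"
 shows "ALL d k. k:om --> d:Rl --> adm y d k --> yc y d k = v --> sb (yk v) (rk w1 kr (nd d k))"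
proof (rule wf_ind[OF wf_YY assms, of "%v. ALL d k. k:om --> d:Rl --> adm y d k --> yc y d k = v --> sb (yk v) (rk w1 kr (nd d k))"])
 fix v assume v: "v:YY" and IH: "!!u. u:YY ==> yr u v ==> ALL d k. k:om --> d:Rl --> adm y d k --> yc y d k = u --> sb (yk u) (rk w1 kr (nd d k))"
 show "ALL d k. k:om --> d:Rl --> adm y d k --> yc y d k = v --> sb (yk v) (rk w1 kr (nd d k))"
 proof (intro allI impI)
  fix d k assume k: "k:om" and d: "d:Rl" and a: "adm y d k" and e: "yc y d k = v"
  note n1 = nd_w1[OF d k a]
  show "sb (yk v) (rk w1 kr (nd d k))" unfolding yk_def
  proof (rule rk_least[OF wf_YY dp_yrv v Ord_rk[OF wf_kr dp_krv n1]])
   fix u assume u: "u:YY" "yr u v"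
   obtain w where w: "v$emp ~= emp" "w:WF" "u = lip (tl v) w" using u(2) yr_def by blast
   define d' where "d' = mk (%i. if i = k then w else cl d i)"
   have dd: "dt (%s. if s 0 = k then w else cl d (s 0))" by simp
   have cR: "(if i = k then w else cl d i):Rl" if "i:om" for i using that w(2) d by simp
   have d': "d':Rl" unfolding d'_def by (rule mk_Rl[OF dd]) (use cR in blast)
   have cl': "cl d' i = (if i = k then w else cl d i)" if "i:om" for i unfolding d'_def by (rule cl_mk[OF dd _ that]) (use cR in blast)
   have ne: "i ~= k" if "i:k" for i using that by auto
   have yc': "sb i k --> yc y d' i = yc y d i" if i: "i:om" for i
   proof (rule nat_ind[OF i])
    fix i assume i: "i:om" and H: "sb i k --> yc y d' i = yc y d i"
    show "sb (sc i) k --> yc y d' (sc i) = yc y d (sc i)"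
    proof
     assume s: "sb (sc i) k"
     then have "i:k" "sb i k" by (auto simp: sb_def)
     then show "yc y d' (sc i) = yc y d (sc i)" using H i cl'[OF i] ne by simp
    qed
   qed simp_all
   have dp': "d'$p = d$p & od d' p = od d p" if p: "p:k" for p
   proof -
    have po: "p:om" using nat_in[OF k p] .
    have "q1 p:k" using sbD[OF nat_sbI[OF k p] q1_le[OF po]] .
    then have c: "cl d' (q1 p) = cl d (q1 p)" using cl'[of "q1 p"] po ne by simp
    have "d'$p = cl d' (q1 p)$(q2 p)" "d$p = cl d (q1 p)$(q2 p)" using po by simp_all
    then show ?thesis using c by (simp add: od_def)
   qed
   have cd': "sb i k --> cd d' i = cd d i" if i: "i:om" for i
   proof (rule nat_ind[OF i])
    fix i assume i: "i:om" and H: "sb i k --> cd d' i = cd d i"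
    show "sb (sc i) k --> cd d' (sc i) = cd d (sc i)"
    proof
     assume s: "sb (sc i) k"
     then have "i:k" "sb i k" by (auto simp: sb_def)
     then show "cd d' (sc i) = cd d (sc i)" using H i dp' by simp
    qed
   qed simp_all
   have n': "nd d' k = nd d k" unfolding nd_def using cd'[OF k] by simp
   have a': "adm y d' (sc k)" unfolding adm_def
   proof (intro allI impI)
    fix i assume i: "i:sc k"
    have io: "i:om" using nat_in[OF sc_om[OF k] i] .
    have s: "sb i k" using i Ord_sb[OF nat_Ord[OF k]] by auto
    show "cl d' i:WF & yc y d' i$emp ~= emp"
     using i cl'[OF io] yc'[OF io] s a w(1,2) e unfolding adm_def by (cases "i = k") auto
   qed
   have yu: "yc y d' (sc k) = u" using yc'[OF k] cl'[OF k] e w(3) k by simp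
   have "sb (yk u) (rk w1 kr (nd d' (sc k)))" using IH[OF u] d' a' yu sc_om[OF k] by blast
   moreover have n2: "nd d' (sc k):w1" using nd_w1[OF d' sc_om[OF k] a'] .
   moreover have "kr (nd d' (sc k)) (nd d k)" unfolding kr_def using d' k a' n' by metis
   then have "rk w1 kr (nd d' (sc k)):rk w1 kr (nd d k)" using rk_mono[OF wf_kr dp_krv n1 n2] by blast
   ultimately show "rk YY yr u:rk w1 kr (nd d k)"
    using Ord_sb_mem[OF Ord_yk[OF u(1)] Ord_rk[OF wf_kr dp_krv n1]] unfolding yk_def by blast
  qed
 qed
qed simp

lemma yk_w2: "yk y:w2"
proof -
 have a: "adm y zr emp" by (simp add: adm_def)
 have n: "nd zr emp:w1" using nd_w1[OF zr_Rl emp_om a] .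
 let ?r = "rk w1 kr (nd zr emp)"
 have s: "sb (yk y) ?r" using yk_kr[OF y] a by (metis yc_0 emp_om zr_Rl)
 have "img w1 ?r"
 proof (rule imgI[of "rk w1 kr"])
  show "EX x. x:w1 & rk w1 kr x = v" if "v:?r" for v using rk_onto[OF wf_kr dp_krv n that] .
 qed simp
 then have "?r:w2" unfolding w2_def mem_hart using Ord_rk[OF wf_kr dp_krv n] by blast
 then show ?thesis using Ord_sb_mem[OF Ord_yk[OF y] Ord_w2 s] by blast
qed

end

theorem w2_regular: assumes f: "!!\<xi>. \<xi>:w1 ==> f$\<xi>:w2" shows "EX \<beta>. \<beta>:w2 & (ALL \<xi>. \<xi>:w1 --> f$\<xi>:\<beta>)"
proof -
 obtain y where "y:YY" "!!\<xi>. \<xi>:w1 ==> f$\<xi>:yk y"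
  using acc_sup[of f] w2_Acc[OF f] Ord_in[OF Ord_w2 f] by blast
 then show ?thesis using yk_w2 by blast
qed

section \<open>Codes for sets in the difference class\<close>

lemma eqn_prI: "n:om ==> x:Rl ==> y:Rl ==> x':Rl ==> y':Rl ==> eqn n x x' ==> eqn n y y' ==>
 eqn n (pr x y) (pr x' y')" using eqn_pr by blast

text \<open>Sections of a tree of pairs; \<open>Sec t x:WF\<close> is a universal coanalytic
  relation by \<open>Sec_code\<close>.\<close>

definition Sec where "Sec t x = mkt (%b n. inn t (pr x b) n)"
lemma dt_Sec [simp]: "dt a ==> dt b ==> dt (%s. Sec (a s) (b s))"
 by (rule dt_lift2) (simp_all add: Sec_def mkt_def)

lemma Sec: assumes x: "x:Rl" shows "Sec t x:Rl" "b:Rl ==> n:om ==> inn (Sec t x) b n <-> inn t (pr x b) n"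
proof -
 have d: "dp (%s. inn t (pr x (s 0)) (s 1))" by simp
 have c: "inn t (pr x b') n" if "b:Rl" "b':Rl" "n:om" "eqn n b b'" "inn t (pr x b) n" for b b' n
  using inn_cong[OF that(3) eqn_prI[OF that(3) x that(1) x that(2) eqn_refl that(4)]] that(5) by blast
 show "Sec t x:Rl" unfolding Sec_def by (rule mkt(1)[OF d], rule c, assumption+) (auto simp: inn_sc)
 show "b:Rl ==> n:om ==> inn (Sec t x) b n <-> inn t (pr x b) n"
  unfolding Sec_def by (rule mkt(2)[OF d], rule c, assumption+) (auto simp: inn_sc)
qed

lemma ct_Sec: assumes "ct F" "ct G" shows "ct (%x. Sec (F x) (G x))"
proof (rule ct2[OF assms])
 fix t x k assume *: "t:Rl" "x:Rl" "k:om"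
 have e: "ex k:Rl" "ln k:om" using *(3) ex by simp_all
 obtain m where m: "m:om" "!!w w'. eqn m w w' ==> inn w (pr x (ex k)) (ln k) = inn w' (pr x (ex k)) (ln k)"
  using inn_ct[of "pr x (ex k)" "ln k"] * e by auto
 obtain l where l: "l:om" "sb m l" "sb (ln k) l" by (rule nat_max[OF m(1) e(2)])
 have "Sec t x$k = Sec t' x'$k" if "x':Rl" "eqn l t t'" "eqn l x x'" for t' x'
 proof -
  have "inn t' (pr x (ex k)) (ln k) = inn t' (pr x' (ex k)) (ln k)"
   by (rule inn_cong[OF e(2) eqn_prI[OF e(2) *(2) e(1) that(1) e(1) eqn_mono[OF that(3) l(3)] eqn_refl]])
  then show ?thesis using m(2)[OF eqn_mono[OF that(2) l(2)]] *(3) by (simp add: Sec_def mkt_def)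
 qed
 then show "EX m. m:om & (ALL t' x'. t':Rl --> x':Rl --> eqn m t t' --> eqn m x x' --> Sec t x$k = Sec t' x'$k)"
  using l(1) by blast
qed (auto simp: Sec(1))

text \<open>The search tree of \<open>attempts\<close> once more, now read at a fixed first
  component.\<close>

lemma Sec_code: assumes F: "ct F" shows "EX t. t:Rl & (ALL x. x:Rl --> (Sec t x:WF <-> F x:WF))"
proof -
 obtain t where t: "t:Rl" "!!z b n. z:Rl ==> b:Rl ==> n:om ==> inn (F z) b n ==> inn t (pr z b) n"
  "!!y n. y:Rl ==> ALL n. n:om --> inn t y n ==> n:om ==> inn (F (fs y)) (sn y) n" using attempts[OF F] by blast
 have "Sec t x:WF <-> F x:WF" if x: "x:Rl" for x
 proof
  assume W: "Sec t x:WF"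
  show "F x:WF" unfolding mem_WF using W t(2)[OF x] Sec(2)[OF x] ct_Rl[OF F x] unfolding mem_WF by blast
 next
  assume W: "F x:WF"
  show "Sec t x:WF" unfolding mem_WF
  proof (intro conjI allI impI Sec(1)[OF x], rule ccontr)
   fix b assume b: "b:Rl" and "~(EX n. n:om & ~inn (Sec t x) b n)"
   then have "inn t (pr x b) n" if "n:om" for n using Sec(2)[OF x b] that by blast
   then have "inn (F (fs (pr x b))) (sn (pr x b)) n" if "n:om" for n using t(3)[OF pr_Rl[OF x b] _ that] by blast
   then have "inn (F x) b n" if "n:om" for n using that x b by simp
   then show False using W b unfolding mem_WF by blast
  qed
 qed
 then show ?thesis using t(1) by blast
qed

lemma dt_sub2: assumes "dt (%s. F (s 0) (s 1))" "dt a" "dt b" shows "dt (%s. F (a s) (b s))"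
 using dt_inst2[of "%s x y. F y x" "%n. n" b a] assms by simp

lemma ct_mk: assumes F: "!!i. i:om ==> ct (F i)" and d: "dt (%s. F (s 0) (s 1))" shows "ct (%x. mk (%i. F i x))"
proof -
 have dF: "dt (%s. F (a s) (b s))" if "dt a" "dt b" for a b using dt_sub2[OF d that] .
 have R: "mk (%i. F i x):Rl" if "x:Rl" for x by (rule mk_Rl) (use dF ct_Rl[OF F that] in auto)
 have e: "mk (%i. F i x)$k = F (q1 k) x$(q2 k)" if "k:om" for x k using that dF by (simp add: mk_def)
 show ?thesis unfolding ct_def ctn_def
 proof (intro conjI allI impI R)
  show "dt (%s. mk (%i. F i (s 0)))" using dF by simp
  fix x k assume "x:Rl" "k:om"
  then show "EX m. m:om & (ALL y. y:Rl --> eqn m x y --> mk (%i. F i x)$k = mk (%i. F i y)$k)"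
   unfolding e[OF \<open>k:om\<close>] using ctD[OF F[OF q1_om], of k x "q2 k"] by simp
 qed
qed

section \<open>Closure properties and codes of the difference class\<close>

abbreviation ff where "ff F x \<equiv> lst (%i. i:om & ~F i x:WF)"

lemma lst_eq: assumes d: "dp (%s. P (s 0))" and i: "i:om" "P i" and k: "!!k. k:i ==> ~P k"
 shows "lst (%i. i:om & P i) = i"
proof -
 have dd: "dp (%s. s 0:om & P (s 0))" using d by simp
 have "i:om & P i" using i by blast
 note l = lst[of "%i. i:om & P i", OF dd nat_Ord[OF i(1)] this]
 show ?thesis using nat_lin[of "lst (%i. i:om & P i)" i] l(2,4) i k by blast
qed

lemma ff: assumes d: "dt (%s. F (s 0) (s 1))" and e: "EX i. i:om & ~F i x:WF"
 shows "ff F x:om" "~F (ff F x) x:WF" "!!k. k:ff F x ==> F k x:WF"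
proof -
 have dF: "dt (%s. F (a s) (b s))" if "dt a" "dt b" for a b using dt_sub2[OF d that] .
 have dd: "dp (%s. s 0:om & ~F (s 0) x:WF)" using dF by simp
 obtain i where i: "i:om & ~F i x:WF" using e by blast
 note l = lst[of "%i. i:om & ~F i x:WF", OF dd nat_Ord i, OF i[THEN conjunct1]]
 show "ff F x:om" "~F (ff F x) x:WF" using l(2) by blast+
 then show "!!k. k:ff F x ==> F k x:WF" using l(4) nat_in by blast
qed

lemma ff_eq: assumes d: "dt (%s. F (s 0) (s 1))" and i: "i:om" "~F i x:WF" and k: "!!k. k:i ==> F k x:WF"
 shows "ff F x = i"
 by (rule lst_eq[of "%i. ~F i x:WF"]) (use dt_sub2[OF d] i k in auto)

lemma DCI:
 assumes F: "!!i. i:om ==> ct (F i)" and d: "dt (%s. F (s 0) (s 1))" and v: "v:Rl" and A: "sb A Rl"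
  and ex: "!!x. x:Rl ==> EX i. i:om & ~F i x:WF"
  and AF: "!!x. x:Rl ==> x:A <-> v$(ff F x) = emp"
 shows "DC A"
proof -
 have dF: "dt (%s. F (a s) (b s))" if "dt a" "dt b" for a b using dt_sub2[OF d that] .
 have c: "ct (%x. mk (%i. F i x))" by (rule ct_mk[OF F d])
 let ?f = "Lam Rl (%x. mk (%i. F i x))"
 have cl: "cl (?f$x) i = F i x" if "x:Rl" "i:om" for x i
  using that ct_Rl[OF F that(1)] dF by (simp add: ct_dt[OF c])
 have dc: "dt (%s. cl (?f$(s 1)) (s 0))" by simp
 have "ff (%i x. cl (?f$x) i) x = ff F x" if x: "x:Rl" for x
 proof (rule ff_eq[of "%i x. cl (?f$x) i", OF dc])
  note i = ff[of F, OF d ex[OF x]]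
  show "ff F x:om" using i(1) .
  show "~cl (?f$x) (ff F x):WF" using i(2) cl[OF x i(1)] by simp
  show "cl (?f$x) k:WF" if "k:ff F x" for k using i(3)[OF that] cl[OF x nat_in[OF i(1) that]] by simp
 qed
 then have "x:A <-> v$(ff (%i x. cl (?f$x) i) x) = emp" if "x:Rl" for x using AF[OF that] that by simp
 moreover have "EX i. i:om & ~cl (?f$x) i:WF" if x: "x:Rl" for x
 proof -
  obtain i where "i:om" "~F i x:WF" using ex[OF x] by blast
  then show ?thesis using cl[OF x, of i] by (intro exI[of _ i]) simp
 qed
 ultimately show ?thesis unfolding DC_def using A v ct_Ct[OF c] by blast
qed

text \<open>A well-founded filler: an index carrying it is passed over.\<close>

definition WT where "WT = cn emp one"
lemma WT: "WT:WF" "WT:Rl" unfolding WT_def using WF_cn[OF emp_om] WF_Rl by blast+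

lemma dbl_mono: assumes "i:om" "m:om" "i:m" shows "sc (dbl i):dbl m"
proof -
 have "~dbl m:dbl i" using dbl_less[OF assms(2,1)] mem_asym assms(3) by blast
 moreover have "dbl m ~= dbl i" using assms by auto
 ultimately show ?thesis using nat_lin[of "sc (dbl i)" "dbl m"] assms by auto
qed

lemma ct_if: assumes F: "ct F" and G: "ct G" and P: "dp (%s. P (s 0))"
 and loc: "!!x. x:Rl ==> EX m. m:om & (ALL y. y:Rl --> eqn m x y --> (P x <-> P y))"
 shows "ct (%x. if P x then F x else G x)"
 unfolding ct_def ctn_def
proof (intro conjI allI impI)
 have dP: "dp (%s. P (a s))" if "dt a" for a using dp_sub1[OF P that] .
 show "dt (%s. if P (s 0) then F (s 0) else G (s 0))" using dP ct_dt[OF F] ct_dt[OF G] by simp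
 show "(if P x then F x else G x):Rl" if "x:Rl" for x using ct_Rl[OF F that] ct_Rl[OF G that] by simp
 fix x k assume x: "x:Rl" and k: "k:om"
 obtain m where m: "m:om" "!!y. y:Rl ==> eqn m x y ==> P x <-> P y" using loc[OF x] by blast
 obtain a where a: "a:om" "!!y. y:Rl ==> eqn a x y ==> F x$k = F y$k" using ctD[OF F x k] by blast
 obtain b where b: "b:om" "!!y. y:Rl ==> eqn b x y ==> G x$k = G y$k" using ctD[OF G x k] by blast
 obtain l1 where l1: "l1:om" "sb m l1" "sb a l1" by (rule nat_max[OF m(1) a(1)])
 obtain l where l: "l:om" "sb l1 l" "sb b l" by (rule nat_max[OF l1(1) b(1)])
 have "(if P x then F x else G x)$k = (if P y then F y else G y)$k" if y: "y:Rl" "eqn l x y" for y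
 proof -
  have "eqn m x y" "eqn a x y" "eqn b x y" using eqn_mono[OF y(2)] l l1 sb_trans by blast+
  then show ?thesis using m(2)[OF y(1)] a(2)[OF y(1)] b(2)[OF y(1)] by simp
 qed
 then show "EX m. m:om & (ALL y. y:Rl --> eqn m x y --> (if P x then F x else G x)$k = (if P y then F y else G y)$k)" using l(1) by blast
qed

text \<open>Values that vary with \<open>x\<close> are absorbed by doubling the indices:
  \<open>2i\<close> is active if the value at \<open>i\<close> is zero and \<open>2i+1\<close>
  otherwise, and the inactive one carries \<open>WT\<close>.\<close>

lemma DC_var:
 assumes F: "!!i. i:om ==> ct (F i)" and d: "dt (%s. F (s 0) (s 1))" and V: "ct V" and A: "sb A Rl"
  and ex: "!!x. x:Rl ==> EX i. i:om & ~F i x:WF"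
  and AF: "!!x. x:Rl ==> x:A <-> V x$(ff F x) = emp"
 shows "DC A"
proof -
 have dF: "dt (%s. F (a s) (b s))" if "dt a" "dt b" for a b using dt_sub2[OF d that] .
 have dV: "dt (%s. V (a s))" if "dt a" for a using ct_dt[OF V that] .
 define F' where "F' p x = (if (V x$(hf p) = emp) = (p = dbl (hf p)) then F (hf p) x else WT)" for p x
 define v where "v = Lam om (%p. if p = dbl (hf p) then emp else sc emp)"
 have v: "v:Rl" unfolding v_def by (rule RlI) auto
 have d': "dt (%s. F' (s 0) (s 1))" unfolding F'_def using dF dV by simp
 show ?thesis
 proof (rule DCI[of F', OF _ d' v A])
  fix p assume p: "p:om"
  show "ct (F' p)" unfolding F'_def
  proof (rule ct_if[OF F[OF hf_om[OF p]] ct_const[OF WT(2)]])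
   show "dp (%s. (V (s 0)$(hf p) = emp) = (p = dbl (hf p)))" using dV by simp
   fix x assume x: "x:Rl"
   show "EX m. m:om & (ALL y. y:Rl --> eqn m x y --> ((V x$(hf p) = emp) = (p = dbl (hf p))) = ((V y$(hf p) = emp) = (p = dbl (hf p))))"
    using ctD[OF V x hf_om[OF p]] by metis
  qed
 next
  fix x assume x: "x:Rl"
  define i where "i = ff F x"
  note i = ff[of F, OF d ex[OF x], folded i_def]
  define p where "p = (if V x$i = emp then dbl i else sc (dbl i))"
  have p: "p:om" "hf p = i" "V x$i = emp <-> p = dbl i" using i(1) by (auto simp: p_def)
  have np: "~F' p x:WF" unfolding F'_def using p i(2) by simp
  then show "EX i. i:om & ~F' i x:WF" using p(1) by blast
  have "F' k x:WF" if k: "k:p" for k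
  proof -
   have ko: "k:om" using nat_in[OF p(1) k] .
   define m where "m = hf k"
   have m: "m:om" "k = dbl m | k = sc (dbl m)" using ko parity[OF ko] by (auto simp: m_def)
   show ?thesis
   proof (cases "m:i")
    case True then show ?thesis unfolding F'_def m_def[symmetric] using i(3) WT(1) by simp
   next
    case False
    have "~i:m"
    proof
     assume "i:m"
     then have s: "sc (dbl i):dbl m" by (rule dbl_mono[OF i(1) m(1)])
     have "p:dbl m"
      using s nat_trans[OF _ s, of "dbl i"] m(1) unfolding p_def by auto
     then have "p:k" using m(2) by auto
     then show False using k mem_asym by blast
    qed
    then have "m = i" using False nat_lin[OF m(1) i(1)] by blast
    then have "k = dbl i" "p = sc (dbl i)" using k m(2) mem_asym[of "dbl i" "sc (dbl i)"] i(1) unfolding p_def by (auto split: if_splits)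
    then show ?thesis unfolding F'_def using p i(1) WT(1) by simp
   qed
  qed
  then have "ff F' x = p" by (rule ff_eq[of F', OF d' p(1) np])
  then show "x:A <-> v$(ff F' x) = emp" using AF[OF x] p by (simp add: v_def i_def[symmetric])
 qed
qed

text \<open>A set of the class is coded by one real: its first component gives the trees, its second
  the values. Validity demands that an ill-founded tree always exists.\<close>

definition vld where "vld \<sigma> <-> (ALL x. x:Rl --> (EX i. i:om & ~Sec (cl (fs \<sigma>) i) x:WF))"
definition DS where "DS \<sigma> = Sep Rl (%x. sn \<sigma>$(ff (%i x. Sec (cl (fs \<sigma>) i) x) x) = emp)"
lemma dp_vld [simp]: "dt a ==> dp (%s. vld (a s))" by (rule dp_lift1) (simp_all add: vld_def)
lemma dt_DS [simp]: "dt a ==> dt (%s. DS (a s))" by (rule dt_lift1) (simp_all add: DS_def)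
lemma mem_DS: "x:DS \<sigma> <-> x:Rl & sn \<sigma>$(ff (%i x. Sec (cl (fs \<sigma>) i) x) x) = emp"
 unfolding DS_def by (rule mem_Sep) simp

lemma DC_code: assumes "DC A" shows "EX \<sigma>. \<sigma>:Rl & vld \<sigma> & A = DS \<sigma>"
proof -
 obtain f v where A: "sb A Rl" and f: "Ct f" and v: "v:Rl" and ex: "!!x. x:Rl ==> EX i. i:om & ~cl (f$x) i:WF"
  and AF: "!!x. x:Rl ==> x:A <-> v$(ff (%i x. cl (f$x) i) x) = emp" using assms unfolding DC_def by blast
 have "EX t. t:Rl & (ALL x. x:Rl --> (Sec t x:WF <-> cl (f$x) i:WF))" if "i:om" for i
  by (rule Sec_code[OF ct_cl[OF Ct_ct[OF f] that]])
 then obtain t where t: "t:Rl" "!!i x. i:om ==> x:Rl ==> Sec (cl t i) x:WF <-> cl (f$x) i:WF"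
  using CC[of "%i t. ALL x. x:Rl --> (Sec t x:WF <-> cl (f$x) i:WF)"] by auto
 let ?s = "pr t v"
 have fs: "fs ?s = t" "sn ?s = v" using t v by simp_all
 have vl: "vld ?s" unfolding vld_def fs using ex t(2) by blast
 have d1: "dt (%s. cl (f$(s 1)) (s 0))" and d2: "dt (%s. Sec (cl t (s 0)) (s 1))" by simp_all
 have e: "ff (%i x. Sec (cl t i) x) x = ff (%i x. cl (f$x) i) x" if x: "x:Rl" for x
 proof (rule ff_eq[of "%i x. Sec (cl t i) x", OF d2])
  note i = ff[of "%i x. cl (f$x) i", OF d1 ex[OF x]]
  show "ff (%i x. cl (f$x) i) x:om" using i(1) .
  show "~Sec (cl t (ff (%i x. cl (f$x) i) x)) x:WF" using i(2) t(2)[OF i(1) x] by simp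
  show "Sec (cl t k) x:WF" if "k:ff (%i x. cl (f$x) i) x" for k using i(3)[OF that] t(2)[OF nat_in[OF i(1) that] x] by simp
 qed
 have "A = DS ?s" by (rule ext) (use A AF e fs in \<open>auto simp: mem_DS sb_def\<close>)
 then show ?thesis using vl t(1) v by (intro exI[of _ ?s]) simp
qed

lemma DC_DS: assumes s: "\<sigma>:Rl" "vld \<sigma>" shows "DC (DS \<sigma>)"
proof (rule DCI[of "%i x. Sec (cl (fs \<sigma>) i) x" "sn \<sigma>"])
 show "ct (Sec (cl (fs \<sigma>) i))" if "i:om" for i
  by (rule ct_Sec[OF ct_const ct_id, of "cl (fs \<sigma>) i"]) (use s(1) that in simp)
qed (use s in \<open>auto simp: mem_DS sb_def vld_def\<close>)

lemma DC_wle: assumes X: "wle X A" and A: "DC A" shows "DC X"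
proof -
 obtain \<sigma> where s: "\<sigma>:Rl" "vld \<sigma>" "A = DS \<sigma>" using DC_code[OF A] by blast
 obtain g where g: "ct (ap g)" "!!x. x:Rl ==> x:X <-> g$x:A" using wleE[OF X] by metis
 show ?thesis
 proof (rule DCI[of "%i x. Sec (cl (fs \<sigma>) i) (g$x)" "sn \<sigma>"])
  show "ct (%x. Sec (cl (fs \<sigma>) i) (g$x))" if "i:om" for i
   by (rule ct_Sec[OF ct_const g(1), of "cl (fs \<sigma>) i"]) (use s(1) that in simp)
 qed (use s g ct_Rl[OF g(1)] wle_sb[OF X] in \<open>auto simp: mem_DS vld_def\<close>)
qed

lemma DC_cmp: assumes "DC A" shows "DC (cmp A)"
proof -
 obtain \<sigma> where s: "\<sigma>:Rl" "vld \<sigma>" "A = DS \<sigma>" using DC_code[OF assms] by blast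
 define v where "v = Lam om (%i. if sn \<sigma>$i = emp then sc emp else emp)"
 have v: "v:Rl" unfolding v_def by (rule RlI) auto
 let ?F = "%i x. Sec (cl (fs \<sigma>) i) x"
 have d: "dt (%s. ?F (s 0) (s 1))" by simp
 show ?thesis
 proof (rule DCI[of ?F v, OF _ d v cmp_sb])
  show "ct (Sec (cl (fs \<sigma>) i))" if "i:om" for i
   by (rule ct_Sec[OF ct_const ct_id, of "cl (fs \<sigma>) i"]) (use s(1) that in simp)
  show e: "EX i. i:om & ~?F i x:WF" if "x:Rl" for x using s(2) that vld_def by blast
  show "x:cmp A <-> v$(ff ?F x) = emp" if x: "x:Rl" for x
   using ff(1)[of ?F, OF d e[OF x]] x unfolding s(3) by (simp add: mem_DS v_def)
 qed
qed

lemma DC_join: assumes z: "z:Rl" "!!n. n:om ==> vld (cl z n)" shows "DC (Jn (Lam om (%n. DS (cl z n))))"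
proof -
 have c: "ct (%x. cl z (x$emp))" by (rule ct_clv[OF z(1) emp_om])
 show ?thesis
 proof (rule DC_var[of "%i x. Sec (cl (fs (cl z (x$emp))) i) (tl x)" "%x. sn (cl z (x$emp))"])
  show "ct (%x. Sec (cl (fs (cl z (x$emp))) i) (tl x))" if "i:om" for i
   by (rule ct_Sec[OF ct_cl[OF ct_fs[OF c] that] ct_tl[OF ct_id]])
  show "ct (%x. sn (cl z (x$emp)))" by (rule ct_sn[OF c])
  show "EX i. i:om & ~Sec (cl (fs (cl z (x$emp))) i) (tl x):WF" if "x:Rl" for x
   using z(2)[of "x$emp"] that unfolding vld_def by simp
 qed (auto simp: sb_def mem_DS)
qed

section \<open>The length of the Wadge order of the difference class\<close>

lemma DC_sb: "DC A ==> sb A Rl" by (simp add: DC_def)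

lemma DC_dbj: assumes "DC A" shows "DC (dbj A)"
proof -
 obtain \<sigma> where s: "\<sigma>:Rl" "vld \<sigma>" "A = DS \<sigma>" using DC_code[OF assms] by blast
 obtain \<tau> where t: "\<tau>:Rl" "vld \<tau>" "cmp A = DS \<tau>" using DC_code[OF DC_cmp[OF assms]] by blast
 define z where "z = mk (%n. if n = emp then \<sigma> else \<tau>)"
 have d: "dt (%u. if u 0 = emp then \<sigma> else \<tau>)" by simp
 have z: "z:Rl" unfolding z_def by (rule mk_Rl[OF d]) (use s t in simp)
 have c: "cl z n = (if n = emp then \<sigma> else \<tau>)" if "n:om" for n
  unfolding z_def by (rule cl_mk[OF d _ that]) (use s t in simp)
 have "Jn (Lam om (%n. DS (cl z n))) = dbj A"
  by (rule ext) (use c in \<open>auto simp: mem_dbj s(3)[symmetric] t(3)[symmetric]\<close>)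
 then show ?thesis using DC_join[OF z] c s t by simp
qed

text \<open>Membership of a node depends only on its length, so this tree is ill-founded exactly for
  the zero real.\<close>

definition Z0 where "Z0 u = Lam om (%m. u$(Uni (ln m)))"
lemma dt_Z0 [simp]: "dt a ==> dt (%s. Z0 (a s))" by (rule dt_lift1) (simp_all add: Z0_def)
lemma Z0_Rl: "u:Rl ==> Z0 u:Rl" unfolding Z0_def by (rule RlI) auto
lemma ct_Z0: "ct F ==> ct (%x. Z0 (F x))"
 by (rule ct2b[of F F "%x y. Z0 x" "%k. Uni (ln k)"], assumption, assumption, simp, simp add: Z0_Rl, simp, simp add: Z0_def)
lemma Z0_WF: assumes u: "u:Rl" shows "Z0 u:WF <-> (EX n. n:om & u$n ~= emp)"
proof -
 have i: "inn (Z0 u) b n <-> (ALL k. k:n --> u$k = emp)" if b: "b:Rl" and n: "n:om" for b n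
 proof -
  have "Z0 u$(kap b (sc k)) = u$k" if "k:n" for k
  proof -
   have k: "k:om" using nat_in[OF n that] .
   have "kap b (sc k):om" "ln (kap b (sc k)) = sc k" using b k ln_kap[OF b sc_om[OF k]] by (simp_all del: kap_sc)
   then show ?thesis using k by (simp add: Z0_def Uni_sc nat_Ord del: kap_sc)
  qed
  then show ?thesis unfolding inn_def by auto
 qed
 show ?thesis
 proof
  assume "Z0 u:WF"
  then obtain n where "n:om" "~inn (Z0 u) zr n" unfolding mem_WF using zr_Rl by blast
  then show "EX n. n:om & u$n ~= emp" using i[OF zr_Rl] nat_in by blast
 next
  assume "EX n. n:om & u$n ~= emp"
  then obtain n where n: "n:om" "u$n ~= emp" by blast
  then have "~inn (Z0 u) b (sc n)" if "b:Rl" for b using i[OF that sc_om[OF n(1)]] by auto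
  then show "Z0 u:WF" unfolding mem_WF using Z0_Rl[OF u] sc_om[OF n(1)] by blast
 qed
qed

lemma pi_mono2: assumes N: "N:om" and ij: "i:om" "j:om" "i:j" shows "pi N i:pi N j"
proof (rule nat_ind[OF N])
 have a: "sc (dbl a):dbl b" if "a:om" "b:om" "a:b" for a b using dbl_mono[OF that] .
 show "pi emp i:pi emp j" using nat_trans[OF _ a[OF ij], of "dbl i"] ij by simp
 show "pi (sc n) i:pi (sc n) j" if "n:om" "pi n i:pi n j" for n
  using a[OF _ _ that(2)] that(1) ij by simp
qed simp

lemma sc_mem_scD: assumes q: "q:om" and s: "sc r:sc q" shows "r:q"
proof -
 have "sc r:q | sc r = q" using s by simp
 then show ?thesis using nat_trans[of r "sc r" q, OF _ _ q] by auto
qed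

definition fz where "fz u N <-> u$N ~= emp & (ALL k. k:N --> u$k = emp)"
lemma dp_fz [simp]: "dt a ==> dt b ==> dp (%s. fz (a s) (b s))" by (rule dp_lift2) (simp_all add: fz_def)
lemma fz_uniq: "fz u N ==> fz u M ==> N:om ==> M:om ==> N = M"
 unfolding fz_def using nat_lin by blast
lemma fz_ex: assumes "n:om" "u$n ~= emp" shows "EX N. N:om & fz u N"
proof -
 have d: "dp (%s. s 0:om & u$(s 0) ~= emp)" by simp
 have i: "n:om & u$n ~= emp" using assms by blast
 note l = lst[of "%n. n:om & u$n ~= emp", OF d nat_Ord[OF assms(1)] i]
 show ?thesis unfolding fz_def using l(2,4) nat_in by blast
qed

text \<open>Above a selfdual \<open>A\<close>: after a reduction has used its first digit, the position of the first nonzero entry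
 of \<open>fs x\<close> and hence the instance of \<open>A\<close> are still open.\<close>

definition MA where "MA A = Sep Rl (%x. EX N. N:om & fz (fs x) N & cl (sn x) N:A)"
lemma mem_MA: "x:MA A <-> x:Rl & (EX N. N:om & fz (fs x) N & cl (sn x) N:A)" by (simp add: MA_def)

text \<open>Index zero catches the points with \<open>fs x\<close> zero, with a value outside
  \<open>MA A\<close>. Index \<open>sc (pi N i)\<close> carries the \<open>i\<close>-th tree of
  \<open>A\<close> if \<open>N\<close> is the first nonzero place and \<open>WT\<close> otherwise;
  as \<open>pi N\<close> is increasing, the first ill-founded tree of \<open>A\<close> is still
  found first.\<close>

lemma DC_MA: assumes "DC A" shows "DC (MA A)"
proof -
 obtain \<sigma> where s: "\<sigma>:Rl" "vld \<sigma>" "A = DS \<sigma>" using DC_code[OF assms] by blast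
 define F where "F p x = (if p = emp then Z0 (fs x) else if fz (fs x) (q1 (Uni p))
  then Sec (cl (fs \<sigma>) (q2 (Uni p))) (cl (sn x) (q1 (Uni p))) else WT)" for p x
 define v where "v = Lam om (%p. if p = emp then sc emp else sn \<sigma>$(q2 (Uni p)))"
 have v: "v:Rl" unfolding v_def by (rule RlI) (use s in auto)
 have d: "dt (%u. F (u 0) (u 1))" unfolding F_def by simp
 let ?G = "%i x. Sec (cl (fs \<sigma>) i) x"
 have dG: "dt (%u. ?G (u 0) (u 1))" by simp
 have Fs: "F (sc q) x = (if fz (fs x) (q1 q) then ?G (q2 q) (cl (sn x) (q1 q)) else WT)" if "q:om" for q x
  unfolding F_def using that by (simp add: Uni_sc nat_Ord)
 show ?thesis
 proof (rule DCI[of F, OF _ d v])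
  fix p assume p: "p:om"
  show "ct (F p)"
  proof (rule nat_cases[OF p])
   assume "p = emp" then show ?thesis unfolding F_def using ct_Z0[OF ct_fs[OF ct_id]] by simp
  next
   fix q assume q: "q:om" "p = sc q"
   have "ct (%x. if fz (fs x) (q1 q) then ?G (q2 q) (cl (sn x) (q1 q)) else WT)"
   proof (rule ct_if)
    show "ct (%x. ?G (q2 q) (cl (sn x) (q1 q)))"
     by (rule ct_Sec[OF ct_const ct_cl[OF ct_sn[OF ct_id]]]) (use s q in simp_all)
    show "ct (%x. WT)" by (rule ct_const[OF WT(2)])
    fix x assume "x:Rl"
    have "fz (fs x) (q1 q) = fz (fs y) (q1 q)" if "eqn (sc (q1 q)) x y" for y
    proof -
     have "eqn (sc (q1 q)) (fs x) (fs y)" by (rule eqn_fs[OF _ that]) (use q in simp)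
     then have "fs x$k = fs y$k" if "k:sc (q1 q)" for k using eqn_in that by blast
     then show ?thesis unfolding fz_def by auto
    qed
    then show "EX m. m:om & (ALL y. y:Rl --> eqn m x y --> fz (fs x) (q1 q) = fz (fs y) (q1 q))"
     using q by (intro exI[of _ "sc (q1 q)"]) simp
   qed simp
   then show ?thesis unfolding q(2) Fs[OF q(1), abs_def] by (simp add: Fs[OF q(1)] cong: if_cong)
  qed
 next
  show "sb (MA A) Rl" by (simp add: sb_def mem_MA)
  fix x assume x: "x:Rl"
  have ux: "fs x:Rl" using x by simp
  consider "ALL n. n:om --> fs x$n = emp" | N where "N:om" "fz (fs x) N" using fz_ex by blast
  then have "EX p. p:om & ~F p x:WF & (ALL k. k:p --> F k x:WF) & (x:MA A <-> v$p = emp)"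
  proof cases
   case 1
   have "~F emp x:WF" unfolding F_def using Z0_WF[OF ux] 1 by simp
   moreover have "~x:MA A" unfolding mem_MA fz_def using 1 by blast
   ultimately show ?thesis by (intro exI[of _ emp]) (simp add: v_def)
  next
   case (2 N)
   let ?y = "cl (sn x) N"
   have y: "?y:Rl" using x 2 by simp
   have e: "EX i. i:om & ~?G i ?y:WF" using s(2) y unfolding vld_def by blast
   note i = ff[of ?G, OF dG e]
   let ?i = "ff ?G ?y" let ?q = "pi N ?i"
   have q: "?q:om" using 2 i(1) by simp
   have "~F (sc ?q) x:WF" unfolding Fs[OF q] using 2 i(1,2) by simp
   moreover have "F k x:WF" if k: "k:sc ?q" for k
   proof (rule nat_cases[OF nat_in[OF sc_om[OF q] k]])
    assume "k = emp"
    moreover have "Z0 (fs x):WF" using Z0_WF[OF ux] 2 unfolding fz_def by blast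
    ultimately show ?thesis by (simp add: F_def)
   next
    fix r assume r: "r:om" "k = sc r"
    have "r:?q" using sc_mem_scD[OF q] k r(2) by blast
    show ?thesis
    proof (cases "q1 r = N")
     case True
     have q2r: "q2 r:om" using r by simp
     have rr: "r = pi N (q2 r)" using pi_q[OF r(1)] True by metis
     have "q2 r:?i"
     proof (rule ccontr)
      assume "~q2 r:?i"
      then have "q2 r = ?i | ?i:q2 r" using nat_lin[OF q2r i(1)] by blast
      then have "?q = r | ?q:r" using pi_mono2[OF 2(1) i(1) q2r] rr by metis
      then show False using \<open>r:?q\<close> mem_asym mem_irrefl by blast
     qed
     then show ?thesis unfolding r(2) Fs[OF r(1)] using i(3) True WT(1) by simp
    next
     case False
     then have "~fz (fs x) (q1 r)" using fz_uniq[OF 2(2) _ 2(1)] r(1) by auto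
     then show ?thesis unfolding r(2) Fs[OF r(1)] using WT(1) by simp
    qed
   qed
   moreover have "x:MA A <-> v$(sc ?q) = emp"
   proof -
    have "x:MA A <-> ?y:A" unfolding mem_MA using x 2 fz_uniq[OF 2(2) _ 2(1)] by blast
    also have "\<dots> <-> sn \<sigma>$?i = emp" using y unfolding s(3) mem_DS by simp
    finally show ?thesis using q 2(1) i(1) by (simp add: v_def Uni_sc nat_Ord)
   qed
   ultimately show ?thesis using sc_om[OF q] by blast
  qed
  then obtain p where p: "p:om" "~F p x:WF" "!!k. k:p ==> F k x:WF" "x:MA A <-> v$p = emp" by blast
  show "EX i. i:om & ~F i x:WF" using p by blast
  have "ff F x = p" by (rule ff_eq[of F, OF d p(1-3)])
  then show "x:MA A <-> v$(ff F x) = emp" using p(4) by simp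
 qed
qed

text \<open>A reduction of \<open>MA A\<close> to \<open>A\<close>, followed by one to a join, has
  the same first digit on all arguments agreeing with zero up to \<open>m\<close>. Placing the first
  nonzero entry at \<open>m\<close> and an arbitrary \<open>a\<close> in column \<open>m\<close>
  then reduces \<open>A\<close> to one set of the join.\<close>

lemma less_MA: assumes A: "DC A" and sd: "wle A (cmp A)" shows "less A (MA A)"
 unfolding less_def
proof
 assume le: "le2 (MA A) A"
 have sA: "sb A Rl" using DC_sb[OF A] .
 have "wle (MA A) A" using le unfolding le2_def using wle_trans[OF _ wle_cmp1[OF sA sd sA]] by blast
 then obtain h where h: "ct (ap h)" "!!x. x:Rl ==> x:MA A <-> h$x:A" using wleE by metis
 obtain f Q where f: "Ct f" and Q: "fn Q om (Pw Rl)" "!!n. n:om ==> less (Q$n) A"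
  and fQ: "!!x. x:Rl ==> x:A <-> f$x:Jn Q" using HG_D(3)[OF HG_Ls DC_Ls[OF A]] sd unfolding SDp_def by blast
 have g: "ct (%x. f$(h$x))" by (rule ct_comp[OF Ct_ct[OF f] h(1)])
 let ?x0 = "pr zr zr"
 have x0: "?x0:Rl" by simp
 let ?n = "f$(h$?x0)$emp"
 have n: "?n:om" using ct_Rl[OF g x0] by simp
 obtain m where m: "m:om" "!!x. x:Rl ==> eqn m ?x0 x ==> ?n = f$(h$x)$emp" using ctD[OF g x0 emp_om] by blast
 define u where "u = upd zr m (sc emp)"
 define E where "E a = mk (%i. if i = m then a else zr)" for a
 have u1: "u:Rl" unfolding u_def by simp
 have u2: "fz u m" unfolding u_def fz_def using m(1) nat_in[OF m(1)] by (auto simp: zr_def)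
 note u = u1 u2
 have dE: "dt (%s. if s 0 = m then s 1 else zr)" by simp
 have cE: "ct E"
 proof -
  have "ct (%a. mk (%i. (%i a. if i = m then a else zr) i a))"
   by (rule ct_mk[OF _ dE]) (case_tac "i = m", simp_all add: ct_id ct_const)
  then show ?thesis by (simp add: E_def[abs_def])
 qed
 have E: "E a:Rl" "cl (E a) m = a" if a: "a:Rl" for a
 proof -
  have d: "dt (%s. if s 0 = m then a else zr)" by simp
  show "E a:Rl" using ct_Rl[OF cE a] .
  have "cl (E a) m = (if m = m then a else zr)" unfolding E_def by (rule cl_mk[OF d _ m(1)]) (use a in simp)
  then show "cl (E a) m = a" by simp
 qed
 have en: "eqn m ?x0 (pr u (E a))" if a: "a:Rl" for a
 proof (rule eqn_prI[OF m(1) zr_Rl zr_Rl u(1) E(1)[OF a]])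
  show "eqn m zr u" unfolding u_def by (rule eqn_sym[OF eqn_upd[OF m(1)]])
  show "eqn m zr (E a)" unfolding eqn_def
  proof (intro allI impI)
   fix k assume k: "k:m"
   have ko: "k:om" using nat_in[OF m(1) k] .
   have "q1 k ~= m" using sbD[OF nat_sbI[OF m(1) k] q1_le[OF ko]] by auto
   then show "zr$k = E a$k" using ko by (simp add: E_def mk_def zr_def)
  qed
 qed
 have c: "ct (%a. tl (f$(h$(pr u (E a)))))"
  by (rule ct_tl[OF ct_comp[OF g ct_pr[OF ct_const[OF u(1)] cE]]])
 have "wle A (Q$?n)"
 proof (rule wleI[OF c sA])
  fix a assume a: "a:Rl"
  let ?x = "pr u (E a)"
  have x: "?x:Rl" by (rule pr_Rl[OF u(1) E(1)[OF a]])
  have "cl (E a) N = a" if "N:om" "fz u N" for N using fz_uniq[OF u(2) that(2) m(1) that(1)] E(2)[OF a] by metis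
  then have "?x:MA A <-> a:A"
   unfolding mem_MA fs_pr[OF u(1) E(1)[OF a]] sn_pr[OF u(1) E(1)[OF a]] using x u(2) m(1) by metis
  moreover have "?x:MA A <-> f$(h$?x):Jn Q" using h(2)[OF x] fQ[OF ct_Rl[OF h(1) x]] by simp
  ultimately show "a:A <-> tl (f$(h$?x)):Q$?n"
   using m(2)[OF x en[OF a]] ct_Rl[OF g x] by simp
 qed
 then show False using Q(2)[OF n] unfolding less_def le2_def by blast
qed

text \<open>A nonselfdual set is exceeded by its join with its complement; this fails for selfdual
  sets, for which \<open>MA\<close> is used.\<close>

lemma no_max: assumes A: "DC A" shows "EX B. DC B & less A B"
proof (cases "wle A (cmp A)")
 case True then show ?thesis using DC_MA[OF A] less_MA[OF A] by blast
next
 case False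
 have sA: "sb A Rl" using DC_sb[OF A] .
 have 1: "wle A (dbj A)" "wle (cmp A) (dbj A)"
  using le2_dbj[OF _ _ sA] le2_refl[OF sA] le2_cmp(1)[OF sA sA] sA by simp_all
 have "less A (dbj A)" unfolding less_def le2_def
 proof
  assume "wle (dbj A) A | wle (dbj A) (cmp A)"
  then show False
  proof
   assume "wle (dbj A) A"
   then have "wle (cmp A) A" using 1 wle_trans by blast
   then show False using False wle_cmp2[OF sA] by blast
  next
   assume "wle (dbj A) (cmp A)"
   then show False using 1 False wle_trans by blast
  qed
 qed
 then show ?thesis using DC_dbj[OF A] by blast
qed

section \<open>Ranks in the Wadge order of the difference class\<close>

definition DD where "DD = Sep (Pw Rl) DC"
definition rho where "rho A = rk DD less A"
lemma mem_DD: "A:DD <-> DC A" using DC_sb by (auto simp: DD_def)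
lemma dt_rho [simp]: "dt a ==> dt (%s. rho (a s))" by (rule dt_lift1) (simp_all add: rho_def)
lemma dp_lessv: "dp (%s. less (s 1) (s 0))" by simp
lemma wf_DD: "wf DD less"
 using HG_D(2)[OF HG_Ls] DC_Ls unfolding wf_def sb_def mem_DD by blast
lemma Ord_rho: "DC A ==> Ord (rho A)" unfolding rho_def using Ord_rk[OF wf_DD dp_lessv] mem_DD by blast
lemma rho_mono: "DC A ==> DC B ==> less A B ==> rho A:rho B"
 unfolding rho_def using rk_mono[OF wf_DD dp_lessv] mem_DD by blast
lemma rho_le: assumes "DC A" "DC B" "le2 A B" shows "sb (rho A) (rho B)"
 unfolding rho_def[of A]
proof (rule rk_least[OF wf_DD dp_lessv])
 show "A:DD" "Ord (rho B)" using assms mem_DD Ord_rho by blast+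
 show "rk DD less Y:rho B" if "Y:DD" "less Y A" for Y
  using rho_mono[OF _ assms(2) less_le2_trans[OF that(2) assms(3)]] that(1) DC_sb assms unfolding mem_DD rho_def by blast
qed

lemma rho_w2: assumes A: "DC A" shows "rho A:w2"
proof -
 have "A:DD" using A mem_DD by blast
 then show ?thesis
 proof (rule wf_ind[OF wf_DD])
  fix A assume AD: "A:DD" and IH: "!!Y. Y:DD ==> less Y A ==> rho Y:w2"
  have A: "DC A" using AD mem_DD by blast
  have sA: "sb A Rl" using DC_sb[OF A] .
  have lo: "DC Y" if Y: "Y:lo A" for Y using DC_wle[OF less_wle(1) A] Y sA unfolding mem_lo by blast
  obtain F where F: "!!\<xi>. \<xi>:w1 ==> (EX X. X:F$\<xi>) ==> (EX Y. Y:lo A & (ALL X. X:F$\<xi> --> le2 X Y))"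
   "!!X. X:lo A ==> EX \<xi>. \<xi>:w1 & X:F$\<xi>" using HG_D(4)[OF HG_Ls DC_Ls[OF A]] unfolding cof1_def by blast
  let ?B = "%\<xi> \<alpha>. EX Y. Y:lo A & (ALL X. X:F$\<xi> --> le2 X Y) & \<alpha> = rho Y"
  \<comment> \<open>For each \<xi> the least rank of a bound of \<open>F$\<xi>\<close> within
    \<open>lo A\<close>; no bound itself has to be chosen.\<close>
  define f where "f = Lam w1 (%\<xi>. if EX X. X:F$\<xi> then lst (?B \<xi>) else emp)"
  have fx: "f$\<xi> = (if EX X. X:F$\<xi> then lst (?B \<xi>) else emp)" if "\<xi>:w1" for \<xi> unfolding f_def using that by simp
  have fB: "?B \<xi> (f$\<xi>)" if x: "\<xi>:w1" "EX X. X:F$\<xi>" for \<xi>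
  proof -
   obtain Y where Y: "Y:lo A" "ALL X. X:F$\<xi> --> le2 X Y" using F(1)[OF x] by blast
   have d: "dp (%s. ?B \<xi> (s 0))" by simp
   have b: "?B \<xi> (rho Y)" using Y by blast
   show ?thesis using lst(2)[of "?B \<xi>", OF d Ord_rho[OF lo[OF Y(1)]] b] fx[OF x(1)] x(2) by simp
  qed
  have "f$\<xi>:w2" if x: "\<xi>:w1" for \<xi>
  proof (cases "EX X. X:F$\<xi>")
   case True
   obtain Y where Y: "Y:lo A" "f$\<xi> = rho Y" using fB[OF x True] by blast
   then show ?thesis using IH lo mem_lo mem_DD by metis
  next
   case False
   have "img w1 emp" by (rule img_sb) (simp add: sb_def)
   then have "emp:w2" unfolding w2_def mem_hart by simp
   then show ?thesis using fx[OF x] False by simp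
  qed
  then obtain \<beta> where b: "\<beta>:w2" "!!\<xi>. \<xi>:w1 ==> f$\<xi>:\<beta>" using w2_regular[of f] by blast
  have bO: "Ord \<beta>" using Ord_in[OF Ord_w2 b(1)] .
  have "sb (rho A) \<beta>" unfolding rho_def
  proof (rule rk_least[OF wf_DD dp_lessv AD bO])
   fix X assume X: "X:DD" "less X A"
   have XA: "X:lo A" unfolding mem_lo using X DC_sb mem_DD by blast
   obtain \<xi> where x: "\<xi>:w1" "X:F$\<xi>" using F(2)[OF XA] by blast
   obtain Y where Y: "Y:lo A" "le2 X Y" "f$\<xi> = rho Y" using fB[OF x(1)] x(2) by blast
   have "sb (rho X) (f$\<xi>)" unfolding Y(3) using rho_le[OF lo[OF XA] lo[OF Y(1)] Y(2)] .
   then show "rk DD less X:\<beta>" using Ord_sb_mem[OF Ord_rho[OF lo[OF XA]] bO _ b(2)[OF x(1)]] unfolding rho_def by blast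
  qed
  then show "rho A:w2" using Ord_sb_mem[OF Ord_rho[OF A] Ord_w2 _ b(1)] by blast
 qed simp
qed

text \<open>The argument carries a tree \<open>w\<close>. If it is ill-founded, index zero catches
  it, with the arbitrary value zero; if it is well-founded, \<open>lip e w\<close> is a valid code
  and is evaluated with all indices shifted by one.\<close>

lemma amalgam:
 assumes e: "e:Rl" and vl: "!!w. w:WF ==> vld (lip e w)"
 shows "EX A. DC A & (ALL w. w:WF --> wle (DS (lip e w)) A)"
proof -
 define F where "F i x = (if i = emp then fs x else Sec (cl (fs (lip e (fs x))) (Uni i)) (sn x))" for i x
 define V where "V x = cn emp (sn (lip e (fs x)))" for x
 have d: "dt (%u. F (u 0) (u 1))" unfolding F_def by simp
 have cl: "ct (%x. lip e (fs x))" by (rule ct_lip[OF ct_const[OF e] ct_fs[OF ct_id]])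
 have cV: "ct V" using ct_cn[OF ct_sn[OF cl] emp_om] by (simp add: V_def[abs_def])
 have cF: "ct (F i)" if i: "i:om" for i
 proof (cases "i = emp")
  case True then show ?thesis unfolding F_def using ct_fs[OF ct_id] by simp
 next
  case False
  have "ct (%x. Sec (cl (fs (lip e (fs x))) (Uni i)) (sn x))"
   by (rule ct_Sec[OF ct_cl[OF ct_fs[OF cl]] ct_sn[OF ct_id]]) (use i in simp)
  then show ?thesis unfolding F_def using False by simp
 qed
 have Fs: "F (sc i) x = Sec (cl (fs (lip e (fs x))) i) (sn x)" if "i:om" for i x
  unfolding F_def using that by (simp add: Uni_sc nat_Ord)
 define A where "A = Sep Rl (%x. V x$(ff F x) = emp)"
 have dff: "dt (%s. ff F (s 0))" using dt_sub2[OF d] by simp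
 have mA: "x:A <-> x:Rl & V x$(ff F x) = emp" for x
  unfolding A_def using dff ct_dt[OF cV] by simp
 have ex: "EX i. i:om & ~F i x:WF" if x: "x:Rl" for x
 proof (cases "fs x:WF")
  case True
  then obtain i where "i:om" "~Sec (cl (fs (lip e (fs x))) i) (sn x):WF"
   using vl[OF True] sn_Rl[OF x] unfolding vld_def by blast
  then show ?thesis using Fs by (intro exI[of _ "sc i"]) simp
 next
  case False
  then show ?thesis by (intro exI[of _ emp]) (simp add: F_def)
 qed
 have "DC A" by (rule DC_var[of F V, OF cF d cV _ ex]) (auto simp: sb_def mA)
 moreover have "wle (DS (lip e w)) A" if w: "w:WF" for w
 proof (rule wleI[OF ct_pr[OF ct_const[OF WF_Rl[OF w]] ct_id]])
  show "sb (DS (lip e w)) Rl" by (simp add: sb_def mem_DS)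
  fix x assume x: "x:Rl"
  have wR: "w:Rl" using w by simp
  let ?G = "%i x. Sec (cl (fs (lip e w)) i) x"
  have dG: "dt (%u. ?G (u 0) (u 1))" by simp
  have e': "EX i. i:om & ~?G i x:WF" using vl[OF w] x unfolding vld_def by blast
  note i = ff[of ?G, OF dG e']
  let ?p = "pr w x"
  have f: "fs ?p = w" "sn ?p = x" using wR x by simp_all
  have "ff F ?p = sc (ff ?G x)"
  proof (rule ff_eq[of F, OF d sc_om[OF i(1)]])
   show "~F (sc (ff ?G x)) ?p:WF" unfolding Fs[OF i(1)] f using i(2) .
   fix k assume k: "k:sc (ff ?G x)"
   show "F k ?p:WF"
   proof (rule nat_cases[OF nat_in[OF sc_om[OF i(1)] k]])
    assume "k = emp" then show ?thesis unfolding F_def f using w by simp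
   next
    fix r assume r: "r:om" "k = sc r"
    have "r:ff ?G x" using sc_mem_scD[OF i(1)] k r(2) by blast
    then show ?thesis unfolding r(2) Fs[OF r(1)] f using i(3) by simp
   qed
  qed
  then show "x:DS (lip e w) <-> ?p:A" unfolding mA mem_DS using wR x i(1) f by (simp add: V_def)
 qed
 ultimately show ?thesis by blast
qed

text \<open>To obtain a relation decreasing in the ordinal, a code is asked to exceed all values up
  to that ordinal: a countable join bounds them, and \<open>no_max\<close> makes the bound
  strict.\<close>

lemma no_cof: assumes F: "!!\<xi>. \<xi>:w1 ==> EX A. DC A & F$\<xi> = rho A"
 shows "EX A. DC A & (ALL \<xi>. \<xi>:w1 --> F$\<xi>:rho A)"
proof -
 let ?R = "%\<eta> \<sigma>. \<sigma>:Rl & vld \<sigma> & (ALL \<xi>. \<xi>:w1 --> sb \<xi> \<eta> --> F$\<xi>:rho (DS \<sigma>))"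
 have "EX e. e:Rl & (ALL w. w:WF --> ?R (rw w) (lip e w))"
 proof (rule UC)
  fix w assume w: "w:WF"
  have s: "sc (rw w):w1" using sc_w1[OF rw_w1[OF w]] .
  obtain h where h: "!!y. y:sc (rw w) ==> EX x. x:om & h$x = y" using s unfolding w1_def mem_hart img_def by blast
  have "EX z. z:Rl & (ALL n. n:om --> vld (cl z n) & (h$n:w1 --> F$(h$n) = rho (DS (cl z n))))"
  proof (rule CC[of "%n \<sigma>. vld \<sigma> & (h$n:w1 --> F$(h$n) = rho (DS \<sigma>))"])
   fix n assume "n:om"
   have "emp:w1" using om_w1 by simp
   then have "EX A. DC A & (h$n:w1 --> F$(h$n) = rho A)" using F by (cases "h$n:w1") blast+
   then show "EX y. y:Rl & vld y & (h$n:w1 --> F$(h$n) = rho (DS y))" using DC_code by metis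
  qed simp
  then obtain z where z: "z:Rl" "!!n. n:om ==> vld (cl z n)" "!!n. n:om ==> h$n:w1 ==> F$(h$n) = rho (DS (cl z n))" by blast
  let ?J = "Jn (Lam om (%n. DS (cl z n)))"
  have J: "DC ?J" by (rule DC_join[OF z(1,2)])
  obtain B where B: "DC B" "less ?J B" using no_max[OF J] by blast
  obtain \<sigma> where sg: "\<sigma>:Rl" "vld \<sigma>" "B = DS \<sigma>" using DC_code[OF B(1)] by blast
  have "F$\<xi>:rho B" if x: "\<xi>:w1" "sb \<xi> (rw w)" for \<xi>
  proof -
   have "\<xi>:sc (rw w)" using Ord_sb_iff[OF w1_Ord[OF x(1)] Ord_rw[OF w]] x(2) by simp
   then obtain n where n: "n:om" "h$n = \<xi>" using h by blast
   have e: "F$\<xi> = rho (DS (cl z n))" using z(3)[OF n(1)] n(2) x(1) by simp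
   have D: "DC (DS (cl z n))" by (rule DC_DS[OF cl_Rl[OF z(1) n(1)] z(2)[OF n(1)]])
   have "wle (DS (cl z n)) ?J"
    by (rule wleI[OF ct_cn[OF ct_id n(1)] DC_sb[OF D]]) (use n(1) in simp)
   then have "sb (rho (DS (cl z n))) (rho ?J)" using rho_le[OF D J wle_le2] by blast
   then show ?thesis unfolding e
    using Ord_sb_mem[OF Ord_rho[OF D] Ord_rho[OF B(1)] _ rho_mono[OF J B]] by blast
  qed
  then show "EX y. y:Rl & ?R (rw w) y" using sg by blast
 next
  show "?R \<xi> \<sigma>" if "sb \<xi> \<eta>" "?R \<eta> \<sigma>" for \<xi> \<eta> \<sigma> using that sb_trans by blast
 qed simp
 then obtain e where e: "e:Rl" "!!w. w:WF ==> ?R (rw w) (lip e w)" by blast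
 obtain A where A: "DC A" "!!w. w:WF ==> wle (DS (lip e w)) A" using amalgam[OF e(1)] e(2) by blast
 have "F$\<xi>:rho A" if x: "\<xi>:w1" for \<xi>
 proof -
  obtain w where w: "w:WF" "sb \<xi> (rw w)" using WF_unb[OF x] by blast
  have m: "F$\<xi>:rho (DS (lip e w))" using e(2)[OF w(1)] x w(2) by blast
  have "DC (DS (lip e w))" using DC_DS e(2)[OF w(1)] by blast
  then show ?thesis using rho_le[OF _ A(1) wle_le2[OF A(2)[OF w(1)]]] m sbD by blast
 qed
 then show ?thesis using A(1) by blast
qed

definition RR where "RR = Rep DD rho"
lemma mem_RR: "v:RR <-> (EX A. DC A & v = rho A)" by (auto simp: RR_def mem_DD)

theorem RR_w2: "RR = w2"
proof -
 have O: "Ord RR" using Ord_rng[OF wf_DD dp_lessv] by (simp add: RR_def rng_def[OF wf_DD dp_lessv] rho_def[abs_def])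
 have s: "sb RR w2" using rho_w2 by (auto simp: sb_def mem_RR)
 have "~RR:w2"
 proof
  assume "RR:w2"
  then obtain g where g: "!!y. y:RR ==> EX x. x:w1 & g$x = y" unfolding w2_def mem_hart img_def by blast
  have DE: "DC emp"
  proof -
   have c: "ct (%x. zr)" by (rule ct_const[OF zr_Rl])
   have z: "~zr:WF"
   proof -
    have "inn zr zr n" if n: "n:om" for n unfolding inn_def
    proof (intro allI impI)
     fix k assume "k:n"
     then have "kap zr (sc k):om" using nat_in[OF n] by (simp del: kap_sc)
     then show "zr$(kap zr (sc k)) = emp" by (simp add: zr_def del: kap_sc)
    qed
    then show ?thesis unfolding mem_WF using zr_Rl by blast
   qed
   have n: "one:Rl" using one by blast
   have ex0: "EX i. i:om" using emp_om by blast
   have d: "dt (%s. (%i x. zr) (s 0) (s 1))" by simp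
   have f: "ff (%i x. zr) x = emp" for x by (rule ff_eq[of "%i x. zr", OF d]) (use z in auto)
   show ?thesis by (rule DCI[of "%i x. zr" one, OF c d n]) (use z f one ex0 in \<open>auto simp: sb_def\<close>)
  qed
  define F where "F = Lam w1 (%\<xi>. if g$\<xi>:RR then g$\<xi> else rho emp)"
  have Fx: "F$\<xi> = (if g$\<xi>:RR then g$\<xi> else rho emp)" if "\<xi>:w1" for \<xi> unfolding F_def using that by simp
  have "EX A. DC A & F$\<xi> = rho A" if "\<xi>:w1" for \<xi> using Fx[OF that] DE mem_RR by auto
  then obtain A where A: "DC A" "!!\<xi>. \<xi>:w1 ==> F$\<xi>:rho A" using no_cof[of F] by blast
  have "rho A:RR" using A(1) mem_RR by blast
  then obtain \<xi> where x: "\<xi>:w1" "g$\<xi> = rho A" using g by blast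
  then have "F$\<xi> = rho A" using Fx \<open>rho A:RR\<close> by simp
  then show False using A(2)[OF x(1)] by simp
 qed
 then show ?thesis using Ord_sb_iff[OF O Ord_w2] s by blast
qed

section \<open>The difference class in terms of the structure\<close>

lemma res_eq: assumes "x:Rl" "y:Rl" "n:om" shows "restriction (:) y n = restriction (:) x n <-> eqn n x y"
proof -
 have r: "restriction (:) z n = Lam n (ap z)" if "z:Rl" for z
  using D_restriction[of z om om n] that nat_sb_om[OF assms(3)] Rl_fn by blast
 show ?thesis unfolding r[OF assms(1)] r[OF assms(2)]
 proof
  assume e: "Lam n (ap y) = Lam n (ap x)"
  have "Lam n (ap y)$k = y$k" "Lam n (ap x)$k = x$k" if "k:n" for k using that by simp_all
  then show "eqn n x y" unfolding eqn_def using e by metis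
 next
  assume "eqn n x y"
  then show "Lam n (ap y) = Lam n (ap x)" unfolding eqn_def by (intro Lam_cong) simp
 qed
qed

lemma D_open: "open_set (:) U <-> sb U Rl & (ALL x. x:U --> (EX n. n:om & (ALL y. y:Rl --> eqn n x y --> y:U)))"
 unfolding open_set_def D_subset D_baire D_omega using res_eq sbD by metis

lemma D_preimage: assumes "fn f Rl Rl" shows "preimage (:) f (baire (:)) U = Sep Rl (%x. f$x:U)"
 unfolding preimage_def D_baire by (rule coll_eqI) (use D_app[OF assms] in auto)

lemma D_cont: "continuous (:) f <-> Ct f"
proof
 assume c: "continuous (:) f"
 then have fn: "fn f Rl Rl" unfolding continuous_def D_fn D_baire by blast
 have "ctn (ap f)" unfolding ctn_def
 proof (intro conjI allI impI)
  show "f$x:Rl" if "x:Rl" for x using fn_ap(2)[OF fn that] .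
  fix x k assume x: "x:Rl" and k: "k:om"
  define U where "U = Sep Rl (%y. y$k = f$x$k)"
  have "open_set (:) U" unfolding D_open
  proof (intro conjI allI impI)
   show "sb U Rl" by (simp add: U_def)
   show "EX n. n:om & (ALL z. z:Rl --> eqn n y z --> z:U)" if "y:U" for y
    using that k by (intro exI[of _ "sc k"]) (simp add: U_def eqn_sc)
  qed
  then have "open_set (:) (Sep Rl (%x. f$x:U))" using c D_preimage[OF fn] unfolding continuous_def by metis
  moreover have "x:Sep Rl (%x. f$x:U)" using x fn_ap(2)[OF fn x] by (simp add: U_def)
  ultimately obtain n where "n:om" "!!y. y:Rl ==> eqn n x y ==> y:Sep Rl (%x. f$x:U)" unfolding D_open by blast
  then show "EX m. m:om & (ALL y. y:Rl --> eqn m x y --> f$x$k = f$y$k)" by (intro exI[of _ n]) (simp add: U_def)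
 qed
 then show "Ct f" unfolding Ct_def using fn by blast
next
 assume f: "Ct f"
 then have fn: "fn f Rl Rl" unfolding Ct_def by blast
 note cf = Ct_ct[OF f]
 have "open_set (:) (Sep Rl (%x. f$x:U))" if U: "open_set (:) U" for U
  unfolding D_open
 proof (intro conjI allI impI)
  show "sb (Sep Rl (%x. f$x:U)) Rl" by simp
  fix x assume "x:Sep Rl (%x. f$x:U)"
  then have x: "x:Rl" "f$x:U" by simp_all
  obtain n where n: "n:om" "!!y. y:Rl ==> eqn n (f$x) y ==> y:U" using U x(2) unfolding D_open by blast
  obtain m where m: "m:om" "!!y. y:Rl ==> eqn m x y ==> eqn n (f$x) (f$y)" using ct_eqn[OF cf x(1) n(1)] by blast
  then show "EX n. n:om & (ALL y. y:Rl --> eqn n x y --> y:Sep Rl (%x. f$x:U))"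
   using n(2) ct_Rl[OF cf] by (intro exI[of _ m]) simp
 qed
 then show "continuous (:) f" unfolding continuous_def D_preimage[OF fn] unfolding D_fn D_baire using fn by blast
qed

lemma D_wadge: "wadge_le (:) A B <-> wle A B"
 unfolding wadge_le_def wle_def D_cont using D_preimage unfolding Ct_def by metis

lemma D_complement: "complement (:) A = cmp A"
 unfolding complement_def D_setminus D_baire cmp_def ..

section \<open>Coanalytic sets and well-founded sections\<close>

definition pi11 where "pi11 A <-> sb A Rl & (EX t. t:Rl & (ALL x. x:Rl --> (x:A <-> Sec t x:WF)))"

lemma pi11I: assumes F: "ct F" and A: "sb A Rl" "!!x. x:Rl ==> x:A <-> F x:WF" shows "pi11 A"
 using Sec_code[OF F] A unfolding pi11_def by metis

lemma D_analytic: "analytic (:) A <-> A = emp | (EX f. Ct f & (ALL y. y:A <-> (EX x. x:Rl & f$x = y)))"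
proof -
 have "app (:) f x = f$x" if "Ct f" "x:Rl" for f x using D_app[of f Rl Rl x] that unfolding Ct_def by blast
 then show ?thesis unfolding analytic_def D_empty D_cont D_baire by metis
qed

text \<open>Forwards, the sections of a tree of attempts search for a preimage of \<open>x\<close>
  under the parametrization of the complement. Backwards, the branches of the tree form a closed
  set, and the retraction onto it makes the projection a total continuous map.\<close>

lemma D_coanalytic: "coanalytic (:) A <-> pi11 A"
proof
 assume "coanalytic (:) A"
 then have s: "sb A Rl" and a: "analytic (:) (cmp A)" unfolding coanalytic_def D_subset D_baire D_complement by auto
 from a show "pi11 A" unfolding D_analytic
 proof
  assume e: "cmp A = emp"
  show ?thesis
  proof (rule pi11I[OF ct_const[OF WT(2)] s])
   fix x assume "x:Rl"
   then have "x:A" using e mem_cmp[of x A] by simp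
   then show "x:A <-> WT:WF" using WT(1) by simp
  qed
 next
  assume "EX f. Ct f & (ALL y. y:cmp A <-> (EX x. x:Rl & f$x = y))"
  then obtain f where f: "Ct f" "!!y. y:cmp A <-> (EX x. x:Rl & f$x = y)" by blast
  note cf = Ct_ct[OF f(1)]
  define Q where "Q w n <-> (EX x. x:Rl & eqn n (pr (f$x) x) w)" for w n
  have dQ: "dp (%s. Q (s 0) (s 1))" unfolding Q_def by simp
  have c: "Q b' n" if "eqn n b b'" "Q b n" for b b' n using that eqn_trans unfolding Q_def by blast
  have m: "Q b n" if "Q b (sc n)" for b n using that unfolding Q_def eqn_sc by blast
  have 0: "Q b emp" for b unfolding Q_def using zr_Rl by (intro exI[of _ zr]) simp
  have WR: "mkt Q:Rl" by (rule mkt(1)[OF dQ], rule c, assumption+, rule m, assumption, rule 0)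
  have WQ: "inn (mkt Q) b n <-> Q b n" if "b:Rl" "n:om" for b n
   by (rule mkt(2)[OF dQ _ _ _ that], rule c, assumption+, rule m, assumption, rule 0)
  have "x:cmp A <-> ~Sec (mkt Q) x:WF" if x: "x:Rl" for x
  proof
   assume "x:cmp A"
   then obtain b where b: "b:Rl" "f$b = x" using f(2) by blast
   have "inn (Sec (mkt Q) x) b n" if n: "n:om" for n
    unfolding Sec(2)[OF x b(1) n] WQ[OF pr_Rl[OF x b(1)] n] Q_def using b eqn_refl by metis
   then show "~Sec (mkt Q) x:WF" unfolding mem_WF using b(1) by blast
  next
   assume "~Sec (mkt Q) x:WF"
   then obtain b where b: "b:Rl" "!!n. n:om ==> inn (Sec (mkt Q) x) b n" unfolding mem_WF using Sec(1)[OF x] by blast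
   have q: "EX z. z:Rl & eqn n (f$z) x & eqn n z b" if n: "n:om" for n
   proof -
    have "Q (pr x b) n" using b(2)[OF n] unfolding Sec(2)[OF x b(1) n] WQ[OF pr_Rl[OF x b(1)] n] .
    then obtain z where "z:Rl" "eqn n (pr (f$z) z) (pr x b)" unfolding Q_def by blast
    then show ?thesis using eqn_pr[OF n ct_Rl[OF cf] _ x b(1)] by blast
   qed
   have "f$b = x"
   proof (rule Rl_ext[OF ct_Rl[OF cf b(1)] x])
    fix k assume k: "k:om"
    obtain m where m: "m:om" "!!y. y:Rl ==> eqn m b y ==> f$b$k = f$y$k" using ctD[OF cf b(1) k] by blast
    obtain l where l: "l:om" "sb m l" "sb (sc k) l" by (rule nat_max[OF m(1) sc_om[OF k]])
    obtain z where z: "z:Rl" "eqn l (f$z) x" "eqn l z b" using q[OF l(1)] by blast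
    have "f$b$k = f$z$k" by (rule m(2)[OF z(1) eqn_sym[OF eqn_mono[OF z(3) l(2)]]])
    also have "\<dots> = x$k" using eqn_in[OF eqn_mono[OF z(2) l(3)], of k] by simp
    finally show "f$b$k = x$k" .
   qed
   then show "x:cmp A" using f(2) b(1) by blast
  qed
  then show ?thesis unfolding pi11_def using s WR by (intro conjI exI[of _ "mkt Q"]) auto
 qed
next
 assume "pi11 A"
 then obtain t where s: "sb A Rl" and t: "t:Rl" "!!x. x:Rl ==> x:A <-> Sec t x:WF" unfolding pi11_def by blast
 define E where "E = Sep Rl (%w. ALL n. n:om --> inn t w n)"
 have mE: "w:E <-> w:Rl & (ALL n. n:om --> inn t w n)" for w by (simp add: E_def)
 have ER: "sb E Rl" by (simp add: sb_def mE)
 have cA: "y:cmp A <-> y:Rl & (EX b. b:Rl & pr y b:E)" for y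
 proof (cases "y:Rl")
  case True
  show ?thesis using True t(2)[OF True] Sec[OF True] unfolding mem_cmp mem_WF mE by auto
 qed simp
 have "analytic (:) (cmp A)" unfolding D_analytic
 proof (cases "E = emp")
  case True
  then have "cmp A = emp" using cA unfolding emp_iff by blast
  then show "cmp A = emp | (EX f. Ct f & (ALL y. y:cmp A <-> (EX x. x:Rl & f$x = y)))" ..
 next
  case False
  have rE: "rt E w:E" if w: "w:Rl" for w
   unfolding mE
  proof (intro conjI allI impI rt_Rl[OF ER False w])
   fix n assume n: "n:om"
   obtain x where x: "x:E" "eqn n (rt E w) x" using rt_near[OF ER False w n] by blast
   then show "inn t (rt E w) n" using inn_cong[OF n x(2)] n mE by blast
  qed
  have ri: "rt E w = w" if "w:E" for w
   by (rule rt_id[OF ER False]) (use that mE in \<open>auto intro: exI[of _ w]\<close>)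
  have c: "ct (%w. fs (rt E w))" by (rule ct_fs[OF ct_rt[OF ER False ct_id]])
  let ?f = "Lam Rl (%w. fs (rt E w))"
  have fa: "?f$w = fs (rt E w)" if "w:Rl" for w using that by simp
  have "y:cmp A <-> (EX x. x:Rl & ?f$x = y)" for y
  proof
   assume "y:cmp A"
   then obtain b where b: "y:Rl" "b:Rl" "pr y b:E" using cA by blast
   have "?f$(pr y b) = y" using fa[OF pr_Rl[OF b(1,2)]] ri[OF b(3)] fs_pr[OF b(1,2)] by simp
   then show "EX x. x:Rl & ?f$x = y" using pr_Rl[OF b(1,2)] by blast
  next
   assume "EX x. x:Rl & ?f$x = y"
   then obtain x where x: "x:Rl" "y = fs (rt E x)" using fa by metis
   have r: "rt E x:Rl" using rt_Rl[OF ER False x(1)] .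
   have "pr y (sn (rt E x)):E" using rE[OF x(1)] pr_fs_sn[OF r] x(2) by simp
   then show "y:cmp A" unfolding cA using x(2) fs_Rl[OF r] sn_Rl[OF r] by blast
  qed
  then show "cmp A = emp | (EX f. Ct f & (ALL y. y:cmp A <-> (EX x. x:Rl & f$x = y)))" using ct_Ct[OF c] by blast
 qed
 then show "coanalytic (:) A" unfolding coanalytic_def D_subset D_baire D_complement using s by blast
qed

text \<open>The sum of the trees \<open>cl z j\<close> for \<open>j:i\<close>. The first entry of a
  node is a pair that selects \<open>j\<close> and also supplies the first entry in that tree, so
  lengths are preserved; \<open>n = emp\<close> keeps the root.\<close>

definition Sm where "Sm i z = mkt (%b n. n = emp | q1 (b$emp):i & inn (cl z (q1 (b$emp))) (sn b) n)"
lemma dt_Sm [simp]: "dt a ==> dt b ==> dt (%s. Sm (a s) (b s))"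
 by (rule dt_lift2) (simp_all add: Sm_def mkt_def)

lemma Sm: "Sm i z:Rl" "b:Rl ==> n:om ==> inn (Sm i z) b n <-> n = emp | q1 (b$emp):i & inn (cl z (q1 (b$emp))) (sn b) n"
proof -
 let ?Q = "%b n. n = emp | q1 (b$emp):i & inn (cl z (q1 (b$emp))) (sn b) n"
 have d: "dp (%s. ?Q (s 0) (s 1))" by simp
 have c: "?Q b' n" if "b:Rl" "b':Rl" and n: "n:om" and e: "eqn n b b'" and q: "?Q b n" for b b' n
 proof (cases "n = emp")
  case False
  have "b$emp = b'$emp" using eqn_in[OF e emp_mem_nat[OF n False]] .
  then show ?thesis using q False inn_cong[OF n eqn_sn[OF n e]] by metis
 qed simp
 show "Sm i z:Rl" unfolding Sm_def by (rule mkt(1)[OF d], rule c, assumption+) (auto simp: inn_sc)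
 show "b:Rl ==> n:om ==> inn (Sm i z) b n <-> ?Q b n"
  unfolding Sm_def by (rule mkt(2)[OF d], rule c, assumption+) (auto simp: inn_sc)
qed

lemma ct_Sm: assumes F: "ct F" shows "ct (%x. Sm i (F x))"
proof (rule ct2[OF F F, of "%x y. Sm i x"])
 fix x y k assume x: "x:Rl" and k: "k:om"
 let ?j = "q1 (ex k$emp)"
 have e: "ex k:Rl" "ln k:om" "?j:om" using k ex by simp_all
 obtain m where m: "m:om" "!!w w'. eqn m w w' ==> inn w (sn (ex k)) (ln k) = inn w' (sn (ex k)) (ln k)"
  using inn_ct[of "sn (ex k)" "ln k"] e by auto
 obtain l where l: "l:om" "!!z. z:Rl ==> eqn l x z ==> eqn m (cl x ?j) (cl z ?j)" using ct_eqn[OF ct_cl[OF ct_id e(3)] x m(1)] by blast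
 have "Sm i x$k = Sm i x'$k" if "x':Rl" "eqn l x x'" for x'
  using m(2)[OF l(2)[OF that]] k by (simp add: Sm_def mkt_def)
 then show "EX m. m:om & (ALL x' y'. x':Rl --> y':Rl --> eqn m x x' --> eqn m y y' --> Sm i x$k = Sm i x'$k)" using l(1) by blast
qed (auto simp: Sm(1))

lemma Sm_WF: assumes z: "z:Rl" and i: "i:om" shows "Sm i z:WF <-> (ALL j. j:i --> cl z j:WF)"
proof
 assume W: "Sm i z:WF"
 show "ALL j. j:i --> cl z j:WF"
 proof (intro allI impI, rule ccontr)
  fix j assume j: "j:i" and nw: "~cl z j:WF"
  have jo: "j:om" using nat_in[OF i j] .
  obtain b where b: "b:Rl" "!!n. n:om ==> inn (cl z j) b n" using nw z jo unfolding mem_WF by auto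
  let ?b = "pr (cn j zr) b"
  have bR: "?b:Rl" using jo b(1) by simp
  have "inn (Sm i z) ?b n" if n: "n:om" for n unfolding Sm(2)[OF bR n] using j jo b n by simp
  then show False using W bR unfolding mem_WF by blast
 qed
next
 assume j: "ALL j. j:i --> cl z j:WF"
 show "Sm i z:WF" unfolding mem_WF
 proof (intro conjI allI impI Sm(1), rule ccontr)
  fix b assume b: "b:Rl" and "~(EX n. n:om & ~inn (Sm i z) b n)"
  then have s: "n = emp | q1 (b$emp):i & inn (cl z (q1 (b$emp))) (sn b) n" if "n:om" for n using Sm(2)[OF b that] that by blast
  have q: "q1 (b$emp):i" using s[of "sc emp"] by simp
  have "inn (cl z (q1 (b$emp))) (sn b) n" if "n:om" for n using s[OF that] inn_0 by metis
  then show False using j q sn_Rl[OF b] unfolding mem_WF by blast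
 qed
qed

definition dec where "dec B <-> (ALL n. n:om --> sb (B$(sc n)) (B$n))"
definition dst where "dst B = Sep Rl (%x. EX m. m:om & x:B$(dbl m) & ~x:B$(sc (dbl m)))"
lemma mem_dst: "x:dst B <-> x:Rl & (EX m. m:om & x:B$(dbl m) & ~x:B$(sc (dbl m)))" by (simp add: dst_def)

lemma D_Dstar: "Dstar_omega (:) (coanalytic (:)) A <->
 (EX B. fn B om (Pw Rl) & dec B & (ALL n. n:om --> pi11 (B$n)) & A = dst B)"
proof -
 have pb: "powerset_baire (:) = Pw Rl" unfolding powerset_baire_def D_subset D_baire by (rule coll_eqI) simp
 have ap: "app (:) B n = B$n" if "fn B om (Pw Rl)" "n:om" for B n using D_app[OF that] .
 have dsq: "decreasing_sequence (:) B <-> fn B om (Pw Rl) & dec B" for B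
  unfolding decreasing_sequence_def pb D_fn D_omega D_subset D_successor dec_def using ap sc_om by metis
 have ds: "Dstar (:) B = dst B" if B: "fn B om (Pw Rl)" for B
  unfolding Dstar_def D_even D_setminus D_successor
 proof (rule coll_eqI)
  fix x
  have s: "sb (B$n) Rl" if "n:om" for n using fn_ap(2)[OF B that] by simp
  have e: "app (:) B (dbl m) = B$(dbl m)" "app (:) B (sc (dbl m)) = B$(sc (dbl m))" if "m:om" for m using ap[OF B] that by simp_all
  show "x:dst B <-> (EX n. (EX m. m:om & n = dbl m) & x:Sep (app (:) B n) (%x. ~x:app (:) B (sc n)))"
  proof
   assume "x:dst B"
   then obtain m where "m:om" "x:B$(dbl m)" "~x:B$(sc (dbl m))" unfolding mem_dst by blast
   then show "EX n. (EX m. m:om & n = dbl m) & x:Sep (app (:) B n) (%x. ~x:app (:) B (sc n))"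
    using e by (intro exI[of _ "dbl m"]) auto
  next
   assume "EX n. (EX m. m:om & n = dbl m) & x:Sep (app (:) B n) (%x. ~x:app (:) B (sc n))"
   then obtain m where m: "m:om" "x:B$(dbl m)" "~x:B$(sc (dbl m))" using e by auto
   then show "x:dst B" unfolding mem_dst using s[of "dbl m"] sbD by auto
  qed
 qed
 show ?thesis unfolding Dstar_omega_def dsq D_omega D_coanalytic using ap ds by metis
qed

lemma dec_mono: assumes B: "dec B" and n: "n:om" and m: "m:om" shows "sb n m --> sb (B$m) (B$n)"
proof (rule nat_ind[OF m])
 show "sb n emp --> sb (B$emp) (B$n)" using sb_antisym[of n emp] by (auto simp: sb_def)
 fix m assume m: "m:om" and IH: "sb n m --> sb (B$m) (B$n)"
 have "n = sc m | sb n m" if "sb n (sc m)"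
  using that Ord_sb_iff[OF nat_Ord[OF n] nat_Ord[OF sc_om[OF m]]] Ord_sb[OF nat_Ord[OF m]] by auto
 then show "sb n (sc m) --> sb (B$(sc m)) (B$n)" using IH B m sb_trans sb_refl unfolding dec_def by metis
qed simp

lemma dst_exit: assumes B: "dec B" and n: "n:om" and x: "x:Rl" "~x:B$n" "!!k. k:n ==> x:B$k"
 shows "x:dst B <-> (EX m. m:om & n = sc (dbl m))"
proof
 assume "x:dst B"
 then obtain m where m: "m:om" "x:B$(dbl m)" "~x:B$(sc (dbl m))" unfolding mem_dst by blast
 have d: "dbl m:om" using m by simp
 have "~sb n (dbl m)" using dec_mono[OF B n d] m(2) x(2) sbD by blast
 then have "dbl m:n" using Ord_not_mem[OF nat_Ord[OF d] nat_Ord[OF n]] by blast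
 moreover have "~sc (dbl m):n" using x(3) m(3) by blast
 moreover have "sb (sc (dbl m)) n" by (rule nat_sbI[OF n]) (use calculation(1) in simp)
 ultimately have "n = sc (dbl m)" using Ord_sb_iff[OF nat_Ord[OF sc_om[OF d]] nat_Ord[OF n]] by auto
 then show "EX m. m:om & n = sc (dbl m)" using m(1) by blast
next
 assume "EX m. m:om & n = sc (dbl m)"
 then obtain m where m: "m:om" "n = sc (dbl m)" by blast
 then show "x:dst B" unfolding mem_dst using x(1,2) x(3)[of "dbl m"] by auto
qed

lemma DC_Dstar: assumes "DC A" shows "Dstar_omega (:) (coanalytic (:)) A"
proof -
 obtain f v where A: "sb A Rl" and f: "Ct f" and v: "v:Rl" and ex: "!!x. x:Rl ==> EX i. i:om & ~cl (f$x) i:WF"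
  and AF: "!!x. x:Rl ==> x:A <-> v$(ff (%i x. cl (f$x) i) x) = emp" using assms unfolding DC_def by blast
 note cf = Ct_ct[OF f]
 define E where "E i = Sep Rl (%x. Sm i (f$x):WF)" for i
 have mE: "x:E i <-> x:Rl & (ALL j. j:i --> cl (f$x) j:WF)" if "i:om" for x i
  unfolding E_def using Sm_WF[OF ct_Rl[OF cf] that] by auto
 have pE: "pi11 (E i)" for i by (rule pi11I[OF ct_Sm[OF cf]]) (auto simp: E_def sb_def)
 have dE: "dt (%s. E (a s))" if "dt a" for a unfolding E_def using dt_pushes[OF that] by simp
 \<comment> \<open>\<open>E m\<close> consists of the points whose first ill-founded index is at
   least \<open>m\<close>. The next set drops index \<open>m\<close> only if its value is zero, so
   the difference is either all points of index \<open>m\<close> or empty.\<close>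
 define G where "G n = (if n = dbl (hf n) then E (hf n) else if v$(hf n) = emp then E (sc (hf n)) else E (hf n))" for n
 have dG: "dt (%s. G (s 0))" unfolding G_def using dE by simp
 define B where "B = Lam om G"
 have Bn: "B$n = G n" if "n:om" for n unfolding B_def by (rule ap_Lam[OF that dG])
 have pG: "pi11 (G n)" for n unfolding G_def using pE by simp
 have B0: "B$(dbl m) = E m" "B$(sc (dbl m)) = (if v$m = emp then E (sc m) else E m)" if "m:om" for m
  using that by (simp_all add: Bn G_def)
 have Es: "sb (E (sc i)) (E i)" if "i:om" for i using mE[OF that] mE[OF sc_om[OF that]] by (auto simp: sb_def)
 have fB: "fn B om (Pw Rl)" unfolding B_def by (rule fn_Lam[OF dG]) (use pG in \<open>simp add: pi11_def\<close>)
 have "dec B" unfolding dec_def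
 proof (intro allI impI)
  fix n assume n: "n:om"
  show "sb (B$(sc n)) (B$n)"
  proof (cases "EX m. m:om & n = dbl m")
   case True then show ?thesis using B0 Es by auto
  next
   case False
   then obtain m where m: "m:om" "n = sc (dbl m)" using parity[OF n] by blast
   have "B$(sc n) = E (sc m)" using B0(1)[OF sc_om[OF m(1)]] m by simp
   then show ?thesis using B0(2)[OF m(1)] m(2) Es[OF m(1)] by simp
  qed
 qed
 moreover have "pi11 (B$n)" if "n:om" for n using Bn[OF that] pG by simp
 moreover have "A = dst B"
 proof (rule ext)
  fix x
  show "x:A <-> x:dst B"
  proof (cases "x:Rl")
   case True
   have d: "dt (%s. cl (f$(s 1)) (s 0))" by simp
   let ?i = "ff (%i x. cl (f$x) i) x"
   note i = ff[of "%i x. cl (f$x) i", OF d ex[OF True]]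
   have e: "x:E j <-> sb j ?i" if j: "j:om" for j
   proof
    assume "x:E j"
    then have "~?i:j" using mE[OF j] i(2) by blast
    then show "sb j ?i" using Ord_not_mem[OF nat_Ord[OF i(1)] nat_Ord[OF j]] by blast
   next
    assume "sb j ?i" then show "x:E j" unfolding mE[OF j] using True i(3) sbD by blast
   qed
   have q: "(x:B$(dbl m) & ~x:B$(sc (dbl m))) <-> m = ?i & v$m = emp" if m: "m:om" for m
   proof -
    have "sb m ?i & ~sb (sc m) ?i <-> m = ?i"
    proof (cases "m = ?i")
     case True
     have "~sb (sc m) m" using sbD[of "sc m" m m] by auto
     then show ?thesis using True sb_refl[of m] by simp
    next
     case False
     then show ?thesis using Ord_sb_iff[OF nat_Ord[OF m] nat_Ord[OF i(1)]] nat_sbI[OF i(1), of m] by blast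
    qed
    then show ?thesis unfolding B0[OF m] using e[OF m] e[OF sc_om[OF m]] by auto
   qed
   have "(EX m. m:om & x:B$(dbl m) & ~x:B$(sc (dbl m))) <-> (EX m. m:om & m = ?i & v$m = emp)"
    using q by blast
   also have "\<dots> <-> v$?i = emp" using i(1) by blast
   finally show ?thesis unfolding mem_dst AF[OF True] using True by blast
  next
   case False then show ?thesis using A sbD mem_dst by blast
  qed
 qed
 ultimately show ?thesis unfolding D_Dstar using fB by blast
qed

text \<open>The two decreasing sequences are interleaved. A point of \<open>A\<close> leaves
  \<open>B\<close> and a point outside \<open>A\<close> leaves \<open>C\<close>, so the first exit
  always exists, and its parity decides membership.\<close>

lemma Delta_DC: "Delta (:) (Dstar_omega (:) (coanalytic (:))) A <-> DC A"
proof
 assume A: "DC A"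
 show "Delta (:) (Dstar_omega (:) (coanalytic (:))) A"
  unfolding Delta_def neg_class_def D_complement
  using DC_Dstar[OF A] DC_Dstar[OF DC_cmp[OF A]] cmp_cmp[OF DC_sb[OF A]] by metis
next
 assume "Delta (:) (Dstar_omega (:) (coanalytic (:))) A"
 then obtain B C where B: "dec B" "!!n. n:om ==> pi11 (B$n)" "A = dst B"
  and C: "dec C" "!!n. n:om ==> pi11 (C$n)" "A = cmp (dst C)"
  unfolding Delta_def neg_class_def D_complement D_Dstar by blast
 have code: "EX t. t:Rl & (ALL n. n:om --> (ALL x. x:Rl --> (x:B$n <-> Sec (cl t n) x:WF)))"
  if "!!n. n:om ==> pi11 (B$n)" for B
  by (rule CC[of "%n t. ALL x. x:Rl --> (x:B$n <-> Sec t x:WF)"]) (use that in \<open>auto simp: pi11_def\<close>)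
 obtain tB where tB: "tB:Rl" "!!n x. n:om ==> x:Rl ==> x:B$n <-> Sec (cl tB n) x:WF" using code[of B] B(2) by blast
 obtain tC where tC: "tC:Rl" "!!n x. n:om ==> x:Rl ==> x:C$n <-> Sec (cl tC n) x:WF" using code[of C] C(2) by blast
 let ?od = "%n. EX m. m:om & n = sc (dbl m)"
 define F where "F p x = (if p = dbl (hf p) then Sec (cl tB (hf p)) x else Sec (cl tC (hf p)) x)" for p x
 \<comment> \<open>Leaving \<open>B\<close> at an odd place means membership in \<open>A\<close>,
   leaving \<open>C\<close> at an odd place means membership in the complement of
   \<open>A\<close>.\<close>
 define v where "v = Lam om (%p. if (p = dbl (hf p)) = ?od (hf p) then emp else sc emp)"
 have v: "v:Rl" unfolding v_def by (rule RlI) auto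
 have d: "dt (%u. F (u 0) (u 1))" unfolding F_def by simp
 have F0: "F (dbl n) x = Sec (cl tB n) x" "F (sc (dbl n)) x = Sec (cl tC n) x" if "n:om" for n x
  using that by (simp_all add: F_def)
 show "DC A"
 proof (rule DCI[of F, OF _ d v])
  fix p assume p: "p:om"
  have "ct (%x. Sec (cl t (hf p)) x)" if "t:Rl" for t
   by (rule ct_Sec[OF ct_const ct_id]) (use that p in simp)
  then show "ct (F p)" unfolding F_def using tB(1) tC(1) by (cases "p = dbl (hf p)") simp_all
 next
  show "sb A Rl" unfolding B(3) by (simp add: sb_def mem_dst)
  fix x assume x: "x:Rl"
  show e: "EX i. i:om & ~F i x:WF"
  proof (cases "x:A")
   case True
   then obtain m where m: "m:om" "~x:B$(sc (dbl m))" unfolding B(3) mem_dst by blast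
   then show ?thesis using F0(1)[of "sc (dbl m)" x] tB(2)[of "sc (dbl m)" x] x by (intro exI[of _ "dbl (sc (dbl m))"]) simp
  next
   case False
   then have "x:dst C" using C(3) x mem_cmp by blast
   then obtain m where m: "m:om" "~x:C$(sc (dbl m))" unfolding mem_dst by blast
   then show ?thesis using F0(2)[of "sc (dbl m)" x] tC(2)[of "sc (dbl m)" x] x by (intro exI[of _ "sc (dbl (sc (dbl m)))"]) simp
  qed
  define p where "p = ff F x"
  note p = ff[of F, OF d e, folded p_def]
  define n where "n = hf p"
  have n: "n:om" "p = dbl n | p = sc (dbl n)" using p(1) parity[OF p(1)] by (auto simp: n_def)
  have lt: "dbl k:p & sc (dbl k):p" if k: "k:n" for k
  proof -
   have ko: "k:om" using nat_in[OF n(1) k] .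
   have s: "sc (dbl k):dbl n" by (rule dbl_mono[OF ko n(1) k])
   have "dbl k:dbl n" using nat_trans[OF _ s] n(1) by simp
   then show ?thesis using s n(2) by auto
  qed
  have below: "x:B$k & x:C$k" if k: "k:n" for k
  proof -
   have ko: "k:om" using nat_in[OF n(1) k] .
   show ?thesis using p(3)[OF conjunct1[OF lt[OF k]]] p(3)[OF conjunct2[OF lt[OF k]]] F0[OF ko] tB(2)[OF ko x] tC(2)[OF ko x] by simp
  qed
  have vp: "v$p = emp <-> (p = dbl n) = ?od n" using p(1) by (simp add: v_def n_def)
  show "x:A <-> v$(ff F x) = emp"
  proof (cases "p = dbl n")
   case True
   have "~x:B$n" using p(2) F0(1)[OF n(1)] tB(2)[OF n(1) x] True by simp
   then have "x:A <-> ?od n" unfolding B(3) using dst_exit[OF B(1) n(1) x] below by blast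
   then show ?thesis using vp True p_def by simp
  next
   case False
   then have pn: "p = sc (dbl n)" using n(2) by blast
   have "~x:C$n" using p(2) F0(2)[OF n(1)] tC(2)[OF n(1) x] pn by simp
   then have "x:dst C <-> ?od n" using dst_exit[OF C(1) n(1) x] below by blast
   then have "x:A <-> ~?od n" unfolding C(3) using x by simp
   then show ?thesis using vp False p_def by simp
  qed
 qed
qed

section \<open>Degrees and the order type\<close>

definition wdg where "wdg A = Sep (Pw Rl) (%C. le2 C A & le2 A C)"
lemma dt_wdg [simp]: "dt a ==> dt (%s. wdg (a s))" by (rule dt_lift1) (simp_all add: wdg_def)
lemma mem_wdg: "C:wdg A <-> sb C Rl & le2 C A & le2 A C" by (simp add: wdg_def)

lemma D_degree: assumes A: "sb A Rl" shows "wadge_degree (:) A = wdg A"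
 unfolding wadge_degree_def wadge_equiv_def D_wadge D_complement D_subset D_baire
proof (rule coll_eqI)
 fix C
 have "le2 C A & le2 A C <-> wle C A & wle A C | wle C (cmp A) & wle (cmp A) C" if C: "sb C Rl"
 proof -
  have 1: "wle A (cmp C) <-> wle (cmp A) C" using wle_cmp1[OF A _ C] wle_cmp2[OF A] by blast
  have 2: "wle C (cmp C) <-> wle (cmp C) C" using wle_cmp1[OF C _ C] wle_cmp2[OF C] by blast
  have 3: "wle A C ==> wle (cmp A) (cmp C)" using wle_cmp by blast
  show ?thesis unfolding le2_def using 1 2 3 wle_trans by blast
 qed
 then show "C:wdg A <-> sb C Rl & (wle C A & wle A C | wle C (cmp A) & wle (cmp A) C)"
  unfolding mem_wdg by blast
qed

lemma D_degrees: "wadge_degrees (:) (Delta (:) (Dstar_omega (:) (coanalytic (:)))) = Rep DD wdg"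
 unfolding wadge_degrees_def Delta_DC D_subset D_baire
proof (rule coll_eqI)
 fix d
 have t: "dt (%s. wdg (s 0))" by simp
 have "DC A & d = wdg A <-> sb A Rl & DC A & d = wadge_degree (:) A" for A
  using DC_sb[of A] D_degree[of A] by (cases "DC A") simp_all
 then show "d:Rep DD wdg <-> (EX A. sb A Rl & DC A & d = wadge_degree (:) A)"
  unfolding mem_Rep[OF t] mem_DD by presburger
qed

lemma D_degree_le: assumes A: "sb A Rl" and B: "sb B Rl" shows "wadge_degree_le (:) (wdg A) (wdg B) <-> le2 A B"
 unfolding wadge_degree_le_def D_wadge
proof
 assume "EX C E. C:wdg A & E:wdg B & wle C E"
 then obtain C E where "sb C Rl" "le2 A C" "sb E Rl" "le2 E B" "wle C E" unfolding mem_wdg by blast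
 then show "le2 A B" using le2_trans[OF _ wle_le2] le2_trans B by metis
next
 have "A:wdg A" "B:wdg B" "cmp B:wdg B" unfolding mem_wdg le2_def using A B by simp_all
 moreover assume "le2 A B"
 ultimately show "EX C E. C:wdg A & E:wdg B & wle C E" unfolding le2_def by blast
qed

lemma le2_rho: assumes A: "DC A" and B: "DC B" shows "le2 A B <-> rho A:rho B | rho A = rho B"
proof
 assume "le2 A B"
 then show "rho A:rho B | rho A = rho B" using rho_le[OF A B] Ord_sb_iff[OF Ord_rho[OF A] Ord_rho[OF B]] by blast
next
 have "rho B:rho A" if "~le2 A B" using rho_mono[OF B A] that unfolding less_def by blast
 then show "rho A:rho B | rho A = rho B ==> le2 A B" using mem_irrefl mem_asym by metis
qed

theorem order_type: "has_order_type (:)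
  (wadge_degrees (:) (Delta (:) (Dstar_omega (:) (coanalytic (:))))) (wadge_degree_le (:)) (omega2 (:))"
 unfolding has_order_type_def D_degrees D_omega2 D_ordinal
proof (intro conjI exI Ord_w2 allI impI)
 let ?W = "Rep DD wdg"
 have "dt (%s. wdg (s 0))" by simp
 from mem_Rep[OF this, of _ DD] have W: "d:?W <-> (EX A. DC A & d = wdg A)" for d unfolding mem_DD .
 \<comment> \<open>All members of a degree have the same rank, so the union of the set of their
   ranks is that rank, and no representative is chosen.\<close>
 let ?F = "%d. Uni (Rep d rho)"
 let ?f = "Lam ?W ?F"
 have dF: "dt (%s. ?F (s 0))" by simp
 have F: "?F (wdg A) = rho A" if A: "DC A" for A
 proof (rule Uni_Rep)
  show "A:wdg A" unfolding mem_wdg using DC_sb[OF A] by simp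
  show "rho C = rho A" if "C:wdg A" for C
  proof -
   have C: "le2 C A" "le2 A C" using that unfolding mem_wdg by auto
   have "DC C" using C(1) DC_wle A DC_cmp[OF A] unfolding le2_def by blast
   then show ?thesis using rho_le[OF _ A C(1)] rho_le[OF A _ C(2)] sb_antisym by blast
  qed
 qed simp
 have f: "?f$(wdg A) = rho A" if "DC A" for A using ap_Lam[OF _ dF, of "wdg A" ?W] F[OF that] W that by metis
 have w: "v:w2 <-> (EX A. DC A & v = rho A)" for v using mem_RR RR_w2 by metis
 have fnf: "fn ?f ?W w2" by (rule fn_Lam[OF dF]) (use W F w in metis)
 show "is_bijection (:) ?f ?W w2"
 proof (rule D_bijI[OF fnf])
  show "EX x. x:?W & ?f$x = y" if "y:w2" for y using that w W f by metis
  fix d e assume d: "d:?W" "e:?W" "?f$d = ?f$e"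
  then obtain A B where A: "DC A" "d = wdg A" and B: "DC B" "e = wdg B" using W by blast
  have "rho A = rho B" using d(3) f A B by metis
  then have AB: "le2 A B" "le2 B A" using le2_rho A B by auto
  have "C:d <-> C:e" for C
   unfolding A(2) B(2) mem_wdg using AB le2_trans DC_sb A(1) B(1) by blast
  then show "d = e" by (rule ext)
 qed
 fix d e assume d: "d:?W & e:?W"
 then obtain A B where A: "DC A" "d = wdg A" and B: "DC B" "e = wdg B" using W by blast
 have "app (:) ?f d = rho A" "app (:) ?f e = rho B" using D_app[OF fnf] d f A B by metis+
 then show "wadge_degree_le (:) d e <-> app (:) ?f d:app (:) ?f e | app (:) ?f d = app (:) ?f e"
  using D_degree_le[OF DC_sb[OF A(1)] DC_sb[OF B(1)]] le2_rho[OF A(1) B(1)] A(2) B(2) by simp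
qed

end

theorem theorem1p1:
  fixes mem :: "'m \<Rightarrow> 'm \<Rightarrow> bool"
  assumes "ZF mem" and "AD mem"
  shows "has_order_type mem
    (wadge_degrees mem (Delta mem (Dstar_omega mem (coanalytic mem))))
    (wadge_degree_le mem)
    (omega2 mem)"
proof -
  interpret zfad mem using assms by unfold_locales
  show ?thesis by (rule order_type)
qed

end
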